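(* $M\subset\mathbb{R}^{3,1}$ is a complete degenerate (space-like) stationary surface of hyperbolic type if and only if it is congruent to the entire space-like stationary graph of a function $F:\mathbb{R}^2\to\mathbb{R}^{1,1}$. Moreover, if $M$ is nonflat, then each $\psi_i$ ($i=1,2$) takes each point of $\mathbb{C}^*=\mathbb{C}\cup\{\infty\}$ infinitely many times, with the exception of exactly $2$ points, and the total Gauss curvature of $M$ is $\infty$ (i.e. $\int_M K\,dA_M$ is not absolutely convergent).
   Context: $\mathbb{R}^{3,1}$ is $\mathbb{R}^4$ with the Minkowski inner product $\langle u,v\rangle=u_1v_1+u_2v_2+u_3v_3-u_4v_4$, extended complex-bilinearly to $\mathbb{C}^4$. A space-like surface is a connected oriented surface with an immersion $\mathbf{x}:M\to\mathbb{R}^{3,1}$ whose induced metric is positive definite; it is stationary if its mean curvature vector field vanishes identically, complete if the induced metric is complete, nonflat if its Gauss curvature $K$ is not identically $0$. Congruent means related by an isometry of $\mathbb{R}^{3,1}$. The entire graph of $F=(F_1,F_2):\mathbb{R}^2\to\mathbb{R}^{1,1}$ is $\{(x_1,x_2,F_1(x_1,x_2),F_2(x_1,x_2)):(x_1,x_2)\in\mathbb{R}^2\}$. Let $Q_{1,1}=\{[z]\in\mathbb{CP}^3:\langle z,z\rangle=0\}$, $Q_{1,1}^+=\{[z]\in Q_{1,1}:\langle z,\bar z\rangle>0\}$, $\mathbb{C}^*=\mathbb{C}\cup\{\infty\}$. There is a biholomorphism $\Psi:Q_{1,1}\to\mathbb{C}^*\times\mathbb{C}^*$ with inverse $(w_1,w_2)\mapsto[(w_1+w_2,-i(w_1-w_2),1-w_1w_2,1+w_1w_2)]$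 for $w_1,w_2\in\mathbb{C}$, $(w_1,\infty)\mapsto[(1,i,-w_1,w_1)]$, $(\infty,w_2)\mapsto[(1,-i,-w_2,w_2)]$, $(\infty,\infty)\mapsto[(0,0,-1,1)]$. With local complex coordinate $z=u+iv$ from oriented isothermal parameters, the Gauss map of a space-like stationary surface is $p\mapsto[\mathbf{x}_z]\in Q_{1,1}^+$, and $(\psi_1,\psi_2):=\Psi([\mathbf{x}_z])$ are holomorphic maps $M\to\mathbb{C}^*$. For $[A]\in\mathbb{CP}^3$, $H_A=\{[z]\in Q_{1,1}:\langle A,z\rangle=0\}$. $M$ is a degenerate stationary surface of hyperbolic type if its Gauss image lies in some $H_A$ such that $\mathrm{Re}\,A,\mathrm{Im}\,A$ are linearly independent and span a space-like $2$-plane (the case $[A]\in Q_{1,1}^+$ is included). *)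

theory Defs
  imports "HOL-Analysis.Analysis"
begin

section \<open>Minkowski space\<close>

text \<open>At type \<^typ>\<open>real^4\<close> this is the inner product of $R^{3,1}$; at type \<^typ>\<open>complex^4\<close> it is
  the complex-bilinear (not sesquilinear) extension.\<close>

definition mink :: "'a::comm_ring_1^4 \<Rightarrow> 'a^4 \<Rightarrow> 'a" where
  "mink u v = u$1 * v$1 + u$2 * v$2 + u$3 * v$3 - u$4 * v$4"

definition mink_isometry :: "(real^4 \<Rightarrow> real^4) \<Rightarrow> bool" where
  "mink_isometry T \<longleftrightarrow>
     (\<exists>L b. linear L \<and> (\<forall>u v. mink (L u) (L v) = mink u v) \<and> T = (\<lambda>p. L p + b))"

definition spacelike_plane :: "(real^4) set \<Rightarrow> bool" where
  "spacelike_plane P \<longleftrightarrow> subspace P \<and> dim P = 2 \<and> (\<forall>v\<in>P. v \<noteq> 0 \<longrightarrow> mink v v > 0)"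


section \<open>Smooth maps on open subsets of the plane\<close>

definition pd :: "2 \<Rightarrow> (real^2 \<Rightarrow> 'b::real_normed_vector) \<Rightarrow> real^2 \<Rightarrow> 'b" where
  "pd i f q = frechet_derivative f (at q) (axis i 1)"

text \<open>Only meant for open \<open>S\<close>: the derivatives in \<^const>\<open>pd\<close> are two-sided.\<close>

primrec Ck_on :: "nat \<Rightarrow> (real^2 \<Rightarrow> 'b::real_normed_vector) \<Rightarrow> (real^2) set \<Rightarrow> bool" where
  "Ck_on 0 f S \<longleftrightarrow> continuous_on S f"
| "Ck_on (Suc k) f S \<longleftrightarrow> f differentiable_on S \<and> (\<forall>i. Ck_on k (pd i f) S)"

definition smooth_on :: "(real^2 \<Rightarrow> 'b::real_normed_vector) \<Rightarrow> (real^2) set \<Rightarrow> bool" where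
  "smooth_on f S \<longleftrightarrow> (\<forall>k. Ck_on k f S)"


section \<open>Local geometry of a parametrised surface in Minkowski space\<close>

context
  fixes X :: "real^2 \<Rightarrow> real^4"
begin

definition metric_coeff :: "2 \<Rightarrow> 2 \<Rightarrow> real^2 \<Rightarrow> real" where
  "metric_coeff i j q = mink (pd i X q) (pd j X q)"

definition metric_matrix :: "real^2 \<Rightarrow> real^2^2" where
  "metric_matrix q = (\<chi> i j. metric_coeff i j q)"

definition inv_metric :: "2 \<Rightarrow> 2 \<Rightarrow> real^2 \<Rightarrow> real" where
  "inv_metric i j q = matrix_inv (metric_matrix q) $ i $ j"

definition normal_part :: "real^2 \<Rightarrow> real^4 \<Rightarrow> real^4" where
  "normal_part q v =
     v - (\<Sum>k\<in>UNIV. \<Sum>l\<in>UNIV. (inv_metric k l q * mink v (pd k X q)) *\<^sub>R pd l X q)"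

text \<open>Half the trace of the second fundamental form $B_{ij} = (\partial_i\partial_j X)^\perp$.\<close>

definition mean_curvature :: "real^2 \<Rightarrow> real^4" where
  "mean_curvature q =
     (1/2) *\<^sub>R (\<Sum>i\<in>UNIV. \<Sum>j\<in>UNIV. inv_metric i j q *\<^sub>R normal_part q (pd i (pd j X) q))"

definition christoffel :: "2 \<Rightarrow> 2 \<Rightarrow> 2 \<Rightarrow> real^2 \<Rightarrow> real" where
  "christoffel k i j q = (1/2) * (\<Sum>l\<in>UNIV. inv_metric k l q *
     (pd i (metric_coeff j l) q + pd j (metric_coeff i l) q - pd l (metric_coeff i j) q))"

text \<open>The \<open>l\<close>-th component of $R(\partial_1,\partial_2)\partial_2 =
  \nabla_1\nabla_2\partial_2 - \nabla_2\nabla_1\partial_2$.\<close>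

definition riemann_122 :: "2 \<Rightarrow> real^2 \<Rightarrow> real" where
  "riemann_122 l q =
     pd 1 (christoffel l 2 2) q - pd 2 (christoffel l 1 2) q
     + (\<Sum>m\<in>UNIV. christoffel l 1 m q * christoffel m 2 2 q
                   - christoffel l 2 m q * christoffel m 1 2 q)"

definition local_gauss_curvature :: "real^2 \<Rightarrow> real" where
  "local_gauss_curvature q =
     (\<Sum>l\<in>UNIV. metric_coeff l 1 q * riemann_122 l q) / det (metric_matrix q)"

text \<open>$X_z = (X_u - i X_v)/2$ for $z = u + iv$.\<close>

definition complex_deriv_z :: "real^2 \<Rightarrow> complex^4" where
  "complex_deriv_z q = (\<chi> k. (complex_of_real (pd 1 X q $ k)
                              - \<i> * complex_of_real (pd 2 X q $ k)) / 2)"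

end


section \<open>Oriented surfaces with a map into Minkowski space\<close>

type_synonym 'a chart = "'a set \<times> ('a \<Rightarrow> real^2)"

record 'a surface =
  points :: "'a topology"
  atlas :: "'a chart set"
  imm :: "'a \<Rightarrow> real^4"

abbreviation pts :: "'a surface \<Rightarrow> 'a set" where
  "pts M \<equiv> topspace (points M)"

abbreviation chart_inv :: "'a chart \<Rightarrow> real^2 \<Rightarrow> 'a" where
  "chart_inv c \<equiv> inv_into (fst c) (snd c)"

abbreviation chart_image :: "'a chart \<Rightarrow> (real^2) set" where
  "chart_image c \<equiv> snd c ` fst c"

definition is_chart :: "'a topology \<Rightarrow> 'a chart \<Rightarrow> bool" where
  "is_chart X c \<longleftrightarrow> openin X (fst c) \<and> open (chart_image c) \<and>
     homeomorphic_map (subtopology X (fst c)) (top_of_set (chart_image c)) (snd c)"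

definition transition :: "'a chart \<Rightarrow> 'a chart \<Rightarrow> real^2 \<Rightarrow> real^2" where
  "transition c d = snd d \<circ> chart_inv c"

text \<open>The change of charts is smooth, in both directions, and preserves the orientation.\<close>

definition compatible :: "'a chart \<Rightarrow> 'a chart \<Rightarrow> bool" where
  "compatible c d \<longleftrightarrow>
     smooth_on (transition c d) (snd c ` (fst c \<inter> fst d)) \<and>
     smooth_on (transition d c) (snd d ` (fst c \<inter> fst d)) \<and>
     (\<forall>q \<in> snd c ` (fst c \<inter> fst d).
        det (matrix (frechet_derivative (transition c d) (at q))) > 0)"

definition oriented_atlas :: "'a topology \<Rightarrow> 'a chart set \<Rightarrow> bool" where
  "oriented_atlas X \<A> \<longleftrightarrow> (\<forall>c\<in>\<A>. is_chart X c) \<and> (\<Union>c\<in>\<A>. fst c) = topspace X \<and>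
     (\<forall>c\<in>\<A>. \<forall>d\<in>\<A>. compatible c d)"

text \<open>Arbitrary oriented charts of \<open>M\<close>, not only those listed in the given atlas.\<close>

definition oriented_chart :: "'a surface \<Rightarrow> 'a chart \<Rightarrow> bool" where
  "oriented_chart M c \<longleftrightarrow> is_chart (points M) c \<and> (\<forall>d\<in>atlas M. compatible c d)"

definition param :: "'a surface \<Rightarrow> 'a chart \<Rightarrow> real^2 \<Rightarrow> real^4" where
  "param M c = imm M \<circ> chart_inv c"

definition spacelike_surface :: "'a surface \<Rightarrow> bool" where
  "spacelike_surface M \<longleftrightarrow>
     pts M \<noteq> {} \<and> connected_space (points M) \<and>
     Hausdorff_space (points M) \<and> second_countable (points M) \<and>
     oriented_atlas (points M) (atlas M) \<and>
     (\<forall>c\<in>atlas M. smooth_on (param M c) (chart_image c) \<and>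
        (\<forall>q\<in>chart_image c.
           inj (frechet_derivative (param M c) (at q)) \<and>
           (\<forall>v. v \<noteq> 0 \<longrightarrow> mink (frechet_derivative (param M c) (at q) v)
                              (frechet_derivative (param M c) (at q) v) > 0)))"

definition stationary :: "'a surface \<Rightarrow> bool" where
  "stationary M \<longleftrightarrow> (\<forall>c\<in>atlas M. \<forall>q\<in>chart_image c. mean_curvature (param M c) q = 0)"


subsection \<open>Completeness of the induced metric\<close>

definition piecewise_C1_curve :: "'a surface \<Rightarrow> (real \<Rightarrow> 'a) \<Rightarrow> bool" where
  "piecewise_C1_curve M \<gamma> \<longleftrightarrow> pathin (points M) \<gamma> \<and>
     (\<exists>S. finite S \<and>
        (\<forall>c\<in>atlas M. (snd c \<circ> \<gamma>) C1_differentiable_on ({t\<in>{0..1}. \<gamma> t \<in> fst c} - S)))"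

text \<open>The finite exceptional set of \<^const>\<open>piecewise_C1_curve\<close> may contain points near which the
  velocity is unbounded, so the length is taken as a nonnegative integral, possibly infinite.\<close>

definition curve_length :: "'a surface \<Rightarrow> (real \<Rightarrow> 'a) \<Rightarrow> ennreal" where
  "curve_length M \<gamma> = (\<integral>\<^sup>+t\<in>{0..1}. ennreal (sqrt
      (mink (vector_derivative (imm M \<circ> \<gamma>) (at t)) (vector_derivative (imm M \<circ> \<gamma>) (at t))))
    \<partial>lborel)"

definition surface_dist :: "'a surface \<Rightarrow> 'a \<Rightarrow> 'a \<Rightarrow> real" where
  "surface_dist M p q =
     enn2real (INF \<gamma>\<in>{\<gamma>. piecewise_C1_curve M \<gamma> \<and> \<gamma> 0 = p \<and> \<gamma> 1 = q}. curve_length M \<gamma>)"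

definition complete_surface :: "'a surface \<Rightarrow> bool" where
  "complete_surface M \<longleftrightarrow> Metric_space.mcomplete (pts M) (surface_dist M)"


subsection \<open>Gauss curvature and area\<close>

text \<open>The choice of the chart does not matter: the curvature of the induced metric is intrinsic.\<close>

definition gauss_curvature :: "'a surface \<Rightarrow> 'a \<Rightarrow> real" where
  "gauss_curvature M p =
     (THE k. \<exists>c\<in>atlas M. p \<in> fst c \<and> k = local_gauss_curvature (param M c) (snd c p))"

definition nonflat :: "'a surface \<Rightarrow> bool" where
  "nonflat M \<longleftrightarrow> (\<exists>p\<in>pts M. gauss_curvature M p \<noteq> 0)"

definition area_measure :: "'a surface \<Rightarrow> 'a measure" where
  "area_measure M = (THE \<mu>.
     space \<mu> = pts M \<and> sets \<mu> = sigma_sets (pts M) {U. openin (points M) U} \<and>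
     (\<forall>c\<in>atlas M. \<forall>B\<in>sets \<mu>. B \<subseteq> fst c \<longrightarrow>
        emeasure \<mu> B =
          (\<integral>\<^sup>+q\<in>snd c ` B. ennreal (sqrt (det (metric_matrix (param M c) q))) \<partial>lborel)))"

definition total_abs_curvature :: "'a surface \<Rightarrow> ennreal" where
  "total_abs_curvature M = (\<integral>\<^sup>+p. ennreal \<bar>gauss_curvature M p\<bar> \<partial>area_measure M)"


subsection \<open>Congruence and entire graphs\<close>

definition smooth_map :: "'a surface \<Rightarrow> 'b surface \<Rightarrow> ('a \<Rightarrow> 'b) \<Rightarrow> bool" where
  "smooth_map M N f \<longleftrightarrow> continuous_map (points M) (points N) f \<and>
     (\<forall>c\<in>atlas M. \<forall>d\<in>atlas N.
        smooth_on (snd d \<circ> f \<circ> chart_inv c) (snd c ` {p\<in>fst c. f p \<in> fst d}))"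

definition diffeomorphism :: "'a surface \<Rightarrow> 'b surface \<Rightarrow> ('a \<Rightarrow> 'b) \<Rightarrow> bool" where
  "diffeomorphism M N f \<longleftrightarrow> bij_betw f (pts M) (pts N) \<and>
     smooth_map M N f \<and> smooth_map N M (inv_into (pts M) f)"

definition congruent_surfaces :: "'a surface \<Rightarrow> 'b surface \<Rightarrow> bool" where
  "congruent_surfaces M N \<longleftrightarrow> (\<exists>T f. mink_isometry T \<and> diffeomorphism M N f \<and>
     (\<forall>p\<in>pts M. imm N (f p) = T (imm M p)))"

definition graph_map :: "(real^2 \<Rightarrow> real^2) \<Rightarrow> real^2 \<Rightarrow> real^4" where
  "graph_map F p = vector [p$1, p$2, F p $ 1, F p $ 2]"

text \<open>The entire graph of $F = (F_1,F_2) : R^2 \to R^{1,1}$; no smoothness of \<open>F\<close> is built in, it is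
  part of \<^const>\<open>spacelike_surface\<close>.\<close>

definition graph_surface :: "(real^2 \<Rightarrow> real^2) \<Rightarrow> (real^2) surface" where
  "graph_surface F =
     \<lparr> points = euclidean, atlas = {(UNIV, \<lambda>p. p)}, imm = graph_map F \<rparr>"


section \<open>The quadric and the Gauss map\<close>

text \<open>A point $[z]$ of complex projective space is represented by the punctured line through \<open>z\<close>.\<close>

definition proj :: "complex^4 \<Rightarrow> (complex^4) set" where
  "proj z = {c *s z | c. c \<noteq> 0}"

definition quadric :: "(complex^4) set set" where
  "quadric = {proj z | z. z \<noteq> 0 \<and> mink z z = 0}"

definition hyperplane_section :: "complex^4 \<Rightarrow> (complex^4) set set" where
  "hyperplane_section A = {proj z | z. z \<noteq> 0 \<and> mink z z = 0 \<and> mink A z = 0}"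

text \<open>The extended plane $C \cup \{\infty\}$, with \<^const>\<open>None\<close> for infinity.\<close>

type_synonym ext_complex = "complex option"

fun Psi_inv :: "ext_complex \<times> ext_complex \<Rightarrow> (complex^4) set" where
  "Psi_inv (Some w1, Some w2) =
     proj (vector [w1 + w2, - \<i> * (w1 - w2), 1 - w1 * w2, 1 + w1 * w2])"
| "Psi_inv (Some w1, None) = proj (vector [1, \<i>, - w1, w1])"
| "Psi_inv (None, Some w2) = proj (vector [1, - \<i>, - w2, w2])"
| "Psi_inv (None, None) = proj (vector [0, 0, - 1, 1])"

text \<open>\<^const>\<open>Psi_inv\<close> is a bijection onto \<^const>\<open>quadric\<close>.\<close>

definition Psi :: "(complex^4) set \<Rightarrow> ext_complex \<times> ext_complex" where
  "Psi = the_inv_into UNIV Psi_inv"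

definition isothermal_chart :: "'a surface \<Rightarrow> 'a chart \<Rightarrow> bool" where
  "isothermal_chart M c \<longleftrightarrow> oriented_chart M c \<and>
     (\<forall>q\<in>chart_image c.
        metric_coeff (param M c) 1 1 q = metric_coeff (param M c) 2 2 q \<and>
        metric_coeff (param M c) 1 2 q = 0)"

text \<open>$[x_z]$ does not depend on the oriented isothermal chart around \<open>p\<close>, and every point
  of a stationary surface has such a chart.\<close>

definition gauss_map :: "'a surface \<Rightarrow> 'a \<Rightarrow> (complex^4) set" where
  "gauss_map M p = (THE L. \<exists>c. isothermal_chart M c \<and> p \<in> fst c \<and>
     L = proj (complex_deriv_z (param M c) (snd c p)))"

definition psi1 :: "'a surface \<Rightarrow> 'a \<Rightarrow> ext_complex" where
  "psi1 M p = fst (Psi (gauss_map M p))"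

definition psi2 :: "'a surface \<Rightarrow> 'a \<Rightarrow> ext_complex" where
  "psi2 M p = snd (Psi (gauss_map M p))"

definition Re_vec :: "complex^4 \<Rightarrow> real^4" where
  "Re_vec A = (\<chi> k. Re (A $ k))"

definition Im_vec :: "complex^4 \<Rightarrow> real^4" where
  "Im_vec A = (\<chi> k. Im (A $ k))"

definition degenerate_hyperbolic :: "'a surface \<Rightarrow> bool" where
  "degenerate_hyperbolic M \<longleftrightarrow>
     (\<exists>A. Re_vec A \<noteq> Im_vec A \<and> independent {Re_vec A, Im_vec A} \<and>
          spacelike_plane (span {Re_vec A, Im_vec A}) \<and>
          gauss_map M ` pts M \<subseteq> hyperplane_section A)"

text \<open>All values are taken infinitely often, with the exception of exactly two.\<close>

definition inf_often_except_two :: "'a set \<Rightarrow> ('a \<Rightarrow> ext_complex) \<Rightarrow> bool" where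
  "inf_often_except_two S \<psi> \<longleftrightarrow>
     (\<exists>E. card E = 2 \<and> (\<forall>w. w \<notin> E \<longleftrightarrow> infinite {p\<in>S. \<psi> p = w}))"

end

(* After a Lorentz transformation a degenerate surface of hyperbolic type satisfies alpha phi_1 + beta phi_2 = 0 for the
   holomorphic null curve phi = x_z, with (alpha, beta) not proportional to a real vector. Hence the induced metric is
   comparable with the flat metric of the (x_1, x_2)-plane, and completeness makes the projection to this plane a covering,
   so a bijection. Conversely, on an entire stationary graph the forms *dx_1, *dx_2 are closed, so g_ij / sqrt(det g) is a
   Hessian of determinant 1; by Joergens' theorem it is constant, which is the degeneracy.
   The function cnj alpha x_1 + cnj beta x_2 is then a global isothermal parameter, with phi = (a, b, (k+h)/2, (k-h)/2) and
   h k = -(a^2 + b^2). If the surface is not flat then k = exp g with g entire and nonconstant, so by Picard's theorem k takes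
   every nonzero value infinitely often; the conic of all admissible null directions is mapped bijectively by each psi_i,
   and k = 0, infinity give the two exceptional values. On the preimage under g of a suitable strip the curvature density
   is at least a multiple of |g'|^2, whose integral is the infinite area of the strip. *)

theory Submission
  imports Defs "HOL-Complex_Analysis.Great_Picard"
begin

section \<open>Calculus on open subsets of the plane\<close>

text \<open>\<open>gauss_map\<close>, \<open>gauss_curvature\<close> and \<open>area_measure\<close>
  are given by descriptions (\<open>THE\<close>), so each needs existence and independence of the
  chart before it can be used. For the Gauss map this is the existence of isothermal charts: on a
  stationary surface a coordinate function of the immersion is harmonic, its conjugate is a
  primitive of a closed form, and the two together form such a chart; \<open>null_vec\<close>
  expresses the same complex line in every chart. For the curvature it is the Gauss equation, for
  the area measure a push-forward from a global parameter. As the Minkowski form is indefinite,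
  Euclidean lengths in space do not bound intrinsic lengths from below; the comparison with the
  (x_1, x_2)-plane supplies the lower bound on which the completeness arguments rest. The distance
  turns an infinite infimum into 0, so finiteness has to be settled before the metric axioms. A
  congruence may reverse the orientation, which conjugates the Gauss map; the degeneracy survives
  because the condition on (alpha, beta) is invariant under conjugation.\<close>

lemma vec2_expand: "(v::real^2) = v$1 *\<^sub>R axis 1 1 + v$2 *\<^sub>R axis 2 1"
  by (simp add: vec_eq_iff forall_2 axis_def)

lemma pd_eqI: "(f has_derivative D) (at q) \<Longrightarrow> pd i f q = D (axis i 1)"
  unfolding pd_def using frechet_derivative_at by metis

lemma linear_vec2:
  fixes D :: "real^2 \<Rightarrow> 'b::real_normed_vector"
  assumes "linear D"
  shows "D v = v$1 *\<^sub>R D (axis 1 1) + v$2 *\<^sub>R D (axis 2 1)"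
  using arg_cong[OF vec2_expand[of v], of D]
  by (simp only: linear_add[OF assms] linear_scale[OF assms])

lemma has_derivative_pd:
  fixes f :: "real^2 \<Rightarrow> 'b::real_normed_vector"
  assumes "f differentiable at q"
  shows "(f has_derivative (\<lambda>v. v$1 *\<^sub>R pd 1 f q + v$2 *\<^sub>R pd 2 f q)) (at q)"
proof -
  obtain D where D: "(f has_derivative D) (at q)"
    using assms by (auto simp: differentiable_def)
  have "D = (\<lambda>v. v$1 *\<^sub>R pd 1 f q + v$2 *\<^sub>R pd 2 f q)"
    unfolding pd_eqI[OF D] by (rule ext, rule linear_vec2[OF has_derivative_linear[OF D]])
  then show ?thesis using D by simp
qed

lemma frechet_derivative_pd:
  fixes f :: "real^2 \<Rightarrow> 'b::real_normed_vector"
  assumes "f differentiable at q"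
  shows "frechet_derivative f (at q) = (\<lambda>v. v$1 *\<^sub>R pd 1 f q + v$2 *\<^sub>R pd 2 f q)"
  by (rule frechet_derivative_at[OF has_derivative_pd[OF assms], symmetric])

lemma pd_cong:
  assumes "open S" "q \<in> S" "\<And>x. x \<in> S \<Longrightarrow> f x = g x"
  shows "pd i f q = pd i g q"
proof -
  have "(f has_derivative D) (at q) \<longleftrightarrow> (g has_derivative D) (at q)" for D
    using has_derivative_transform_within_open[OF _ assms(1,2), of f D UNIV g]
      has_derivative_transform_within_open[OF _ assms(1,2), of g D UNIV f] assms(3) by auto
  then show ?thesis by (simp add: pd_def frechet_derivative_def)
qed

lemma Ck_on_cong:
  assumes "open S" "\<And>x. x \<in> S \<Longrightarrow> f x = g x"
  shows "Ck_on k f S \<longleftrightarrow> Ck_on k g S"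
  using assms
proof (induction k arbitrary: f g)
  case 0
  then show ?case by (simp cong: continuous_on_cong)
next
  case (Suc k)
  have "f differentiable_on S \<longleftrightarrow> g differentiable_on S"
    using Suc.prems(2) unfolding differentiable_on_def
    by (metis differentiable_transform_within zero_less_one)
  moreover have "Ck_on k (pd i f) S \<longleftrightarrow> Ck_on k (pd i g) S" for i
    by (rule Suc.IH) (use Suc.prems pd_cong in metis)+
  ultimately show ?case by simp
qed

lemma smooth_on_cong:
  assumes "open S" "\<And>x. x \<in> S \<Longrightarrow> f x = g x"
  shows "smooth_on f S \<longleftrightarrow> smooth_on g S"
  by (simp add: smooth_on_def Ck_on_cong[OF assms])

lemma Ck_on_SucD: "Ck_on (Suc k) f S \<Longrightarrow> Ck_on k f S"
proof (induction k arbitrary: f)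
  case 0
  then show ?case by (simp add: differentiable_imp_continuous_on)
next
  case (Suc k)
  then show ?case by (simp add: Suc.IH)
qed

lemma Ck_on_subset: "Ck_on k f S \<Longrightarrow> T \<subseteq> S \<Longrightarrow> Ck_on k f T"
  by (induction k arbitrary: f) (auto intro: continuous_on_subset differentiable_on_subset)

lemma smooth_on_subset: "smooth_on f S \<Longrightarrow> T \<subseteq> S \<Longrightarrow> smooth_on f T"
  by (auto simp: smooth_on_def intro: Ck_on_subset)

lemma Ck_on_Suc_open:
  assumes "open S"
  shows "Ck_on (Suc k) f S \<longleftrightarrow> (\<forall>x\<in>S. f differentiable (at x)) \<and> (\<forall>i. Ck_on k (pd i f) S)"
  by (simp add: differentiable_on_eq_differentiable_at[OF assms])

text \<open>The common pattern of the closure lemmas: once an explicit derivative \<open>D\<close>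
  is known, the induction on \<open>k\<close> only has to see that the columns of \<open>D\<close>
  are again of class \<open>k\<close>.\<close>

lemma Ck_on_SucI:
  assumes "open S" "\<And>x. x \<in> S \<Longrightarrow> (f has_derivative D x) (at x)"
    "\<And>i. Ck_on k (\<lambda>x. D x (axis i 1)) S"
  shows "Ck_on (Suc k) f S"
proof -
  have "Ck_on k (pd i f) S" for i
    using Ck_on_cong[OF assms(1), of "pd i f" "\<lambda>x. D x (axis i 1)" k] assms(2,3) pd_eqI by metis
  with assms(1,2) show ?thesis
    unfolding Ck_on_Suc_open[OF assms(1)] differentiable_def by blast
qed

lemma Ck_on_Suc_has_derivative:
  assumes "open S" "Ck_on (Suc k) f S" "x \<in> S"
  shows "(f has_derivative (\<lambda>v. v$1 *\<^sub>R pd 1 f x + v$2 *\<^sub>R pd 2 f x)) (at x)"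
  using assms by (intro has_derivative_pd) (simp add: Ck_on_Suc_open del: Ck_on.simps)

section \<open>Closure properties of the classes \<open>Ck_on\<close>\<close>

lemma Ck_on_const [simp, intro]: 
  assumes "open S" shows "Ck_on k (\<lambda>x. c) S"
  using assms
proof (induction k arbitrary: c)
  case (Suc k)
  then show ?case by (intro Ck_on_SucI[where D = "\<lambda>_ _. 0"]) auto
qed auto

lemma Ck_on_bounded_linear:
  assumes "bounded_linear h" "open S" "Ck_on k f S"
  shows "Ck_on k (\<lambda>x. h (f x)) S"
  using assms(3)
proof (induction k arbitrary: f)
  case 0
  then show ?case using assms(1) by (auto intro: bounded_linear.continuous_on)
next
  case (Suc k)
  show ?case
  proof (rule Ck_on_SucI[OF assms(2)])
    fix x assume "x \<in> S"
    from Ck_on_Suc_has_derivative[OF assms(2) Suc.prems this]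
    show "((\<lambda>x. h (f x)) has_derivative (\<lambda>v. h (v$1 *\<^sub>R pd 1 f x + v$2 *\<^sub>R pd 2 f x))) (at x)"
      by (rule bounded_linear.has_derivative[OF assms(1)])
  next
    fix i :: 2
    have "Ck_on k (\<lambda>x. h (pd i f x)) S"
      using Suc.prems by (intro Suc.IH) simp
    then show "Ck_on k (\<lambda>x. h ((axis i 1::real^2)$1 *\<^sub>R pd 1 f x + (axis i 1::real^2)$2 *\<^sub>R pd 2 f x)) S"
      using exhaust_2[of i] by (auto simp: axis_def)
  qed
qed

lemma Ck_on_add:
  assumes "open S" "Ck_on k f S" "Ck_on k g S"
  shows "Ck_on k (\<lambda>x. f x + g x) S"
  using assms(2,3)
proof (induction k arbitrary: f g)
  case 0
  then show ?case by (auto intro: continuous_intros)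
next
  case (Suc k)
  show ?case
  proof (rule Ck_on_SucI[OF assms(1)])
    fix x assume "x \<in> S"
    from Ck_on_Suc_has_derivative[OF assms(1) Suc.prems(1) this]
      Ck_on_Suc_has_derivative[OF assms(1) Suc.prems(2) this]
    show "((\<lambda>x. f x + g x) has_derivative (\<lambda>v. (v$1 *\<^sub>R pd 1 f x + v$2 *\<^sub>R pd 2 f x)
        + (v$1 *\<^sub>R pd 1 g x + v$2 *\<^sub>R pd 2 g x))) (at x)"
      by (rule has_derivative_add)
  next
    fix i :: 2
    have "Ck_on k (\<lambda>x. pd i f x + pd i g x) S"
      using Suc.prems by (intro Suc.IH) simp_all
    then show "Ck_on k (\<lambda>x. ((axis i 1::real^2)$1 *\<^sub>R pd 1 f x + (axis i 1::real^2)$2 *\<^sub>R pd 2 f x)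
        + ((axis i 1::real^2)$1 *\<^sub>R pd 1 g x + (axis i 1::real^2)$2 *\<^sub>R pd 2 g x)) S"
      using exhaust_2[of i] by (auto simp: axis_def)
  qed
qed

lemma Ck_on_bilinear:
  assumes "bounded_bilinear b" "open S" "Ck_on k f S" "Ck_on k g S"
  shows "Ck_on k (\<lambda>x. b (f x) (g x)) S"
  using assms(3,4)
proof (induction k arbitrary: f g)
  case 0
  then show ?case using assms(1) by (auto intro: bounded_bilinear.continuous_on)
next
  case (Suc k)
  show ?case
  proof (rule Ck_on_SucI[OF assms(2)])
    fix x assume "x \<in> S"
    from Ck_on_Suc_has_derivative[OF assms(2) Suc.prems(1) this]
      Ck_on_Suc_has_derivative[OF assms(2) Suc.prems(2) this]
    show "((\<lambda>x. b (f x) (g x)) has_derivative (\<lambda>v. b (f x) (v$1 *\<^sub>R pd 1 g x + v$2 *\<^sub>R pd 2 g x)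
        + b (v$1 *\<^sub>R pd 1 f x + v$2 *\<^sub>R pd 2 f x) (g x))) (at x)"
      by (rule bounded_bilinear.FDERIV[OF assms(1)])
  next
    fix i :: 2
    have "Ck_on k (\<lambda>x. b (f x) (pd i g x) + b (pd i f x) (g x)) S"
      using Suc.prems by (intro Ck_on_add assms(2) Suc.IH) (simp_all del: Ck_on.simps add: Ck_on_SucD, simp_all)
    then show "Ck_on k (\<lambda>x. b (f x) ((axis i 1::real^2)$1 *\<^sub>R pd 1 g x + (axis i 1::real^2)$2 *\<^sub>R pd 2 g x)
        + b ((axis i 1::real^2)$1 *\<^sub>R pd 1 f x + (axis i 1::real^2)$2 *\<^sub>R pd 2 f x) (g x)) S"
      using exhaust_2[of i] by (auto simp: axis_def)
  qed
qed

text \<open>The induction generalises \<open>f\<close> but keeps \<open>\<tau>\<close>: the chain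
  rule produces the functions \<open>pd j f\<close> composed with the same inner map.\<close>

lemma Ck_on_compose:
  fixes \<tau> :: "real^2 \<Rightarrow> real^2"
  assumes "open S" "open T" "\<tau> ` S \<subseteq> T" "Ck_on k f T" "Ck_on k \<tau> S"
  shows "Ck_on k (\<lambda>x. f (\<tau> x)) S"
  using assms(4,5)
proof (induction k arbitrary: f)
  case 0
  then show ?case using assms(3) continuous_on_compose2[of T f S \<tau>] by auto
next
  case (Suc k)
  note d\<tau> = Ck_on_Suc_has_derivative[OF assms(1) Suc.prems(2)]
  show ?case
  proof (rule Ck_on_SucI[OF assms(1)])
    fix x assume "x \<in> S"
    with assms(3) have "\<tau> x \<in> T" by blast
    from has_derivative_compose[OF d\<tau>[OF \<open>x \<in> S\<close>] Ck_on_Suc_has_derivative[OF assms(2) Suc.prems(1) this]]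
    show "((\<lambda>x. f (\<tau> x)) has_derivative (\<lambda>v. (v$1 *\<^sub>R pd 1 \<tau> x + v$2 *\<^sub>R pd 2 \<tau> x)$1 *\<^sub>R pd 1 f (\<tau> x)
       + (v$1 *\<^sub>R pd 1 \<tau> x + v$2 *\<^sub>R pd 2 \<tau> x)$2 *\<^sub>R pd 2 f (\<tau> x))) (at x)" .
  next
    fix i :: 2
    have "Ck_on k (\<lambda>x. pd j f (\<tau> x)) S" for j
      using Suc.prems by (intro Suc.IH Ck_on_SucD[OF Suc.prems(2)]) simp
    moreover have "Ck_on k (\<lambda>x. pd i \<tau> x $ j) S" for j
      using Suc.prems(2) by (intro Ck_on_bounded_linear[OF bounded_linear_vec_nth assms(1)]) simp
    ultimately have "Ck_on k (\<lambda>x. pd i \<tau> x $ 1 *\<^sub>R pd 1 f (\<tau> x) + pd i \<tau> x $ 2 *\<^sub>R pd 2 f (\<tau> x)) S"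
      by (intro Ck_on_add Ck_on_bilinear[OF bounded_bilinear_scaleR] assms(1))
    then show "Ck_on k (\<lambda>x. ((axis i 1::real^2)$1 *\<^sub>R pd 1 \<tau> x + (axis i 1::real^2)$2 *\<^sub>R pd 2 \<tau> x)$1 *\<^sub>R pd 1 f (\<tau> x)
       + ((axis i 1::real^2)$1 *\<^sub>R pd 1 \<tau> x + (axis i 1::real^2)$2 *\<^sub>R pd 2 \<tau> x)$2 *\<^sub>R pd 2 f (\<tau> x)) S"
      using exhaust_2[of i] by (auto simp: axis_def)
  qed
qed

text \<open>The derivative of the reciprocal is a polynomial in the reciprocal itself and
  \<open>pd i f\<close>, so the induction hypothesis for the same \<open>f\<close> suffices.\<close>

lemma Ck_on_inverse:
  fixes f :: "real^2 \<Rightarrow> real"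
  assumes "open S" "Ck_on k f S" "\<And>x. x \<in> S \<Longrightarrow> f x \<noteq> 0"
  shows "Ck_on k (\<lambda>x. inverse (f x)) S"
  using assms(2)
proof (induction k)
  case 0
  then show ?case using assms(3) by (auto intro: continuous_intros)
next
  case (Suc k)
  show ?case
  proof (rule Ck_on_SucI[OF assms(1)])
    fix x assume "x \<in> S"
    from Ck_on_Suc_has_derivative[OF assms(1) Suc.prems this] assms(3)[OF this]
    show "((\<lambda>x. inverse (f x)) has_derivative (\<lambda>v. - (inverse (f x) * (v$1 *\<^sub>R pd 1 f x + v$2 *\<^sub>R pd 2 f x) * inverse (f x)))) (at x)"
      by (rule Deriv.has_derivative_inverse[rotated])
  next
    fix i :: 2
    have "Ck_on k (\<lambda>x. inverse (f x)) S" by (rule Suc.IH[OF Ck_on_SucD[OF Suc.prems]])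
    then have "Ck_on k (\<lambda>x. - (inverse (f x) * pd i f x * inverse (f x))) S"
      using Suc.prems
      by (intro Ck_on_bounded_linear[OF bounded_linear_minus[OF bounded_linear_ident]] Ck_on_bilinear[OF bounded_bilinear_mult] assms(1)) simp_all
    then show "Ck_on k (\<lambda>x. - (inverse (f x) * ((axis i 1::real^2)$1 *\<^sub>R pd 1 f x + (axis i 1::real^2)$2 *\<^sub>R pd 2 f x) * inverse (f x))) S"
      using exhaust_2[of i] by (auto simp: axis_def)
  qed
qed

lemma Ck_on_sqrt:
  fixes f :: "real^2 \<Rightarrow> real"
  assumes "open S" "Ck_on k f S" "\<And>x. x \<in> S \<Longrightarrow> f x > 0"
  shows "Ck_on k (\<lambda>x. sqrt (f x)) S"
  using assms(2)
proof (induction k)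
  case 0
  then show ?case by (auto intro: continuous_intros)
next
  case (Suc k)
  show ?case
  proof (rule Ck_on_SucI[OF assms(1)])
    fix x assume "x \<in> S"
    from Ck_on_Suc_has_derivative[OF assms(1) Suc.prems this] assms(3)[OF this]
    show "((\<lambda>x. sqrt (f x)) has_derivative (\<lambda>v. (v$1 *\<^sub>R pd 1 f x + v$2 *\<^sub>R pd 2 f x) * inverse (2 * sqrt (f x)))) (at x)"
      by (auto intro!: derivative_eq_intros simp: divide_simps)
  next
    fix i :: 2
    have "Ck_on k (\<lambda>x. inverse (2 * sqrt (f x))) S"
      using Suc.IH[OF Ck_on_SucD[OF Suc.prems]] assms(3)
      by (intro Ck_on_inverse assms(1) Ck_on_bounded_linear[OF bounded_linear_mult_right]) fastforce+
    then have "Ck_on k (\<lambda>x. pd i f x * inverse (2 * sqrt (f x))) S"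
      using Suc.prems
      by (intro Ck_on_bilinear[OF bounded_bilinear_mult] assms(1)) simp_all
    then show "Ck_on k (\<lambda>x. ((axis i 1::real^2)$1 *\<^sub>R pd 1 f x + (axis i 1::real^2)$2 *\<^sub>R pd 2 f x) * inverse (2 * sqrt (f x))) S"
      using exhaust_2[of i] by (auto simp: axis_def)
  qed
qed

section \<open>Smooth functions\<close>

lemma smooth_on_const [simp, intro]: "open S \<Longrightarrow> smooth_on (\<lambda>x. c) S"
  by (simp add: smooth_on_def)

lemma smooth_on_bounded_linear:
  "bounded_linear h \<Longrightarrow> open S \<Longrightarrow> smooth_on f S \<Longrightarrow> smooth_on (\<lambda>x. h (f x)) S"
  by (simp add: smooth_on_def Ck_on_bounded_linear)

lemma smooth_on_add: "open S \<Longrightarrow> smooth_on f S \<Longrightarrow> smooth_on g S \<Longrightarrow> smooth_on (\<lambda>x. f x + g x) S"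
  by (simp add: smooth_on_def Ck_on_add)

lemma smooth_on_minus: "open S \<Longrightarrow> smooth_on f S \<Longrightarrow> smooth_on (\<lambda>x. - f x) S"
  by (rule smooth_on_bounded_linear[OF bounded_linear_minus[OF bounded_linear_ident]])

lemma smooth_on_diff: "open S \<Longrightarrow> smooth_on f S \<Longrightarrow> smooth_on g S \<Longrightarrow> smooth_on (\<lambda>x. f x - g x) S"
  using smooth_on_add[OF _ _ smooth_on_minus, of S f g] by simp

lemma smooth_on_bilinear:
  "bounded_bilinear b \<Longrightarrow> open S \<Longrightarrow> smooth_on f S \<Longrightarrow> smooth_on g S \<Longrightarrow> smooth_on (\<lambda>x. b (f x) (g x)) S"
  by (simp add: smooth_on_def Ck_on_bilinear)

lemma smooth_on_mult:
  fixes f g :: "real^2 \<Rightarrow> real"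
  shows "open S \<Longrightarrow> smooth_on f S \<Longrightarrow> smooth_on g S \<Longrightarrow> smooth_on (\<lambda>x. f x * g x) S"
  by (rule smooth_on_bilinear[OF bounded_bilinear_mult])

lemma smooth_on_compose:
  fixes \<tau> :: "real^2 \<Rightarrow> real^2"
  shows "smooth_on f T \<Longrightarrow> smooth_on \<tau> S \<Longrightarrow> \<tau> ` S \<subseteq> T \<Longrightarrow> open S \<Longrightarrow> open T \<Longrightarrow> smooth_on (\<lambda>x. f (\<tau> x)) S"
  by (simp add: smooth_on_def Ck_on_compose)

lemma smooth_on_divide:
  fixes f g :: "real^2 \<Rightarrow> real"
  assumes "open S" "smooth_on f S" "smooth_on g S" "\<And>x. x \<in> S \<Longrightarrow> g x \<noteq> 0"
  shows "smooth_on (\<lambda>x. f x / g x) S"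
  using smooth_on_mult[of S f "\<lambda>x. inverse (g x)"] assms
  by (simp add: smooth_on_def Ck_on_inverse divide_inverse)

lemma smooth_on_sqrt:
  fixes f :: "real^2 \<Rightarrow> real"
  shows "open S \<Longrightarrow> smooth_on f S \<Longrightarrow> (\<And>x. x \<in> S \<Longrightarrow> f x > 0) \<Longrightarrow> smooth_on (\<lambda>x. sqrt (f x)) S"
  by (simp add: smooth_on_def Ck_on_sqrt)

lemma smooth_on_linear:
  fixes h :: "real^2 \<Rightarrow> 'b::real_normed_vector"
  assumes "bounded_linear h" "open S"
  shows "smooth_on h S"
  unfolding smooth_on_def
proof
  fix k
  show "Ck_on k h S"
  proof (cases k)
    case 0
    then show ?thesis using assms(1) by (simp add: linear_continuous_on)
  next
    case (Suc k')
    show ?thesis unfolding Suc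
      by (rule Ck_on_SucI[OF assms(2), where D = "\<lambda>_. h"])
         (auto simp: assms intro: bounded_linear_imp_has_derivative)
  qed
qed

lemma smooth_on_ident: "open S \<Longrightarrow> smooth_on (\<lambda>x. x) S"
  by (rule smooth_on_linear[OF bounded_linear_ident])

lemma smooth_on_differentiable: "open S \<Longrightarrow> smooth_on f S \<Longrightarrow> x \<in> S \<Longrightarrow> f differentiable (at x)"
  unfolding smooth_on_def using Ck_on_Suc_open by blast

lemma smooth_on_has_derivative:
  "open S \<Longrightarrow> smooth_on f S \<Longrightarrow> x \<in> S \<Longrightarrow>
    (f has_derivative (\<lambda>v. v$1 *\<^sub>R pd 1 f x + v$2 *\<^sub>R pd 2 f x)) (at x)"
  by (intro has_derivative_pd smooth_on_differentiable)

lemma smooth_on_pd: "smooth_on f S \<Longrightarrow> smooth_on (pd i f) S"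
  unfolding smooth_on_def using Ck_on.simps(2) by blast

lemma smooth_on_continuous: "smooth_on f S \<Longrightarrow> continuous_on S f"
  unfolding smooth_on_def using Ck_on.simps(1) by blast

lemma smooth_onI:
  assumes "open S" "\<And>x. x \<in> S \<Longrightarrow> (f has_derivative D x) (at x)"
    "\<And>i. smooth_on (\<lambda>x. D x (axis i 1)) S"
  shows "smooth_on f S"
  unfolding smooth_on_def
proof
  fix k
  have "Ck_on (Suc k) f S"
    using assms(3) by (intro Ck_on_SucI[OF assms(1,2)]) (auto simp: smooth_on_def)
  then show "Ck_on k f S" by (rule Ck_on_SucD)
qed

lemma smooth_on_local:
  assumes "open S" "\<And>x. x \<in> S \<Longrightarrow> \<exists>U. open U \<and> x \<in> U \<and> smooth_on f U"
  shows "smooth_on f S"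
proof -
  have "Ck_on k f S" if "\<And>x. x \<in> S \<Longrightarrow> \<exists>U. open U \<and> x \<in> U \<and> Ck_on k f U" for k
    using that
  proof (induction k arbitrary: f)
    case 0
    then show ?case
      by (simp add: continuous_on_eq_continuous_at assms(1)) (metis continuous_on_eq_continuous_at)
  next
    case (Suc k)
    show ?case unfolding Ck_on_Suc_open[OF assms(1)]
    proof (intro conjI ballI allI)
      show "f differentiable at x" if "x \<in> S" for x
        using Suc.prems[OF that] Ck_on_Suc_open by blast
      show "Ck_on k (pd i f) S" for i
        by (rule Suc.IH) (use Suc.prems in fastforce)
    qed
  qed
  with assms(2) show ?thesis unfolding smooth_on_def by metis
qed

lemma smooth_on_vec:
  fixes f :: "real^2 \<Rightarrow> real^'n"
  assumes "open S" "\<And>i. smooth_on (\<lambda>x. f x $ i) S"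
  shows "smooth_on f S"
proof -
  have "smooth_on (\<lambda>x. \<Sum>i\<in>A. (f x $ i) *\<^sub>R axis i (1::real)) S" if "finite A" for A
    using that
    by induction (auto simp: assms intro!: smooth_on_add smooth_on_bounded_linear[OF bounded_linear_scaleR_left])
  then have "smooth_on (\<lambda>x. \<Sum>i\<in>UNIV. (f x $ i) *\<^sub>R axis i (1::real)) S" by simp
  moreover have "(\<Sum>i\<in>UNIV. (f x $ i) *\<^sub>R axis i (1::real)) = f x" for x
    using basis_expansion[of "f x"] by (simp add: scalar_mult_eq_scaleR)
  ultimately show ?thesis by simp
qed

lemma smooth_on_nth: "open S \<Longrightarrow> smooth_on f S \<Longrightarrow> smooth_on (\<lambda>x. f x $ i) S" for f :: "real^2 \<Rightarrow> real^'n"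
  by (rule smooth_on_bounded_linear[OF bounded_linear_vec_nth])

section \<open>Rules for partial derivatives\<close>

lemma pd_bounded_linear:
  assumes "bounded_linear h" "f differentiable (at q)"
  shows "pd i (\<lambda>x. h (f x)) q = h (pd i f q)"
  using pd_eqI[OF bounded_linear.has_derivative[OF assms(1) has_derivative_pd[OF assms(2)]], of i]
    pd_eqI[OF has_derivative_pd[OF assms(2)], of i] by simp

lemma pd_nth: "f differentiable (at q) \<Longrightarrow> pd i (\<lambda>x. f x $ k) q = pd i f q $ k"
  for f :: "real^2 \<Rightarrow> real^'n"
  by (rule pd_bounded_linear[OF bounded_linear_vec_nth])

lemma pd_bilinear:
  assumes "bounded_bilinear b" "f differentiable (at q)" "g differentiable (at q)"
  shows "pd i (\<lambda>x. b (f x) (g x)) q = b (pd i f q) (g q) + b (f q) (pd i g q)"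
  using pd_eqI[OF bounded_bilinear.FDERIV[OF assms(1) has_derivative_pd[OF assms(2)] has_derivative_pd[OF assms(3)]], of i]
    pd_eqI[OF has_derivative_pd[OF assms(2)], of i] pd_eqI[OF has_derivative_pd[OF assms(3)], of i] by simp

lemma pd_compose:
  fixes \<tau> :: "real^2 \<Rightarrow> real^2"
  assumes "\<tau> differentiable (at q)" "f differentiable (at (\<tau> q))"
  shows "pd i (\<lambda>x. f (\<tau> x)) q = (pd i \<tau> q $ 1) *\<^sub>R pd 1 f (\<tau> q) + (pd i \<tau> q $ 2) *\<^sub>R pd 2 f (\<tau> q)"
  using pd_eqI[OF has_derivative_compose[OF has_derivative_pd[OF assms(1)] has_derivative_pd[OF assms(2)]], of i]
    pd_eqI[OF has_derivative_pd[OF assms(1)], of i] by simp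

lemma pd_add:
  assumes "f differentiable (at q)" "g differentiable (at q)"
  shows "pd i (\<lambda>x. f x + g x) q = pd i f q + pd i g q"
  using pd_eqI[OF has_derivative_add[OF has_derivative_pd[OF assms(1)] has_derivative_pd[OF assms(2)]], of i]
    pd_eqI[OF has_derivative_pd[OF assms(1)], of i] pd_eqI[OF has_derivative_pd[OF assms(2)], of i] by simp

lemma pd_const [simp]: "pd i (\<lambda>x. c) q = 0"
  using pd_eqI[OF has_derivative_const] by metis

lemma pd_linear: "bounded_linear h \<Longrightarrow> pd i h q = h (axis i 1)"
  by (rule pd_eqI[OF bounded_linear_imp_has_derivative])

section \<open>Jacobian determinants and smooth inverse maps\<close>

definition jac :: "(real^2 \<Rightarrow> real^2) \<Rightarrow> real^2 \<Rightarrow> real" where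
  "jac \<tau> q = pd 1 \<tau> q $ 1 * pd 2 \<tau> q $ 2 - pd 2 \<tau> q $ 1 * pd 1 \<tau> q $ 2"

lemma det_frechet_derivative:
  "\<tau> differentiable (at q) \<Longrightarrow> det (matrix (frechet_derivative \<tau> (at q))) = jac \<tau> q"
  by (simp add: frechet_derivative_pd det_2 matrix_def jac_def axis_def)

text \<open>Openness is invariance of domain. Smoothness is a bootstrap: by Cramer's rule the
  derivative \<open>D\<close> of \<open>\<sigma>\<close> consists of smooth functions composed with
  \<open>\<sigma>\<close>, so it is of class \<open>k\<close> as soon as \<open>\<sigma>\<close>
  is.\<close>

lemma smooth_on_inverse_map:
  fixes \<tau> \<sigma> :: "real^2 \<Rightarrow> real^2"
  assumes U: "open U" and sm: "smooth_on \<tau> U" and inv: "\<And>q. q \<in> U \<Longrightarrow> \<sigma> (\<tau> q) = q"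
    and J: "\<And>q. q \<in> U \<Longrightarrow> jac \<tau> q \<noteq> 0"
  shows "open (\<tau> ` U)" "smooth_on \<sigma> (\<tau> ` U)"
proof -
  have inj: "inj_on \<tau> U" using inv by (metis inj_onI)
  show op: "open (\<tau> ` U)"
    using invariance_of_domain[OF smooth_on_continuous[OF sm] U inj] .
  define D where "D = (\<lambda>y (v::real^2). vector [(pd 2 \<tau> (\<sigma> y) $ 2 * v$1 - pd 2 \<tau> (\<sigma> y) $ 1 * v$2) / jac \<tau> (\<sigma> y),
     (pd 1 \<tau> (\<sigma> y) $ 1 * v$2 - pd 1 \<tau> (\<sigma> y) $ 2 * v$1) / jac \<tau> (\<sigma> y)] :: real^2)"
  have der: "(\<sigma> has_derivative D y) (at y)" if "y \<in> \<tau> ` U" for y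
  proof -
    from that obtain x where x: "x \<in> U" "y = \<tau> x" by blast
    have "(\<lambda>v. v$1 *\<^sub>R pd 1 \<tau> x + v$2 *\<^sub>R pd 2 \<tau> x) \<circ> D y = id"
    proof
      fix v :: "real^2"
      have J: "jac \<tau> x \<noteq> 0" using J x by auto
      have "a / jac \<tau> x = b \<longleftrightarrow> a = b * jac \<tau> x" for a b using J by (simp add: field_simps)
      then show "((\<lambda>v. v$1 *\<^sub>R pd 1 \<tau> x + v$2 *\<^sub>R pd 2 \<tau> x) \<circ> D y) v = id v"
        using J unfolding D_def
        by (simp add: vec_eq_iff forall_2 x inv add_divide_distrib[symmetric])
           (simp add: jac_def algebra_simps)
    qed
    from has_derivative_inverse_strong[OF U x(1) smooth_on_continuous[OF sm] inv
        smooth_on_has_derivative[OF U sm x(1)] this] x(2)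
    show ?thesis by simp
  qed
  have cont: "continuous_on (\<tau> ` U) \<sigma>"
    by (intro continuous_at_imp_continuous_on ballI has_derivative_continuous[OF der])
  have img: "\<sigma> ` (\<tau> ` U) \<subseteq> U" using inv by auto
  have jsm: "smooth_on (jac \<tau>) U" unfolding jac_def
    by (intro smooth_on_diff smooth_on_mult smooth_on_nth smooth_on_pd U sm)
  have sm1: "smooth_on (\<lambda>y. pd i \<tau> y $ j / jac \<tau> y) U" for i j
    by (rule smooth_on_divide[OF U smooth_on_nth[OF U smooth_on_pd[OF sm]] jsm J])
  have "Ck_on k \<sigma> (\<tau> ` U)" for k
  proof (induction k)
    case 0
    then show ?case using cont by simp
  next
    case (Suc k)
    have E: "Ck_on k (\<lambda>y. pd i \<tau> (\<sigma> y) $ j / jac \<tau> (\<sigma> y)) (\<tau> ` U)" for i j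
      using Ck_on_compose[OF op U img, of k "\<lambda>y. pd i \<tau> y $ j / jac \<tau> y"] Suc sm1
      by (simp add: smooth_on_def)
    show ?case
    proof (rule Ck_on_SucI[OF op der])
      fix i :: 2
      have vE: "(vector [a, b] :: real^2) = a *\<^sub>R axis 1 1 + b *\<^sub>R axis 2 1" for a b :: real
        by (simp add: vec_eq_iff forall_2 axis_def)
      have V: "Ck_on k (\<lambda>y. vector [a y, b y] :: real^2) (\<tau> ` U)"
        if "Ck_on k a (\<tau> ` U)" "Ck_on k b (\<tau> ` U)" for a b :: "real^2 \<Rightarrow> real"
        unfolding vE by (intro Ck_on_add op Ck_on_bounded_linear[OF bounded_linear_scaleR_left] that)
      have M: "Ck_on k (\<lambda>y. - a y) (\<tau> ` U)" if "Ck_on k a (\<tau> ` U)" for a :: "real^2 \<Rightarrow> real"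
        by (intro Ck_on_bounded_linear[OF bounded_linear_minus[OF bounded_linear_ident]] op that)
      show "Ck_on k (\<lambda>y. D y (axis i 1)) (\<tau> ` U)"
        using exhaust_2[of i] V[OF E M[OF E]] V[OF M[OF E] E] by (auto simp: D_def axis_def)
    qed
  qed
  then show "smooth_on \<sigma> (\<tau> ` U)" by (simp add: smooth_on_def)
qed


section \<open>Symmetry of second derivatives and closed one-forms\<close>

text \<open>The mean value theorem is applied first in direction \<open>i\<close>, then in direction
  \<open>j\<close>. The left-hand side of the equation is symmetric in the two directions, so
  comparing both orders for small \<open>h\<close> gives the symmetry of second derivatives.\<close>

lemma mixed_difference_mvt:
  fixes f :: "real^2 \<Rightarrow> real"
  assumes "i \<noteq> j" "h > 0"
    and D1: "\<And>s t. 0 \<le> s \<Longrightarrow> s \<le> h \<Longrightarrow> 0 \<le> t \<Longrightarrow> t \<le> h \<Longrightarrow> f differentiable (at (q + s *\<^sub>R axis i 1 + t *\<^sub>R axis j 1))"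
    and D2: "\<And>s t. 0 \<le> s \<Longrightarrow> s \<le> h \<Longrightarrow> 0 \<le> t \<Longrightarrow> t \<le> h \<Longrightarrow> pd i f differentiable (at (q + s *\<^sub>R axis i 1 + t *\<^sub>R axis j 1))"
  obtains s t where "0 < s" "s < h" "0 < t" "t < h"
    "f (q + h *\<^sub>R axis i 1 + h *\<^sub>R axis j 1) - f (q + h *\<^sub>R axis i 1) - f (q + h *\<^sub>R axis j 1) + f q
      = h * h * pd j (pd i f) (q + s *\<^sub>R axis i 1 + t *\<^sub>R axis j 1)"
proof -
  have der: "((\<lambda>s. f (p + s *\<^sub>R axis k 1)) has_real_derivative pd k f (p + s *\<^sub>R axis k 1)) (at s)"
    if "f differentiable (at (p + s *\<^sub>R axis k 1))" for f :: "real^2 \<Rightarrow> real" and k :: 2 and p s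
  proof -
    have "((\<lambda>s. p + s *\<^sub>R axis k 1) has_derivative (\<lambda>s. s *\<^sub>R axis k 1)) (at s)"
      by (auto intro!: derivative_eq_intros)
    from has_derivative_compose[OF this has_derivative_pd[OF that]]
    have "((\<lambda>s. f (p + s *\<^sub>R axis k 1)) has_derivative
        (\<lambda>r. (r *\<^sub>R axis k 1 :: real^2)$1 *\<^sub>R pd 1 f (p + s *\<^sub>R axis k 1) + (r *\<^sub>R axis k 1 :: real^2)$2 *\<^sub>R pd 2 f (p + s *\<^sub>R axis k 1))) (at s)" .
    moreover have "(\<lambda>r. (r *\<^sub>R axis k 1 :: real^2)$1 *\<^sub>R pd 1 f (p + s *\<^sub>R axis k 1) + (r *\<^sub>R axis k 1 :: real^2)$2 *\<^sub>R pd 2 f (p + s *\<^sub>R axis k 1))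
       = (\<lambda>r. pd k f (p + s *\<^sub>R axis k 1) * r)"
      using exhaust_2[of k] by (auto simp: axis_def fun_eq_iff)
    ultimately show ?thesis by (simp add: has_field_derivative_def)
  qed
  define G where "G = (\<lambda>s. f ((q + h *\<^sub>R axis j 1) + s *\<^sub>R axis i 1) - f (q + s *\<^sub>R axis i 1))"
  have "\<exists>s>0. s < h \<and> G h - G 0 = (h - 0) * (pd i f ((q + h *\<^sub>R axis j 1) + s *\<^sub>R axis i 1) - pd i f (q + s *\<^sub>R axis i 1))"
  proof (rule MVT2[OF \<open>h > 0\<close>])
    fix s assume s: "0 \<le> s" "s \<le> h"
    show "(G has_real_derivative pd i f ((q + h *\<^sub>R axis j 1) + s *\<^sub>R axis i 1) - pd i f (q + s *\<^sub>R axis i 1)) (at s)"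
      unfolding G_def using D1[OF s, of h] D1[OF s, of 0] \<open>h > 0\<close>
      by (intro DERIV_diff der) (auto simp: algebra_simps)
  qed
  then obtain s where s: "0 < s" "s < h" and
    Gs: "G h - G 0 = h * (pd i f ((q + h *\<^sub>R axis j 1) + s *\<^sub>R axis i 1) - pd i f (q + s *\<^sub>R axis i 1))" by auto
  have "\<exists>t>0. t < h \<and> pd i f ((q + s *\<^sub>R axis i 1) + h *\<^sub>R axis j 1) - pd i f ((q + s *\<^sub>R axis i 1) + 0 *\<^sub>R axis j 1)
      = (h - 0) * pd j (pd i f) ((q + s *\<^sub>R axis i 1) + t *\<^sub>R axis j 1)"
    by (rule MVT2[OF \<open>h > 0\<close>], rule der, rule D2) (use s in auto)
  then obtain t where t: "0 < t" "t < h" and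
    Ht: "pd i f ((q + s *\<^sub>R axis i 1) + h *\<^sub>R axis j 1) - pd i f (q + s *\<^sub>R axis i 1)
      = h * pd j (pd i f) ((q + s *\<^sub>R axis i 1) + t *\<^sub>R axis j 1)" by auto
  have "q + h *\<^sub>R axis j 1 + s *\<^sub>R axis i 1 = (q + s *\<^sub>R axis i 1) + h *\<^sub>R axis j (1::real)" by simp
  with Gs Ht have "G h - G 0 = h * h * pd j (pd i f) (q + s *\<^sub>R axis i 1 + t *\<^sub>R axis j 1)"
    by (simp add: mult.assoc)
  then show ?thesis
    using that[OF s t] by (simp add: G_def algebra_simps)
qed

lemma pd_commute_real:
  fixes f :: "real^2 \<Rightarrow> real"
  assumes "open S" "smooth_on f S" "q \<in> S"
  shows "pd 1 (pd 2 f) q = pd 2 (pd 1 f) q"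
proof (rule ccontr)
  assume neq: "pd 1 (pd 2 f) q \<noteq> pd 2 (pd 1 f) q"
  define e where "e = \<bar>pd 1 (pd 2 f) q - pd 2 (pd 1 f) q\<bar> / 2"
  have "e > 0" using neq by (simp add: e_def)
  have cont: "isCont (pd i (pd j f)) q" for i j
    using smooth_on_continuous[OF smooth_on_pd[OF smooth_on_pd[OF assms(2)]]] assms
    by (simp add: continuous_on_eq_continuous_at)
  obtain d where "d > 0" and d: "ball q d \<subseteq> S" using assms open_contains_ball by blast
  obtain d1 where "d1 > 0" and d1: "\<And>x. dist x q < d1 \<Longrightarrow> \<bar>pd 1 (pd 2 f) x - pd 1 (pd 2 f) q\<bar> < e"
    using cont[of 1 2] \<open>e > 0\<close> unfolding continuous_at_eps_delta by (auto simp: dist_real_def)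
  obtain d2 where "d2 > 0" and d2: "\<And>x. dist x q < d2 \<Longrightarrow> \<bar>pd 2 (pd 1 f) x - pd 2 (pd 1 f) q\<bar> < e"
    using cont[of 2 1] \<open>e > 0\<close> unfolding continuous_at_eps_delta by (auto simp: dist_real_def)
  \<comment> \<open>All points of the squares lie at distance at most \<open>2 * h\<close> from
    \<open>q\<close>, hence inside each of the three balls.\<close>
  define h where "h = min d (min d1 d2) / 3"
  have h: "h > 0" "3 * h \<le> d" "3 * h \<le> d1" "3 * h \<le> d2" using \<open>d > 0\<close> \<open>d1 > 0\<close> \<open>d2 > 0\<close> by (auto simp: h_def)
  have near: "dist (q + s *\<^sub>R axis i 1 + t *\<^sub>R axis j 1) q < 3 * h" if "0 \<le> s" "s \<le> h" "0 \<le> t" "t \<le> h" for s t and i j :: 2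
  proof -
    have "norm (s *\<^sub>R axis i 1 + t *\<^sub>R axis j (1::real)) \<le> \<bar>s\<bar> + \<bar>t\<bar>"
      by (rule order_trans[OF norm_triangle_ineq]) (simp add: norm_axis_1)
    then show ?thesis using that h(1) by (simp add: dist_norm add.assoc)
  qed
  have inS: "q + s *\<^sub>R axis i 1 + t *\<^sub>R axis j 1 \<in> S" if "0 \<le> s" "s \<le> h" "0 \<le> t" "t \<le> h" for s t and i j :: 2
    using near[OF that, of i j] d h(2) by (auto simp: subset_iff dist_commute)
  note df = smooth_on_differentiable[OF assms(1,2) inS]
    smooth_on_differentiable[OF assms(1) smooth_on_pd[OF assms(2)] inS]
  obtain s t where st: "0 < s" "s < h" "0 < t" "t < h" and
    1: "f (q + h *\<^sub>R axis 1 1 + h *\<^sub>R axis 2 1) - f (q + h *\<^sub>R axis 1 1) - f (q + h *\<^sub>R axis 2 1) + f q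
      = h * h * pd 2 (pd 1 f) (q + s *\<^sub>R axis 1 1 + t *\<^sub>R axis 2 1)"
    by (rule mixed_difference_mvt[of 1 2 h f q, OF _ h(1) df]) auto
  obtain s' t' where st': "0 < s'" "s' < h" "0 < t'" "t' < h" and
    2: "f (q + h *\<^sub>R axis 2 1 + h *\<^sub>R axis 1 1) - f (q + h *\<^sub>R axis 2 1) - f (q + h *\<^sub>R axis 1 1) + f q
      = h * h * pd 1 (pd 2 f) (q + s' *\<^sub>R axis 2 1 + t' *\<^sub>R axis 1 1)"
    by (rule mixed_difference_mvt[of 2 1 h f q, OF _ h(1) df]) auto
  have "h * h * pd 2 (pd 1 f) (q + s *\<^sub>R axis 1 1 + t *\<^sub>R axis 2 1) = h * h * pd 1 (pd 2 f) (q + s' *\<^sub>R axis 2 1 + t' *\<^sub>R axis 1 1)"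
    unfolding 1[symmetric] 2[symmetric] by (simp add: ac_simps)
  then have "pd 2 (pd 1 f) (q + s *\<^sub>R axis 1 1 + t *\<^sub>R axis 2 1) = pd 1 (pd 2 f) (q + s' *\<^sub>R axis 2 1 + t' *\<^sub>R axis 1 1)"
    using h(1) by simp
  moreover have "\<bar>pd 2 (pd 1 f) (q + s *\<^sub>R axis 1 1 + t *\<^sub>R axis 2 1) - pd 2 (pd 1 f) q\<bar> < e"
    by (rule d2) (use near[of s t 1 2] st h in auto)
  moreover have "\<bar>pd 1 (pd 2 f) (q + s' *\<^sub>R axis 2 1 + t' *\<^sub>R axis 1 1) - pd 1 (pd 2 f) q\<bar> < e"
    by (rule d1) (use near[of s' t' 2 1] st' h in auto)
  moreover have "x = y \<Longrightarrow> \<bar>x - b\<bar> < e \<Longrightarrow> \<bar>y - a\<bar> < e \<Longrightarrow> \<bar>a - b\<bar> < 2 * e" for a b x y :: real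
    by arith
  ultimately have "\<bar>pd 1 (pd 2 f) q - pd 2 (pd 1 f) q\<bar> < 2 * e" by blast
  then show False unfolding e_def by simp
qed

lemma pd_commute:
  fixes f :: "real^2 \<Rightarrow> real^'n"
  assumes "open S" "smooth_on f S" "q \<in> S"
  shows "pd 1 (pd 2 f) q = pd 2 (pd 1 f) q"
proof -
  have "pd i (pd j f) q $ k = pd i (pd j (\<lambda>x. f x $ k)) q" for i j k
  proof -
    have "pd i (pd j (\<lambda>x. f x $ k)) q = pd i (\<lambda>x. pd j f x $ k) q"
      by (rule pd_cong[OF assms(1,3)]) (rule pd_nth[OF smooth_on_differentiable[OF assms(1,2)]])
    then show ?thesis
      using pd_nth[OF smooth_on_differentiable[OF assms(1) smooth_on_pd[OF assms(2)] assms(3)]] by simp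
  qed
  then show ?thesis
    using pd_commute_real[OF assms(1) smooth_on_nth[OF assms(1,2)] assms(3)] by (simp add: vec_eq_iff)
qed

text \<open>The primitive is the integral of the form along the segment from \<open>q0\<close>,
  differentiated under the integral sign.\<close>

lemma poincare_lemma:
  fixes P Q :: "real^2 \<Rightarrow> real"
  assumes U: "open U" "convex U" "q0 \<in> U" and sm: "smooth_on P U" "smooth_on Q U"
    and closed: "\<And>q. q \<in> U \<Longrightarrow> pd 2 P q = pd 1 Q q"
  obtains y where "\<And>q. q \<in> U \<Longrightarrow> (y has_derivative (\<lambda>v. P q * v$1 + Q q * v$2)) (at q)" "smooth_on y U"
proof -
  define w where "w = (\<lambda>q t. q0 + t *\<^sub>R (q - q0))"
  define f where "f = (\<lambda>q t. (q - q0)$1 * P (w q t) + (q - q0)$2 * Q (w q t))"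
  define D where "D = (\<lambda>q t (v::real^2). v$1 * P (w q t) + v$2 * Q (w q t)
     + (q - q0)$1 * (t * (v$1 * pd 1 P (w q t) + v$2 * pd 2 P (w q t)))
     + (q - q0)$2 * (t * (v$1 * pd 1 Q (w q t) + v$2 * pd 2 Q (w q t))))"
  \<comment> \<open>The same derivative as \<open>D\<close>, packed as a bounded linear map, the
    form in which \<open>leibniz_rule\<close> takes it.\<close>
  define B where "B = (\<lambda>q t. (P (w q t) + (q - q0)$1 * (t * pd 1 P (w q t)) + (q - q0)$2 * (t * pd 1 Q (w q t))) *\<^sub>R blinfun_inner_left (axis 1 1)
     + (Q (w q t) + (q - q0)$1 * (t * pd 2 P (w q t)) + (q - q0)$2 * (t * pd 2 Q (w q t))) *\<^sub>R blinfun_inner_left (axis 2 1 :: real^2))"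
  define y where "y = (\<lambda>q. integral (cbox 0 1) (f q))"
  have wU: "w q t \<in> U" if "q \<in> U" "t \<in> cbox 0 1" for q t
  proof -
    have "w q t = (1 - t) *\<^sub>R q0 + t *\<^sub>R q" by (simp add: w_def algebra_simps)
    with that convexD_alt[OF U(2,3), of q t] show ?thesis by simp
  qed
  have BD: "blinfun_apply (B q t) = D q t" for q t
    by (simp add: fun_eq_iff B_def blinfun.add_left blinfun.scaleR_left inner_axis inner_commute[of "axis _ _"])
       (simp add: D_def algebra_simps)
  have Dw1: "((\<lambda>q. w q t) has_derivative (\<lambda>v. t *\<^sub>R v)) (at q)" for q t
    unfolding w_def by (auto intro!: derivative_eq_intros)
  have dcomp: "((\<lambda>q. h (w q t)) has_derivative (\<lambda>v. t * (v$1 * pd 1 h (w q t) + v$2 * pd 2 h (w q t)))) (at q)"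
    if "smooth_on h U" "q \<in> U" "t \<in> cbox 0 1" for h :: "real^2 \<Rightarrow> real" and q t
    using has_derivative_compose[OF Dw1 smooth_on_has_derivative[OF U(1) that(1) wU[OF that(2,3)]]]
    by (simp add: algebra_simps)
  have fD: "((\<lambda>q. f q t) has_derivative blinfun_apply (B q t)) (at q within U)" if "q \<in> U" "t \<in> cbox 0 1" for q t
    unfolding BD f_def
    by (rule has_derivative_at_withinI, rule has_derivative_eq_rhs,
        rule has_derivative_add[OF has_derivative_mult[OF _ dcomp[OF sm(1) that]] has_derivative_mult[OF _ dcomp[OF sm(2) that]]])
       (auto intro!: derivative_eq_intros bounded_linear.has_derivative[OF bounded_linear_vec_nth] simp: D_def algebra_simps)
  have cw: "continuous_on (U \<times> cbox 0 1) (\<lambda>x. w (fst x) (snd x))"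
    unfolding w_def by (intro continuous_intros)
  have ch: "continuous_on (U \<times> cbox 0 1) (\<lambda>x. h (w (fst x) (snd x)))" if "smooth_on h U" for h :: "real^2 \<Rightarrow> real"
    by (rule continuous_on_compose2[OF smooth_on_continuous[OF that] cw]) (use wU in auto)
  have cB: "continuous_on (U \<times> cbox 0 1) (\<lambda>(q, t). B q t)"
    unfolding B_def case_prod_unfold
    by (intro continuous_intros ch smooth_on_pd sm)
  have cf: "continuous_on (cbox 0 1) (f q)" if "q \<in> U" for q
  proof -
    have "continuous_on (cbox 0 1) (\<lambda>t. (\<lambda>x. h (w (fst x) (snd x))) (q, t))" if "smooth_on h U" for h :: "real^2 \<Rightarrow> real"
      by (rule continuous_on_compose2[OF ch[OF that]])
         (use \<open>q \<in> U\<close> in \<open>auto intro!: continuous_on_Pair continuous_on_const continuous_on_id\<close>)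
    then have "continuous_on (cbox 0 1) (\<lambda>t. P (w q t))" "continuous_on (cbox 0 1) (\<lambda>t. Q (w q t))"
      using sm by simp_all
    then show ?thesis unfolding f_def by (intro continuous_intros)
  qed
  have yD: "(y has_derivative (\<lambda>v. P q * v$1 + Q q * v$2)) (at q)" if q: "q \<in> U" for q
  proof -
    have "(y has_derivative blinfun_apply (integral (cbox 0 1) (B q))) (at q within U)"
      unfolding y_def
      by (rule leibniz_rule[OF fD integrable_continuous[OF cf] cB q U(2)])
    then have 1: "(y has_derivative blinfun_apply (integral (cbox 0 1) (B q))) (at q)"
      using at_within_open[OF q U(1)] by simp
    have "blinfun_apply (integral (cbox 0 1) (B q)) v = P q * v$1 + Q q * v$2" for v
    proof -
      have "continuous_on (cbox 0 1) (\<lambda>t. (\<lambda>(q, t). B q t) (q, t))"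
        by (rule continuous_on_compose2[OF cB])
           (use q in \<open>auto intro!: continuous_on_Pair continuous_on_const continuous_on_id\<close>)
      then have "B q integrable_on cbox 0 1" by (simp add: integrable_continuous_interval)
      then have "blinfun_apply (integral (cbox 0 1) (B q)) v = integral (cbox 0 1) (\<lambda>t. D q t v)"
        by (subst blinfun_apply_integral) (simp_all add: BD)
      \<comment> \<open>Closedness makes \<open>D q t v\<close> the derivative with respect to
        \<open>t\<close> of \<open>t * (v$1 * P + v$2 * Q)\<close> along the segment.\<close>
      also have "((\<lambda>t. D q t v) has_integral (1 * (v$1 * P (w q 1) + v$2 * Q (w q 1)) - 0 * (v$1 * P (w q 0) + v$2 * Q (w q 0)))) {0..1}"
      proof (rule fundamental_theorem_of_calculus)
        fix t :: real assume t: "t \<in> {0..1}"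
        then have W: "w q t \<in> U" using wU[OF q] by simp
        have "(w q has_derivative (\<lambda>s. s *\<^sub>R (q - q0))) (at t)"
          unfolding w_def by (auto intro!: derivative_eq_intros)
        note dw = has_derivative_compose[OF this smooth_on_has_derivative[OF U(1) _ W]]
        have dh: "((\<lambda>t. h (w q t)) has_real_derivative ((q - q0)$1 * pd 1 h (w q t) + (q - q0)$2 * pd 2 h (w q t))) (at t)"
          if "smooth_on h U" for h :: "real^2 \<Rightarrow> real"
        proof -
          have "((\<lambda>t. h (w q t)) has_derivative
              (\<lambda>s. (s *\<^sub>R (q - q0))$1 *\<^sub>R pd 1 h (w q t) + (s *\<^sub>R (q - q0))$2 *\<^sub>R pd 2 h (w q t))) (at t)"
            by (rule dw[OF that])
          moreover have "(\<lambda>s. (s *\<^sub>R (q - q0))$1 *\<^sub>R pd 1 h (w q t) + (s *\<^sub>R (q - q0))$2 *\<^sub>R pd 2 h (w q t))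
             = (*) ((q - q0)$1 * pd 1 h (w q t) + (q - q0)$2 * pd 2 h (w q t))"
            by (simp add: fun_eq_iff algebra_simps)
          ultimately show ?thesis by (simp add: has_field_derivative_def)
        qed
        have "((\<lambda>t. t * (v$1 * P (w q t) + v$2 * Q (w q t))) has_real_derivative D q t v) (at t)"
          by (rule derivative_eq_intros dh sm refl)+ (simp add: D_def closed[OF W] algebra_simps)
        then show "((\<lambda>t. t * (v$1 * P (w q t) + v$2 * Q (w q t))) has_vector_derivative D q t v) (at t within {0..1})"
          by (simp add: has_real_derivative_iff_has_vector_derivative has_vector_derivative_at_within)
      qed simp
      then have "integral (cbox 0 1) (\<lambda>t. D q t v) = v$1 * P (w q 1) + v$2 * Q (w q 1)"
        by (simp add: integral_unique)
      finally show ?thesis by (simp add: w_def)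
    qed
    then have "blinfun_apply (integral (cbox 0 1) (B q)) = (\<lambda>v. P q * v$1 + Q q * v$2)" by blast
    with 1 show ?thesis by simp
  qed
  have "smooth_on y U"
  proof (rule smooth_onI[OF U(1) yD])
    show "smooth_on (\<lambda>x. P x * (axis i 1 :: real^2)$1 + Q x * (axis i 1 :: real^2)$2) U" for i :: 2
      using exhaust_2[of i] sm by (auto simp: axis_def)
  qed
  with yD show ?thesis using that by blast
qed

lemma smooth_on_eqI:
  "open S \<Longrightarrow> smooth_on g S \<Longrightarrow> (\<And>x. x \<in> S \<Longrightarrow> f x = g x) \<Longrightarrow> smooth_on f S"
  using smooth_on_cong[of S f g] by simp

section \<open>Minkowski algebra\<close>

lemma mink_add_left: "mink (u + v) w = mink u w + mink v w"
  and mink_add_right: "mink w (u + v) = mink w u + mink w v"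
  and mink_diff_left: "mink (u - v) w = mink u w - mink v w"
  and mink_diff_right: "mink w (u - v) = mink w u - mink w v"
  and mink_minus_left: "mink (- u) w = - mink u w"
  and mink_minus_right: "mink w (- u) = - mink w u"
  and mink_zero_left: "mink 0 w = 0"
  and mink_zero_right: "mink w 0 = 0"
  by (simp_all add: mink_def algebra_simps)

lemma mink_scaleR_left: "mink (c *\<^sub>R u) w = c * mink u w"
  and mink_scaleR_right: "mink w (c *\<^sub>R u) = c * mink w u" for u w :: "real^4"
  by (simp_all add: mink_def algebra_simps)

lemma mink_smult_left: "mink (c *s u) w = c * mink u w"
  and mink_smult_right: "mink w (c *s u) = c * mink w u"
  by (simp_all add: mink_def algebra_simps)

lemma mink_commute: "mink u v = mink v u"
  by (simp add: mink_def mult.commute)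

lemmas mink_simps = mink_add_left mink_add_right mink_diff_left mink_diff_right mink_minus_left
  mink_minus_right mink_zero_left mink_zero_right mink_scaleR_left mink_scaleR_right

lemma bounded_bilinear_mink: "bounded_bilinear (mink :: real^4 \<Rightarrow> real^4 \<Rightarrow> real)"
  by (simp add: bilinear_conv_bounded_bilinear[symmetric] bilinear_def linear_iff mink_add_left
      mink_add_right mink_scaleR_left mink_scaleR_right)

lemma pd_mink:
  fixes f g :: "real^2 \<Rightarrow> real^4"
  assumes "f differentiable at q" "g differentiable at q"
  shows "pd i (\<lambda>x. mink (f x) (g x)) q = mink (pd i f q) (g q) + mink (f q) (pd i g q)"
  by (rule pd_bilinear[OF bounded_bilinear_mink assms])

section \<open>Space-like frames and the normal projection\<close>

text \<open>Sylvester's criterion for the form to be positive definite on the plane of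
  \<open>a\<close> and \<open>b\<close>, with their independence included.\<close>

definition spacelike_frame :: "real^4 \<Rightarrow> real^4 \<Rightarrow> bool" where
  "spacelike_frame a b \<longleftrightarrow> mink a a > 0 \<and> mink a a * mink b b - (mink a b)\<^sup>2 > 0"

definition gram :: "real^4 \<Rightarrow> real^4 \<Rightarrow> real" where
  "gram a b = mink a a * mink b b - (mink a b)\<^sup>2"

lemma spacelike_frame_combination:
  "mink (r *\<^sub>R a + s *\<^sub>R b) (r *\<^sub>R a + s *\<^sub>R b) = r\<^sup>2 * mink a a + 2 * r * s * mink a b + s\<^sup>2 * mink b b"
  by (simp add: mink_simps mink_commute[of b a] algebra_simps power2_eq_square)

lemma spacelike_frameI:
  assumes "\<And>r s. r \<noteq> 0 \<or> s \<noteq> 0 \<Longrightarrow> mink (r *\<^sub>R a + s *\<^sub>R b) (r *\<^sub>R a + s *\<^sub>R b) > 0"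
  shows "spacelike_frame a b"
proof -
  have a: "mink a a > 0" using assms[of 1 0] by simp
  \<comment> \<open>At this vector the quadratic form takes the value \<open>mink a a\<close> times
    the Gram determinant.\<close>
  have "mink (mink a b *\<^sub>R a + (- mink a a) *\<^sub>R b) (mink a b *\<^sub>R a + (- mink a a) *\<^sub>R b) > 0"
    by (rule assms) (use a in simp)
  then have "mink a a * (mink a a * mink b b - (mink a b)\<^sup>2) > 0"
    unfolding spacelike_frame_combination by (simp add: algebra_simps power2_eq_square)
  with a show ?thesis by (simp add: spacelike_frame_def zero_less_mult_iff)
qed

lemma spacelike_frame_pos:
  assumes "spacelike_frame a b" "r \<noteq> 0 \<or> s \<noteq> 0"
  shows "mink (r *\<^sub>R a + s *\<^sub>R b) (r *\<^sub>R a + s *\<^sub>R b) > 0"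
proof -
  have "mink a a * mink (r *\<^sub>R a + s *\<^sub>R b) (r *\<^sub>R a + s *\<^sub>R b)
      = (r * mink a a + s * mink a b)\<^sup>2 + s\<^sup>2 * (mink a a * mink b b - (mink a b)\<^sup>2)"
    unfolding spacelike_frame_combination by (simp add: algebra_simps power2_eq_square)
  also have "\<dots> > 0"
  proof (cases "s = 0")
    case True
    with assms show ?thesis by (simp add: spacelike_frame_def)
  next
    case False
    then have "s\<^sup>2 * (mink a a * mink b b - (mink a b)\<^sup>2) > 0"
      using assms by (simp add: spacelike_frame_def)
    then show ?thesis by (meson add_nonneg_pos zero_le_power2)
  qed
  finally show ?thesis using assms by (simp add: spacelike_frame_def zero_less_mult_iff)
qed

text \<open>The form is definite on the tangent plane, so there a vector orthogonal to the plane is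
  zero although the ambient form has null vectors.\<close>

lemma spacelike_frame_orthogonal_zero:
  assumes "spacelike_frame a b" "v = r *\<^sub>R a + s *\<^sub>R b" "mink v a = 0" "mink v b = 0"
  shows "v = 0"
proof -
  have "mink v v = r * mink v a + s * mink v b"
    by (subst (2) assms(2)) (simp add: mink_simps)
  with assms spacelike_frame_pos[OF assms(1), of r s] show ?thesis by (cases "r = 0 \<and> s = 0") auto
qed

text \<open>\<open>normal_part\<close> as a function of the frame alone, with the inverse of the
  metric written out; a change of parameters then becomes linear algebra in the tangent
  plane.\<close>

definition nrm :: "real^4 \<Rightarrow> real^4 \<Rightarrow> real^4 \<Rightarrow> real^4" where
  "nrm a b v = v - ((mink b b * mink v a - mink a b * mink v b) / gram a b) *\<^sub>R a
                 - ((mink a a * mink v b - mink a b * mink v a) / gram a b) *\<^sub>R b"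

lemma spacelike_frame_gram: "spacelike_frame a b \<Longrightarrow> gram a b > 0"
  by (simp add: spacelike_frame_def gram_def)

lemma nrm_add: "nrm a b (u + v) = nrm a b u + nrm a b v"
  and nrm_scaleR: "nrm a b (c *\<^sub>R v) = c *\<^sub>R nrm a b v"
  by (simp_all add: nrm_def mink_simps vec_eq_iff algebra_simps add_divide_distrib diff_divide_distrib)

lemma nrm_orthogonal:
  assumes "spacelike_frame a b"
  shows "mink (nrm a b v) a = 0" "mink (nrm a b v) b = 0"
proof -
  have g: "gram a b \<noteq> 0" using spacelike_frame_gram[OF assms] by simp
  have "gram a b * mink (nrm a b v) a = 0" "gram a b * mink (nrm a b v) b = 0"
    using g by (simp_all add: nrm_def mink_simps mink_commute[of b a] right_diff_distrib)
      (simp_all add: gram_def algebra_simps power2_eq_square)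
  with g show "mink (nrm a b v) a = 0" "mink (nrm a b v) b = 0" by auto
qed

lemma nrm_unique:
  assumes "spacelike_frame a b" "v = n + r *\<^sub>R a + s *\<^sub>R b" "mink n a = 0" "mink n b = 0"
  shows "nrm a b v = n"
proof -
  have g: "gram a b \<noteq> 0" using spacelike_frame_gram[OF assms(1)] by simp
  have "(mink b b * mink v a - mink a b * mink v b) = r * gram a b"
    "(mink a a * mink v b - mink a b * mink v a) = s * gram a b"
    by (simp_all add: assms mink_simps mink_commute[of b a] gram_def algebra_simps power2_eq_square)
  with g have "(mink b b * mink v a - mink a b * mink v b) / gram a b = r"
    "(mink a a * mink v b - mink a b * mink v a) / gram a b = s" by simp_all
  then show ?thesis by (simp add: nrm_def assms(2))
qed

lemma nrm_tangent: "spacelike_frame a b \<Longrightarrow> nrm a b (r *\<^sub>R a + s *\<^sub>R b) = 0"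
  by (rule nrm_unique[where r = r and s = s]) (simp_all add: mink_simps)

lemma nrm_self [simp]: "spacelike_frame a b \<Longrightarrow> nrm a b a = 0" "spacelike_frame a b \<Longrightarrow> nrm a b b = 0"
  using nrm_tangent[of a b 1 0] nrm_tangent[of a b 0 1] by simp_all

lemma nrm_decompose: 
  obtains r s where "v = nrm a b v + r *\<^sub>R a + s *\<^sub>R b"
  by (rule that[of "(mink b b * mink v a - mink a b * mink v b) / gram a b"
        "(mink a a * mink v b - mink a b * mink v a) / gram a b"]) (simp add: nrm_def)

lemma gram_change_frame:
  "gram (p *\<^sub>R a + r *\<^sub>R b) (q *\<^sub>R a + s *\<^sub>R b) = (p * s - q * r)\<^sup>2 * gram a b"
  by (simp add: gram_def mink_simps mink_commute[of b a] algebra_simps power2_eq_square)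

lemma spacelike_frame_change:
  assumes "spacelike_frame a b" "p * s - q * r \<noteq> 0"
  shows "spacelike_frame (p *\<^sub>R a + r *\<^sub>R b) (q *\<^sub>R a + s *\<^sub>R b)"
proof -
  have "mink (p *\<^sub>R a + r *\<^sub>R b) (p *\<^sub>R a + r *\<^sub>R b) > 0"
    by (rule spacelike_frame_pos[OF assms(1)]) (use assms(2) in auto)
  moreover have "gram (p *\<^sub>R a + r *\<^sub>R b) (q *\<^sub>R a + s *\<^sub>R b) > 0"
    unfolding gram_change_frame using assms(2) spacelike_frame_gram[OF assms(1)] by simp
  ultimately show ?thesis by (simp add: spacelike_frame_def gram_def)
qed

lemma nrm_change_frame:
  assumes "spacelike_frame a b" "p * s - q * r \<noteq> 0"
  shows "nrm (p *\<^sub>R a + r *\<^sub>R b) (q *\<^sub>R a + s *\<^sub>R b) v = nrm a b v"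
proof -
  let ?d = "p * s - q * r"
  obtain x y where xy: "v = nrm a b v + x *\<^sub>R a + y *\<^sub>R b" by (rule nrm_decompose)
  have "v = nrm a b v + ((x * s - y * q) / ?d) *\<^sub>R (p *\<^sub>R a + r *\<^sub>R b) + ((y * p - x * r) / ?d) *\<^sub>R (q *\<^sub>R a + s *\<^sub>R b)"
  proof -
    have "(x * s - y * q) / ?d * p + (y * p - x * r) / ?d * q = x"
      "(x * s - y * q) / ?d * r + (y * p - x * r) / ?d * s = y"
      using assms(2) by (simp_all add: divide_simps) (simp_all add: algebra_simps)
    moreover have "\<alpha> *\<^sub>R (p *\<^sub>R a + r *\<^sub>R b) + \<beta> *\<^sub>R (q *\<^sub>R a + s *\<^sub>R b)
        = (\<alpha> * p + \<beta> * q) *\<^sub>R a + (\<alpha> * r + \<beta> * s) *\<^sub>R b" for \<alpha> \<beta>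
      by (simp add: algebra_simps)
    ultimately have "((x * s - y * q) / ?d) *\<^sub>R (p *\<^sub>R a + r *\<^sub>R b) + ((y * p - x * r) / ?d) *\<^sub>R (q *\<^sub>R a + s *\<^sub>R b)
       = x *\<^sub>R a + y *\<^sub>R b"
      by simp
    with xy show ?thesis by (metis add.assoc)
  qed
  then show ?thesis
    by (rule nrm_unique[OF spacelike_frame_change[OF assms]])
       (simp_all add: mink_simps nrm_orthogonal[OF assms(1)])
qed

section \<open>Curvature of a parametrised surface\<close>

lemma matrix_inv_2:
  fixes A :: "real^2^2"
  assumes "det A \<noteq> 0"
  shows "matrix_inv A $ 1 $ 1 = A$2$2 / det A" "matrix_inv A $ 1 $ 2 = - A$1$2 / det A"
    "matrix_inv A $ 2 $ 1 = - A$2$1 / det A" "matrix_inv A $ 2 $ 2 = A$1$1 / det A"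
proof -
  define B :: "real^2^2" where
    "B = vector [vector [A$2$2 / det A, - A$1$2 / det A], vector [- A$2$1 / det A, A$1$1 / det A]]"
  have AB: "A ** B = mat 1" "B ** A = mat 1"
    using assms by (simp_all add: B_def matrix_matrix_mult_def mat_def vec_eq_iff forall_2 sum_2 divide_simps)
      (simp_all add: det_2 algebra_simps)
  have "matrix_inv A = B" unfolding matrix_inv_def
  proof (rule some_equality)
    fix C assume "A ** C = mat 1 \<and> C ** A = mat 1"
    then show "C = B" using AB(1) by (metis matrix_mul_assoc matrix_mul_lid matrix_mul_rid)
  qed (use AB in simp)
  then show "matrix_inv A $ 1 $ 1 = A$2$2 / det A" "matrix_inv A $ 1 $ 2 = - A$1$2 / det A"
    "matrix_inv A $ 2 $ 1 = - A$2$1 / det A" "matrix_inv A $ 2 $ 2 = A$1$1 / det A"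
    by (simp_all add: B_def)
qed

definition regular_on :: "(real^2 \<Rightarrow> real^4) \<Rightarrow> (real^2) set \<Rightarrow> bool" where
  "regular_on X S \<longleftrightarrow> open S \<and> smooth_on X S \<and> (\<forall>q\<in>S. spacelike_frame (pd 1 X q) (pd 2 X q))"

abbreviation gramX where "gramX X q \<equiv> gram (pd 1 X q) (pd 2 X q)"

abbreviation nrmX where "nrmX X q \<equiv> nrm (pd 1 X q) (pd 2 X q)"

context
  fixes X :: "real^2 \<Rightarrow> real^4" and S
  assumes reg: "regular_on X S"
begin

lemma reg_open: "open S" and reg_smooth: "smooth_on X S"
  and reg_frame: "q \<in> S \<Longrightarrow> spacelike_frame (pd 1 X q) (pd 2 X q)"
  and reg_gram: "q \<in> S \<Longrightarrow> gramX X q > 0"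
  using reg by (auto simp: regular_on_def intro: spacelike_frame_gram)

lemma reg_pd: "smooth_on (pd i X) S" and reg_pd2: "smooth_on (pd i (pd j X)) S"
  by (intro smooth_on_pd reg_smooth)+

lemma reg_diff: "q \<in> S \<Longrightarrow> X differentiable at q" "q \<in> S \<Longrightarrow> pd i X differentiable at q"
  "q \<in> S \<Longrightarrow> pd i (pd j X) differentiable at q"
  by (rule smooth_on_differentiable[OF reg_open reg_smooth] smooth_on_differentiable[OF reg_open reg_pd] smooth_on_differentiable[OF reg_open reg_pd2], assumption)+

lemma pd2_commute: "q \<in> S \<Longrightarrow> pd 2 (pd 1 X) q = pd 1 (pd 2 X) q"
  using pd_commute[OF reg_open reg_smooth] by simp

lemma det_metric_matrix: "det (metric_matrix X q) = gramX X q"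
  by (simp add: det_2 metric_matrix_def metric_coeff_def gram_def power2_eq_square mink_commute[of "pd 2 X q" "pd 1 X q"])

lemma inv_metric_eq:
  assumes "q \<in> S"
  shows "inv_metric X 1 1 q = mink (pd 2 X q) (pd 2 X q) / gramX X q"
    "inv_metric X 2 2 q = mink (pd 1 X q) (pd 1 X q) / gramX X q"
    "inv_metric X 1 2 q = - mink (pd 1 X q) (pd 2 X q) / gramX X q"
    "inv_metric X 2 1 q = - mink (pd 1 X q) (pd 2 X q) / gramX X q"
proof -
  have "det (metric_matrix X q) \<noteq> 0" using reg_gram[OF assms] by (simp add: det_metric_matrix)
  from matrix_inv_2[OF this] show "inv_metric X 1 1 q = mink (pd 2 X q) (pd 2 X q) / gramX X q"
    "inv_metric X 2 2 q = mink (pd 1 X q) (pd 1 X q) / gramX X q"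
    "inv_metric X 1 2 q = - mink (pd 1 X q) (pd 2 X q) / gramX X q"
    "inv_metric X 2 1 q = - mink (pd 1 X q) (pd 2 X q) / gramX X q"
    unfolding inv_metric_def det_metric_matrix
    by (simp_all add: metric_matrix_def metric_coeff_def mink_commute)
qed

lemma normal_part_eq: "q \<in> S \<Longrightarrow> normal_part X q v = nrmX X q v"
  by (simp add: normal_part_def nrm_def sum_2 inv_metric_eq algebra_simps diff_divide_distrib)

lemma mean_curvature_eq:
  assumes "q \<in> S"
  shows "mean_curvature X q = (1 / (2 * gramX X q)) *\<^sub>R nrmX X q
    (mink (pd 2 X q) (pd 2 X q) *\<^sub>R pd 1 (pd 1 X) q - (2 * mink (pd 1 X q) (pd 2 X q)) *\<^sub>R pd 1 (pd 2 X) q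
      + mink (pd 1 X q) (pd 1 X q) *\<^sub>R pd 2 (pd 2 X) q)"
proof -
  have "nrmX X q (a *\<^sub>R u - b *\<^sub>R v + c *\<^sub>R w) = a *\<^sub>R nrmX X q u - b *\<^sub>R nrmX X q v + c *\<^sub>R nrmX X q w" for a b c u v w
    using nrm_add[of _ _ "a *\<^sub>R u + (- b) *\<^sub>R v"] nrm_add[of _ _ "a *\<^sub>R u" "(- b) *\<^sub>R v"] nrm_scaleR[of _ _ "- b"]
    by (simp add: nrm_add nrm_scaleR)
  note lin = this
  show ?thesis
    using reg_gram[OF assms] unfolding lin mean_curvature_def sum_2 normal_part_eq[OF assms] inv_metric_eq[OF assms]
      pd2_commute[OF assms]
    by (simp add: vec_eq_iff field_simps)
qed

text \<open>After multiplication by the Gram determinant the inverse metric becomes its adjugate,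
  and a vanishing normal part means that the trace is tangential. This form contains neither
  quotients nor projections.\<close>

lemma mean_curvature_zero_iff:
  assumes "q \<in> S"
  shows "mean_curvature X q = 0 \<longleftrightarrow> (\<exists>r s.
    mink (pd 2 X q) (pd 2 X q) *\<^sub>R pd 1 (pd 1 X) q - (2 * mink (pd 1 X q) (pd 2 X q)) *\<^sub>R pd 1 (pd 2 X) q
      + mink (pd 1 X q) (pd 1 X q) *\<^sub>R pd 2 (pd 2 X) q = r *\<^sub>R pd 1 X q + s *\<^sub>R pd 2 X q)" (is "_ \<longleftrightarrow> (\<exists>r s. ?V = _ r s)")
proof -
  have "mean_curvature X q = 0 \<longleftrightarrow> nrmX X q ?V = 0"
    using reg_gram[OF assms] by (simp add: mean_curvature_eq[OF assms])
  also have "\<dots> \<longleftrightarrow> (\<exists>r s. ?V = r *\<^sub>R pd 1 X q + s *\<^sub>R pd 2 X q)"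
    using nrm_decompose[of ?V "pd 1 X q" "pd 2 X q"] nrm_tangent[OF reg_frame[OF assms]]
    by (metis add_0)
  finally show ?thesis .
qed

lemma smooth_metric: "smooth_on (\<lambda>q. mink (pd i X q) (pd j X q)) S"
  by (rule smooth_on_bilinear[OF bounded_bilinear_mink reg_open reg_pd reg_pd])

lemma smooth_gram: "smooth_on (gramX X) S"
  unfolding gram_def power2_eq_square
  by (rule smooth_on_diff[OF reg_open smooth_on_mult[OF reg_open smooth_metric smooth_metric]
        smooth_on_mult[OF reg_open smooth_metric smooth_metric]])

lemma smooth_sqrt_gram: "smooth_on (\<lambda>q. sqrt (gramX X q)) S"
  by (rule smooth_on_sqrt[OF reg_open smooth_gram reg_gram])

lemma smooth_metric_quotient: "smooth_on (\<lambda>q. mink (pd i X q) (pd j X q) / sqrt (gramX X q)) S"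
  by (rule smooth_on_divide[OF reg_open smooth_metric smooth_sqrt_gram]) (use reg_gram in force)

text \<open>Componentwise this says that the coordinates of a stationary surface are harmonic for the
  induced metric: the forms $*dX^k$ are closed.\<close>

lemma stationary_divergence:
  assumes "q \<in> S" "mean_curvature X q = 0"
  shows "pd 1 (\<lambda>q. (mink (pd 2 X q) (pd 2 X q) / sqrt (gramX X q)) *\<^sub>R pd 1 X q
            - (mink (pd 1 X q) (pd 2 X q) / sqrt (gramX X q)) *\<^sub>R pd 2 X q) q
       + pd 2 (\<lambda>q. (mink (pd 1 X q) (pd 1 X q) / sqrt (gramX X q)) *\<^sub>R pd 2 X q
            - (mink (pd 1 X q) (pd 2 X q) / sqrt (gramX X q)) *\<^sub>R pd 1 X q) q = 0"
    (is "pd 1 ?P q + pd 2 ?Q q = 0")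
proof -
  define W where "W = (\<lambda>q. sqrt (gramX X q))"
  define g where "g = (\<lambda>i j q. mink (pd i X q) (pd j X q))"
  have Weq: "sqrt (gramX X x) = W x" for x by (simp add: W_def)
  have W0: "W q > 0" using reg_gram[OF assms(1)] by (simp add: W_def)
  have WW: "W x * W x = g 1 1 x * g 2 2 x - g 1 2 x * g 1 2 x" if "x \<in> S" for x
    using reg_gram[OF that] by (simp add: W_def g_def gram_def power2_eq_square)
  have dW: "W differentiable at q" unfolding W_def
    by (rule smooth_on_differentiable[OF reg_open smooth_sqrt_gram assms(1)])
  have dg: "g i j differentiable at q" for i j unfolding g_def
    by (rule smooth_on_differentiable[OF reg_open smooth_metric assms(1)])
  have dgW: "(\<lambda>x. g i j x / W x) differentiable at q" for i j unfolding g_def W_def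
    by (rule smooth_on_differentiable[OF reg_open smooth_metric_quotient assms(1)])
  note dX = reg_diff(2)[OF assms(1)]
  have dgWX: "(\<lambda>x. (g i j x / W x) *\<^sub>R pd k X x) differentiable at q" for i j k
    by (rule differentiable_scaleR[OF dgW dX])
  have PQ: "?P = (\<lambda>x. (g 2 2 x / W x) *\<^sub>R pd 1 X x + (- 1) *\<^sub>R ((g 1 2 x / W x) *\<^sub>R pd 2 X x))"
    "?Q = (\<lambda>x. (g 1 1 x / W x) *\<^sub>R pd 2 X x + (- 1) *\<^sub>R ((g 1 2 x / W x) *\<^sub>R pd 1 X x))"
    by (simp_all add: g_def W_def)
  have dP: "?P differentiable at q" and dQ: "?Q differentiable at q"
    unfolding PQ by (intro differentiable_add dgWX differentiable_scaleR differentiable_const)+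
  have pdgWX: "pd m (\<lambda>x. (g i j x / W x) *\<^sub>R pd k X x) q
      = pd m (\<lambda>x. g i j x / W x) q *\<^sub>R pd k X q + (g i j q / W q) *\<^sub>R pd m (pd k X) q" for m i j k
    using pd_bilinear[OF bounded_bilinear_scaleR dgW dX] .
  have pdm: "pd m (\<lambda>x. (- 1) *\<^sub>R f x) q = (- 1) *\<^sub>R pd m f q" if "f differentiable at q" for m and f :: "real^2 \<Rightarrow> real^4"
    by (rule pd_bounded_linear[OF bounded_linear_scaleR_right that])
  let ?V = "pd 1 ?P q + pd 2 ?Q q"
  obtain r s where rs: "g 2 2 q *\<^sub>R pd 1 (pd 1 X) q - (2 * g 1 2 q) *\<^sub>R pd 1 (pd 2 X) q
      + g 1 1 q *\<^sub>R pd 2 (pd 2 X) q = r *\<^sub>R pd 1 X q + s *\<^sub>R pd 2 X q"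
    using assms(2) unfolding mean_curvature_zero_iff[OF assms(1)] g_def by blast
  \<comment> \<open>The second derivatives of \<open>X\<close> enter in the combination that is
    tangential because the mean curvature vanishes; all other terms are multiples of the
    frame.\<close>
  have "\<exists>r s. ?V = r *\<^sub>R pd 1 X q + s *\<^sub>R pd 2 X q"
  proof -
    have "?V = (1 / W q) *\<^sub>R (g 2 2 q *\<^sub>R pd 1 (pd 1 X) q - (2 * g 1 2 q) *\<^sub>R pd 1 (pd 2 X) q
      + g 1 1 q *\<^sub>R pd 2 (pd 2 X) q) + (pd 1 (\<lambda>x. g 2 2 x / W x) q - pd 2 (\<lambda>x. g 1 2 x / W x) q) *\<^sub>R pd 1 X q
        + (pd 2 (\<lambda>x. g 1 1 x / W x) q - pd 1 (\<lambda>x. g 1 2 x / W x) q) *\<^sub>R pd 2 X q"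
      unfolding PQ pd_add[OF dgWX differentiable_scaleR[OF differentiable_const dgWX]] pdm[OF dgWX] pdgWX pd2_commute[OF assms(1)]
      by (simp add: vec_eq_iff algebra_simps diff_divide_distrib add_divide_distrib)
    also have "\<dots> = (r / W q + pd 1 (\<lambda>x. g 2 2 x / W x) q - pd 2 (\<lambda>x. g 1 2 x / W x) q) *\<^sub>R pd 1 X q
        + (s / W q + pd 2 (\<lambda>x. g 1 1 x / W x) q - pd 1 (\<lambda>x. g 1 2 x / W x) q) *\<^sub>R pd 2 X q"
      unfolding rs by (simp add: vec_eq_iff algebra_simps diff_divide_distrib add_divide_distrib)
    finally show ?thesis by blast
  qed
  then obtain r s where V: "?V = r *\<^sub>R pd 1 X q + s *\<^sub>R pd 2 X q" by blast
  \<comment> \<open>It remains to see that \<open>?V\<close> is orthogonal to the frame. The two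
    fields pair with the frame as \<open>W\<close> times the identity matrix; differentiating these
    pairings expresses the products with \<open>?V\<close> by derivatives of
    \<open>W\<close>.\<close>
  have mP: "mink (?P x) (pd 1 X x) = W x" "mink (?P x) (pd 2 X x) = 0"
    "mink (?Q x) (pd 1 X x) = 0" "mink (?Q x) (pd 2 X x) = W x" if "x \<in> S" for x
  proof -
    have w: "W x \<noteq> 0" using reg_gram[OF that] by (simp add: W_def)
    show "mink (?P x) (pd 1 X x) = W x" "mink (?P x) (pd 2 X x) = 0"
    "mink (?Q x) (pd 1 X x) = 0" "mink (?Q x) (pd 2 X x) = W x"
      using w WW[OF that] unfolding Weq mink_simps g_def
      by (simp_all add: divide_simps mink_commute[of "pd 2 X x" "pd 1 X x"] mult.commute)
  qed
  have pdP: "mink (pd i ?P q) (pd j X q) = pd i (\<lambda>x. mink (?P x) (pd j X x)) q - mink (?P q) (pd i (pd j X) q)" for i j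
    using pd_mink[OF dP dX] by simp
  have pdQ: "mink (pd i ?Q q) (pd j X q) = pd i (\<lambda>x. mink (?Q x) (pd j X x)) q - mink (?Q q) (pd i (pd j X) q)" for i j
    using pd_mink[OF dQ dX] by simp
  have cW: "pd i (\<lambda>x. mink (?P x) (pd 1 X x)) q = pd i W q" "pd i (\<lambda>x. mink (?P x) (pd 2 X x)) q = 0"
    "pd i (\<lambda>x. mink (?Q x) (pd 1 X x)) q = 0" "pd i (\<lambda>x. mink (?Q x) (pd 2 X x)) q = pd i W q" for i
    by (subst pd_cong[OF reg_open assms(1) mP(1)] pd_cong[OF reg_open assms(1) mP(2)]
      pd_cong[OF reg_open assms(1) mP(3)] pd_cong[OF reg_open assms(1) mP(4)]; simp)+
  \<comment> \<open>Both sides are the derivative of the Gram determinant; this cancels the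
    remaining second derivatives.\<close>
  have WdW: "2 * (W q * pd i W q) = pd i (g 1 1) q * g 2 2 q + g 1 1 q * pd i (g 2 2) q - 2 * (g 1 2 q * pd i (g 1 2) q)" for i
  proof -
    have "pd i (\<lambda>x. W x * W x) q = pd i (\<lambda>x. g 1 1 x * g 2 2 x - g 1 2 x * g 1 2 x) q"
      by (rule pd_cong[OF reg_open assms(1) WW])
    also have "\<dots> = pd i (\<lambda>x. g 1 1 x * g 2 2 x + (- 1) *\<^sub>R (g 1 2 x * g 1 2 x)) q" by simp
    also have "\<dots> = pd i (\<lambda>x. g 1 1 x * g 2 2 x) q + (- 1) *\<^sub>R pd i (\<lambda>x. g 1 2 x * g 1 2 x) q"
      by (subst pd_add, intro differentiable_mult dg, intro differentiable_scaleR differentiable_mult differentiable_const dg,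
          subst pd_bounded_linear[OF bounded_linear_scaleR_right], intro differentiable_mult dg, rule refl)
    finally show ?thesis
      by (simp add: pd_bilinear[OF bounded_bilinear_mult] dW dg)
  qed
  have pdg: "pd i (g j k) q = mink (pd i (pd j X) q) (pd k X q) + mink (pd j X q) (pd i (pd k X) q)" for i j k
    unfolding g_def by (rule pd_mink[OF dX dX])
  have "W q * mink ?V (pd 1 X q) = 0" "W q * mink ?V (pd 2 X q) = 0"
    unfolding mink_add_left pdP pdQ cW
    unfolding mink_simps Weq
    using WdW[of 1] WdW[of 2] W0 unfolding pdg
    by (simp_all add: pd2_commute[OF assms(1)] algebra_simps g_def)
       (simp_all add: mink_commute)
  with W0 have "mink ?V (pd 1 X q) = 0" "mink ?V (pd 2 X q) = 0" by auto
  with V spacelike_frame_orthogonal_zero[OF reg_frame[OF assms(1)]] show ?thesis by blast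
qed

lemma pd2_commute': "q \<in> S \<Longrightarrow> pd i (pd j X) q = pd j (pd i X) q"
  using pd2_commute exhaust_2[of i] exhaust_2[of j] by auto

section \<open>Christoffel symbols and the Gauss equation\<close>

text \<open>By the product rule and the symmetry of second derivatives, the three derivatives of the
  metric collapse to \<open>2 * mink (pd i (pd j X) q) (pd l X q)\<close>.\<close>

lemma christoffel_eq:
  assumes "q \<in> S"
  shows "christoffel X 1 i j q = (mink (pd 2 X q) (pd 2 X q) * mink (pd i (pd j X) q) (pd 1 X q)
      - mink (pd 1 X q) (pd 2 X q) * mink (pd i (pd j X) q) (pd 2 X q)) / gramX X q"
    "christoffel X 2 i j q = (mink (pd 1 X q) (pd 1 X q) * mink (pd i (pd j X) q) (pd 2 X q)
      - mink (pd 1 X q) (pd 2 X q) * mink (pd i (pd j X) q) (pd 1 X q)) / gramX X q"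
proof -
  have "pd i (metric_coeff X j l) q + pd j (metric_coeff X i l) q - pd l (metric_coeff X i j) q
     = 2 * mink (pd i (pd j X) q) (pd l X q)" for l
    unfolding metric_coeff_def[abs_def] pd_mink[OF reg_diff(2)[OF assms] reg_diff(2)[OF assms]]
    using pd2_commute'[OF assms, of i j] pd2_commute'[OF assms, of l j] pd2_commute'[OF assms, of l i]
    by (simp add: mink_commute)
  then show "christoffel X 1 i j q = (mink (pd 2 X q) (pd 2 X q) * mink (pd i (pd j X) q) (pd 1 X q)
      - mink (pd 1 X q) (pd 2 X q) * mink (pd i (pd j X) q) (pd 2 X q)) / gramX X q"
    "christoffel X 2 i j q = (mink (pd 1 X q) (pd 1 X q) * mink (pd i (pd j X) q) (pd 2 X q)
      - mink (pd 1 X q) (pd 2 X q) * mink (pd i (pd j X) q) (pd 1 X q)) / gramX X q"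
    by (simp_all add: christoffel_def sum_2 inv_metric_eq[OF assms] diff_divide_distrib)
qed

lemma gauss_formula:
  assumes "q \<in> S"
  shows "pd i (pd j X) q = nrmX X q (pd i (pd j X) q)
      + christoffel X 1 i j q *\<^sub>R pd 1 X q + christoffel X 2 i j q *\<^sub>R pd 2 X q"
  by (simp add: christoffel_eq[OF assms] nrm_def)

lemma smooth_second_metric: "smooth_on (\<lambda>q. mink (pd i (pd j X) q) (pd k X q)) S"
  by (rule smooth_on_bilinear[OF bounded_bilinear_mink reg_open reg_pd2 reg_pd])

lemma smooth_christoffel: "smooth_on (christoffel X l i j) S"
proof -
  note m = smooth_on_mult[OF reg_open smooth_metric smooth_second_metric]
  have q: "smooth_on (\<lambda>q. (mink (pd a X q) (pd b X q) * mink (pd i (pd j X) q) (pd c X q)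
      - mink (pd d X q) (pd e X q) * mink (pd i (pd j X) q) (pd f X q)) / gramX X q) S" for a b c d e f
    by (rule smooth_on_divide[OF reg_open smooth_on_diff[OF reg_open m m] smooth_gram])
       (use reg_gram in force)
  show ?thesis
    using smooth_on_eqI[OF reg_open q christoffel_eq(1)] smooth_on_eqI[OF reg_open q christoffel_eq(2)] exhaust_2[of l]
    by auto
qed

lemma smooth_normal_part: "smooth_on (\<lambda>q. nrmX X q (pd i (pd j X) q)) S"
proof -
  have "smooth_on (\<lambda>q. pd i (pd j X) q - christoffel X 1 i j q *\<^sub>R pd 1 X q - christoffel X 2 i j q *\<^sub>R pd 2 X q) S"
    by (rule smooth_on_diff[OF reg_open smooth_on_diff[OF reg_open reg_pd2
        smooth_on_bilinear[OF bounded_bilinear_scaleR reg_open smooth_christoffel reg_pd]]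
        smooth_on_bilinear[OF bounded_bilinear_scaleR reg_open smooth_christoffel reg_pd]])
  then show ?thesis
  proof (rule smooth_on_eqI[OF reg_open])
    fix q assume "q \<in> S"
    then show "nrmX X q (pd i (pd j X) q)
      = pd i (pd j X) q - christoffel X 1 i j q *\<^sub>R pd 1 X q - christoffel X 2 i j q *\<^sub>R pd 2 X q"
      using gauss_formula[of q i j] by (simp add: algebra_simps)
  qed
qed

text \<open>The Gauss formula is differentiated once more, and the derivative is moved off the
  normal part by the product rule. Exchanging \<open>m\<close> and \<open>i\<close> leaves the
  left-hand side unchanged; the difference of the two right-hand sides is the Gauss
  equation.\<close>

lemma third_derivative_tangential:
  assumes "q \<in> S"
  shows "mink (pd m (pd i (pd j X)) q) (pd 1 X q)
    = - mink (nrmX X q (pd i (pd j X) q)) (nrmX X q (pd m (pd 1 X) q))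
      + mink (pd 1 X q) (pd 1 X q) * (pd m (christoffel X 1 i j) q
          + christoffel X 1 m 1 q * christoffel X 1 i j q + christoffel X 1 m 2 q * christoffel X 2 i j q)
      + mink (pd 2 X q) (pd 1 X q) * (pd m (christoffel X 2 i j) q
          + christoffel X 2 m 1 q * christoffel X 1 i j q + christoffel X 2 m 2 q * christoffel X 2 i j q)"
proof -
  define B where "B = (\<lambda>q. nrmX X q (pd i (pd j X) q))"
  note dX = reg_diff(2)[OF assms]
  have dB: "B differentiable at q" unfolding B_def
    by (rule smooth_on_differentiable[OF reg_open smooth_normal_part assms])
  have dC: "christoffel X l i j differentiable at q" for l
    by (rule smooth_on_differentiable[OF reg_open smooth_christoffel assms])
  have dCX: "(\<lambda>x. christoffel X l i j x *\<^sub>R pd l X x) differentiable at q" for l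
    by (rule differentiable_scaleR[OF dC dX])
  have 1: "pd m (pd i (pd j X)) q = pd m (\<lambda>x. B x + christoffel X 1 i j x *\<^sub>R pd 1 X x + christoffel X 2 i j x *\<^sub>R pd 2 X x) q"
    unfolding B_def by (rule pd_cong[OF reg_open assms gauss_formula])
  have 2: "pd m (pd i (pd j X)) q = pd m B q
      + (pd m (christoffel X 1 i j) q *\<^sub>R pd 1 X q + christoffel X 1 i j q *\<^sub>R pd m (pd 1 X) q)
      + (pd m (christoffel X 2 i j) q *\<^sub>R pd 2 X q + christoffel X 2 i j q *\<^sub>R pd m (pd 2 X) q)"
    unfolding 1 by (simp add: pd_add dB dCX differentiable_add pd_bilinear[OF bounded_bilinear_scaleR dC dX])
  have "mink (pd m B q) (pd 1 X q) + mink (B q) (pd m (pd 1 X) q) = pd m (\<lambda>x. mink (B x) (pd 1 X x)) q"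
    by (rule pd_mink[OF dB dX, symmetric])
  also have "\<dots> = pd m (\<lambda>x. 0) q"
    by (rule pd_cong[OF reg_open assms]) (simp add: B_def nrm_orthogonal reg_frame)
  finally have 3: "mink (pd m B q) (pd 1 X q) = - mink (B q) (pd m (pd 1 X) q)" by simp
  have 4: "mink (B q) (pd m (pd 1 X) q) = mink (B q) (nrmX X q (pd m (pd 1 X) q))"
    by (subst gauss_formula[OF assms]) (simp add: mink_simps B_def nrm_orthogonal[OF reg_frame[OF assms]])
  have 5: "mink (pd m (pd k X) q) (pd 1 X q)
      = christoffel X 1 m k q * mink (pd 1 X q) (pd 1 X q) + christoffel X 2 m k q * mink (pd 2 X q) (pd 1 X q)" for k
    by (subst gauss_formula[OF assms]) (simp add: mink_simps nrm_orthogonal[OF reg_frame[OF assms]])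
  show ?thesis
    unfolding 2 mink_add_left mink_scaleR_left 3 4 5 by (simp add: B_def algebra_simps)
qed

text \<open>The Gauss equation. It reduces the invariance of \<^const>\<open>local_gauss_curvature\<close> under changes of
  charts to that of the second fundamental form.\<close>

lemma local_gauss_curvature_eq:
  assumes "q \<in> S"
  shows "local_gauss_curvature X q =
    (mink (nrmX X q (pd 1 (pd 1 X) q)) (nrmX X q (pd 2 (pd 2 X) q))
     - mink (nrmX X q (pd 1 (pd 2 X) q)) (nrmX X q (pd 1 (pd 2 X) q))) / gramX X q"
proof -
  have "pd 1 (pd 2 (pd 2 X)) q = pd 2 (pd 1 (pd 2 X)) q"
    by (rule pd_commute[OF reg_open reg_pd assms])
  then have "mink (pd 1 (pd 2 (pd 2 X)) q) (pd 1 X q) = mink (pd 2 (pd 1 (pd 2 X)) q) (pd 1 X q)" by simp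
  then have "(\<Sum>l\<in>UNIV. metric_coeff X l 1 q * riemann_122 X l q)
    = mink (nrmX X q (pd 1 (pd 1 X) q)) (nrmX X q (pd 2 (pd 2 X) q))
     - mink (nrmX X q (pd 1 (pd 2 X) q)) (nrmX X q (pd 1 (pd 2 X) q))"
    unfolding third_derivative_tangential[OF assms] pd2_commute[OF assms]
    by (simp add: sum_2 riemann_122_def metric_coeff_def mink_commute[of "nrmX X q (pd 2 (pd 2 X) q)"] algebra_simps)
  then show ?thesis by (simp add: local_gauss_curvature_def det_metric_matrix)
qed

end

section \<open>Reparametrisation and isometries\<close>

text \<open>Both quadratic forms are transformed by the same Jacobian matrix, and contracting one
  with the adjugate of the other leaves the squared determinant. The unsimplified sums such as
  \<open>b * d + d * b\<close> keep the shape of the second form and the metric after substitution,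
  so that the identity applies as a rule.\<close>

lemma hessian_trace_change:
  fixes u v w :: "real^'n"
  shows "(b * b * E + (b * d + d * b) * F + d * d * G) *\<^sub>R ((a * a) *\<^sub>R u + (a * c + c * a) *\<^sub>R v + (c * c) *\<^sub>R w)
    - (2 * (a * b * E + (a * d + c * b) * F + c * d * G)) *\<^sub>R ((b * a) *\<^sub>R u + (b * c + d * a) *\<^sub>R v + (d * c) *\<^sub>R w)
    + (a * a * E + (a * c + c * a) * F + c * c * G) *\<^sub>R ((b * b) *\<^sub>R u + (b * d + d * b) *\<^sub>R v + (d * d) *\<^sub>R w)
    = (a * d - b * c)\<^sup>2 *\<^sub>R (G *\<^sub>R u - (2 * F) *\<^sub>R v + E *\<^sub>R w)"
  unfolding vec_eq_iff by (simp del: vec_eq_iff) algebra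

lemma hessian_det_change:
  "mink ((a * a) *\<^sub>R u + (a * c + c * a) *\<^sub>R v + (c * c) *\<^sub>R w) ((b * b) *\<^sub>R u + (b * d + d * b) *\<^sub>R v + (d * d) *\<^sub>R w)
    - mink ((b * a) *\<^sub>R u + (b * c + d * a) *\<^sub>R v + (d * c) *\<^sub>R w) ((b * a) *\<^sub>R u + (b * c + d * a) *\<^sub>R v + (d * c) *\<^sub>R w)
    = (a * d - b * c)\<^sup>2 * (mink u w - mink v v)"
  unfolding mink_simps mink_commute[of w u] mink_commute[of w v] mink_commute[of v u] by algebra

context
  fixes X Y :: "real^2 \<Rightarrow> real^4" and \<tau> U V
  assumes Y: "regular_on Y V" and U: "open U" and sm: "smooth_on \<tau> U" and img: "\<tau> ` U \<subseteq> V"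
    and XY: "\<And>q. q \<in> U \<Longrightarrow> X q = Y (\<tau> q)"
begin

lemma reparam_pd:
  assumes "q \<in> U"
  shows "pd i X q = (pd i \<tau> q $ 1) *\<^sub>R pd 1 Y (\<tau> q) + (pd i \<tau> q $ 2) *\<^sub>R pd 2 Y (\<tau> q)"
proof -
  have "pd i X q = pd i (\<lambda>q. Y (\<tau> q)) q" by (rule pd_cong[OF U assms XY])
  also have "\<dots> = (pd i \<tau> q $ 1) *\<^sub>R pd 1 Y (\<tau> q) + (pd i \<tau> q $ 2) *\<^sub>R pd 2 Y (\<tau> q)"
    using assms img by (intro pd_compose smooth_on_differentiable[OF U sm] reg_diff[OF Y]) auto
  finally show ?thesis .
qed

text \<open>The second derivatives of \<open>\<tau>\<close> enter only tangentially. They stay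
  hidden in \<open>r\<close> and \<open>s\<close> because the normal projection removes
  them.\<close>

lemma reparam_pd2:
  assumes "q \<in> U"
  obtains r s where "pd i (pd j X) q =
      (pd j \<tau> q $ 1) *\<^sub>R ((pd i \<tau> q $ 1) *\<^sub>R pd 1 (pd 1 Y) (\<tau> q) + (pd i \<tau> q $ 2) *\<^sub>R pd 1 (pd 2 Y) (\<tau> q))
    + (pd j \<tau> q $ 2) *\<^sub>R ((pd i \<tau> q $ 1) *\<^sub>R pd 1 (pd 2 Y) (\<tau> q) + (pd i \<tau> q $ 2) *\<^sub>R pd 2 (pd 2 Y) (\<tau> q))
    + r *\<^sub>R pd 1 Y (\<tau> q) + s *\<^sub>R pd 2 Y (\<tau> q)"
proof -
  have \<tau>V: "\<tau> q \<in> V" using assms img by blast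
  have dt: "(\<lambda>x. pd j \<tau> x $ k) differentiable at q" for k
    by (rule smooth_on_differentiable[OF U smooth_on_nth[OF U smooth_on_pd[OF sm]] assms])
  have sY: "smooth_on (\<lambda>x. pd k Y (\<tau> x)) U" for k
    by (rule smooth_on_compose[OF reg_pd[OF Y] sm img U reg_open[OF Y]])
  have dY: "(\<lambda>x. pd k Y (\<tau> x)) differentiable at q" for k
    by (rule smooth_on_differentiable[OF U sY assms])
  have dtY: "(\<lambda>x. (pd j \<tau> x $ k) *\<^sub>R pd k Y (\<tau> x)) differentiable at q" for k
    by (rule differentiable_scaleR[OF dt dY])
  have "pd i (pd j X) q = pd i (\<lambda>x. (pd j \<tau> x $ 1) *\<^sub>R pd 1 Y (\<tau> x) + (pd j \<tau> x $ 2) *\<^sub>R pd 2 Y (\<tau> x)) q"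
    by (rule pd_cong[OF U assms reparam_pd])
  also have "\<dots> = (pd i (\<lambda>x. pd j \<tau> x $ 1) q *\<^sub>R pd 1 Y (\<tau> q) + (pd j \<tau> q $ 1) *\<^sub>R pd i (\<lambda>x. pd 1 Y (\<tau> x)) q)
      + (pd i (\<lambda>x. pd j \<tau> x $ 2) q *\<^sub>R pd 2 Y (\<tau> q) + (pd j \<tau> q $ 2) *\<^sub>R pd i (\<lambda>x. pd 2 Y (\<tau> x)) q)"
    by (simp add: pd_add[OF dtY dtY] pd_bilinear[OF bounded_bilinear_scaleR dt dY])
  also have "pd i (\<lambda>x. pd 1 Y (\<tau> x)) q = (pd i \<tau> q $ 1) *\<^sub>R pd 1 (pd 1 Y) (\<tau> q) + (pd i \<tau> q $ 2) *\<^sub>R pd 1 (pd 2 Y) (\<tau> q)"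
    using pd_compose[OF smooth_on_differentiable[OF U sm assms] reg_diff(2)[OF Y \<tau>V], of i 1] pd2_commute[OF Y \<tau>V] by simp
  also have "pd i (\<lambda>x. pd 2 Y (\<tau> x)) q = (pd i \<tau> q $ 1) *\<^sub>R pd 1 (pd 2 Y) (\<tau> q) + (pd i \<tau> q $ 2) *\<^sub>R pd 2 (pd 2 Y) (\<tau> q)"
    by (rule pd_compose[OF smooth_on_differentiable[OF U sm assms] reg_diff(2)[OF Y \<tau>V]])
  finally show ?thesis by (intro that) (simp add: algebra_simps)
qed

context
  assumes jac: "\<And>q. q \<in> U \<Longrightarrow> jac \<tau> q \<noteq> 0"
begin

lemma reparam_jac: "q \<in> U \<Longrightarrow> pd 1 \<tau> q $ 1 * pd 2 \<tau> q $ 2 - pd 2 \<tau> q $ 1 * pd 1 \<tau> q $ 2 \<noteq> 0"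
  using jac by (simp add: jac_def)

lemma reparam_regular: "regular_on X U"
proof -
  have "smooth_on X U"
    by (rule smooth_on_eqI[OF U smooth_on_compose[OF reg_smooth[OF Y] sm img U reg_open[OF Y]] XY])
  moreover have "spacelike_frame (pd 1 X q) (pd 2 X q)" if "q \<in> U" for q
    unfolding reparam_pd[OF that]
    by (rule spacelike_frame_change[OF reg_frame[OF Y] reparam_jac[OF that]]) (use that img in auto)
  ultimately show ?thesis using U by (simp add: regular_on_def)
qed

lemma reparam_gram: "q \<in> U \<Longrightarrow> gramX X q = (jac \<tau> q)\<^sup>2 * gramX Y (\<tau> q)"
  by (simp add: reparam_pd gram_change_frame jac_def mult.commute)

lemma reparam_nrm:
  assumes "q \<in> U"
  shows "nrmX X q v = nrmX Y (\<tau> q) v"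
  unfolding reparam_pd[OF assms]
  by (rule nrm_change_frame[OF reg_frame[OF Y] reparam_jac[OF assms]]) (use assms img in auto)

lemma reparam_second_form:
  assumes "q \<in> U"
  shows "nrmX X q (pd i (pd j X) q) =
      (pd j \<tau> q $ 1 * pd i \<tau> q $ 1) *\<^sub>R nrmX Y (\<tau> q) (pd 1 (pd 1 Y) (\<tau> q))
    + (pd j \<tau> q $ 1 * pd i \<tau> q $ 2 + pd j \<tau> q $ 2 * pd i \<tau> q $ 1) *\<^sub>R nrmX Y (\<tau> q) (pd 1 (pd 2 Y) (\<tau> q))
    + (pd j \<tau> q $ 2 * pd i \<tau> q $ 2) *\<^sub>R nrmX Y (\<tau> q) (pd 2 (pd 2 Y) (\<tau> q))"
proof -
  have f: "spacelike_frame (pd 1 Y (\<tau> q)) (pd 2 Y (\<tau> q))" using reg_frame[OF Y] assms img by auto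
  obtain r s where "pd i (pd j X) q =
      (pd j \<tau> q $ 1) *\<^sub>R ((pd i \<tau> q $ 1) *\<^sub>R pd 1 (pd 1 Y) (\<tau> q) + (pd i \<tau> q $ 2) *\<^sub>R pd 1 (pd 2 Y) (\<tau> q))
    + (pd j \<tau> q $ 2) *\<^sub>R ((pd i \<tau> q $ 1) *\<^sub>R pd 1 (pd 2 Y) (\<tau> q) + (pd i \<tau> q $ 2) *\<^sub>R pd 2 (pd 2 Y) (\<tau> q))
    + r *\<^sub>R pd 1 Y (\<tau> q) + s *\<^sub>R pd 2 Y (\<tau> q)" by (rule reparam_pd2[OF assms])
  then show ?thesis
    unfolding reparam_nrm[OF assms] by (simp add: nrm_add nrm_scaleR f algebra_simps)
qed

lemma reparam_mean_curvature:
  assumes "q \<in> U" "mean_curvature Y (\<tau> q) = 0"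
  shows "mean_curvature X q = 0"
proof -
  have tV: "\<tau> q \<in> V" using assms(1) img by blast
  have lin: "nrm a b (x *\<^sub>R u - y *\<^sub>R v + z *\<^sub>R w) = x *\<^sub>R nrm a b u - y *\<^sub>R nrm a b v + z *\<^sub>R nrm a b w" for a b u v w x y z
    using nrm_add[of a b "x *\<^sub>R u + (- y) *\<^sub>R v" "z *\<^sub>R w"] nrm_add[of a b "x *\<^sub>R u" "(- y) *\<^sub>R v"] nrm_scaleR[of a b "- y" v]
    by (simp add: nrm_scaleR)
  let ?B = "\<lambda>i j. nrmX Y (\<tau> q) (pd i (pd j Y) (\<tau> q))" and ?g = "\<lambda>i j. mink (pd i Y (\<tau> q)) (pd j Y (\<tau> q))"
  have 0: "?g 2 2 *\<^sub>R ?B 1 1 - (2 * ?g 1 2) *\<^sub>R ?B 1 2 + ?g 1 1 *\<^sub>R ?B 2 2 = 0"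
    using assms(2) reg_gram[OF Y tV] unfolding mean_curvature_eq[OF Y tV] lin by simp
  have g: "mink (pd i X q) (pd j X q) = pd i \<tau> q $ 1 * pd j \<tau> q $ 1 * ?g 1 1
      + (pd i \<tau> q $ 1 * pd j \<tau> q $ 2 + pd i \<tau> q $ 2 * pd j \<tau> q $ 1) * ?g 1 2
      + pd i \<tau> q $ 2 * pd j \<tau> q $ 2 * ?g 2 2" for i j
    unfolding reparam_pd[OF assms(1)] mink_simps
    by (simp add: mink_commute[of "pd 2 Y (\<tau> q)" "pd 1 Y (\<tau> q)"] algebra_simps)
  have "mink (pd 2 X q) (pd 2 X q) *\<^sub>R nrmX X q (pd 1 (pd 1 X) q)
      - (2 * mink (pd 1 X q) (pd 2 X q)) *\<^sub>R nrmX X q (pd 1 (pd 2 X) q)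
      + mink (pd 1 X q) (pd 1 X q) *\<^sub>R nrmX X q (pd 2 (pd 2 X) q)
    = (jac \<tau> q)\<^sup>2 *\<^sub>R (?g 2 2 *\<^sub>R ?B 1 1 - (2 * ?g 1 2) *\<^sub>R ?B 1 2 + ?g 1 1 *\<^sub>R ?B 2 2)"
    unfolding reparam_second_form[OF assms(1)] g jac_def by (rule hessian_trace_change)
  with 0 show ?thesis
    unfolding mean_curvature_eq[OF reparam_regular assms(1)] lin by simp
qed

lemma reparam_gauss_curvature:
  assumes "q \<in> U"
  shows "local_gauss_curvature X q = local_gauss_curvature Y (\<tau> q)"
proof -
  have tV: "\<tau> q \<in> V" using assms(1) img by blast
  let ?B = "\<lambda>i j. nrmX Y (\<tau> q) (pd i (pd j Y) (\<tau> q))"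
  have "mink (nrmX X q (pd 1 (pd 1 X) q)) (nrmX X q (pd 2 (pd 2 X) q))
     - mink (nrmX X q (pd 1 (pd 2 X) q)) (nrmX X q (pd 1 (pd 2 X) q))
    = (jac \<tau> q)\<^sup>2 * (mink (?B 1 1) (?B 2 2) - mink (?B 1 2) (?B 1 2))"
    unfolding reparam_second_form[OF assms(1)] jac_def by (rule hessian_det_change)
  then show ?thesis
    using jac[OF assms] unfolding local_gauss_curvature_eq[OF reparam_regular assms] local_gauss_curvature_eq[OF Y tV]
      reparam_gram[OF assms] by simp
qed

end

end

lemma isometry_regular:
  assumes reg: "regular_on X S" and L: "linear L" "\<And>u v. mink (L u) (L v) = mink u v" and Y: "Y = (\<lambda>q. L (X q) + b)"
  shows "regular_on Y S" "q \<in> S \<Longrightarrow> pd i Y q = L (pd i X q)"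
    "q \<in> S \<Longrightarrow> mean_curvature X q = 0 \<Longrightarrow> mean_curvature Y q = 0"
proof -
  have bl: "bounded_linear L" using L(1) by (simp add: linear_conv_bounded_linear)
  note S = reg_open[OF reg]
  have smY: "smooth_on Y S" unfolding Y
    by (intro smooth_on_add smooth_on_bounded_linear[OF bl] smooth_on_const S reg_smooth[OF reg])
  have pdY: "pd i Y q = L (pd i X q)" if "q \<in> S" for i q
    unfolding Y
    by (subst pd_add) (auto intro!: differentiable_compose[OF bounded_linear_imp_differentiable[OF bl]] 
        reg_diff[OF reg that] simp: pd_bounded_linear[OF bl reg_diff(1)[OF reg that]])
  then show "q \<in> S \<Longrightarrow> pd i Y q = L (pd i X q)" .
  show regY: "regular_on Y S"
    unfolding regular_on_def using smY S reg_frame[OF reg] by (simp add: pdY spacelike_frame_def L(2))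
  assume q: "q \<in> S" and "mean_curvature X q = 0"
  then obtain r s where rs: "mink (pd 2 X q) (pd 2 X q) *\<^sub>R pd 1 (pd 1 X) q - (2 * mink (pd 1 X q) (pd 2 X q)) *\<^sub>R pd 1 (pd 2 X) q
      + mink (pd 1 X q) (pd 1 X q) *\<^sub>R pd 2 (pd 2 X) q = r *\<^sub>R pd 1 X q + s *\<^sub>R pd 2 X q"
    unfolding mean_curvature_zero_iff[OF reg q] by blast
  have pdY2: "pd i (pd j Y) q = L (pd i (pd j X) q)" for i j
    by (rule trans[OF pd_cong[OF S q pdY] pd_bounded_linear[OF bl reg_diff(2)[OF reg q]]])
  show "mean_curvature Y q = 0"
    unfolding mean_curvature_zero_iff[OF regY q]
    using arg_cong[OF rs, of L] by (auto simp: pdY[OF q] pdY2 L linear_add[OF L(1)] linear_diff[OF L(1)] linear_scale[OF L(1)])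
qed

section \<open>Local inversion in the plane\<close>

text \<open>The injectivity half of the inverse function theorem;
  \<open>smooth_on_inverse_map\<close> adds that the inverse is smooth on an open image.\<close>

lemma smooth_locally_injective:
  fixes \<theta> :: "real^2 \<Rightarrow> real^2"
  assumes S: "open S" "smooth_on \<theta> S" "q0 \<in> S" and J: "jac \<theta> q0 \<noteq> 0"
  obtains r where "r > 0" "ball q0 r \<subseteq> S" "inj_on \<theta> (ball q0 r)"
proof -
  define f' where "f' = (\<lambda>x (v::real^2). v$1 *\<^sub>R pd 1 \<theta> x + v$2 *\<^sub>R pd 2 \<theta> x)"
  define g' where "g' = (\<lambda>v::real^2. vector [(pd 2 \<theta> q0 $ 2 * v$1 - pd 2 \<theta> q0 $ 1 * v$2) / jac \<theta> q0,
     (pd 1 \<theta> q0 $ 1 * v$2 - pd 1 \<theta> q0 $ 2 * v$1) / jac \<theta> q0] :: real^2)"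
  have "linear g'"
    by (simp add: linear_iff g'_def vec_eq_iff forall_2 algebra_simps add_divide_distrib diff_divide_distrib)
  then have bl: "bounded_linear g'" by (simp add: linear_conv_bounded_linear)
  have inv: "g' \<circ> f' q0 = id"
  proof
    fix v :: "real^2"
    have div: "x / jac \<theta> q0 = y \<longleftrightarrow> x = y * jac \<theta> q0" for x y using J by (simp add: field_simps)
    show "(g' \<circ> f' q0) v = id v"
      by (simp add: g'_def f'_def vec_eq_iff forall_2 div) (simp add: jac_def algebra_simps)
  qed
  have der: "(\<theta> has_derivative f' x) (at x)" if "x \<in> S" for x
    unfolding f'_def by (rule smooth_on_has_derivative[OF S(1,2) that])
  have on: "\<exists>d>0. \<forall>x. dist q0 x < d \<longrightarrow> onorm (\<lambda>v. f' x v - f' q0 v) < e" if "e > 0" for e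
  proof -
    have c: "isCont (pd i \<theta>) q0" for i
      using smooth_on_continuous[OF smooth_on_pd[OF S(2)]] S by (simp add: continuous_on_eq_continuous_at)
    \<comment> \<open>Thirds, so that the two columns together stay strictly below
      \<open>e\<close>.\<close>
    obtain d1 where d1: "d1 > 0" "\<And>x. dist x q0 < d1 \<Longrightarrow> dist (pd 1 \<theta> x) (pd 1 \<theta> q0) < e/3"
      using c[of 1] \<open>e > 0\<close> unfolding continuous_at_eps_delta by (meson divide_pos_pos zero_less_numeral)
    obtain d2 where d2: "d2 > 0" "\<And>x. dist x q0 < d2 \<Longrightarrow> dist (pd 2 \<theta> x) (pd 2 \<theta> q0) < e/3"
      using c[of 2] \<open>e > 0\<close> unfolding continuous_at_eps_delta by (meson divide_pos_pos zero_less_numeral)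
    have "onorm (\<lambda>v. f' x v - f' q0 v) < e" if "dist q0 x < min d1 d2" for x
    proof -
      have n1: "norm (pd 1 \<theta> x - pd 1 \<theta> q0) < e/3" and n2: "norm (pd 2 \<theta> x - pd 2 \<theta> q0) < e/3"
        using d1(2)[of x] d2(2)[of x] that by (simp_all add: dist_norm dist_commute norm_minus_commute)
      have "onorm (\<lambda>v. f' x v - f' q0 v) \<le> e/3 + e/3"
      proof (rule onorm_le)
        fix v :: "real^2"
        have "f' x v - f' q0 v = v$1 *\<^sub>R (pd 1 \<theta> x - pd 1 \<theta> q0) + v$2 *\<^sub>R (pd 2 \<theta> x - pd 2 \<theta> q0)"
          by (simp add: f'_def algebra_simps)
        also have "norm \<dots> \<le> \<bar>v$1\<bar> * norm (pd 1 \<theta> x - pd 1 \<theta> q0) + \<bar>v$2\<bar> * norm (pd 2 \<theta> x - pd 2 \<theta> q0)"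
          by (rule order_trans[OF norm_triangle_ineq]) simp
        also have "\<dots> \<le> norm v * (e/3) + norm v * (e/3)"
          using n1 n2 component_le_norm_cart[of v 1] component_le_norm_cart[of v 2]
          by (intro add_mono mult_mono) auto
        finally show "norm (f' x v - f' q0 v) \<le> (e/3 + e/3) * norm v" by (simp add: algebra_simps)
      qed
      with \<open>e > 0\<close> show ?thesis by simp
    qed
    with d1(1) d2(1) show ?thesis by (intro exI[of _ "min d1 d2"]) auto
  qed
  show ?thesis
    using has_derivative_locally_injective[OF S(3,1) bl inv der on] that by blast
qed

lemma jac_compose:
  fixes \<sigma> \<tau> :: "real^2 \<Rightarrow> real^2"
  assumes "\<tau> differentiable (at q)" "\<sigma> differentiable (at (\<tau> q))"
  shows "jac (\<lambda>x. \<sigma> (\<tau> x)) q = jac \<sigma> (\<tau> q) * jac \<tau> q"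
  unfolding jac_def pd_compose[OF assms] by (simp add: algebra_simps)

lemma jac_cong: "open S \<Longrightarrow> q \<in> S \<Longrightarrow> (\<And>x. x \<in> S \<Longrightarrow> f x = g x) \<Longrightarrow> jac f q = jac g q"
  using pd_cong[of S q f g 1] pd_cong[of S q f g 2] by (simp add: jac_def)

lemma jac_id: "jac (\<lambda>x. x) q = 1"
  by (simp add: jac_def pd_linear[OF bounded_linear_ident] axis_def)

lemma jac_inverse:
  fixes \<sigma> \<tau> :: "real^2 \<Rightarrow> real^2"
  assumes "open U" "q \<in> U" "\<And>x. x \<in> U \<Longrightarrow> \<sigma> (\<tau> x) = x" "\<tau> differentiable (at q)" "\<sigma> differentiable (at (\<tau> q))"
  shows "jac \<sigma> (\<tau> q) * jac \<tau> q = 1"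
  using jac_compose[OF assms(4,5)] jac_cong[OF assms(1,2), of "\<lambda>x. \<sigma> (\<tau> x)" "\<lambda>x. x"] assms(3)
  by (simp add: jac_id)

section \<open>Charts\<close>

lemma chart_inv_in:
  assumes "q \<in> chart_image c"
  shows "chart_inv c q \<in> fst c" "snd c (chart_inv c q) = q"
  using assms by (auto intro: inv_into_into f_inv_into_f)

context
  fixes X :: "'a topology" and c :: "'a chart"
  assumes c: "is_chart X c"
begin

lemma chart_domain_subset: "fst c \<subseteq> topspace X"
  using c openin_subset by (auto simp: is_chart_def)

lemma chart_homeo: "homeomorphic_map (subtopology X (fst c)) (top_of_set (chart_image c)) (snd c)"
  using c by (simp add: is_chart_def)

lemma chart_inj: "inj_on (snd c) (fst c)"
  using homeomorphic_imp_injective_map[OF chart_homeo] chart_domain_subset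
  by (simp add: topspace_subtopology Int_absorb1)

lemma chart_inv_left: "p \<in> fst c \<Longrightarrow> chart_inv c (snd c p) = p"
  by (rule inv_into_f_f[OF chart_inj])

lemma chart_open_image:
  assumes "openin X W" "W \<subseteq> fst c"
  shows "open (snd c ` W)"
proof -
  have "openin (subtopology X (fst c)) W" using assms by (simp add: openin_open_subtopology c[unfolded is_chart_def])
  then have "openin (top_of_set (chart_image c)) (snd c ` W)"
    using homeomorphic_imp_open_map[OF chart_homeo] by (simp add: open_map_def)
  moreover have "open (chart_image c)" using c by (simp add: is_chart_def)
  ultimately show ?thesis using openin_open_trans by blast
qed

lemma chart_open_preimage:
  assumes "open V"
  shows "openin X {p \<in> fst c. snd c p \<in> V}"
proof -
  have "openin (top_of_set (chart_image c)) (chart_image c \<inter> V)" using assms by (simp add: openin_open_Int)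
  with homeomorphic_imp_continuous_map[OF chart_homeo]
  have "openin (subtopology X (fst c)) {x \<in> topspace (subtopology X (fst c)). snd c x \<in> chart_image c \<inter> V}"
    by (rule openin_continuous_map_preimage)
  moreover have "{x \<in> topspace (subtopology X (fst c)). snd c x \<in> chart_image c \<inter> V} = {p \<in> fst c. snd c p \<in> V}"
    using chart_domain_subset by auto
  moreover have "openin X (fst c)" using c by (simp add: is_chart_def)
  ultimately show ?thesis by (metis (no_types, lifting) openin_open_subtopology)
qed

end

context
  fixes M :: "'a surface"
  assumes M: "spacelike_surface M"
begin

lemma surface_atlas: "oriented_atlas (points M) (atlas M)"
  and surface_connected: "connected_space (points M)"
  and surface_hausdorff: "Hausdorff_space (points M)"
  and surface_nonempty: "pts M \<noteq> {}"
  using M by (auto simp: spacelike_surface_def)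

lemma atlas_chart: "c \<in> atlas M \<Longrightarrow> is_chart (points M) c"
  using surface_atlas by (simp add: oriented_atlas_def)

lemma atlas_inv_left: "c \<in> atlas M \<Longrightarrow> p \<in> fst c \<Longrightarrow> chart_inv c (snd c p) = p"
  by (rule chart_inv_left[OF atlas_chart])

lemma atlas_open: "c \<in> atlas M \<Longrightarrow> open (chart_image c)"
  using atlas_chart by (auto simp: is_chart_def)

lemma atlas_openin: "c \<in> atlas M \<Longrightarrow> openin (points M) (fst c)"
  using atlas_chart by (auto simp: is_chart_def)

lemma atlas_cover: "p \<in> pts M \<Longrightarrow> \<exists>c\<in>atlas M. p \<in> fst c"
  using surface_atlas by (auto simp: oriented_atlas_def)

lemma atlas_subset: "c \<in> atlas M \<Longrightarrow> fst c \<subseteq> pts M"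
  using atlas_chart chart_domain_subset by blast

lemma atlas_regular:
  assumes "c \<in> atlas M"
  shows "regular_on (param M c) (chart_image c)"
proof -
  have sm: "smooth_on (param M c) (chart_image c)" using M assms by (simp add: spacelike_surface_def)
  have "spacelike_frame (pd 1 (param M c) q) (pd 2 (param M c) q)" if q: "q \<in> chart_image c" for q
  proof (rule spacelike_frameI)
    fix r s :: real assume rs: "r \<noteq> 0 \<or> s \<noteq> 0"
    then have "(vector [r, s] :: real^2) \<noteq> 0" by (auto simp: vec_eq_iff forall_2)
    then have "mink (frechet_derivative (param M c) (at q) (vector [r, s]))
           (frechet_derivative (param M c) (at q) (vector [r, s])) > 0"
      using M assms q unfolding spacelike_surface_def by blast
    then show "mink (r *\<^sub>R pd 1 (param M c) q + s *\<^sub>R pd 2 (param M c) q) (r *\<^sub>R pd 1 (param M c) q + s *\<^sub>R pd 2 (param M c) q) > 0"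
      by (simp add: frechet_derivative_pd[OF smooth_on_differentiable[OF atlas_open[OF assms] sm q]])
  qed
  with sm atlas_open[OF assms] show ?thesis by (simp add: regular_on_def)
qed

lemma transition_image:
  assumes "c \<in> atlas M"
  shows "q \<in> snd c ` (fst c \<inter> D) \<longleftrightarrow> q \<in> chart_image c \<and> chart_inv c q \<in> D"
  using chart_inv_left[OF atlas_chart[OF assms]] chart_inv_in[of q c] by force

lemma atlas_open_image: "c \<in> atlas M \<Longrightarrow> openin (points M) D \<Longrightarrow> open (snd c ` (fst c \<inter> D))"
  by (rule chart_open_image[OF atlas_chart]) (auto simp: atlas_openin)

lemma atlas_compatible: "c \<in> atlas M \<Longrightarrow> d \<in> atlas M \<Longrightarrow> compatible c d"
  using surface_atlas by (simp add: oriented_atlas_def)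

lemma atlas_transition:
  assumes "c \<in> atlas M" "d \<in> atlas M"
  shows "smooth_on (transition c d) (snd c ` (fst c \<inter> fst d))"
    "q \<in> snd c ` (fst c \<inter> fst d) \<Longrightarrow> jac (transition c d) q > 0"
proof -
  have o: "open (snd c ` (fst c \<inter> fst d))" using atlas_open_image assms atlas_openin by blast
  show s: "smooth_on (transition c d) (snd c ` (fst c \<inter> fst d))"
    using atlas_compatible[OF assms] by (simp add: compatible_def)
  show "q \<in> snd c ` (fst c \<inter> fst d) \<Longrightarrow> jac (transition c d) q > 0"
    using atlas_compatible[OF assms] det_frechet_derivative[OF smooth_on_differentiable[OF o s]]
    by (auto simp: compatible_def)
qed

section \<open>Charts outside the given atlas\<close>

text \<open>Smoothness with positive Jacobian in the atlas charts suffices: images of open sets are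
  open by invariance of domain, and the inverse transitions are smooth by
  \<open>smooth_on_inverse_map\<close>.\<close>

lemma oriented_chartI:
  assumes D: "openin (points M) D" and inj: "inj_on h D"
    and sm: "\<And>c. c \<in> atlas M \<Longrightarrow> smooth_on (\<lambda>q. h (chart_inv c q)) (snd c ` (fst c \<inter> D))"
    and J: "\<And>c q. c \<in> atlas M \<Longrightarrow> q \<in> snd c ` (fst c \<inter> D) \<Longrightarrow> jac (\<lambda>q. h (chart_inv c q)) q > 0"
  shows "oriented_chart M (D, h)"
proof -
  let ?U = "\<lambda>c. snd c ` (fst c \<inter> D)"
  have U: "open (?U c)" if "c \<in> atlas M" for c using atlas_open_image[OF that D] .
  have injc: "inj_on (\<lambda>q. h (chart_inv c q)) (?U c)" if "c \<in> atlas M" for c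
    using inj unfolding inj_on_def
    by (metis chart_inv_in transition_image[OF that])
  have openW: "open (h ` W)" if W: "openin (points M) W" "W \<subseteq> D" for W
  proof -
    have "open (h ` (W \<inter> fst c))" if c: "c \<in> atlas M" for c
    proof -
      have "h ` (W \<inter> fst c) = (\<lambda>q. h (chart_inv c q)) ` (snd c ` (fst c \<inter> W))"
        using chart_inv_left[OF atlas_chart[OF c]] by (force simp: image_image)
      moreover have "snd c ` (fst c \<inter> W) \<subseteq> ?U c" using W(2) by blast
      moreover have "open (snd c ` (fst c \<inter> W))" by (rule atlas_open_image[OF c W(1)])
      ultimately show ?thesis
        using invariance_of_domain[of "snd c ` (fst c \<inter> W)" "\<lambda>q. h (chart_inv c q)"]
          continuous_on_subset[OF smooth_on_continuous[OF sm[OF c]]] inj_on_subset[OF injc[OF c]] by auto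
    qed
    moreover have "h ` W = (\<Union>c\<in>atlas M. h ` (W \<inter> fst c))"
      using atlas_cover openin_subset[OF W(1)] by blast
    ultimately show ?thesis by auto
  qed
  have pre: "openin (points M) {p \<in> D. h p \<in> V}" if V: "open V" for V
  proof -
    have eq: "{p \<in> D. h p \<in> V} = (\<Union>c\<in>atlas M. {p \<in> fst c. snd c p \<in> ?U c \<inter> (\<lambda>q. h (chart_inv c q)) -` V})" (is "?l = ?r")
    proof
      show "?l \<subseteq> ?r"
      proof
        fix p assume p: "p \<in> ?l"
        then obtain c where "c \<in> atlas M" "p \<in> fst c" using atlas_cover openin_subset[OF D] by blast
        moreover from this have "snd c p \<in> ?U c" "chart_inv c (snd c p) = p"
          using p chart_inv_left[OF atlas_chart] by auto
        ultimately show "p \<in> ?r" using p by auto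
      qed
      show "?r \<subseteq> ?l"
      proof
        fix p assume "p \<in> ?r"
        then obtain c where "c \<in> atlas M" "p \<in> fst c" "snd c p \<in> ?U c" "h (chart_inv c (snd c p)) \<in> V" by blast
        then show "p \<in> ?l" using chart_inv_left[OF atlas_chart, of c p] by (simp add: transition_image)
      qed
    qed
    have op: "openin (points M) {p \<in> fst c. snd c p \<in> ?U c \<inter> (\<lambda>q. h (chart_inv c q)) -` V}" if c: "c \<in> atlas M" for c
      by (rule chart_open_preimage[OF atlas_chart[OF c]
            continuous_open_preimage[OF smooth_on_continuous[OF sm[OF c]] U[OF c] V]])
    show ?thesis unfolding eq by (rule openin_Union) (use op in blast)
  qed
  have "homeomorphic_map (subtopology (points M) D) (top_of_set (h ` D)) h"
  proof (rule bijective_open_imp_homeomorphic_map)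
    show "continuous_map (subtopology (points M) D) (top_of_set (h ` D)) h"
      unfolding continuous_map_def
    proof (intro conjI allI impI)
      fix W assume "openin (top_of_set (h ` D)) W"
      then obtain V where V: "open V" "W = h ` D \<inter> V" by (auto simp: openin_open)
      have "{x \<in> topspace (subtopology (points M) D). h x \<in> W} = {p \<in> D. h p \<in> V}"
        using V openin_subset[OF D] by auto
      then show "openin (subtopology (points M) D) {x \<in> topspace (subtopology (points M) D). h x \<in> W}"
        using pre[OF V(1)] openin_open_subtopology[OF D] by auto
    qed auto
    show "open_map (subtopology (points M) D) (top_of_set (h ` D)) h"
      unfolding open_map_def using openW openin_open_subtopology[OF D]
      by (auto simp: openin_open_eq openW[OF D subset_refl])
    show "h ` topspace (subtopology (points M) D) = topspace (top_of_set (h ` D))"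
      using openin_subset[OF D] by (simp add: Int_absorb1)
    show "inj_on h (topspace (subtopology (points M) D))"
      using inj openin_subset[OF D] by (simp add: Int_absorb1)
  qed
  then have chart: "is_chart (points M) (D, h)" using D openW[OF D] by (simp add: is_chart_def)
  have "compatible (D, h) c" if c: "c \<in> atlas M" for c
  proof -
    have tr: "transition c (D, h) = (\<lambda>q. h (chart_inv c q))" by (auto simp: transition_def)
    have inv: "transition (D, h) c (h (chart_inv c q)) = q" if "q \<in> ?U c" for q
    proof -
      have q: "q \<in> chart_image c" "chart_inv c q \<in> D" using that by (simp_all add: transition_image[OF c])
      then show ?thesis
        using chart_inv_left[OF chart, of "chart_inv c q"] chart_inv_in(2)[OF q(1)] by (simp add: transition_def)
    qed
    have Jn: "jac (\<lambda>q. h (chart_inv c q)) q \<noteq> 0" if "q \<in> ?U c" for q using J[OF c that] by simp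
    have img: "h ` (D \<inter> fst c) = (\<lambda>q. h (chart_inv c q)) ` ?U c"
      using chart_inv_left[OF atlas_chart[OF c]] by (force simp: image_image)
    have 1: "smooth_on (transition (D, h) c) (h ` (D \<inter> fst c))" and 2: "open (h ` (D \<inter> fst c))"
      unfolding img using smooth_on_inverse_map[OF U[OF c] sm[OF c], of "transition (D, h) c"] inv Jn by blast+
    have "jac (transition (D, h) c) y > 0" if "y \<in> h ` (D \<inter> fst c)" for y
    proof -
      from that obtain q where q: "q \<in> ?U c" "y = h (chart_inv c q)" unfolding img by blast
      have "jac (transition (D, h) c) y * jac (\<lambda>q. h (chart_inv c q)) q = 1"
        unfolding q(2)
        by (rule jac_inverse[where \<sigma> = "transition (D, h) c" and \<tau> = "\<lambda>q. h (chart_inv c q)", OF U[OF c] q(1) inv])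
           (use q that in \<open>auto intro: smooth_on_differentiable[OF U[OF c] sm[OF c]] smooth_on_differentiable[OF 2 1]\<close>)
      then show ?thesis using J[OF c q(1)] by (metis zero_less_mult_pos2 zero_less_one)
    qed
    then show ?thesis
      using 1 sm[OF c] det_frechet_derivative[OF smooth_on_differentiable[OF 2 1]]
      unfolding compatible_def tr by (simp add: Int_commute)
  qed
  with chart show ?thesis by (simp add: oriented_chart_def)
qed

lemma oriented_chart_change:
  assumes e: "oriented_chart M e" and c: "c \<in> atlas M"
  shows "open (snd e ` (fst e \<inter> fst c))" "smooth_on (transition e c) (snd e ` (fst e \<inter> fst c))"
    "transition e c ` (snd e ` (fst e \<inter> fst c)) \<subseteq> chart_image c"
    "q \<in> snd e ` (fst e \<inter> fst c) \<Longrightarrow> jac (transition e c) q > 0"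
    "q \<in> snd e ` (fst e \<inter> fst c) \<Longrightarrow> param M e q = param M c (transition e c q)"
    "p \<in> fst e \<Longrightarrow> p \<in> fst c \<Longrightarrow> transition e c (snd e p) = snd c p"
proof -
  have ec: "is_chart (points M) e" "compatible e c" using e c by (auto simp: oriented_chart_def)
  show o: "open (snd e ` (fst e \<inter> fst c))"
    by (rule chart_open_image[OF ec(1)]) (use ec(1) atlas_openin[OF c] in \<open>auto simp: is_chart_def\<close>)
  show sm: "smooth_on (transition e c) (snd e ` (fst e \<inter> fst c))" using ec(2) by (simp add: compatible_def)
  show "transition e c ` (snd e ` (fst e \<inter> fst c)) \<subseteq> chart_image c"
    using chart_inv_left[OF ec(1)] by (auto simp: transition_def)
  show "q \<in> snd e ` (fst e \<inter> fst c) \<Longrightarrow> jac (transition e c) q > 0"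
    using ec(2) det_frechet_derivative[OF smooth_on_differentiable[OF o sm]] by (auto simp: compatible_def)
  show "q \<in> snd e ` (fst e \<inter> fst c) \<Longrightarrow> param M e q = param M c (transition e c q)"
    using chart_inv_left[OF ec(1)] chart_inv_left[OF atlas_chart[OF c]] by (auto simp: transition_def param_def)
  show "p \<in> fst e \<Longrightarrow> p \<in> fst c \<Longrightarrow> transition e c (snd e p) = snd c p"
    using chart_inv_left[OF ec(1)] by (auto simp: transition_def)
qed

end

section \<open>Isothermal charts and the Gauss map\<close>

definition cvec :: "real^4 \<Rightarrow> complex^4" where
  "cvec a = (\<chi> k. complex_of_real (a $ k))"

lemma mink_cvec: "mink (cvec a) (cvec b) = complex_of_real (mink a b)"
  by (simp add: mink_def cvec_def)

lemma cvec_scaleR: "cvec (r *\<^sub>R a) = complex_of_real r *s cvec a"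
  by (simp_all add: cvec_def vec_eq_iff)

text \<open>If \<open>J\<close> is the rotation by a right angle in the plane of the oriented frame \<open>(a, b)\<close>, then this
  is a real multiple of $a - i\,Ja$; it therefore spans the same line as $x_z$ in an isothermal chart.\<close>

definition null_vec :: "real^4 \<Rightarrow> real^4 \<Rightarrow> complex^4" where
  "null_vec a b = Complex (sqrt (gram a b)) (mink a b) *s cvec a - (\<i> * complex_of_real (mink a a)) *s cvec b"

definition cnj_vec :: "complex^4 \<Rightarrow> complex^4" where
  "cnj_vec z = (\<chi> k. cnj (z $ k))"

lemma sqrt_gram_square: "spacelike_frame a b \<Longrightarrow> sqrt (gram a b) * sqrt (gram a b) = mink a a * mink b b - mink a b * mink a b"
  using spacelike_frame_gram[of a b] by (simp add: gram_def power2_eq_square)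

lemma null_vec_null:
  assumes "spacelike_frame a b"
  shows "mink (null_vec a b) (null_vec a b) = 0"
proof -
  have "mink (null_vec a b) (null_vec a b) = complex_of_real (mink a a) *
      (complex_of_real (sqrt (gram a b) * sqrt (gram a b)) - complex_of_real (mink a a * mink b b - mink a b * mink a b))"
    unfolding null_vec_def mink_simps mink_smult_left mink_smult_right mink_cvec mink_commute[of b a]
    by (simp add: complex_eq_iff algebra_simps)
  then show ?thesis unfolding sqrt_gram_square[OF assms] by simp
qed

lemma null_vec_nonzero:
  assumes "spacelike_frame a b"
  shows "null_vec a b \<noteq> 0"
proof
  assume 0: "null_vec a b = 0"
  have "Re (null_vec a b $ k) = sqrt (gram a b) * a $ k" for k
    by (simp add: null_vec_def cvec_def)
  with 0 spacelike_frame_gram[OF assms] have "a = 0" by (simp add: vec_eq_iff)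
  with assms show False by (simp add: spacelike_frame_def mink_zero_left)
qed

text \<open>The complex line depends only on the plane and its orientation, since the rotation
  \<open>J\<close> does; reversing the orientation replaces \<open>J\<close> by \<open>- J\<close>
  and thus conjugates the line.\<close>

lemma null_vec_change_frame:
  assumes f: "spacelike_frame a b" and D: "p * s - q * r \<noteq> 0"
  shows "\<exists>\<mu>. \<mu> \<noteq> 0 \<and> null_vec (p *\<^sub>R a + r *\<^sub>R b) (q *\<^sub>R a + s *\<^sub>R b)
    = \<mu> *s (if p * s - q * r > 0 then null_vec a b else cnj_vec (null_vec a b))"
proof -
  define E F G W where "E = mink a a" and "F = mink a b" and "G = mink b b" and "W = sqrt (gram a b)"
  have E: "E > 0" and W: "W > 0" using f spacelike_frame_gram[OF f] by (auto simp: E_def W_def spacelike_frame_def)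
  have WW: "W * W = E * G - F * F" using sqrt_gram_square[OF f] by (simp add: E_def F_def G_def W_def)
  let ?D = "p * s - q * r"
  \<comment> \<open>In the plane \<open>b\<close> equals \<open>(F a + W J a) / E\<close>, so
    replacing \<open>a\<close> by \<open>p a + r b\<close> multiplies \<open>a - i J a\<close> by
    \<open>(p E + r F + i r W) / E\<close>; the factor \<open>?D\<close> accounts for the change of
    the root of the Gram determinant.\<close>
  define \<mu>0 where "\<mu>0 = Complex (?D * (p * E + r * F) / E) (?D * (r * W) / E)"
  have \<mu>0: "\<mu>0 \<noteq> 0"
  proof
    assume "\<mu>0 = 0"
    then have "p * E + r * F = 0" "r = 0" using D E W by (auto simp: \<mu>0_def complex_eq_iff)
    with E D show False by auto
  qed
  have W': "sqrt (gram (p *\<^sub>R a + r *\<^sub>R b) (q *\<^sub>R a + s *\<^sub>R b)) = \<bar>?D\<bar> * W"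
    by (simp add: gram_change_frame W_def real_sqrt_mult)
  have F': "mink (p *\<^sub>R a + r *\<^sub>R b) (q *\<^sub>R a + s *\<^sub>R b) = p * q * E + (p * s + r * q) * F + r * s * G"
    and E': "mink (p *\<^sub>R a + r *\<^sub>R b) (p *\<^sub>R a + r *\<^sub>R b) = p * p * E + 2 * p * r * F + r * r * G"
    by (simp_all add: E_def F_def G_def mink_simps mink_commute[of b a] algebra_simps)
  have N: "null_vec a b = Complex W F *s cvec a - (\<i> * complex_of_real E) *s cvec b"
    by (simp add: null_vec_def W_def F_def E_def)
  have Er: "r * W * W = r * (E * G - F * F)" using WW by (simp add: mult.assoc)
  have N': "null_vec (p *\<^sub>R a + r *\<^sub>R b) (q *\<^sub>R a + s *\<^sub>R b) $ k =
      Complex (\<bar>?D\<bar> * W * p) (?D * (p * F + r * G)) * a $ k + Complex (\<bar>?D\<bar> * W * r) (- ?D * (p * E + r * F)) * b $ k" for k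
    unfolding null_vec_def W' E' F' by (simp add: cvec_def complex_eq_iff algebra_simps)
  have M1: "(\<mu>0 *s null_vec a b) $ k = Complex (?D * W * p) (?D * (p * F + r * G)) * a $ k + Complex (?D * W * r) (- ?D * (p * E + r * F)) * b $ k" for k
  proof -
    have "\<mu>0 * Complex W F = Complex (?D * W * p) (?D * (p * F + r * G))"
      using E Er by (simp add: \<mu>0_def complex_eq_iff divide_simps) (simp add: algebra_simps, algebra)
    moreover have "\<mu>0 * (\<i> * complex_of_real E) = - Complex (?D * W * r) (- ?D * (p * E + r * F))"
      using E by (simp add: \<mu>0_def complex_eq_iff) (simp add: algebra_simps)
    ultimately show ?thesis by (simp add: N cvec_def right_diff_distrib mult.assoc[symmetric])
  qed
  show ?thesis
  proof (cases "?D > 0")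
    case True
    then have "null_vec (p *\<^sub>R a + r *\<^sub>R b) (q *\<^sub>R a + s *\<^sub>R b) = \<mu>0 *s null_vec a b"
      by (subst vec_eq_iff) (simp only: N' M1, simp)
    with True \<mu>0 show ?thesis by (intro exI[of _ \<mu>0]) auto
  next
    case False
    have "null_vec (p *\<^sub>R a + r *\<^sub>R b) (q *\<^sub>R a + s *\<^sub>R b) $ k = (- cnj \<mu>0 *s cnj_vec (null_vec a b)) $ k" for k
    proof -
      have "(- cnj \<mu>0 *s cnj_vec (null_vec a b)) $ k = - cnj ((\<mu>0 *s null_vec a b) $ k)"
        by (simp add: cnj_vec_def)
      moreover have "\<bar>?D\<bar> = - ?D" using False by simp
      ultimately show ?thesis unfolding N' M1 by (simp only:) (simp add: complex_eq_iff algebra_simps)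
    qed
    then have "null_vec (p *\<^sub>R a + r *\<^sub>R b) (q *\<^sub>R a + s *\<^sub>R b) = - cnj \<mu>0 *s cnj_vec (null_vec a b)"
      by (simp add: vec_eq_iff)
    with False \<mu>0 show ?thesis by (intro exI[of _ "- cnj \<mu>0"]) auto
  qed
qed

lemma proj_smult: "c \<noteq> 0 \<Longrightarrow> proj (c *s z) = proj z"
proof -
  assume c: "c \<noteq> 0"
  have "\<exists>c''. d *s (c *s z) = c'' *s z \<and> c'' \<noteq> 0" if "d \<noteq> 0" for d
    using c that by (intro exI[of _ "d * c"]) simp
  moreover have "\<exists>c''. d *s z = c'' *s (c *s z) \<and> c'' \<noteq> 0" if "d \<noteq> 0" for d
    using c that by (intro exI[of _ "d / c"]) simp
  ultimately show ?thesis unfolding proj_def by (metis (no_types, lifting))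
qed

lemma proj_eq_iff: "z \<noteq> 0 \<Longrightarrow> proj z = proj w \<longleftrightarrow> (\<exists>c. c \<noteq> 0 \<and> z = c *s w)"
proof
  assume "proj z = proj w"
  moreover have "z \<in> proj z" by (auto simp: proj_def intro!: exI[of _ 1])
  ultimately show "\<exists>c. c \<noteq> 0 \<and> z = c *s w" by (auto simp: proj_def)
qed (auto simp: proj_smult)

lemma hyperplane_section_iff:
  assumes "z \<noteq> 0" "mink z z = 0"
  shows "proj z \<in> hyperplane_section A \<longleftrightarrow> mink A z = 0"
proof
  assume "mink A z = 0"
  then show "proj z \<in> hyperplane_section A" using assms by (auto simp: hyperplane_section_def)
qed (use assms proj_eq_iff[of z] in \<open>auto simp: hyperplane_section_def mink_smult_right\<close>)

lemma null_vec_isothermal: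
  assumes "spacelike_frame (pd 1 X q) (pd 2 X q)" "metric_coeff X 1 1 q = metric_coeff X 2 2 q" "metric_coeff X 1 2 q = 0"
  shows "null_vec (pd 1 X q) (pd 2 X q) = complex_of_real (2 * mink (pd 1 X q) (pd 1 X q)) *s complex_deriv_z X q"
proof -
  have "sqrt (gramX X q) = mink (pd 1 X q) (pd 1 X q)"
    using assms by (simp add: gram_def metric_coeff_def power2_eq_square spacelike_frame_def real_sqrt_mult)
  then show ?thesis
    using assms(3) by (simp add: null_vec_def metric_coeff_def complex_deriv_z_def vec_eq_iff cvec_def complex_eq_iff)
qed

section \<open>Existence of isothermal charts\<close>

text \<open>By \<open>stationary_divergence\<close> the conjugate differential of a coordinate
  \<open>X $ k\<close> is closed, so it has a primitive \<open>y\<close> on a small ball. A function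
  and its conjugate have orthogonal gradients of equal length, hence \<open>(X $ k, y)\<close> is
  isothermal wherever the differential of \<open>X $ k\<close> does not vanish.\<close>

lemma isothermal_coordinates_exist:
  assumes reg: "regular_on X S" and H: "\<And>q. q \<in> S \<Longrightarrow> mean_curvature X q = 0" and q0: "q0 \<in> S"
  obtains U \<theta> \<sigma> where "open U" "q0 \<in> U" "U \<subseteq> S" "smooth_on \<theta> U" "\<And>q. q \<in> U \<Longrightarrow> \<sigma> (\<theta> q) = q"
    "\<And>q. q \<in> U \<Longrightarrow> jac \<theta> q > 0"
    "\<And>y. y \<in> \<theta> ` U \<Longrightarrow> metric_coeff (\<lambda>y. X (\<sigma> y)) 1 1 y = metric_coeff (\<lambda>y. X (\<sigma> y)) 2 2 y"
    "\<And>y. y \<in> \<theta> ` U \<Longrightarrow> metric_coeff (\<lambda>y. X (\<sigma> y)) 1 2 y = 0"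
proof -
  note S = reg_open[OF reg]
  have "pd 1 X q0 \<noteq> 0" using reg_frame[OF reg q0] by (auto simp: spacelike_frame_def mink_zero_left)
  \<comment> \<open>The index of a coordinate whose differential is nonzero at \<open>q0\<close>;
    this coordinate becomes the first isothermal parameter.\<close>
  then obtain k where k: "pd 1 X q0 $ k \<noteq> 0" by (auto simp: vec_eq_iff)
  define g where "g = (\<lambda>i j q. mink (pd i X q) (pd j X q))"
  define W where "W = (\<lambda>q. sqrt (gramX X q))"
  define x where "x = (\<lambda>i q. pd i X q $ k)"
  define P where "P = (\<lambda>q. (g 2 2 q / W q) *\<^sub>R pd 1 X q - (g 1 2 q / W q) *\<^sub>R pd 2 X q)"
  define Q where "Q = (\<lambda>q. (g 1 1 q / W q) *\<^sub>R pd 2 X q - (g 1 2 q / W q) *\<^sub>R pd 1 X q)"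
  have sg: "smooth_on (\<lambda>q. (g i j q / W q) *\<^sub>R pd m X q) S" for i j m
    unfolding g_def W_def
    by (rule smooth_on_bilinear[OF bounded_bilinear_scaleR S smooth_metric_quotient[OF reg] reg_pd[OF reg]])
  have sP: "smooth_on P S" and sQ: "smooth_on Q S"
    unfolding P_def Q_def by (rule smooth_on_diff[OF S sg sg])+
  obtain r where r: "r > 0" "ball q0 r \<subseteq> S" using S q0 open_contains_ball by blast
  have closed: "pd 2 (\<lambda>q. - Q q $ k) q = pd 1 (\<lambda>q. P q $ k) q" if "q \<in> ball q0 r" for q
  proof -
    have q: "q \<in> S" using that r by blast
    have dP: "P differentiable at q" and dQ: "Q differentiable at q"
      using smooth_on_differentiable[OF S _ q] sP sQ by auto
    have "pd 1 P q + pd 2 Q q = 0"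
      unfolding P_def Q_def g_def W_def by (rule stationary_divergence[OF reg q H[OF q]])
    then have "pd 1 P q $ k + pd 2 Q q $ k = 0" by (metis vector_add_component zero_index)
    moreover have "pd 2 (\<lambda>q. - Q q $ k) q = - pd 2 Q q $ k"
      by (rule pd_bounded_linear[OF bounded_linear_minus[OF bounded_linear_vec_nth] dQ])
    ultimately show ?thesis using pd_nth[OF dP, of 1 k] by simp
  qed
  have sPk: "smooth_on (\<lambda>q. P q $ k) (ball q0 r)" and sQk: "smooth_on (\<lambda>q. - Q q $ k) (ball q0 r)"
    using smooth_on_subset[OF sP r(2)] smooth_on_subset[OF sQ r(2)]
    by (auto intro!: smooth_on_nth smooth_on_minus)
  obtain y where y: "\<And>q. q \<in> ball q0 r \<Longrightarrow> (y has_derivative (\<lambda>v. (- Q q $ k) * v$1 + P q $ k * v$2)) (at q)"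
    and sy: "smooth_on y (ball q0 r)"
    using poincare_lemma[OF open_ball convex_ball _ sQk sPk closed, of q0] r(1) by auto
  define \<theta> where "\<theta> = (\<lambda>q. vector [X q $ k, y q] :: real^2)"
  have s\<theta>: "smooth_on \<theta> (ball q0 r)"
  proof (rule smooth_on_vec[OF open_ball])
    fix i :: 2
    have "smooth_on (\<lambda>q. X q $ k) (ball q0 r)"
      using smooth_on_subset[OF reg_smooth[OF reg] r(2)] by (auto intro!: smooth_on_nth)
    then show "smooth_on (\<lambda>x. \<theta> x $ i) (ball q0 r)" using sy exhaust_2[of i] by (auto simp: \<theta>_def)
  qed
  have d\<theta>: "pd i \<theta> q $ 1 = x i q" "pd 1 \<theta> q $ 2 = - Q q $ k" "pd 2 \<theta> q $ 2 = P q $ k" if "q \<in> ball q0 r" for i q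
  proof -
    have d: "\<theta> differentiable at q" by (rule smooth_on_differentiable[OF open_ball s\<theta> that])
    have "pd i \<theta> q $ j = pd i (\<lambda>x. \<theta> x $ j) q" for i j using pd_nth[OF d] by simp
    moreover have "pd i (\<lambda>q. X q $ k) q = x i q" for i
      unfolding x_def using pd_nth[OF reg_diff(1)[OF reg]] that r(2) by blast
    moreover have "pd 1 y q = - Q q $ k" "pd 2 y q = P q $ k" using pd_eqI[OF y[OF that]] by (simp_all add: axis_def)
    ultimately show "pd i \<theta> q $ 1 = x i q" "pd 1 \<theta> q $ 2 = - Q q $ k" "pd 2 \<theta> q $ 2 = P q $ k"
      by (simp_all add: \<theta>_def)
  qed
  have PQk: "P q $ k = (g 2 2 q * x 1 q - g 1 2 q * x 2 q) / W q" "Q q $ k = (g 1 1 q * x 2 q - g 1 2 q * x 1 q) / W q" for q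
    by (simp_all add: P_def Q_def x_def diff_divide_distrib)
  \<comment> \<open>\<open>N\<close> is the squared length of the differential of
    \<open>X $ k\<close> in the induced metric, times the Gram determinant.\<close>
  define N where "N = (\<lambda>q. g 2 2 q * x 1 q * x 1 q - 2 * g 1 2 q * x 1 q * x 2 q + g 1 1 q * x 2 q * x 2 q)"
  have J\<theta>: "jac \<theta> q = N q / W q" if "q \<in> ball q0 r" for q
    unfolding jac_def d\<theta>[OF that] PQk N_def by (simp add: algebra_simps add_divide_distrib diff_divide_distrib)
  have W0: "W q > 0" if "q \<in> S" for q using reg_gram[OF reg that] by (simp add: W_def)
  have WW: "W q * W q = g 1 1 q * g 2 2 q - g 1 2 q * g 1 2 q" if "q \<in> S" for q
    unfolding W_def g_def by (rule sqrt_gram_square[OF reg_frame[OF reg that]])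
  have N_eq: "N q = mink (x 2 q *\<^sub>R pd 1 X q + (- x 1 q) *\<^sub>R pd 2 X q) (x 2 q *\<^sub>R pd 1 X q + (- x 1 q) *\<^sub>R pd 2 X q)" for q
    unfolding spacelike_frame_combination N_def g_def by (simp add: power2_eq_square algebra_simps)
  have N0: "N q0 > 0" unfolding N_eq
    by (rule spacelike_frame_pos[OF reg_frame[OF reg q0]]) (use k in \<open>simp add: x_def\<close>)
  have Npos: "N q > 0" if "q \<in> S" "x 1 q \<noteq> 0" for q unfolding N_eq
    by (rule spacelike_frame_pos[OF reg_frame[OF reg that(1)]]) (use that in simp)
  have q0r: "q0 \<in> ball q0 r" using r by simp
  have "jac \<theta> q0 \<noteq> 0" using J\<theta>[OF q0r] N0 W0[OF q0] by simp
  then obtain r' where r': "r' > 0" "ball q0 r' \<subseteq> ball q0 r" "inj_on \<theta> (ball q0 r')"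
    using smooth_locally_injective[OF open_ball s\<theta> q0r] by blast
  have "isCont (\<lambda>q. pd 1 X q $ k) q0"
    using smooth_on_continuous[OF smooth_on_nth[OF S reg_pd[OF reg]]] S q0
    by (simp add: continuous_on_eq_continuous_at)
  then obtain d where d: "d > 0" "\<And>q. dist q q0 < d \<Longrightarrow> dist (pd 1 X q $ k) (pd 1 X q0 $ k) < \<bar>pd 1 X q0 $ k\<bar>"
    using k unfolding continuous_at_eps_delta by (meson zero_less_abs_iff)
  define U where "U = ball q0 (min d r')"
  have U: "U \<subseteq> ball q0 r" "U \<subseteq> S" "open U" "q0 \<in> U" using r r' d(1) by (auto simp: U_def)
  have xU: "x 1 q \<noteq> 0" if "q \<in> U" for q
    using d(2)[of q] that by (auto simp: U_def dist_real_def x_def dist_commute)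
  define \<sigma> where "\<sigma> = inv_into U \<theta>"
  have inj: "inj_on \<theta> U" by (rule inj_on_subset[OF r'(3)]) (auto simp: U_def)
  have \<sigma>: "\<sigma> (\<theta> q) = q" if "q \<in> U" for q using inj that by (simp add: \<sigma>_def)
  have sU: "smooth_on \<theta> U" by (rule smooth_on_subset[OF s\<theta> U(1)])
  have JU: "jac \<theta> q > 0" if "q \<in> U" for q
  proof -
    have "q \<in> ball q0 r" "q \<in> S" using that U by auto
    then show ?thesis using J\<theta>[of q] Npos[of q] W0[of q] xU[OF that] by simp
  qed
  have JU0: "jac \<theta> q \<noteq> 0" if "q \<in> U" for q using JU[OF that] by simp
  have o\<sigma>: "open (\<theta> ` U)" "smooth_on \<sigma> (\<theta> ` U)"
    using smooth_on_inverse_map[OF U(3) sU \<sigma> JU0] by blast+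
  define Y where "Y = (\<lambda>y. X (\<sigma> y))"
  have img: "\<sigma> ` (\<theta> ` U) \<subseteq> S" using \<sigma> U by auto
  have J\<sigma>: "jac \<sigma> y \<noteq> 0" if "y \<in> \<theta> ` U" for y
  proof -
    from that obtain q where q: "q \<in> U" "y = \<theta> q" by blast
    have "jac \<sigma> (\<theta> q) * jac \<theta> q = 1"
      by (rule jac_inverse[where \<sigma> = \<sigma> and \<tau> = \<theta>, OF U(3) q(1) \<sigma>])
         (use q in \<open>auto intro: smooth_on_differentiable[OF U(3) sU] smooth_on_differentiable[OF o\<sigma>]\<close>)
    then show ?thesis using q by auto
  qed
  have regY: "regular_on Y (\<theta> ` U)" unfolding Y_def
    by (rule reparam_regular[OF reg o\<sigma> img refl J\<sigma>])
  have XY: "X q = Y (\<theta> q)" if "q \<in> U" for q using \<sigma>[OF that] by (simp add: Y_def)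
  have iso: "mink (pd 1 Y y) (pd 1 Y y) = mink (pd 2 Y y) (pd 2 Y y)" "mink (pd 1 Y y) (pd 2 Y y) = 0" if y: "y \<in> \<theta> ` U" for y
  proof -
    from y obtain q where q: "q \<in> U" "y = \<theta> q" by blast
    have qS: "q \<in> S" and qb: "q \<in> ball q0 r" using q U by auto
    have fr: "pd 1 X q = x 1 q *\<^sub>R pd 1 Y y + (- Q q $ k) *\<^sub>R pd 2 Y y" "pd 2 X q = x 2 q *\<^sub>R pd 1 Y y + (P q $ k) *\<^sub>R pd 2 Y y"
      using reparam_pd[OF regY U(3) sU subset_refl XY q(1)] unfolding q(2) d\<theta>[OF qb, symmetric] by simp_all
    have w: "W q \<noteq> 0" using W0[OF qS] by simp
    \<comment> \<open>\<open>?Y1\<close> is the gradient of \<open>X $ k\<close> times the Gram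
      determinant, and \<open>W q\<close> times \<open>?Y2\<close> is that vector turned by a right
      angle. Both turn out to be \<open>N q\<close> times the coordinate fields of the new
      parametrisation.\<close>
    let ?Y1 = "(g 2 2 q * x 1 q - g 1 2 q * x 2 q) *\<^sub>R pd 1 X q + (g 1 1 q * x 2 q - g 1 2 q * x 1 q) *\<^sub>R pd 2 X q"
    let ?Y2 = "x 1 q *\<^sub>R pd 2 X q - x 2 q *\<^sub>R pd 1 X q"
    have J: "x 1 q * P q $ k + x 2 q * Q q $ k = N q / W q"
      using J\<theta>[OF qb] unfolding jac_def d\<theta>[OF qb] by simp
    have 1: "?Y2 = (x 1 q * P q $ k + x 2 q * Q q $ k) *\<^sub>R pd 2 Y y"
      unfolding fr by (simp add: algebra_simps)
    have "P q $ k *\<^sub>R pd 1 X q + Q q $ k *\<^sub>R pd 2 X q = (x 1 q * P q $ k + x 2 q * Q q $ k) *\<^sub>R pd 1 Y y"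
      unfolding fr by (simp add: algebra_simps)
    then have "W q *\<^sub>R (P q $ k *\<^sub>R pd 1 X q + Q q $ k *\<^sub>R pd 2 X q) = (W q * (N q / W q)) *\<^sub>R pd 1 Y y"
      unfolding J by simp
    then have 2: "?Y1 = N q *\<^sub>R pd 1 Y y"
      using w by (simp add: PQk scaleR_add_right)
    have 3: "W q *\<^sub>R ?Y2 = N q *\<^sub>R pd 2 Y y" using w 1 unfolding J by simp
    have gi: "mink (pd 1 X q) (pd 1 X q) = g 1 1 q" "mink (pd 1 X q) (pd 2 X q) = g 1 2 q"
       "mink (pd 2 X q) (pd 1 X q) = g 1 2 q" "mink (pd 2 X q) (pd 2 X q) = g 2 2 q"
      by (simp_all add: g_def mink_commute)
    have "mink ?Y1 ?Y1 = (g 1 1 q * g 2 2 q - g 1 2 q * g 1 2 q) * N q"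
      unfolding mink_simps gi N_def by algebra
    moreover have "mink (W q *\<^sub>R ?Y2) (W q *\<^sub>R ?Y2) = (W q * W q) * N q"
      unfolding mink_simps gi N_def by algebra
    ultimately have "mink ?Y1 ?Y1 = mink (W q *\<^sub>R ?Y2) (W q *\<^sub>R ?Y2)" using WW[OF qS] by simp
    then show "mink (pd 1 Y y) (pd 1 Y y) = mink (pd 2 Y y) (pd 2 Y y)"
      unfolding 2 3 using Npos[OF qS xU[OF q(1)]] by (simp add: mink_simps)
    have "mink ?Y1 (W q *\<^sub>R ?Y2) = 0" unfolding mink_simps gi by algebra
    then show "mink (pd 1 Y y) (pd 2 Y y) = 0"
      unfolding 2 3 using Npos[OF qS xU[OF q(1)]] by (simp add: mink_simps)
  qed
  show ?thesis
    by (rule that[OF U(3,4,2) sU \<sigma> JU]) (use iso in \<open>auto simp: metric_coeff_def Y_def\<close>)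
qed


section \<open>The Gauss map in the charts of the atlas\<close>

definition nvec :: "'a surface \<Rightarrow> 'a chart \<Rightarrow> real^2 \<Rightarrow> complex^4" where
  "nvec M c q = null_vec (pd 1 (param M c) q) (pd 2 (param M c) q)"

context
  fixes M :: "'a surface"
  assumes M: "spacelike_surface M"
begin

lemma nvec_null: "c \<in> atlas M \<Longrightarrow> q \<in> chart_image c \<Longrightarrow> mink (nvec M c q) (nvec M c q) = 0"
  and nvec_nonzero: "c \<in> atlas M \<Longrightarrow> q \<in> chart_image c \<Longrightarrow> nvec M c q \<noteq> 0"
  unfolding nvec_def using null_vec_null null_vec_nonzero reg_frame[OF atlas_regular[OF M]] by blast+

lemma isothermal_chart_exists:
  assumes st: "stationary M" and p: "p \<in> pts M"
  obtains e where "isothermal_chart M e" "p \<in> fst e"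
proof -
  obtain c where c: "c \<in> atlas M" "p \<in> fst c" using atlas_cover[OF M p] by blast
  note ch = atlas_chart[OF M c(1)]
  have H: "mean_curvature (param M c) q = 0" if "q \<in> chart_image c" for q
    using st c(1) that unfolding stationary_def by blast
  have q0: "snd c p \<in> chart_image c" using c(2) by blast
  obtain U \<theta> \<sigma> where U: "open U" "snd c p \<in> U" "U \<subseteq> chart_image c" "smooth_on \<theta> U" and \<sigma>: "\<And>q. q \<in> U \<Longrightarrow> \<sigma> (\<theta> q) = q"
    and J: "\<And>q. q \<in> U \<Longrightarrow> jac \<theta> q > 0"
    and iso: "\<And>y. y \<in> \<theta> ` U \<Longrightarrow> metric_coeff (\<lambda>y. param M c (\<sigma> y)) 1 1 y = metric_coeff (\<lambda>y. param M c (\<sigma> y)) 2 2 y"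
    "\<And>y. y \<in> \<theta> ` U \<Longrightarrow> metric_coeff (\<lambda>y. param M c (\<sigma> y)) 1 2 y = 0"
    by (rule isothermal_coordinates_exist[OF atlas_regular[OF M c(1)] H q0], assumption, rule that)
  define D where "D = {p \<in> fst c. snd c p \<in> U}"
  define h where "h = (\<lambda>p. \<theta> (snd c p))"
  have D: "openin (points M) D" unfolding D_def by (rule chart_open_preimage[OF ch U(1)])
  have inj: "inj_on h D"
  proof (rule inj_onI)
    fix x y assume "x \<in> D" "y \<in> D" "h x = h y"
    then have "x \<in> fst c" "y \<in> fst c" "snd c x = snd c y" unfolding h_def D_def using \<sigma> by (auto, metis)
    then show "x = y" using chart_inj[OF ch] by (simp add: inj_onD)
  qed
  have sub: "snd d ` (fst d \<inter> D) \<subseteq> snd d ` (fst d \<inter> fst c)" for d by (auto simp: D_def)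
  have im: "transition d c ` (snd d ` (fst d \<inter> D)) \<subseteq> U" if "d \<in> atlas M" for d
    using chart_inv_left[OF atlas_chart[OF M that]] by (auto simp: D_def transition_def)
  have h_eq: "(\<lambda>q. h (chart_inv d q)) = (\<lambda>q. \<theta> (transition d c q))" for d by (simp add: h_def transition_def)
  have sm: "smooth_on (\<lambda>q. h (chart_inv d q)) (snd d ` (fst d \<inter> D))" if d: "d \<in> atlas M" for d
    unfolding h_eq
    by (rule smooth_on_compose[OF U(4) smooth_on_subset[OF atlas_transition(1)[OF M d c(1)] sub] im[OF d] atlas_open_image[OF M d D] U(1)])
  have Jh: "jac (\<lambda>q. h (chart_inv d q)) q > 0" if d: "d \<in> atlas M" and q: "q \<in> snd d ` (fst d \<inter> D)" for d q
  proof -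
    have qs: "q \<in> snd d ` (fst d \<inter> fst c)" by (rule subsetD[OF sub q])
    have qU: "transition d c q \<in> U" by (rule subsetD[OF im[OF d] imageI[OF q]])
    have dt: "transition d c differentiable at q"
      by (rule smooth_on_differentiable[OF atlas_open_image[OF M d atlas_openin[OF M c(1)]] atlas_transition(1)[OF M d c(1)] qs])
    show ?thesis unfolding h_eq jac_compose[OF dt smooth_on_differentiable[OF U(1,4) qU]]
      using J[OF qU] atlas_transition(2)[OF M d c(1) qs] by simp
  qed
  have oc: "oriented_chart M (D, h)" by (rule oriented_chartI[OF M D inj sm Jh])
  then have chD: "is_chart (points M) (D, h)" by (simp add: oriented_chart_def)
  have hD: "h ` D = \<theta> ` U"
  proof
    show "\<theta> ` U \<subseteq> h ` D"
    proof
      fix y assume "y \<in> \<theta> ` U"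
      then obtain q where q: "q \<in> U" "y = \<theta> q" by blast
      then have "chart_inv c q \<in> D" "h (chart_inv c q) = y" using chart_inv_in[of q c] U(3) by (auto simp: D_def h_def)
      then show "y \<in> h ` D" by blast
    qed
  qed (auto simp: h_def D_def)
  have op: "open (\<theta> ` U)" using chD hD by (simp add: is_chart_def)
  have par: "param M (D, h) y = param M c (\<sigma> y)" if "y \<in> \<theta> ` U" for y
  proof -
    from that obtain q where q: "q \<in> U" "y = \<theta> q" by blast
    then have "chart_inv c q \<in> D" "h (chart_inv c q) = y" using chart_inv_in[of q c] U(3) by (auto simp: D_def h_def)
    then have "chart_inv (D, h) y = chart_inv c q" using chart_inv_left[OF chD, of "chart_inv c q"] by simp
    then show ?thesis using q \<sigma> by (simp add: param_def)
  qed
  have "metric_coeff (param M (D, h)) i j y = metric_coeff (\<lambda>y. param M c (\<sigma> y)) i j y" if "y \<in> \<theta> ` U" for i j y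
    using pd_cong[OF op that par] by (simp add: metric_coeff_def)
  then have "isothermal_chart M (D, h)"
    unfolding isothermal_chart_def using oc iso by (simp add: hD)
  moreover have "p \<in> fst (D, h)" using c(2) U(2) by (simp add: D_def)
  ultimately show ?thesis by (rule that)
qed

text \<open>The right-hand side does not mention \<open>e\<close>, so the description in
  \<open>gauss_map\<close> has at most one solution; it may moreover be computed in any chart of the
  atlas.\<close>

lemma isothermal_chart_nvec:
  assumes e: "isothermal_chart M e" and p: "p \<in> fst e" "p \<in> fst c" and c: "c \<in> atlas M"
  shows "proj (complex_deriv_z (param M e) (snd e p)) = proj (nvec M c (snd c p))"
proof -
  have oc: "oriented_chart M e" using e by (simp add: isothermal_chart_def)
  note ch = oriented_chart_change[OF M oc c]
  let ?U = "snd e ` (fst e \<inter> fst c)" and ?q = "snd e p" and ?\<tau> = "transition e c"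
  have q: "?q \<in> ?U" using p by blast
  have jn: "jac ?\<tau> x \<noteq> 0" if "x \<in> ?U" for x using ch(4)[OF that] by simp
  note reg = atlas_regular[OF M c]
  have XY: "param M e x = param M c (?\<tau> x)" if "x \<in> ?U" for x using ch(5)[OF that] .
  note rp = reparam_pd[where X = "param M e" and Y = "param M c" and \<tau> = "?\<tau>", OF reg ch(1,2,3) XY q]
  have fe: "spacelike_frame (pd 1 (param M e) ?q) (pd 2 (param M e) ?q)"
    by (rule reg_frame[OF reparam_regular[OF reg ch(1,2,3) ch(5) jn] q])
  have \<tau>q: "?\<tau> ?q = snd c p" by (rule ch(6)[OF p])
  have fc: "spacelike_frame (pd 1 (param M c) (snd c p)) (pd 2 (param M c) (snd c p))"
    by (rule reg_frame[OF reg]) (use p in blast)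
  have Jq: "pd 1 ?\<tau> ?q $ 1 * pd 2 ?\<tau> ?q $ 2 - pd 2 ?\<tau> ?q $ 1 * pd 1 ?\<tau> ?q $ 2 > 0" using ch(4)[OF q] by (simp add: jac_def)
  then have Jq0: "pd 1 ?\<tau> ?q $ 1 * pd 2 ?\<tau> ?q $ 2 - pd 2 ?\<tau> ?q $ 1 * pd 1 ?\<tau> ?q $ 2 \<noteq> 0" by simp
  have "\<exists>\<mu>. \<mu> \<noteq> 0 \<and> null_vec (pd 1 (param M e) ?q) (pd 2 (param M e) ?q) = \<mu> *s nvec M c (snd c p)"
    using null_vec_change_frame[OF fc Jq0] Jq by (simp only: rp \<tau>q nvec_def if_True)
  then obtain \<mu> where \<mu>: "\<mu> \<noteq> 0" "null_vec (pd 1 (param M e) ?q) (pd 2 (param M e) ?q) = \<mu> *s nvec M c (snd c p)"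
    by blast
  have "metric_coeff (param M e) 1 1 ?q = metric_coeff (param M e) 2 2 ?q" "metric_coeff (param M e) 1 2 ?q = 0"
    using e p by (auto simp: isothermal_chart_def)
  from null_vec_isothermal[OF fe this] \<mu>(2)
  have "\<mu> *s nvec M c (snd c p) = complex_of_real (2 * mink (pd 1 (param M e) ?q) (pd 1 (param M e) ?q)) *s complex_deriv_z (param M e) ?q"
    by simp
  moreover have "complex_of_real (2 * mink (pd 1 (param M e) ?q) (pd 1 (param M e) ?q)) \<noteq> 0"
    using fe by (simp add: spacelike_frame_def)
  ultimately show ?thesis using proj_smult \<mu>(1) by metis
qed

lemma gauss_map_eq:
  assumes st: "stationary M" and c: "c \<in> atlas M" and p: "p \<in> fst c"
  shows "gauss_map M p = proj (nvec M c (snd c p))"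
  unfolding gauss_map_def
proof (rule the_equality)
  have "p \<in> pts M" using atlas_subset[OF M c] p by blast
  then obtain e where "isothermal_chart M e" "p \<in> fst e" by (rule isothermal_chart_exists[OF st])
  then show "\<exists>e. isothermal_chart M e \<and> p \<in> fst e \<and> proj (nvec M c (snd c p)) = proj (complex_deriv_z (param M e) (snd e p))"
    using isothermal_chart_nvec[OF _ _ p c] by metis
qed (use isothermal_chart_nvec[OF _ _ p c] in metis)

lemma gauss_image_in_hyperplane_iff:
  assumes st: "stationary M"
  shows "gauss_map M ` pts M \<subseteq> hyperplane_section A \<longleftrightarrow> (\<forall>c\<in>atlas M. \<forall>q\<in>chart_image c. mink A (nvec M c q) = 0)"
proof -
  have 1: "gauss_map M (chart_inv c q) \<in> hyperplane_section A \<longleftrightarrow> mink A (nvec M c q) = 0" "chart_inv c q \<in> pts M"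
    if "c \<in> atlas M" "q \<in> chart_image c" for c q
    using gauss_map_eq[OF st that(1) chart_inv_in(1)[OF that(2)]] chart_inv_in[OF that(2)] atlas_subset[OF M that(1)]
      hyperplane_section_iff[OF nvec_nonzero[OF that] nvec_null[OF that]] by auto
  have 2: "\<exists>c\<in>atlas M. \<exists>q\<in>chart_image c. p = chart_inv c q" if "p \<in> pts M" for p
    using atlas_cover[OF M that] chart_inv_left[OF atlas_chart[OF M]] by (metis imageI)
  show ?thesis
  proof
    assume "gauss_map M ` pts M \<subseteq> hyperplane_section A"
    then show "\<forall>c\<in>atlas M. \<forall>q\<in>chart_image c. mink A (nvec M c q) = 0" using 1 by blast
  next
    assume r: "\<forall>c\<in>atlas M. \<forall>q\<in>chart_image c. mink A (nvec M c q) = 0"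
    show "gauss_map M ` pts M \<subseteq> hyperplane_section A"
    proof (rule image_subsetI)
      fix p assume "p \<in> pts M"
      then obtain c q where "c \<in> atlas M" "q \<in> chart_image c" "p = chart_inv c q" using 2 by blast
      then show "gauss_map M p \<in> hyperplane_section A" using 1(1) r by blast
    qed
  qed
qed

end

section \<open>Lorentz transformations and the normal form of a degenerate surface\<close>

definition lorentz :: "(real^4 \<Rightarrow> real^4) \<Rightarrow> bool" where
  "lorentz L \<longleftrightarrow> linear L \<and> (\<forall>u v. mink (L u) (L v) = mink u v)"

lemma mink_nondegenerate:
  assumes "\<And>w. mink u w = 0"
  shows "u = (0::real^4)"
  using assms[of "axis 1 1"] assms[of "axis 2 1"] assms[of "axis 3 1"] assms[of "axis 4 1"]
  by (simp add: mink_def axis_def vec_eq_iff forall_4)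

lemma lorentz_inj:
  assumes "lorentz L"
  shows "inj L"
proof -
  have "u = 0" if "L u = 0" for u
  proof (rule mink_nondegenerate)
    fix w
    have "mink u w = mink (L u) (L w)" using assms by (simp add: lorentz_def)
    then show "mink u w = 0" by (simp add: that mink_zero_left)
  qed
  then show ?thesis using assms by (simp add: lorentz_def linear_injective_0)
qed

lemma lorentz_inverse:
  assumes "lorentz L"
  obtains L' where "lorentz L'" "\<And>u. L' (L u) = u" "\<And>u. L (L' u) = u"
proof -
  have lin: "linear L" and m: "\<And>u v. mink (L u) (L v) = mink u v" using assms by (auto simp: lorentz_def)
  obtain L' where L': "linear L'" "L' \<circ> L = id"
    using linear_injective_left_inverse[OF lin lorentz_inj[OF assms]] by blast
  have r: "L (L' u) = u" for u
    using linear_injective_imp_surjective[OF lin lorentz_inj[OF assms]] L'(2) by (metis comp_apply id_apply surjD)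
  have "mink (L' u) (L' v) = mink u v" for u v using m[of "L' u" "L' v"] by (simp add: r)
  with L' r show ?thesis by (intro that[of L']) (auto simp: lorentz_def fun_eq_iff)
qed

lemma lorentz_mink_isometry: "lorentz L \<Longrightarrow> mink_isometry L"
  unfolding lorentz_def mink_isometry_def by (intro exI[of _ L] exI[of _ 0]) auto

text \<open>Lagrange's identity for the spatial parts bounds \<open>(n$4 * t$4)^2\<close> by
  \<open>ns * ts\<close>. Since \<open>ts < t$4 * t$4\<close>, a vector with
  \<open>ns \<le> n$4 * n$4\<close> would have to vanish.\<close>

lemma timelike_orthogonal_spacelike:
  assumes "mink (t::real^4) t < 0" "mink n t = 0" "n \<noteq> 0"
  shows "mink n n > 0"
proof (rule ccontr)
  assume "\<not> mink n n > 0"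
  define ns ts where "ns = n$1 * n$1 + n$2 * n$2 + n$3 * n$3" and "ts = t$1 * t$1 + t$2 * t$2 + t$3 * t$3"
  have t4: "ts < t$4 * t$4" and n4: "ns \<le> n$4 * n$4"
    using assms(1) \<open>\<not> mink n n > 0\<close> by (simp_all add: mink_def ns_def ts_def)
  have e: "n$1 * t$1 + n$2 * t$2 + n$3 * t$3 = n$4 * t$4" using assms(2) by (simp add: mink_def)
  have "ns * ts - (n$1 * t$1 + n$2 * t$2 + n$3 * t$3)\<^sup>2
     = (n$1 * t$2 - n$2 * t$1)\<^sup>2 + (n$1 * t$3 - n$3 * t$1)\<^sup>2 + (n$2 * t$3 - n$3 * t$2)\<^sup>2"
    unfolding ns_def ts_def by algebra
  moreover have "(n$4 * t$4)\<^sup>2 = (n$4 * n$4) * (t$4 * t$4)" by algebra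
  ultimately have le: "(n$4 * n$4) * (t$4 * t$4) \<le> ns * ts" unfolding e
    by (smt (verit, best) zero_le_power2)
  have ts: "ts \<ge> 0" by (simp add: ts_def)
  have "ns * ts \<le> (n$4 * n$4) * ts" by (rule mult_right_mono[OF n4 ts])
  with le have "(n$4 * n$4) * (t$4 * t$4 - ts) \<le> 0" by (simp add: algebra_simps)
  with t4 have "n$4 * n$4 \<le> 0" by (simp add: mult_le_0_iff)
  then have "n$4 = 0" by (metis mult_eq_0_iff order_antisym zero_le_square)
  with n4 have "ns \<le> 0" by simp
  then have "n$1 * n$1 = 0 \<and> n$2 * n$2 = 0 \<and> n$3 * n$3 = 0" unfolding ns_def
    by (smt (verit) zero_le_square)
  with \<open>n$4 = 0\<close> assms(3) show False by (simp add: vec_eq_iff forall_4)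
qed

lemma mink_orthogonal_exists:
  fixes a b c :: "real^4"
  obtains n where "n \<noteq> 0" "mink n a = 0" "mink n b = 0" "mink n c = 0"
proof -
  \<comment> \<open>Changing the sign of the last entry turns Minkowski orthogonality into Euclidean
    orthogonality, and three vectors do not span a space of dimension 4.\<close>
  define \<eta> where "\<eta> = (\<lambda>e::real^4. vector [e$1, e$2, e$3, - e$4] :: real^4)"
  have \<eta>: "mink x e = x \<bullet> \<eta> e" for x e
    by (simp add: mink_def \<eta>_def inner_vec_def sum_4 vector_def)
  have "dim {\<eta> a, \<eta> b, \<eta> c} \<le> card {\<eta> a, \<eta> b, \<eta> c}" by (rule dim_le_card') simp
  also have "\<dots> \<le> 3" by (simp add: card_insert_if)
  finally have "dim {\<eta> a, \<eta> b, \<eta> c} < DIM(real^4)" by simp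
  then obtain n where "n \<noteq> 0" "\<And>y. y \<in> span {\<eta> a, \<eta> b, \<eta> c} \<Longrightarrow> orthogonal n y"
    using orthogonal_to_subspace_exists by blast
  then show ?thesis by (intro that[of n]) (auto simp: \<eta> orthogonal_def span_base)
qed

text \<open>Gram-Schmidt applied to \<open>u\<close> and \<open>v\<close>, completed to a Lorentz
  basis by a time-like \<open>e4\<close> and a space-like \<open>e3\<close>; \<open>L\<close> is the
  inverse of the map \<open>P\<close> with these columns.\<close>

lemma lorentz_adapted:
  fixes u v :: "real^4"
  assumes pos: "\<And>r s. r \<noteq> 0 \<or> s \<noteq> 0 \<Longrightarrow> mink (r *\<^sub>R u + s *\<^sub>R v) (r *\<^sub>R u + s *\<^sub>R v) > 0"
  obtains L where "lorentz L" "L u $ 3 = 0" "L u $ 4 = 0" "L v $ 3 = 0" "L v $ 4 = 0"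
proof -
  have uu: "mink u u > 0" using pos[of 1 0] by simp
  define e1 where "e1 = (1 / sqrt (mink u u)) *\<^sub>R u"
  have e11: "mink e1 e1 = 1" using uu by (simp add: e1_def mink_simps)
  define v' where "v' = v - mink v e1 *\<^sub>R e1"
  have "v' = (- (mink v e1 / sqrt (mink u u))) *\<^sub>R u + 1 *\<^sub>R v" by (simp add: v'_def e1_def)
  then have vv: "mink v' v' > 0" using pos[of "- (mink v e1 / sqrt (mink u u))" 1] by simp
  have v'1: "mink v' e1 = 0" by (simp add: v'_def mink_simps e11)
  define e2 where "e2 = (1 / sqrt (mink v' v')) *\<^sub>R v'"
  have e22: "mink e2 e2 = 1" and e21: "mink e2 e1 = 0" "mink e1 e2 = 0"
    using vv v'1 by (simp_all add: e2_def mink_simps mink_commute[of e1])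
  define t where "t = (axis 4 1 :: real^4)"
  define t' where "t' = t - mink t e1 *\<^sub>R e1 - mink t e2 *\<^sub>R e2"
  have tt: "mink t t = -1" by (simp add: t_def mink_def axis_def)
  \<comment> \<open>Removing space-like components from the time axis only makes it more
    time-like.\<close>
  have "mink t' t' = -1 - (mink t e1)\<^sup>2 - (mink t e2)\<^sup>2"
    by (simp add: t'_def mink_simps e11 e22 e21 tt mink_commute[of e1 t] mink_commute[of e2 t] power2_eq_square)
  then have t't': "mink t' t' < 0" by (smt (verit) zero_le_power2)
  have t'1: "mink t' e1 = 0" "mink t' e2 = 0" by (simp_all add: t'_def mink_simps e11 e22 e21)
  define e4 where "e4 = (1 / sqrt (- mink t' t')) *\<^sub>R t'"
  have e44: "mink e4 e4 = -1" and e41: "mink e4 e1 = 0" "mink e4 e2 = 0" "mink e1 e4 = 0" "mink e2 e4 = 0"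
    using t't' t'1 by (simp_all add: e4_def mink_simps mink_commute[of e1] mink_commute[of e2] divide_simps)
  obtain n where n: "n \<noteq> 0" "mink n e1 = 0" "mink n e2 = 0" "mink n e4 = 0" by (rule mink_orthogonal_exists)
  have nn: "mink n n > 0" using timelike_orthogonal_spacelike[of e4 n] e44 n by simp
  define e3 where "e3 = (1 / sqrt (mink n n)) *\<^sub>R n"
  have e33: "mink e3 e3 = 1" and e31: "mink e3 e1 = 0" "mink e3 e2 = 0" "mink e3 e4 = 0" "mink e1 e3 = 0" "mink e2 e3 = 0" "mink e4 e3 = 0"
    using nn n by (simp_all add: e3_def mink_simps mink_commute[of e1] mink_commute[of e2] mink_commute[of e4])
  define P where "P = (\<lambda>w::real^4. w$1 *\<^sub>R e1 + w$2 *\<^sub>R e2 + w$3 *\<^sub>R e3 + w$4 *\<^sub>R e4)"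
  have "linear P" by (simp add: linear_iff P_def algebra_simps)
  moreover have "mink (P x) (P y) = mink x y" for x y
    unfolding P_def mink_simps e11 e22 e33 e44 e21 e31 e41 by (simp add: mink_def)
  ultimately have "lorentz P" by (simp add: lorentz_def)
  then obtain L where L: "lorentz L" "\<And>u. L (P u) = u" using lorentz_inverse by metis
  have "P (axis 1 r + axis 2 s) = r *\<^sub>R e1 + s *\<^sub>R e2" for r s by (simp add: P_def axis_def)
  then have L12: "L (r *\<^sub>R e1 + s *\<^sub>R e2) = axis 1 r + axis 2 s" for r s using L(2) by metis
  have u: "u = sqrt (mink u u) *\<^sub>R e1 + 0 *\<^sub>R e2" using uu by (simp add: e1_def)
  have v: "v = mink v e1 *\<^sub>R e1 + sqrt (mink v' v') *\<^sub>R e2" using vv by (simp add: e2_def) (simp add: v'_def)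
  show ?thesis
    by (rule that[OF L(1)]) (subst u v, unfold L12, simp add: axis_def)+
qed

section \<open>Complexified Lorentz maps and the normal form\<close>

definition clin :: "(real^4 \<Rightarrow> real^4) \<Rightarrow> complex^4 \<Rightarrow> complex^4" where
  "clin L z = (\<chi> k. Complex (L (Re_vec z) $ k) (L (Im_vec z) $ k))"

lemma mink_complex:
  "mink z w = Complex (mink (Re_vec z) (Re_vec w) - mink (Im_vec z) (Im_vec w))
      (mink (Re_vec z) (Im_vec w) + mink (Im_vec z) (Re_vec w))"
  by (simp add: mink_def Re_vec_def Im_vec_def complex_eq_iff algebra_simps)

lemma Re_Im_clin: "Re_vec (clin L z) = L (Re_vec z)" "Im_vec (clin L z) = L (Im_vec z)"
  by (simp_all add: clin_def Re_vec_def Im_vec_def)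

lemma Re_Im_eqI: "Re_vec z = Re_vec w \<Longrightarrow> Im_vec z = Im_vec w \<Longrightarrow> z = w"
  by (simp add: Re_vec_def Im_vec_def vec_eq_iff complex_eq_iff)

lemma mink_clin: "lorentz L \<Longrightarrow> mink (clin L z) (clin L w) = mink z w"
  by (simp add: mink_complex Re_Im_clin lorentz_def)

lemma Re_Im_smult: "Re_vec (c *s z) = Re c *\<^sub>R Re_vec z - Im c *\<^sub>R Im_vec z"
  "Im_vec (c *s z) = Re c *\<^sub>R Im_vec z + Im c *\<^sub>R Re_vec z"
  by (simp_all add: Re_vec_def Im_vec_def vec_eq_iff)

lemma Re_Im_diff: "Re_vec (z - w) = Re_vec z - Re_vec w" "Im_vec (z - w) = Im_vec z - Im_vec w"
  by (simp_all add: Re_vec_def Im_vec_def vec_eq_iff)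

lemma Re_Im_cvec: "Re_vec (cvec a) = a" "Im_vec (cvec a) = 0"
  by (simp_all add: Re_vec_def Im_vec_def vec_eq_iff cvec_def)

lemma clin_smult:
  assumes "linear L" shows "clin L (c *s z) = c *s clin L z"
  by (rule Re_Im_eqI) (simp_all add: Re_Im_clin Re_Im_smult linear_add[OF assms] linear_diff[OF assms] linear_scale[OF assms])

lemma clin_null_vec:
  assumes "lorentz L"
  shows "clin L (null_vec a b) = null_vec (L a) (L b)"
proof -
  have lin: "linear L" and m: "mink (L u) (L v) = mink u v" for u v using assms by (auto simp: lorentz_def)
  have g: "gram (L a) (L b) = gram a b" by (simp add: gram_def m)
  show ?thesis
    by (rule Re_Im_eqI) (simp_all add: null_vec_def g m Re_Im_clin Re_Im_diff Re_Im_smult Re_Im_cvec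
        linear_diff[OF lin] linear_add[OF lin] linear_scale[OF lin] linear_0[OF lin])
qed

lemma clin_cnj_vec:
  assumes "linear L" shows "clin L (cnj_vec z) = cnj_vec (clin L z)"
proof -
  have "Re_vec (cnj_vec w) = Re_vec w" "Im_vec (cnj_vec w) = - Im_vec w" for w
    by (simp_all add: Re_vec_def Im_vec_def cnj_vec_def vec_eq_iff)
  then show ?thesis by (intro Re_Im_eqI) (simp_all add: Re_Im_clin linear_neg[OF assms])
qed

lemma independent_pair:
  assumes "independent {u, v}" "u \<noteq> v" "r *\<^sub>R u + s *\<^sub>R v = 0"
  shows "r = 0" "s = 0"
proof -
  have "(\<Sum>w\<in>{u, v}. (if w = u then r else s) *\<^sub>R w) = 0" using assms(2,3) by simp
  from independentD[OF assms(1) _ subset_refl this, of u] independentD[OF assms(1) _ subset_refl this, of v] assms(2)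
  show "r = 0" "s = 0" by auto
qed

text \<open>The Gauss image lies in the hyperplane $\alpha z_1 + \beta z_2 = 0$ after the Lorentz
  transformation \<open>L\<close>; \<open>Im (\<alpha> * cnj \<beta>) \<noteq> 0\<close> says that \<open>(\<alpha>, \<beta>)\<close> is not a complex multiple of a real vector.\<close>

definition normal_form :: "'a surface \<Rightarrow> (real^4 \<Rightarrow> real^4) \<Rightarrow> complex \<Rightarrow> complex \<Rightarrow> bool" where
  "normal_form M L \<alpha> \<beta> \<longleftrightarrow> lorentz L \<and> Im (\<alpha> * cnj \<beta>) \<noteq> 0 \<and>
     (\<forall>c\<in>atlas M. \<forall>q\<in>chart_image c. \<alpha> * clin L (nvec M c q) $ 1 + \<beta> * clin L (nvec M c q) $ 2 = 0)"

text \<open>\<open>L\<close> moves the space-like plane of \<open>Re_vec A\<close> and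
  \<open>Im_vec A\<close> into the plane of the first two coordinates, so \<open>clin L A\<close>
  has the form \<open>(\<alpha>, \<beta>, 0, 0)\<close>. Independence of the real and imaginary
  parts becomes \<open>Im (\<alpha> * cnj \<beta>) \<noteq> 0\<close>.\<close>

lemma degenerate_normal_form:
  assumes M: "spacelike_surface M" and st: "stationary M" and deg: "degenerate_hyperbolic M"
  obtains L \<alpha> \<beta> where "normal_form M L \<alpha> \<beta>"
proof -
  obtain A where A: "Re_vec A \<noteq> Im_vec A" "independent {Re_vec A, Im_vec A}"
    "spacelike_plane (span {Re_vec A, Im_vec A})" "gauss_map M ` pts M \<subseteq> hyperplane_section A"
    using deg unfolding degenerate_hyperbolic_def by blast
  have "mink (r *\<^sub>R Re_vec A + s *\<^sub>R Im_vec A) (r *\<^sub>R Re_vec A + s *\<^sub>R Im_vec A) > 0" if "r \<noteq> 0 \<or> s \<noteq> 0" for r s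
  proof -
    have "r *\<^sub>R Re_vec A + s *\<^sub>R Im_vec A \<in> span {Re_vec A, Im_vec A}"
      by (intro span_add span_scale span_base) auto
    moreover have "r *\<^sub>R Re_vec A + s *\<^sub>R Im_vec A \<noteq> 0" using independent_pair[OF A(2,1)] that by blast
    ultimately show ?thesis using A(3) unfolding spacelike_plane_def by blast
  qed
  then obtain L where L: "lorentz L" "L (Re_vec A) $ 3 = 0" "L (Re_vec A) $ 4 = 0" "L (Im_vec A) $ 3 = 0" "L (Im_vec A) $ 4 = 0"
    by (rule lorentz_adapted)
  have lin: "linear L" using L(1) by (simp add: lorentz_def)
  define \<alpha> where "\<alpha> = clin L A $ 1"
  define \<beta> where "\<beta> = clin L A $ 2"
  have c34: "clin L A $ 3 = 0" "clin L A $ 4 = 0" by (simp_all add: clin_def L complex_eq_iff)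
  have "Im (\<alpha> * cnj \<beta>) \<noteq> 0"
  proof
    assume 0: "Im (\<alpha> * cnj \<beta>) = 0"
    have ne: "r = 0 \<and> s = 0" if "L (r *\<^sub>R Re_vec A + s *\<^sub>R Im_vec A) = 0" for r s
    proof -
      have "r *\<^sub>R Re_vec A + s *\<^sub>R Im_vec A = 0"
        using that lorentz_inj[OF L(1)] lin by (metis injD linear_0)
      then show ?thesis using independent_pair[OF A(2,1)] by blast
    qed
    have Lk: "L (r *\<^sub>R Re_vec A + s *\<^sub>R Im_vec A) $ 1 = r * Re \<alpha> + s * Im \<alpha>"
      "L (r *\<^sub>R Re_vec A + s *\<^sub>R Im_vec A) $ 2 = r * Re \<beta> + s * Im \<beta>"
      "L (r *\<^sub>R Re_vec A + s *\<^sub>R Im_vec A) $ 3 = 0" "L (r *\<^sub>R Re_vec A + s *\<^sub>R Im_vec A) $ 4 = 0" for r s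
      by (simp_all add: linear_add[OF lin] linear_scale[OF lin] \<alpha>_def \<beta>_def clin_def L)
    \<comment> \<open>Multiplying by \<open>Im \<alpha>\<close> and \<open>- Re \<alpha>\<close>
      cancels the first entry, and the second entry is \<open>Im (\<alpha> * cnj \<beta>)\<close>;
      the choice with \<open>\<beta>\<close> exchanges the two roles.\<close>
    have "L (Im \<alpha> *\<^sub>R Re_vec A + (- Re \<alpha>) *\<^sub>R Im_vec A) = 0" "L (Im \<beta> *\<^sub>R Re_vec A + (- Re \<beta>) *\<^sub>R Im_vec A) = 0"
      unfolding vec_eq_iff forall_4 Lk using 0 by (simp_all add: algebra_simps)
    then have "\<alpha> = 0" "\<beta> = 0"
      using ne[of "Im \<alpha>" "- Re \<alpha>"] ne[of "Im \<beta>" "- Re \<beta>"] by (simp_all add: complex_eq_iff)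
    then have "L (1 *\<^sub>R Re_vec A + 0 *\<^sub>R Im_vec A) = 0" unfolding vec_eq_iff forall_4 Lk by simp
    then show False using ne by fastforce
  qed
  moreover have "\<alpha> * clin L (nvec M c q) $ 1 + \<beta> * clin L (nvec M c q) $ 2 = 0" if "c \<in> atlas M" "q \<in> chart_image c" for c q
  proof -
    have "mink A (nvec M c q) = 0"
      using A(4) that unfolding gauss_image_in_hyperplane_iff[OF M st] by blast
    then have "mink (clin L A) (clin L (nvec M c q)) = 0" by (simp add: mink_clin[OF L(1)])
    then show ?thesis by (simp add: mink_def c34 \<alpha>_def \<beta>_def)
  qed
  ultimately show ?thesis using L(1) that unfolding normal_form_def by blast
qed

text \<open>\<open>A\<close> is \<open>(\<alpha>, \<beta>, 0, 0)\<close> carried back by the inverse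
  of \<open>L\<close>. The form is Euclidean on the plane of the first two coordinates, so the span
  is space-like because the real and imaginary parts are independent.\<close>

lemma normal_form_degenerate:
  assumes M: "spacelike_surface M" and st: "stationary M" and nf: "normal_form M L \<alpha> \<beta>"
  shows "degenerate_hyperbolic M"
proof -
  have L: "lorentz L" and im: "Im (\<alpha> * cnj \<beta>) \<noteq> 0"
    and eq: "\<And>c q. c \<in> atlas M \<Longrightarrow> q \<in> chart_image c \<Longrightarrow> \<alpha> * clin L (nvec M c q) $ 1 + \<beta> * clin L (nvec M c q) $ 2 = 0"
    using nf by (auto simp: normal_form_def)
  obtain L' where L': "lorentz L'" "\<And>u. L' (L u) = u" "\<And>u. L (L' u) = u" using lorentz_inverse[OF L] by blast
  have lin': "linear L'" and lin: "linear L" using L' L by (auto simp: lorentz_def)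
  define A0 where "A0 = (vector [\<alpha>, \<beta>, 0, 0] :: complex^4)"
  define A where "A = clin L' A0"
  have LA: "clin L A = A0" by (rule Re_Im_eqI) (simp_all add: A_def Re_Im_clin L')
  have RI: "Re_vec A = L' (Re_vec A0)" "Im_vec A = L' (Im_vec A0)" by (simp_all add: A_def Re_Im_clin)
  have comp: "r *\<^sub>R Re_vec A0 + s *\<^sub>R Im_vec A0 = vector [r * Re \<alpha> + s * Im \<alpha>, r * Re \<beta> + s * Im \<beta>, 0, 0]" for r s
    by (simp add: A0_def Re_vec_def Im_vec_def vec_eq_iff forall_4 vector_def)
  have pos: "mink (r *\<^sub>R Re_vec A + s *\<^sub>R Im_vec A) (r *\<^sub>R Re_vec A + s *\<^sub>R Im_vec A) > 0" if "r \<noteq> 0 \<or> s \<noteq> 0" for r s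
  proof -
    define x y where "x = r * Re \<alpha> + s * Im \<alpha>" and "y = r * Re \<beta> + s * Im \<beta>"
    have det: "Im \<alpha> * Re \<beta> - Re \<alpha> * Im \<beta> \<noteq> 0" using im by simp
    have "x \<noteq> 0 \<or> y \<noteq> 0"
    proof (rule ccontr)
      assume "\<not> (x \<noteq> 0 \<or> y \<noteq> 0)"
      then have xy: "x = 0" "y = 0" by auto
      have "r * (Im \<alpha> * Re \<beta> - Re \<alpha> * Im \<beta>) = y * Im \<alpha> - x * Im \<beta>"
        "s * (Im \<alpha> * Re \<beta> - Re \<alpha> * Im \<beta>) = x * Re \<beta> - y * Re \<alpha>"
        by (simp_all add: x_def y_def algebra_simps)
      then show False using det that by (simp add: xy)
    qed
    moreover have "r *\<^sub>R Re_vec A + s *\<^sub>R Im_vec A = L' (vector [x, y, 0, 0])"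
      unfolding x_def y_def comp[symmetric] RI by (simp add: linear_add[OF lin'] linear_scale[OF lin'])
    moreover have "mink (vector [x, y, 0, 0] :: real^4) (vector [x, y, 0, 0]) = x * x + y * y"
      by (simp add: mink_def vector_def)
    ultimately show ?thesis using L'(1) by (simp add: lorentz_def sum_squares_gt_zero_iff)
  qed
  have neq: "Re_vec A \<noteq> Im_vec A"
  proof
    assume "Re_vec A = Im_vec A"
    then have "1 *\<^sub>R Re_vec A + (-1) *\<^sub>R Im_vec A = 0" by simp
    with pos[of 1 "-1"] show False by (simp add: mink_zero_left)
  qed
  have zero: "r = 0 \<and> s = 0" if "r *\<^sub>R Re_vec A + s *\<^sub>R Im_vec A = 0" for r s
    using pos[of r s] that by (cases "r = 0 \<and> s = 0") (auto simp: mink_zero_left)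
  have ind: "independent {Re_vec A, Im_vec A}"
  proof -
    have "Im_vec A \<noteq> 0" using zero[of 0 1] by auto
    moreover have "Re_vec A \<notin> span {Im_vec A}"
    proof
      assume "Re_vec A \<in> span {Im_vec A}"
      then obtain s where "Re_vec A = s *\<^sub>R Im_vec A" by (auto simp: span_singleton)
      with zero[of 1 "- s"] show False by simp
    qed
    ultimately show ?thesis using neq by (simp add: independent_insert)
  qed
  have sp: "spacelike_plane (span {Re_vec A, Im_vec A})"
    unfolding spacelike_plane_def
  proof (intro conjI ballI impI)
    show "dim (span {Re_vec A, Im_vec A}) = 2" using ind neq by (simp add: dim_eq_card_independent)
    fix v assume "v \<in> span {Re_vec A, Im_vec A}" "v \<noteq> 0"
    then obtain r s where v: "v = r *\<^sub>R Re_vec A + s *\<^sub>R Im_vec A"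
      by (auto simp: span_insert span_singleton algebra_simps)
    then show "mink v v > 0" using \<open>v \<noteq> 0\<close> pos[of r s] by (cases "r = 0 \<and> s = 0") auto
  qed simp
  have "mink A (nvec M c q) = 0" if "c \<in> atlas M" "q \<in> chart_image c" for c q
  proof -
    have "mink A (nvec M c q) = mink A0 (clin L (nvec M c q))" using mink_clin[OF L, of A] LA by simp
    then show ?thesis using eq[OF that] by (simp add: mink_def A0_def vector_def)
  qed
  then show ?thesis unfolding degenerate_hyperbolic_def gauss_image_in_hyperplane_iff[OF M st, symmetric]
    using neq ind sp gauss_image_in_hyperplane_iff[OF M st] by blast
qed

section \<open>Comparison with the flat metric\<close>

text \<open>The pull-back of the flat metric under the projection is uniformly equivalent to the
  induced metric. The results on distance and completeness are derived from this property
  alone.\<close>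

definition flat_comparable :: "'a surface \<Rightarrow> (real^4 \<Rightarrow> real^2) \<Rightarrow> real \<Rightarrow> bool" where
  "flat_comparable M B \<kappa> \<longleftrightarrow> linear B \<and> \<kappa> > 0 \<and> (\<forall>c\<in>atlas M. \<forall>q\<in>chart_image c. \<forall>r s.
     (let v = r *\<^sub>R pd 1 (param M c) q + s *\<^sub>R pd 2 (param M c) q
      in (norm (B v))\<^sup>2 \<le> \<kappa> * mink v v \<and> mink v v \<le> \<kappa> * (norm (B v))\<^sup>2))"

definition pr12 :: "real^4 \<Rightarrow> real^2" where
  "pr12 v = vector [v$1, v$2]"

lemma linear_pr12: "linear pr12"
  by (simp add: linear_iff pr12_def vec_eq_iff forall_2)

text \<open>\<open>null_vec a b\<close> is a real multiple of \<open>a - i J a\<close>, and the real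
  parts of the complex multiples of that vector fill the tangent plane.\<close>

lemma tangent_real_part:
  assumes "spacelike_frame a b"
  obtains w where "\<And>k. (r *\<^sub>R a + s *\<^sub>R b) $ k = Re (w * null_vec a b $ k)"
proof -
  define E F W where "E = mink a a" and "F = mink a b" and "W = sqrt (gram a b)"
  have E: "E > 0" and W: "W > 0" using assms spacelike_frame_gram[OF assms] by (auto simp: E_def W_def spacelike_frame_def)
  have "(r *\<^sub>R a + s *\<^sub>R b) $ k = Re (Complex ((r + s / E * F) / W) (s / E) * null_vec a b $ k)" for k
  proof -
    have "null_vec a b $ k = Complex (W * a $ k) (F * a $ k - E * b $ k)"
      by (simp add: null_vec_def E_def F_def W_def cvec_def complex_eq_iff)
    then show ?thesis using E W by (simp add: field_simps)
  qed
  then show ?thesis by (rule that)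
qed

lemma Re_mult_square: "(Re (w * z))\<^sup>2 = ((cmod w)\<^sup>2 * (cmod z)\<^sup>2 + Re (w\<^sup>2 * z\<^sup>2)) / 2"
  unfolding cmod_power2 by (simp add: power2_eq_square algebra_simps)

text \<open>Both squared lengths equal \<open>k * p\<close> up to an error of at most
  \<open>k * d\<close>. For the projection the error is half the real part of
  \<open>w^2 * (z$1^2 + z$2^2)\<close>; for \<open>v\<close> it comes from the difference of the
  squared moduli of \<open>z$3\<close> and \<open>z$4\<close>, which nullity bounds by the modulus
  of \<open>z$1^2 + z$2^2\<close>. Since \<open>p^2 - d^2\<close> is the square of
  \<open>2 * Im (\<alpha> * cnj \<beta>)\<close>, the error never exhausts the main term.\<close>

lemma null_vector_bounds:
  fixes z :: "complex^4" and w :: complex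
  assumes null: "mink z z = 0" and eq: "\<alpha> * z$1 + \<beta> * z$2 = 0" and im: "Im (\<alpha> * cnj \<beta>) \<noteq> 0"
  defines "p \<equiv> (cmod \<alpha>)\<^sup>2 + (cmod \<beta>)\<^sup>2" and "d \<equiv> cmod (\<alpha>\<^sup>2 + \<beta>\<^sup>2)" and "v \<equiv> (\<chi> k. Re (w * z $ k)) :: real^4"
  shows "d < p" "(norm (pr12 v))\<^sup>2 \<le> (p + d) / (p - d) * mink v v" "mink v v \<le> (p + d) / (p - d) * (norm (pr12 v))\<^sup>2"
proof -
  have d0: "d \<ge> 0" and p0: "p \<ge> 0" by (simp_all add: d_def p_def)
  have "p\<^sup>2 - d\<^sup>2 = 4 * (Im (\<alpha> * cnj \<beta>))\<^sup>2"
    unfolding p_def d_def cmod_power2 by (simp add: power2_eq_square) algebra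
  then have "d\<^sup>2 < p\<^sup>2" using im by (smt (verit) zero_less_power2)
  then show dp: "d < p" using p0 by (simp add: power2_less_imp_less)
  obtain \<sigma> where \<sigma>: "z$1 = \<beta> * \<sigma>" "z$2 = - \<alpha> * \<sigma>"
  proof (cases "\<beta> = 0")
    case True
    then show ?thesis using im by simp
  next
    case False
    then have "z$2 = - (\<alpha> * z$1) / \<beta>" using eq by (simp add: field_simps add_eq_0_iff)
    then show ?thesis using False by (intro that[of "z$1 / \<beta>"]) auto
  qed
  define k where "k = (cmod w)\<^sup>2 * (cmod \<sigma>)\<^sup>2 / 2"
  have k0: "k \<ge> 0" by (simp add: k_def)
  have S: "(cmod (z$1))\<^sup>2 + (cmod (z$2))\<^sup>2 = (cmod \<sigma>)\<^sup>2 * p"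
    unfolding \<sigma> p_def by (simp add: norm_mult power_mult_distrib algebra_simps)
  have D: "cmod ((z$1)\<^sup>2 + (z$2)\<^sup>2) = (cmod \<sigma>)\<^sup>2 * d"
  proof -
    have "(z$1)\<^sup>2 + (z$2)\<^sup>2 = \<sigma>\<^sup>2 * (\<alpha>\<^sup>2 + \<beta>\<^sup>2)" unfolding \<sigma> by algebra
    then show ?thesis by (simp add: d_def norm_mult norm_power)
  qed
  have z34: "(z$3)\<^sup>2 - (z$4)\<^sup>2 = - ((z$1)\<^sup>2 + (z$2)\<^sup>2)" using null by (simp add: mink_def power2_eq_square algebra_simps add_eq_0_iff)
  have "\<bar>(cmod (z$3))\<^sup>2 - (cmod (z$4))\<^sup>2\<bar> \<le> cmod ((z$3)\<^sup>2 - (z$4)\<^sup>2)"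
    using norm_triangle_ineq3[of "(z$3)\<^sup>2" "(z$4)\<^sup>2"] by (simp add: norm_power)
  also have "\<dots> = (cmod \<sigma>)\<^sup>2 * d" unfolding z34 by (simp only: norm_minus_cancel D)
  finally have D34: "\<bar>(cmod (z$3))\<^sup>2 - (cmod (z$4))\<^sup>2\<bar> \<le> (cmod \<sigma>)\<^sup>2 * d" .
  have "Re (w\<^sup>2 * ((z$1)\<^sup>2 + (z$2)\<^sup>2)) + Re (w\<^sup>2 * ((z$3)\<^sup>2 - (z$4)\<^sup>2)) = 0"
    unfolding z34 mult_minus_right by simp
  then have "mink v v = (cmod w)\<^sup>2 * ((cmod (z$1))\<^sup>2 + (cmod (z$2))\<^sup>2 + ((cmod (z$3))\<^sup>2 - (cmod (z$4))\<^sup>2)) / 2"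
    unfolding mink_def v_def by (simp only: vec_lambda_beta power2_eq_square[symmetric] Re_mult_square)
      (simp add: algebra_simps add_divide_distrib diff_divide_distrib)
  also have "\<dots> = k * p + (cmod w)\<^sup>2 * ((cmod (z$3))\<^sup>2 - (cmod (z$4))\<^sup>2) / 2"
    unfolding S k_def by (simp add: algebra_simps add_divide_distrib diff_divide_distrib)
  finally have mv: "mink v v = k * p + (cmod w)\<^sup>2 * ((cmod (z$3))\<^sup>2 - (cmod (z$4))\<^sup>2) / 2" .
  have "\<bar>(cmod w)\<^sup>2 * ((cmod (z$3))\<^sup>2 - (cmod (z$4))\<^sup>2) / 2\<bar> \<le> k * d"
    using mult_left_mono[OF D34, of "(cmod w)\<^sup>2"] by (simp add: k_def abs_mult)
  moreover have near: "k * (p - d) \<le> m \<and> m \<le> k * (p + d)" if "m = k * p + y" "\<bar>y\<bar> \<le> k * d" for m y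
    using that by (simp add: algebra_simps abs_le_iff)
  ultimately have m: "k * (p - d) \<le> mink v v" "mink v v \<le> k * (p + d)"
    using mv by blast+
  have "(norm (pr12 v))\<^sup>2 = (Re (w * z$1))\<^sup>2 + (Re (w * z$2))\<^sup>2"
    by (simp add: pr12_def norm_vec_def L2_set_def sum_2 v_def)
  also have "\<dots> = k * p + Re (w\<^sup>2 * ((z$1)\<^sup>2 + (z$2)\<^sup>2)) / 2"
  proof -
    have "k * p = (cmod w)\<^sup>2 * ((cmod (z$1))\<^sup>2 + (cmod (z$2))\<^sup>2) / 2" unfolding S k_def by simp
    then show ?thesis unfolding Re_mult_square
      by (simp add: algebra_simps add_divide_distrib diff_divide_distrib)
  qed
  finally have nv: "(norm (pr12 v))\<^sup>2 = k * p + Re (w\<^sup>2 * ((z$1)\<^sup>2 + (z$2)\<^sup>2)) / 2" .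
  have "\<bar>Re (w\<^sup>2 * ((z$1)\<^sup>2 + (z$2)\<^sup>2))\<bar> \<le> (cmod w)\<^sup>2 * ((cmod \<sigma>)\<^sup>2 * d)"
    using abs_Re_le_cmod[of "w\<^sup>2 * ((z$1)\<^sup>2 + (z$2)\<^sup>2)"] by (simp only: norm_mult D norm_power)
  then have "\<bar>Re (w\<^sup>2 * ((z$1)\<^sup>2 + (z$2)\<^sup>2)) / 2\<bar> \<le> k * d" by (simp add: k_def)
  with nv near have n: "k * (p - d) \<le> (norm (pr12 v))\<^sup>2" "(norm (pr12 v))\<^sup>2 \<le> k * (p + d)"
    by blast+
  have K: "x \<le> (p + d) / (p - d) * y" if "x \<le> k * (p + d)" "k * (p - d) \<le> y" for x y
  proof -
    have "k * (p + d) = (p + d) / (p - d) * (k * (p - d))" using dp by simp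
    also have "\<dots> \<le> (p + d) / (p - d) * y" using dp d0 by (intro mult_left_mono that) auto
    finally show ?thesis using that by simp
  qed
  show "(norm (pr12 v))\<^sup>2 \<le> (p + d) / (p - d) * mink v v" "mink v v \<le> (p + d) / (p - d) * (norm (pr12 v))\<^sup>2"
    using K m n by auto
qed

lemma normal_form_flat_comparable:
  assumes M: "spacelike_surface M" and nf: "normal_form M L \<alpha> \<beta>"
  obtains \<kappa> where "flat_comparable M (\<lambda>v. pr12 (L v)) \<kappa>"
proof -
  have L: "lorentz L" and im: "Im (\<alpha> * cnj \<beta>) \<noteq> 0"
    and eq: "\<And>c q. c \<in> atlas M \<Longrightarrow> q \<in> chart_image c \<Longrightarrow> \<alpha> * clin L (nvec M c q) $ 1 + \<beta> * clin L (nvec M c q) $ 2 = 0"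
    using nf by (auto simp: normal_form_def)
  have lin: "linear L" using L by (simp add: lorentz_def)
  define p d where "p = (cmod \<alpha>)\<^sup>2 + (cmod \<beta>)\<^sup>2" and "d = cmod (\<alpha>\<^sup>2 + \<beta>\<^sup>2)"
  have "linear (\<lambda>v. pr12 (L v))" using linear_compose[OF lin linear_pr12] by (simp add: o_def)
  have dp: "d < p" unfolding p_def d_def
    by (rule null_vector_bounds(1)[of 0]) (use im in \<open>simp_all add: mink_zero_left\<close>)
  have "(norm (pr12 (L v)))\<^sup>2 \<le> (p + d) / (p - d) * mink v v \<and> mink v v \<le> (p + d) / (p - d) * (norm (pr12 (L v)))\<^sup>2"
    if c: "c \<in> atlas M" "q \<in> chart_image c" and v: "v = r *\<^sub>R pd 1 (param M c) q + s *\<^sub>R pd 2 (param M c) q" for c q v r s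
  proof -
    let ?a = "L (pd 1 (param M c) q)" and ?b = "L (pd 2 (param M c) q)"
    have fr: "spacelike_frame ?a ?b"
      using reg_frame[OF atlas_regular[OF M c(1)] c(2)] L by (simp add: spacelike_frame_def lorentz_def)
    have z: "clin L (nvec M c q) = null_vec ?a ?b" unfolding nvec_def by (rule clin_null_vec[OF L])
    have Lv: "L v = r *\<^sub>R ?a + s *\<^sub>R ?b" unfolding v by (simp add: linear_add[OF lin] linear_scale[OF lin])
    obtain w where "\<And>k. (r *\<^sub>R ?a + s *\<^sub>R ?b) $ k = Re (w * null_vec ?a ?b $ k)"
      using tangent_real_part[OF fr] by blast
    then have "L v = (\<chi> k. Re (w * null_vec ?a ?b $ k))" by (simp add: Lv vec_eq_iff)
    moreover have "mink (L v) (L v) = mink v v" using L by (simp add: lorentz_def)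
    ultimately show ?thesis
      using null_vector_bounds(2,3)[OF null_vec_null[OF fr] eq[OF c, unfolded z] im, of w] unfolding p_def d_def by simp
  qed
  note bounds = this
  have "(p + d) / (p - d) > 0" 
  proof (rule divide_pos_pos)
    show "0 < p + d" using dp norm_ge_zero[of "\<alpha>\<^sup>2 + \<beta>\<^sup>2"] unfolding d_def by linarith
  qed (use dp in simp)
  then have "flat_comparable M (\<lambda>v. pr12 (L v)) ((p + d) / (p - d))"
    unfolding flat_comparable_def Let_def using \<open>linear (\<lambda>v. pr12 (L v))\<close> bounds by blast
  then show ?thesis by (rule that)
qed

section \<open>The Riemannian distance\<close>

definition mink_length :: "(real \<Rightarrow> real^4) \<Rightarrow> ennreal" where
  "mink_length g = (\<integral>\<^sup>+t\<in>{0..1}. ennreal (sqrt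
      (mink (vector_derivative g (at t)) (vector_derivative g (at t)))) \<partial>lborel)"

lemma curve_length_eq: "curve_length M \<gamma> = mink_length (imm M \<circ> \<gamma>)"
  by (simp add: curve_length_def mink_length_def)

text \<open>The speed is continuous only off a finite set, which here contains the endpoints, and
  its values on that set are arbitrary. Setting it to 0 there and outside the interval gives a Borel
  function with the same integral, to which affine substitutions apply.\<close>

lemma valid_path_speed_measurable:
  assumes "valid_path g"
  obtains S f where "finite S" "{0, 1} \<subseteq> S" "f \<in> borel_measurable borel"
    "g C1_differentiable_on ({0..1} - S)"
    "\<And>t. t \<in> {0..1} - S \<Longrightarrow> f t = ennreal (sqrt (mink (vector_derivative g (at t)) (vector_derivative g (at t))))"
    "\<And>t. t \<notin> {0..1} - S \<Longrightarrow> f t = 0" "mink_length g = (\<integral>\<^sup>+t. f t \<partial>lborel)"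
proof -
  define spd where "spd = (\<lambda>t. sqrt (mink (vector_derivative g (at t)) (vector_derivative g (at t))))"
  obtain S0 where S0: "finite S0" "g C1_differentiable_on ({0..1} - S0)"
    using assms by (auto simp: valid_path_def piecewise_C1_differentiable_on_def)
  define S where "S = insert 0 (insert 1 S0)"
  have fin: "finite S" using S0 by (simp add: S_def)
  have C1: "g C1_differentiable_on ({0..1} - S)"
    by (rule C1_differentiable_on_subset[OF S0(2)]) (auto simp: S_def)
  define A where "A = {0..1} - S"
  have "continuous_on A (\<lambda>t. vector_derivative g (at t))"
    using C1 by (simp add: C1_differentiable_on_eq A_def)
  then have cont: "continuous_on A spd" unfolding spd_def
    by (intro continuous_on_real_sqrt bounded_bilinear.continuous_on[OF bounded_bilinear_mink])
  have "A \<in> sets borel" unfolding A_def using fin by (intro sets.Diff) (auto intro!: borel_closed finite_imp_closed)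
  then have m: "(\<lambda>t. indicator A t *\<^sub>R spd t) \<in> borel_measurable borel"
    by (rule borel_measurable_continuous_on_indicator[OF _ cont])
  define f where "f = (\<lambda>t. ennreal (indicator A t *\<^sub>R spd t))"
  have "AE t in lborel. t \<notin> S" by (rule AE_not_in[OF finite_imp_null_set_lborel[OF fin]])
  then have "AE t in lborel. ennreal (spd t) * indicator {0..1} t = f t"
    by (rule AE_mp) (rule AE_I2, auto simp: f_def A_def indicator_def)
  then have "(\<integral>\<^sup>+t. ennreal (spd t) * indicator {0..1} t \<partial>lborel) = (\<integral>\<^sup>+t. f t \<partial>lborel)"
    by (rule nn_integral_cong_AE)
  then have "mink_length g = (\<integral>\<^sup>+t. f t \<partial>lborel)" by (simp add: mink_length_def spd_def)
  moreover have "f \<in> borel_measurable borel" using m unfolding f_def by measurable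
  moreover have "f t = ennreal (sqrt (mink (vector_derivative g (at t)) (vector_derivative g (at t))))"
    if "t \<in> {0..1} - S" for t using that by (simp add: f_def A_def spd_def)
  moreover have "f t = 0" if "t \<notin> {0..1} - S" for t using that by (simp add: f_def A_def)
  moreover have "{0, 1} \<subseteq> S" by (simp add: S_def)
  ultimately show ?thesis by (intro that[OF fin _ _ C1])
qed

lemma mink_length_reversepath:
  assumes "valid_path g"
  shows "mink_length (reversepath g) = mink_length g"
proof -
  obtain S f where S: "finite S" "{0, 1} \<subseteq> S" "f \<in> borel_measurable borel" "g C1_differentiable_on ({0..1} - S)"
    and f: "\<And>t. t \<in> {0..1} - S \<Longrightarrow> f t = ennreal (sqrt (mink (vector_derivative g (at t)) (vector_derivative g (at t))))"
    "\<And>t. t \<notin> {0..1} - S \<Longrightarrow> f t = 0" and len: "mink_length g = (\<integral>\<^sup>+t. f t \<partial>lborel)"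
    using valid_path_speed_measurable[OF assms] by metis
  have "AE t in lborel. t \<notin> (\<lambda>t. 1 - t) ` S" by (rule AE_not_in[OF finite_imp_null_set_lborel]) (use S in simp)
  then have "AE t in lborel. ennreal (sqrt (mink (vector_derivative (reversepath g) (at t)) (vector_derivative (reversepath g) (at t)))) * indicator {0..1} t
      = f (1 + (-1) * t)"
  proof (rule AE_mp, intro AE_I2 impI)
    fix t :: real assume t: "t \<notin> (\<lambda>t. 1 - t) ` S"
    then have tS: "1 - t \<notin> S" by (auto simp: image_iff)
    show "ennreal (sqrt (mink (vector_derivative (reversepath g) (at t)) (vector_derivative (reversepath g) (at t)))) * indicator {0..1} t
      = f (1 + (-1) * t)"
    proof (cases "t \<in> {0..1}")
      case True
      then have t1: "1 - t \<in> {0..1} - S" using tS by auto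
      then have "(g has_vector_derivative vector_derivative g (at (1 - t))) (at (1 - t))"
        using S(4) by (simp add: C1_differentiable_on_eq vector_derivative_works)
      moreover have "((\<lambda>t. 1 - t) has_vector_derivative (-1)) (at t)" by (auto intro!: derivative_eq_intros)
      ultimately have "(g \<circ> (\<lambda>t. 1 - t) has_vector_derivative (-1) *\<^sub>R vector_derivative g (at (1 - t))) (at t)"
        by (rule vector_diff_chain_at[rotated])
      then have "vector_derivative (reversepath g) (at t) = - vector_derivative g (at (1 - t))"
        by (simp add: reversepath_def o_def vector_derivative_at)
      then show ?thesis using True f(1)[OF t1] by (simp add: mink_simps)
    next
      case False
      then show ?thesis using f(2)[of "1 - t"] by auto
    qed
  qed
  then have "mink_length (reversepath g) = (\<integral>\<^sup>+t. f (1 + (-1) * t) \<partial>lborel)"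
    unfolding mink_length_def by (rule nn_integral_cong_AE)
  also have "\<dots> = (\<integral>\<^sup>+t. f t \<partial>lborel)"
    using nn_integral_real_affine[OF S(3), of "-1" 1] by simp
  finally show ?thesis using len by simp
qed

lemma mink_length_join:
  assumes "valid_path g1" "valid_path g2"
  shows "mink_length (g1 +++ g2) = mink_length g1 + mink_length g2"
proof -
  obtain S1 f1 where S1: "finite S1" "{0, 1} \<subseteq> S1" "f1 \<in> borel_measurable borel" "g1 C1_differentiable_on ({0..1} - S1)"
    and f1: "\<And>t. t \<in> {0..1} - S1 \<Longrightarrow> f1 t = ennreal (sqrt (mink (vector_derivative g1 (at t)) (vector_derivative g1 (at t))))"
    "\<And>t. t \<notin> {0..1} - S1 \<Longrightarrow> f1 t = 0" and len1: "mink_length g1 = (\<integral>\<^sup>+t. f1 t \<partial>lborel)"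
    using valid_path_speed_measurable[OF assms(1)] by metis
  obtain S2 f2 where S2: "finite S2" "{0, 1} \<subseteq> S2" "f2 \<in> borel_measurable borel" "g2 C1_differentiable_on ({0..1} - S2)"
    and f2: "\<And>t. t \<in> {0..1} - S2 \<Longrightarrow> f2 t = ennreal (sqrt (mink (vector_derivative g2 (at t)) (vector_derivative g2 (at t))))"
    "\<And>t. t \<notin> {0..1} - S2 \<Longrightarrow> f2 t = 0" and len2: "mink_length g2 = (\<integral>\<^sup>+t. f2 t \<partial>lborel)"
    using valid_path_speed_measurable[OF assms(2)] by metis
  have [measurable]: "f1 \<in> borel_measurable borel" "f2 \<in> borel_measurable borel" by (rule S1(3) S2(3))+
  define Z where "Z = (\<lambda>t. t / 2) ` S1 \<union> (\<lambda>t. (t + 1) / 2) ` S2"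
  have two: "sqrt (mink (2 *\<^sub>R v) (2 *\<^sub>R v)) = 2 * sqrt (mink v v)" for v :: "real^4"
    by (simp add: mink_simps real_sqrt_mult)
  have "AE t in lborel. t \<notin> Z" by (rule AE_not_in[OF finite_imp_null_set_lborel]) (use S1 S2 in \<open>simp add: Z_def\<close>)
  then have "AE t in lborel. ennreal (sqrt (mink (vector_derivative (g1 +++ g2) (at t)) (vector_derivative (g1 +++ g2) (at t)))) * indicator {0..1} t
      = 2 * f1 (0 + 2 * t) + 2 * f2 (- 1 + 2 * t)"
  proof (rule AE_mp, intro AE_I2 impI)
    fix t :: real assume t: "t \<notin> Z"
    have t1: "2 * t \<notin> S1" "2 * t - 1 \<notin> S2"
      using t image_eqI[of t "\<lambda>t. t / 2" "2 * t" S1] image_eqI[of t "\<lambda>t. (t + 1) / 2" "2 * t - 1" S2] by (auto simp: Z_def)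
    have "2 * t \<noteq> 0" "2 * t \<noteq> 1" "2 * t - 1 \<noteq> 1" using t1 S1(2) S2(2) by (metis insert_subset)+
    then have half: "t \<noteq> 0" "t \<noteq> 1/2" "t \<noteq> 1" by auto
    have dbl: "((\<lambda>t. 2 * t + c) has_vector_derivative 2) (at t)" for c :: real by (auto intro!: derivative_eq_intros)
    consider "t < 0 \<or> t > 1" | "0 < t" "t < 1/2" | "1/2 < t" "t < 1" using half by linarith
    then show "ennreal (sqrt (mink (vector_derivative (g1 +++ g2) (at t)) (vector_derivative (g1 +++ g2) (at t)))) * indicator {0..1} t
      = 2 * f1 (0 + 2 * t) + 2 * f2 (- 1 + 2 * t)"
    proof cases
      case 1
      then show ?thesis using f1(2)[of "2 * t"] f2(2)[of "- 1 + 2 * t"] by auto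
    next
      case 2
      then have m: "2 * t \<in> {0..1} - S1" using t1 by auto
      then have "(g1 has_vector_derivative vector_derivative g1 (at (2 * t))) (at (2 * t + 0))"
        using S1(4) by (simp add: C1_differentiable_on_eq vector_derivative_works)
      then have "(g1 \<circ> (\<lambda>t. 2 * t + 0) has_vector_derivative 2 *\<^sub>R vector_derivative g1 (at (2 * t))) (at t)"
        by (rule vector_diff_chain_at[OF dbl])
      then have "(g1 +++ g2 has_vector_derivative 2 *\<^sub>R vector_derivative g1 (at (2 * t))) (at t)"
        by (rule has_vector_derivative_transform_within_open[where S = "{0<..<1/2}"])
           (use 2 in \<open>auto simp: joinpaths_def\<close>)
      then have "vector_derivative (g1 +++ g2) (at t) = 2 *\<^sub>R vector_derivative g1 (at (2 * t))" by (rule vector_derivative_at)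
      then show ?thesis using 2 f1(1)[OF m] f2(2)[of "- 1 + 2 * t"] by (simp add: two ennreal_mult')
    next
      case 3
      then have m: "2 * t - 1 \<in> {0..1} - S2" using t1 by auto
      then have "(g2 has_vector_derivative vector_derivative g2 (at (2 * t - 1))) (at (2 * t + (-1)))"
        using S2(4) by (simp add: C1_differentiable_on_eq vector_derivative_works)
      then have "(g2 \<circ> (\<lambda>t. 2 * t + (-1)) has_vector_derivative 2 *\<^sub>R vector_derivative g2 (at (2 * t - 1))) (at t)"
        by (rule vector_diff_chain_at[OF dbl])
      then have "(g1 +++ g2 has_vector_derivative 2 *\<^sub>R vector_derivative g2 (at (2 * t - 1))) (at t)"
        by (rule has_vector_derivative_transform_within_open[where S = "{1/2<..<1}"])
           (use 3 in \<open>auto simp: joinpaths_def\<close>)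
      then have "vector_derivative (g1 +++ g2) (at t) = 2 *\<^sub>R vector_derivative g2 (at (2 * t - 1))" by (rule vector_derivative_at)
      then show ?thesis using 3 f2(1)[OF m] f1(2)[of "2 * t"] by (simp add: two ennreal_mult')
    qed
  qed
  then have "mink_length (g1 +++ g2) = (\<integral>\<^sup>+t. 2 * f1 (0 + 2 * t) + 2 * f2 (- 1 + 2 * t) \<partial>lborel)"
    unfolding mink_length_def by (rule nn_integral_cong_AE)
  also have "\<dots> = (\<integral>\<^sup>+t. 2 * f1 (0 + 2 * t) \<partial>lborel) + (\<integral>\<^sup>+t. 2 * f2 (- 1 + 2 * t) \<partial>lborel)"
    by (rule nn_integral_add) measurable
  also have "\<dots> = 2 * (\<integral>\<^sup>+t. f1 (0 + 2 * t) \<partial>lborel) + 2 * (\<integral>\<^sup>+t. f2 (- 1 + 2 * t) \<partial>lborel)"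
    by (simp add: nn_integral_cmult)
  also have "\<dots> = (\<integral>\<^sup>+t. f1 t \<partial>lborel) + (\<integral>\<^sup>+t. f2 t \<partial>lborel)"
    using nn_integral_real_affine[OF S1(3), of 2 0] nn_integral_real_affine[OF S2(3), of 2 "-1"] by simp
  finally show ?thesis using len1 len2 by simp
qed

section \<open>Regularity of curves in charts\<close>

lemma C1_differentiable_on_local:
  assumes "\<And>t. t \<in> A \<Longrightarrow> \<exists>N. open N \<and> t \<in> N \<and> f C1_differentiable_on (A \<inter> N)"
  shows "f C1_differentiable_on A"
  unfolding C1_differentiable_on_eq
proof (intro conjI ballI)
  show "f differentiable at t" if "t \<in> A" for t
    using assms[OF that] that by (auto simp: C1_differentiable_on_eq)
  show "continuous_on A (\<lambda>t. vector_derivative f (at t))"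
    unfolding continuous_on_eq_continuous_within
  proof
    fix t assume t: "t \<in> A"
    then obtain N where N: "open N" "t \<in> N" "f C1_differentiable_on (A \<inter> N)" using assms by blast
    then have "continuous (at t within A \<inter> N) (\<lambda>t. vector_derivative f (at t))"
      using t by (simp add: C1_differentiable_on_eq continuous_on_eq_continuous_within)
    moreover have "at t within A \<inter> N = at t within A"
      by (rule at_within_nhd[OF N(2,1)]) blast
    ultimately show "continuous (at t within A) (\<lambda>t. vector_derivative f (at t))" by simp
  qed
qed

lemma C1_differentiable_on_cong_open:
  assumes "open N" "A \<subseteq> N" "\<And>t. t \<in> N \<Longrightarrow> f t = g t" "f C1_differentiable_on A"
  shows "g C1_differentiable_on A"
proof -
  obtain D where D: "\<And>t. t \<in> A \<Longrightarrow> (f has_vector_derivative D t) (at t)" "continuous_on A D"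
    using assms(4) by (auto simp: C1_differentiable_on_def)
  have "(g has_vector_derivative D t) (at t)" if "t \<in> A" for t
    by (rule has_vector_derivative_transform_within_open[OF D(1)[OF that] assms(1) _ assms(3)]) (use that assms(2) in auto)
  with D(2) show ?thesis by (auto simp: C1_differentiable_on_def)
qed

lemma smooth_on_C1_compose:
  fixes f :: "real \<Rightarrow> real^2" and h :: "real^2 \<Rightarrow> 'b::real_normed_vector"
  assumes h: "open W" "smooth_on h W" and f: "f C1_differentiable_on A" "f ` A \<subseteq> W"
  shows "(\<lambda>t. h (f t)) C1_differentiable_on A"
    "t \<in> A \<Longrightarrow> vector_derivative (\<lambda>t. h (f t)) (at t)
      = (vector_derivative f (at t) $ 1) *\<^sub>R pd 1 h (f t) + (vector_derivative f (at t) $ 2) *\<^sub>R pd 2 h (f t)"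
proof -
  have der: "((\<lambda>t. h (f t)) has_vector_derivative
      (vector_derivative f (at t) $ 1) *\<^sub>R pd 1 h (f t) + (vector_derivative f (at t) $ 2) *\<^sub>R pd 2 h (f t)) (at t)" if t: "t \<in> A" for t
  proof -
    have "(f has_vector_derivative vector_derivative f (at t)) (at t)"
      using f(1) t by (simp add: C1_differentiable_on_eq vector_derivative_works)
    moreover have "f t \<in> W" using f(2) t by blast
    ultimately show ?thesis
      using has_derivative_compose[OF _ smooth_on_has_derivative[OF h(1,2)], of f "\<lambda>s. s *\<^sub>R vector_derivative f (at t)" t UNIV]
      by (simp add: has_vector_derivative_def algebra_simps)
  qed
  then show "t \<in> A \<Longrightarrow> vector_derivative (\<lambda>t. h (f t)) (at t)
      = (vector_derivative f (at t) $ 1) *\<^sub>R pd 1 h (f t) + (vector_derivative f (at t) $ 2) *\<^sub>R pd 2 h (f t)"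
    by (rule vector_derivative_at)
  have cf: "continuous_on A f" using f(1) by (auto simp: C1_differentiable_on_eq continuous_at_imp_continuous_on differentiable_imp_continuous_within)
  have "continuous_on A (\<lambda>t. pd i h (f t))" for i
    by (rule continuous_on_compose2[OF smooth_on_continuous[OF smooth_on_pd[OF h(2)]] cf f(2)])
  moreover have "continuous_on A (\<lambda>t. vector_derivative f (at t))" using f(1) by (simp add: C1_differentiable_on_eq)
  ultimately have "continuous_on A (\<lambda>t. (vector_derivative f (at t) $ 1) *\<^sub>R pd 1 h (f t) + (vector_derivative f (at t) $ 2) *\<^sub>R pd 2 h (f t))"
    by (intro continuous_intros)
  then show "(\<lambda>t. h (f t)) C1_differentiable_on A" unfolding C1_differentiable_on_def
    by (intro exI conjI ballI) (rule der, assumption+)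
qed

lemma chart_inv_continuous:
  assumes c: "is_chart X c"
  shows "continuous_map (top_of_set (chart_image c)) X (chart_inv c)"
  unfolding continuous_map_def
proof (intro conjI allI impI)
  show "chart_inv c \<in> topspace (top_of_set (chart_image c)) \<rightarrow> topspace X"
    by (rule funcsetI) (metis chart_domain_subset[OF c] chart_inv_in(1) subsetD topspace_euclidean_subtopology)
  fix W assume W: "openin X W"
  have "{q \<in> chart_image c. chart_inv c q \<in> W} = snd c ` (W \<inter> fst c)"
    using chart_inv_left[OF c] chart_inv_in[of _ c] by force
  moreover have "open (snd c ` (W \<inter> fst c))"
    by (rule chart_open_image[OF c]) (use W c in \<open>auto simp: is_chart_def\<close>)
  ultimately show "openin (top_of_set (chart_image c)) {q \<in> topspace (top_of_set (chart_image c)). chart_inv c q \<in> W}"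
    by (auto simp: openin_open)
qed

lemma continuous_map_atlas:
  fixes f :: "'a \<Rightarrow> 'b::topological_space"
  assumes M: "spacelike_surface M" and f: "\<And>c. c \<in> atlas M \<Longrightarrow> continuous_on (chart_image c) (\<lambda>q. f (chart_inv c q))"
  shows "continuous_map (points M) euclidean f"
  unfolding continuous_map_def
proof (intro conjI allI impI)
  fix V :: "'b set" assume "openin euclidean V"
  then have V: "open V" by simp
  have eq: "{p \<in> topspace (points M). f p \<in> V} = (\<Union>c\<in>atlas M. {p \<in> fst c. snd c p \<in> chart_image c \<inter> (\<lambda>q. f (chart_inv c q)) -` V})"
    (is "?l = ?r")
  proof
    show "?l \<subseteq> ?r"
    proof
      fix p assume p: "p \<in> ?l"
      then obtain c where "c \<in> atlas M" "p \<in> fst c" using atlas_cover[OF M] by blast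
      with p show "p \<in> ?r" using atlas_inv_left[OF M, of c p] by auto
    qed
    show "?r \<subseteq> ?l" using atlas_inv_left[OF M] atlas_subset[OF M] by fastforce
  qed
  have op: "openin (points M) {p \<in> fst c. snd c p \<in> chart_image c \<inter> (\<lambda>q. f (chart_inv c q)) -` V}" if c: "c \<in> atlas M" for c
    by (rule chart_open_preimage[OF atlas_chart[OF M c] continuous_open_preimage[OF f[OF c] atlas_open[OF M c] V]])
  show "openin (points M) {p \<in> topspace (points M). f p \<in> V}"
    unfolding eq by (rule openin_Union) (use op in blast)
qed simp

lemma imm_continuous:
  assumes "spacelike_surface M" shows "continuous_map (points M) euclidean (imm M)"
proof (rule continuous_map_atlas[OF assms])
  fix c assume "c \<in> atlas M"
  from smooth_on_continuous[OF reg_smooth[OF atlas_regular[OF assms this]]]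
  show "continuous_on (chart_image c) (\<lambda>q. imm M (chart_inv c q))" by (simp add: param_def o_def)
qed

section \<open>The developing map: local inverses and uniqueness of lifts\<close>

context
  fixes M :: "'a surface" and B :: "real^4 \<Rightarrow> real^2" and \<kappa> :: real
  assumes M: "spacelike_surface M" and fc: "flat_comparable M B \<kappa>"
begin

lemma B_bounded_linear: "bounded_linear B" and \<kappa>_pos: "\<kappa> > 0"
  using fc by (auto simp: flat_comparable_def linear_conv_bounded_linear)

lemma flat_bounds:
  assumes "c \<in> atlas M" "q \<in> chart_image c" "v = r *\<^sub>R pd 1 (param M c) q + s *\<^sub>R pd 2 (param M c) q"
  shows "(norm (B v))\<^sup>2 \<le> \<kappa> * mink v v" "mink v v \<le> \<kappa> * (norm (B v))\<^sup>2"
  using fc assms by (auto simp: flat_comparable_def Let_def)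

lemma flat_chart:
  assumes c: "c \<in> atlas M"
  shows "smooth_on (\<lambda>q. B (param M c q)) (chart_image c)"
    "q \<in> chart_image c \<Longrightarrow> pd i (\<lambda>q. B (param M c q)) q = B (pd i (param M c) q)"
    "q \<in> chart_image c \<Longrightarrow> jac (\<lambda>q. B (param M c q)) q \<noteq> 0"
proof -
  note reg = atlas_regular[OF M c]
  show "smooth_on (\<lambda>q. B (param M c q)) (chart_image c)"
    by (rule smooth_on_bounded_linear[OF B_bounded_linear reg_open[OF reg] reg_smooth[OF reg]])
  show pdB: "pd i (\<lambda>q. B (param M c q)) q = B (pd i (param M c) q)" if "q \<in> chart_image c" for q i
    by (rule pd_bounded_linear[OF B_bounded_linear reg_diff(1)[OF reg that]])
  assume q: "q \<in> chart_image c"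
  define x y where "x = B (pd 1 (param M c) q)" and "y = B (pd 2 (param M c) q)"
  show "jac (\<lambda>q. B (param M c q)) q \<noteq> 0"
  proof
    assume "jac (\<lambda>q. B (param M c q)) q = 0"
    then have J: "x$1 * y$2 - y$1 * x$2 = 0" by (simp add: jac_def pdB[OF q] x_def y_def)
    \<comment> \<open>A kernel vector of the singular matrix with columns \<open>x\<close> and
      \<open>y\<close>; the tangent vector with these coefficients would be nonzero with vanishing
      projection, against the comparison of the metrics.\<close>
    obtain r s where rs: "r \<noteq> 0 \<or> s \<noteq> 0" "r *\<^sub>R x + s *\<^sub>R y = 0"
    proof (cases "x = 0")
      case True
      then show ?thesis using that[of 1 0] by simp
    next
      case False
      show ?thesis
      proof (cases "x$1 = 0")
        case True
        with False have "x$2 \<noteq> 0" by (simp add: vec_eq_iff forall_2)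
        with J True show ?thesis by (intro that[of "y$2" "- x$2"]) (auto simp: vec_eq_iff forall_2)
      next
        case False
        with J show ?thesis by (intro that[of "y$1" "- x$1"]) (auto simp: vec_eq_iff forall_2 algebra_simps)
      qed
    qed
    define v where "v = r *\<^sub>R pd 1 (param M c) q + s *\<^sub>R pd 2 (param M c) q"
    have "B v = r *\<^sub>R x + s *\<^sub>R y"
      by (simp add: v_def x_def y_def bounded_linear.linear[OF B_bounded_linear] linear_add linear_scale)
    then have "mink v v \<le> 0" using flat_bounds(2)[OF c q v_def] rs by simp
    moreover have "mink v v > 0" unfolding v_def by (rule spacelike_frame_pos[OF reg_frame[OF reg q] rs(1)])
    ultimately show False by simp
  qed
qed

lemma flat_local_inverse:
  assumes c: "c \<in> atlas M" and q: "q0 \<in> chart_image c"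
  obtains V \<tau> where "open V" "q0 \<in> V" "V \<subseteq> chart_image c" "open ((\<lambda>q. B (param M c q)) ` V)"
    "smooth_on \<tau> ((\<lambda>q. B (param M c q)) ` V)" "\<And>q. q \<in> V \<Longrightarrow> \<tau> (B (param M c q)) = q"
proof -
  let ?f = "\<lambda>q. B (param M c q)"
  obtain r where r: "r > 0" "ball q0 r \<subseteq> chart_image c" "inj_on ?f (ball q0 r)"
    using smooth_locally_injective[OF atlas_open[OF M c] flat_chart(1)[OF c] q flat_chart(3)[OF c q]] by blast
  define \<tau> where "\<tau> = inv_into (ball q0 r) ?f"
  have \<tau>: "\<tau> (?f q) = q" if "q \<in> ball q0 r" for q
    unfolding \<tau>_def by (rule inv_into_f_f[OF r(3) that])
  have J: "jac ?f q \<noteq> 0" if "q \<in> ball q0 r" for q using flat_chart(3)[OF c] r that by blast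
  note inv = smooth_on_inverse_map[where \<sigma> = \<tau> and \<tau> = ?f, OF open_ball smooth_on_subset[OF flat_chart(1)[OF c] r(2)] \<tau> J]
  show ?thesis by (rule that[of "ball q0 r" \<tau>]) (use r \<tau> inv in auto)
qed

lemma flat_map_continuous: "continuous_map (points M) euclidean (\<lambda>p. B (imm M p))"
  using continuous_map_compose[OF imm_continuous[OF M], of euclidean B] B_bounded_linear
  by (simp add: o_def linear_continuous_on)

text \<open>The developing map is a local homeomorphism, in the form of an injective neighbourhood
  together with a section over a disk. \<open>U\<close> may be larger than the image of the
  section.\<close>

lemma flat_nbhd:
  assumes p: "p \<in> pts M"
  obtains U \<epsilon> \<sigma> where "openin (points M) U" "p \<in> U" "\<epsilon> > 0" "inj_on (\<lambda>p. B (imm M p)) U"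
    "continuous_map (top_of_set (ball (B (imm M p)) \<epsilon>)) (points M) \<sigma>"
    "\<And>z. z \<in> ball (B (imm M p)) \<epsilon> \<Longrightarrow> \<sigma> z \<in> U \<and> B (imm M (\<sigma> z)) = z"
proof -
  obtain c where c: "c \<in> atlas M" "p \<in> fst c" using atlas_cover[OF M p] by blast
  note ch = atlas_chart[OF M c(1)]
  have "snd c p \<in> chart_image c" using c(2) by blast
  then obtain V \<tau> where V: "open V" "snd c p \<in> V" "V \<subseteq> chart_image c" "open ((\<lambda>q. B (param M c q)) ` V)"
    "smooth_on \<tau> ((\<lambda>q. B (param M c q)) ` V)" and \<tau>: "\<And>q. q \<in> V \<Longrightarrow> \<tau> (B (param M c q)) = q"
    using flat_local_inverse[OF c(1)] by metis
  have par: "param M c (snd c x) = imm M x" if "x \<in> fst c" for x using chart_inv_left[OF ch that] by (simp add: param_def)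
  have "B (imm M p) \<in> (\<lambda>q. B (param M c q)) ` V" using V(2) par[OF c(2)] by (metis imageI)
  then obtain \<epsilon> where \<epsilon>: "\<epsilon> > 0" "ball (B (imm M p)) \<epsilon> \<subseteq> (\<lambda>q. B (param M c q)) ` V"
    using V(4) open_contains_ball by blast
  define U where "U = {x \<in> fst c. snd c x \<in> V}"
  have inj: "inj_on (\<lambda>p. B (imm M p)) U"
  proof (rule inj_onI)
    fix x y assume xy: "x \<in> U" "y \<in> U" "B (imm M x) = B (imm M y)"
    then have "snd c x = snd c y" using \<tau>[of "snd c x"] \<tau>[of "snd c y"] par by (simp add: U_def)
    then show "x = y" using xy chart_inj[OF ch] by (auto simp: U_def inj_on_def)
  qed
  define \<sigma> where "\<sigma> = (\<lambda>z. chart_inv c (\<tau> z))"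
  have \<tau>V: "\<tau> z \<in> V" "B (param M c (\<tau> z)) = z" if "z \<in> ball (B (imm M p)) \<epsilon>" for z
    using that \<epsilon>(2) \<tau> by auto
  have "continuous_on (ball (B (imm M p)) \<epsilon>) \<tau>"
    using continuous_on_subset[OF smooth_on_continuous[OF V(5)] \<epsilon>(2)] .
  then have "continuous_map (top_of_set (ball (B (imm M p)) \<epsilon>)) (top_of_set (chart_image c)) \<tau>"
    using \<tau>V(1) V(3) by (auto simp: continuous_map_in_subtopology continuous_on_def image_subset_iff Pi_iff)
  from continuous_map_compose[OF this chart_inv_continuous[OF ch]]
  have "continuous_map (top_of_set (ball (B (imm M p)) \<epsilon>)) (points M) \<sigma>" by (simp add: \<sigma>_def o_def)
  moreover have "\<sigma> z \<in> U \<and> B (imm M (\<sigma> z)) = z" if "z \<in> ball (B (imm M p)) \<epsilon>" for z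
    using \<tau>V[OF that] V(3) chart_inv_in[of "\<tau> z" c] by (auto simp: U_def \<sigma>_def param_def)
  moreover have "openin (points M) U" unfolding U_def by (rule chart_open_preimage[OF ch V(1)])
  ultimately show ?thesis by (intro that[of U \<epsilon> \<sigma>]) (use inj \<epsilon> c V in \<open>auto simp: U_def\<close>)
qed

text \<open>The set where two lifts agree is closed because the surface is Hausdorff, and open
  because the projection is locally injective.\<close>

lemma flat_lift_unique:
  fixes g1 g2 :: "'b::topological_space \<Rightarrow> 'a"
  assumes T: "connected T" and g: "continuous_map (top_of_set T) (points M) g1" "continuous_map (top_of_set T) (points M) g2"
    and eq: "\<And>t. t \<in> T \<Longrightarrow> B (imm M (g1 t)) = B (imm M (g2 t))" and u: "u \<in> T" "g1 u = g2 u" and t: "t \<in> T"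
  shows "g1 t = g2 t"
proof -
  define E where "E = {t \<in> T. g1 t = g2 t}"
  have "closedin (top_of_set T) E"
    using closedin_continuous_maps_eq[OF surface_hausdorff[OF M] g] by (simp add: E_def)
  moreover have "openin (top_of_set T) E"
  proof (subst openin_subopen, intro ballI)
    fix s assume s: "s \<in> E"
    then have "s \<in> T" by (simp add: E_def)
    then have "g1 s \<in> pts M" using g(1) unfolding continuous_map_def Pi_iff by simp
    then obtain U where U: "openin (points M) U" "g1 s \<in> U" "inj_on (\<lambda>p. B (imm M p)) U" using flat_nbhd by metis
    define O' where "O' = {t \<in> T. g1 t \<in> U} \<inter> {t \<in> T. g2 t \<in> U}"
    have "openin (top_of_set T) {t \<in> T. g1 t \<in> U}" "openin (top_of_set T) {t \<in> T. g2 t \<in> U}"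
      using openin_continuous_map_preimage[OF g(1) U(1)] openin_continuous_map_preimage[OF g(2) U(1)] by simp_all
    then have "openin (top_of_set T) O'" unfolding O'_def by (rule openin_Int)
    moreover have "s \<in> O'" using s U(2) by (auto simp: O'_def E_def)
    moreover have "O' \<subseteq> E" using U(3) eq by (auto simp: O'_def E_def inj_on_def)
    ultimately show "\<exists>O'. openin (top_of_set T) O' \<and> s \<in> O' \<and> O' \<subseteq> E" by blast
  qed
  moreover have "E \<noteq> {}" using u by (auto simp: E_def)
  ultimately have "E = T" using T connected_clopen by blast
  then show ?thesis using t by (auto simp: E_def)
qed

section \<open>Curves and their lengths\<close>

lemma curve_tangent:
  assumes "piecewise_C1_curve M \<gamma>"
  obtains S where "finite S" "{0, 1} \<subseteq> S" "(imm M \<circ> \<gamma>) C1_differentiable_on ({0..1} - S)"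
    "\<And>t v. t \<in> {0..1} - S \<Longrightarrow> v = vector_derivative (imm M \<circ> \<gamma>) (at t) \<Longrightarrow>
       (norm (B v))\<^sup>2 \<le> \<kappa> * mink v v \<and> mink v v \<le> \<kappa> * (norm (B v))\<^sup>2"
proof -
  have path: "pathin (points M) \<gamma>" using assms by (simp add: piecewise_C1_curve_def)
  obtain S0 where S0: "finite S0" "\<And>c. c \<in> atlas M \<Longrightarrow> (snd c \<circ> \<gamma>) C1_differentiable_on ({t\<in>{0..1}. \<gamma> t \<in> fst c} - S0)"
    using assms by (auto simp: piecewise_C1_curve_def)
  \<comment> \<open>The endpoints are exceptional: derivatives are two-sided, and nothing is known
    about \<open>\<gamma>\<close> outside the unit interval.\<close>
  define S where "S = insert 0 (insert 1 S0)"
  have loc: "\<exists>N. open N \<and> t \<in> N \<and> (imm M \<circ> \<gamma>) C1_differentiable_on (({0..1} - S) \<inter> N)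
      \<and> (\<forall>v. v = vector_derivative (imm M \<circ> \<gamma>) (at t) \<longrightarrow> (norm (B v))\<^sup>2 \<le> \<kappa> * mink v v \<and> mink v v \<le> \<kappa> * (norm (B v))\<^sup>2)"
    if t: "t \<in> {0..1} - S" for t
  proof -
    have "\<gamma> t \<in> pts M" using path t by (auto simp: pathin_def continuous_map_def)
    then obtain c where c: "c \<in> atlas M" "\<gamma> t \<in> fst c" using atlas_cover[OF M] by blast
    have "openin (top_of_set {0..1}) {s \<in> {0..1}. \<gamma> s \<in> fst c}"
      using openin_continuous_map_preimage[OF path[unfolded pathin_def] atlas_openin[OF M c(1)]] by simp
    then obtain N0 where N0: "open N0" "{s \<in> {0..1}. \<gamma> s \<in> fst c} = {0..1} \<inter> N0" by (auto simp: openin_open)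
    define N where "N = N0 \<inter> {0<..<1}"
    have "t \<in> {0..1} \<inter> N0" "t \<in> {0<..<1}" using N0(2)[symmetric] t c(2) by (auto simp: S_def)
    moreover have "\<gamma> s \<in> fst c" if "s \<in> {0..1} \<inter> N0" for s using that unfolding N0(2)[symmetric] by simp
    ultimately have N: "open N" "t \<in> N" "\<And>s. s \<in> N \<Longrightarrow> \<gamma> s \<in> fst c"
      using N0(1) by (simp_all add: N_def open_Int)
    let ?A = "({0..1} - S) \<inter> N"
    have C1: "(snd c \<circ> \<gamma>) C1_differentiable_on ?A"
      by (rule C1_differentiable_on_subset[OF S0(2)[OF c(1)]]) (use N in \<open>auto simp: S_def\<close>)
    have im: "(snd c \<circ> \<gamma>) ` ?A \<subseteq> chart_image c" using N by auto
    note comp = smooth_on_C1_compose[OF atlas_open[OF M c(1)] reg_smooth[OF atlas_regular[OF M c(1)]] C1 im]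
    have eqN: "param M c ((snd c \<circ> \<gamma>) s) = (imm M \<circ> \<gamma>) s" if "s \<in> N" for s
      using atlas_inv_left[OF M c(1) N(3)[OF that]] by (simp add: param_def)
    have 1: "(imm M \<circ> \<gamma>) C1_differentiable_on ?A"
      by (rule C1_differentiable_on_cong_open[OF N(1) _ eqN comp(1)]) auto
    have tA: "t \<in> ?A" using t N by auto
    have "((\<lambda>t. param M c ((snd c \<circ> \<gamma>) t)) has_vector_derivative vector_derivative (\<lambda>t. param M c ((snd c \<circ> \<gamma>) t)) (at t)) (at t)"
      using comp(1) tA by (simp add: C1_differentiable_on_eq vector_derivative_works)
    from has_vector_derivative_transform_within_open[OF this N(1,2) eqN]
    have "vector_derivative (imm M \<circ> \<gamma>) (at t) = vector_derivative (\<lambda>t. param M c ((snd c \<circ> \<gamma>) t)) (at t)"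
      by (rule vector_derivative_at)
    then have 2: "vector_derivative (imm M \<circ> \<gamma>) (at t) = (vector_derivative (snd c \<circ> \<gamma>) (at t) $ 1) *\<^sub>R pd 1 (param M c) ((snd c \<circ> \<gamma>) t)
        + (vector_derivative (snd c \<circ> \<gamma>) (at t) $ 2) *\<^sub>R pd 2 (param M c) ((snd c \<circ> \<gamma>) t)"
      using comp(2)[OF tA] by simp
    have "(snd c \<circ> \<gamma>) t \<in> chart_image c" using im tA by blast
    note bounds = flat_bounds[OF c(1) this 2]
    show ?thesis using N(1,2) 1 bounds by (intro exI[of _ N]) simp
  qed
  have "(imm M \<circ> \<gamma>) C1_differentiable_on ({0..1} - S)"
    by (rule C1_differentiable_on_local) (use loc in blast)
  then show ?thesis by (intro that[of S]) (use S0 loc in \<open>auto simp: S_def\<close>)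
qed

lemma curve_valid_path:
  assumes "piecewise_C1_curve M \<gamma>"
  shows "valid_path (imm M \<circ> \<gamma>)"
proof -
  obtain S where "finite S" "(imm M \<circ> \<gamma>) C1_differentiable_on ({0..1} - S)"
    using curve_tangent[OF assms] by metis
  moreover have "continuous_on {0..1} (imm M \<circ> \<gamma>)"
    using continuous_map_compose[OF _ imm_continuous[OF M], of "top_of_set {0..1}" \<gamma>] assms
    by (simp add: piecewise_C1_curve_def pathin_def)
  ultimately show ?thesis by (auto simp: valid_path_def piecewise_C1_differentiable_on_def)
qed

lemma valid_path_bounded_linear:
  assumes "bounded_linear h" "valid_path g"
  shows "valid_path (\<lambda>t. h (g t))"
proof -
  obtain S where S: "finite S" "g C1_differentiable_on ({0..1} - S)" and c: "continuous_on {0..1} g"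
    using assms(2) by (auto simp: valid_path_def piecewise_C1_differentiable_on_def)
  obtain D where D: "\<And>t. t \<in> {0..1} - S \<Longrightarrow> (g has_vector_derivative D t) (at t)" "continuous_on ({0..1} - S) D"
    using S(2) unfolding C1_differentiable_on_def by blast
  have "(\<lambda>t. h (g t)) C1_differentiable_on ({0..1} - S)"
    unfolding C1_differentiable_on_def
    by (intro exI[of _ "\<lambda>t. h (D t)"] conjI ballI bounded_linear.has_vector_derivative[OF assms(1) D(1)]
        bounded_linear.continuous_on[OF assms(1) D(2)])
  then show ?thesis using S(1) bounded_linear.continuous_on[OF assms(1) c]
    by (auto simp: valid_path_def piecewise_C1_differentiable_on_def)
qed

text \<open>Regularity can be tested after projection to the plane, since each chart is locally a
  smooth function \<open>\<tau>\<close> of the projection.\<close>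

lemma curveI:
  assumes path: "pathin (points M) \<gamma>" and vp: "valid_path (\<lambda>t. B (imm M (\<gamma> t)))"
  shows "piecewise_C1_curve M \<gamma>"
proof -
  obtain S0 where S0: "finite S0" "(\<lambda>t. B (imm M (\<gamma> t))) C1_differentiable_on ({0..1} - S0)"
    using vp by (auto simp: valid_path_def piecewise_C1_differentiable_on_def)
  define S where "S = insert 0 (insert 1 S0)"
  note BC1 = C1_differentiable_on_subset[OF S0(2)]
  have "(snd c \<circ> \<gamma>) C1_differentiable_on ({t\<in>{0..1}. \<gamma> t \<in> fst c} - S)" if c: "c \<in> atlas M" for c
  proof (rule C1_differentiable_on_local)
    fix t assume t: "t \<in> {t\<in>{0..1}. \<gamma> t \<in> fst c} - S"
    then have "snd c (\<gamma> t) \<in> chart_image c" by blast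
    then obtain V \<tau> where V: "open V" "snd c (\<gamma> t) \<in> V" "V \<subseteq> chart_image c" "open ((\<lambda>q. B (param M c q)) ` V)"
      "smooth_on \<tau> ((\<lambda>q. B (param M c q)) ` V)" and \<tau>: "\<And>q. q \<in> V \<Longrightarrow> \<tau> (B (param M c q)) = q"
      using flat_local_inverse[OF c] by metis
    have "openin (top_of_set {0..1}) {s \<in> {0..1}. \<gamma> s \<in> {x \<in> fst c. snd c x \<in> V}}"
      using openin_continuous_map_preimage[OF path[unfolded pathin_def] chart_open_preimage[OF atlas_chart[OF M c] V(1)]] by simp
    then obtain N0 where N0: "open N0" "{s \<in> {0..1}. \<gamma> s \<in> {x \<in> fst c. snd c x \<in> V}} = {0..1} \<inter> N0" by (auto simp: openin_open)
    define N where "N = N0 \<inter> {0<..<1}"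
    have "t \<in> {0..1} \<inter> N0" "t \<in> {0<..<1}" using N0(2)[symmetric] t V(2) by (auto simp: S_def)
    moreover have "\<gamma> s \<in> fst c \<and> snd c (\<gamma> s) \<in> V" if "s \<in> {0..1} \<inter> N0" for s using that unfolding N0(2)[symmetric] by simp
    ultimately have N: "open N" "t \<in> N" "\<And>s. s \<in> N \<Longrightarrow> \<gamma> s \<in> fst c \<and> snd c (\<gamma> s) \<in> V"
      using N0(1) by (simp_all add: N_def open_Int)
    let ?A = "({t\<in>{0..1}. \<gamma> t \<in> fst c} - S) \<inter> N"
    have par: "param M c (snd c (\<gamma> s)) = imm M (\<gamma> s)" if "s \<in> N" for s
      using atlas_inv_left[OF M c] N(3)[OF that] by (simp add: param_def)
    have "(\<lambda>t. \<tau> (B (imm M (\<gamma> t)))) C1_differentiable_on ?A"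
    proof (rule smooth_on_C1_compose(1)[OF V(4,5) BC1])
      show "(\<lambda>t. B (imm M (\<gamma> t))) ` ?A \<subseteq> (\<lambda>q. B (param M c q)) ` V"
      proof (rule image_subsetI)
        fix s assume s: "s \<in> ?A"
        then have "B (imm M (\<gamma> s)) = B (param M c (snd c (\<gamma> s)))" using par by simp
        then show "B (imm M (\<gamma> s)) \<in> (\<lambda>q. B (param M c q)) ` V" using N(3) s by blast
      qed
    qed (auto simp: S_def)
    moreover have "\<tau> (B (imm M (\<gamma> s))) = (snd c \<circ> \<gamma>) s" if "s \<in> N" for s
      using \<tau>[of "snd c (\<gamma> s)"] par[OF that] N(3)[OF that] by simp
    ultimately have "(snd c \<circ> \<gamma>) C1_differentiable_on ?A"
      by (rule C1_differentiable_on_cong_open[OF N(1) Int_lower2, rotated])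
    then show "\<exists>N. open N \<and> t \<in> N \<and> (snd c \<circ> \<gamma>) C1_differentiable_on (({t\<in>{0..1}. \<gamma> t \<in> fst c} - S) \<inter> N)"
      using N by blast
  qed
  moreover have "finite S" using S0 by (simp add: S_def)
  ultimately show ?thesis using path unfolding piecewise_C1_curve_def by blast
qed

text \<open>Integrating the velocity of the projected curve, which the comparison bounds by
  \<open>sqrt \<kappa>\<close> times the speed. The subinterval serves to confine every point of a
  short curve to a disk, not only its endpoint.\<close>

lemma flat_length:
  assumes \<gamma>: "piecewise_C1_curve M \<gamma>" and ab: "0 \<le> a" "a \<le> b" "b \<le> 1"
  shows "ennreal (norm (B (imm M (\<gamma> b)) - B (imm M (\<gamma> a))) / sqrt \<kappa>) \<le> curve_length M \<gamma>"
proof (cases "curve_length M \<gamma> = \<infinity>")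
  case False
  define g where "g = imm M \<circ> \<gamma>"
  have vp: "valid_path g" unfolding g_def by (rule curve_valid_path[OF \<gamma>])
  obtain S1 f where S1: "finite S1" "f \<in> borel_measurable borel" "g C1_differentiable_on ({0..1} - S1)"
    and f: "\<And>t. t \<in> {0..1} - S1 \<Longrightarrow> f t = ennreal (sqrt (mink (vector_derivative g (at t)) (vector_derivative g (at t))))"
    "\<And>t. t \<notin> {0..1} - S1 \<Longrightarrow> f t = 0" and len: "mink_length g = (\<integral>\<^sup>+t. f t \<partial>lborel)"
    using valid_path_speed_measurable[OF vp] by metis
  obtain S2 where S2: "finite S2" "\<And>t v. t \<in> {0..1} - S2 \<Longrightarrow> v = vector_derivative g (at t) \<Longrightarrow>
       (norm (B v))\<^sup>2 \<le> \<kappa> * mink v v \<and> mink v v \<le> \<kappa> * (norm (B v))\<^sup>2"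
    using curve_tangent[OF \<gamma>] unfolding g_def by metis
  define h where "h = (\<lambda>t. enn2real (f t))"
  have ftop: "f t < top" for t using f[of t] by (cases "t \<in> {0..1} - S1") auto
  then have hf: "ennreal (h t) = f t" for t by (simp add: h_def)
  have hm: "h \<in> borel_measurable borel" using S1(2) unfolding h_def by measurable
  have h0: "h t \<ge> 0" for t by (simp add: h_def)
  have len': "curve_length M \<gamma> = (\<integral>\<^sup>+t. ennreal (h t) \<partial>lborel)" by (simp add: curve_length_eq g_def[symmetric] len hf)
  have int: "integrable lborel h"
    by (rule integrableI_nonneg) (use hm h0 False len' in \<open>auto simp: top.not_eq_extremum\<close>)
  have leneq: "curve_length M \<gamma> = ennreal (integral\<^sup>L lborel h)"
    unfolding len' by (rule nn_integral_eq_integral[OF int]) (simp add: h0)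
  have hU: "(h has_integral (integral\<^sup>L lborel h)) UNIV" by (rule has_integral_integral_lborel[OF int])
  have hab: "h integrable_on {a..b}" using integrable_on_subcbox[of h UNIV a b] hU by auto
  define D where "D = (\<lambda>t. if t \<in> S1 \<union> S2 then 0 else B (vector_derivative g (at t)))"
  have "(D has_integral (B (g b) - B (g a))) {a..b}"
  proof (rule fundamental_theorem_of_calculus_interior_strong[where S = "S1 \<union> S2"])
    fix t assume t: "t \<in> {a<..<b} - (S1 \<union> S2)"
    then have "(g has_vector_derivative vector_derivative g (at t)) (at t)"
      using S1(3) ab by (simp add: C1_differentiable_on_eq vector_derivative_works)
    then show "((\<lambda>t. B (g t)) has_vector_derivative D t) (at t)"
      using bounded_linear.has_vector_derivative[OF B_bounded_linear] t by (simp add: D_def)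
  next
    have "continuous_on {0..1} g" using vp by (simp add: valid_path_def piecewise_C1_differentiable_on_def)
    then have "continuous_on {a..b} g" by (rule continuous_on_subset) (use ab in auto)
    then show "continuous_on {a..b} (\<lambda>t. B (g t))" by (rule bounded_linear.continuous_on[OF B_bounded_linear])
  qed (use S1 S2 ab in auto)
  then have "norm (B (g b) - B (g a)) = norm (integral {a..b} D)" and Dint: "D integrable_on {a..b}"
    by (auto simp: integral_unique)
  note this(1)
  also have "norm (integral {a..b} D) \<le> integral {a..b} (\<lambda>t. sqrt \<kappa> * h t)"
  proof (rule integral_norm_bound_integral[OF Dint])
    show "(\<lambda>t. sqrt \<kappa> * h t) integrable_on {a..b}" using hab by (rule integrable_on_mult_right)
    fix t assume t: "t \<in> {a..b}"
    show "norm (D t) \<le> sqrt \<kappa> * h t"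
    proof (cases "t \<in> S1 \<union> S2")
      case False
      let ?v = "vector_derivative g (at t)"
      have t01: "t \<in> {0..1} - S1" "t \<in> {0..1} - S2" using t False ab by auto
      have "(norm (B ?v))\<^sup>2 \<le> \<kappa> * mink ?v ?v" using S2(2)[OF t01(2) refl] by blast
      then have "norm (B ?v) \<le> sqrt (\<kappa> * mink ?v ?v)" by (rule real_le_rsqrt)
      moreover have "sqrt (mink ?v ?v) = h t"
      proof -
        have "0 \<le> \<kappa> * mink ?v ?v" using \<open>(norm (B ?v))\<^sup>2 \<le> _\<close> by (rule order_trans[OF zero_le_power2])
        then have "mink ?v ?v \<ge> 0" using \<kappa>_pos by (simp add: zero_le_mult_iff)
        then show ?thesis using f(1)[OF t01(1)] by (simp add: h_def)
      qed
      ultimately show ?thesis using False by (simp add: D_def real_sqrt_mult)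
    qed (use h0 \<kappa>_pos in \<open>simp add: D_def\<close>)
  qed
  also have "\<dots> = sqrt \<kappa> * integral {a..b} h" by simp
  also have "\<dots> \<le> sqrt \<kappa> * integral\<^sup>L lborel h"
  proof (rule mult_left_mono)
    have "integral {a..b} h \<le> integral UNIV h"
      by (rule integral_subset_le) (use hab hU h0 in auto)
    then show "integral {a..b} h \<le> integral\<^sup>L lborel h" using hU by (simp add: integral_unique)
  qed (use \<kappa>_pos in simp)
  finally have "norm (B (g b) - B (g a)) / sqrt \<kappa> \<le> integral\<^sup>L lborel h"
    using \<kappa>_pos by (simp add: divide_le_eq mult.commute)
  then show ?thesis unfolding leneq g_def by (auto intro: ennreal_leI)
qed simp

text \<open>The projection of the lifted segment has constant velocity \<open>z1 - z0\<close>, so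
  the other half of the comparison bounds the speed of the lift.\<close>

lemma flat_segment:
  assumes \<sigma>: "continuous_map (top_of_set D) (points M) \<sigma>" "\<And>z. z \<in> D \<Longrightarrow> B (imm M (\<sigma> z)) = z"
    and D: "closed_segment z0 z1 \<subseteq> D"
  defines "\<gamma> \<equiv> \<lambda>t. \<sigma> (z0 + t *\<^sub>R (z1 - z0))"
  shows "piecewise_C1_curve M \<gamma>" "curve_length M \<gamma> \<le> ennreal (sqrt \<kappa> * norm (z1 - z0))"
proof -
  have seg: "z0 + t *\<^sub>R (z1 - z0) \<in> D" if "t \<in> {0..1}" for t
  proof -
    have "z0 + t *\<^sub>R (z1 - z0) = (1 - t) *\<^sub>R z0 + t *\<^sub>R z1" by (simp add: algebra_simps)
    then have "z0 + t *\<^sub>R (z1 - z0) \<in> closed_segment z0 z1" using that by (auto simp: closed_segment_def)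
    then show ?thesis using D by blast
  qed
  have "continuous_map (top_of_set {0..1}) (top_of_set D) (\<lambda>t. z0 + t *\<^sub>R (z1 - z0))"
    using seg by (auto simp: continuous_map_in_subtopology intro!: continuous_intros)
  from continuous_map_compose[OF this \<sigma>(1)] have path: "pathin (points M) \<gamma>"
    by (simp add: pathin_def \<gamma>_def o_def)
  have B\<gamma>: "B (imm M (\<gamma> t)) = z0 + t *\<^sub>R (z1 - z0)" if "t \<in> {0..1}" for t
    using \<sigma>(2)[OF seg[OF that]] by (simp add: \<gamma>_def)
  have dB: "((\<lambda>t. B (imm M (\<gamma> t))) has_vector_derivative (z1 - z0)) (at t)" if "t \<in> {0<..<1}" for t
  proof -
    have "((\<lambda>t. z0 + t *\<^sub>R (z1 - z0)) has_vector_derivative (z1 - z0)) (at t)" by (auto intro!: derivative_eq_intros)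
    then show ?thesis by (rule has_vector_derivative_transform_within_open[OF _ open_greaterThanLessThan that]) (use B\<gamma> in auto)
  qed
  have "valid_path (\<lambda>t. B (imm M (\<gamma> t)))"
    unfolding valid_path_def piecewise_C1_differentiable_on_def C1_differentiable_on_def
  proof (intro conjI exI[of _ "{0, 1}"] exI[of _ "\<lambda>_. z1 - z0"] ballI)
    have "continuous_on {0..1} (\<lambda>t. z0 + t *\<^sub>R (z1 - z0))" by (intro continuous_intros)
    then show "continuous_on {0..1} (\<lambda>t. B (imm M (\<gamma> t)))" by (rule continuous_on_eq) (simp add: B\<gamma>)
  qed (auto intro!: dB)
  then show cur: "piecewise_C1_curve M \<gamma>" by (rule curveI[OF path])
  obtain S where S: "finite S" "{0, 1} \<subseteq> S" "(imm M \<circ> \<gamma>) C1_differentiable_on ({0..1} - S)"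
    "\<And>t v. t \<in> {0..1} - S \<Longrightarrow> v = vector_derivative (imm M \<circ> \<gamma>) (at t) \<Longrightarrow>
       (norm (B v))\<^sup>2 \<le> \<kappa> * mink v v \<and> mink v v \<le> \<kappa> * (norm (B v))\<^sup>2"
    using curve_tangent[OF cur] by metis
  have "AE t in lborel. t \<notin> S" by (rule AE_not_in[OF finite_imp_null_set_lborel[OF S(1)]])
  then have "AE t in lborel. ennreal (sqrt (mink (vector_derivative (imm M \<circ> \<gamma>) (at t)) (vector_derivative (imm M \<circ> \<gamma>) (at t)))) * indicator {0..1} t
      \<le> ennreal (sqrt \<kappa> * norm (z1 - z0)) * indicator {0..1} t"
  proof (rule AE_mp, intro AE_I2 impI)
    fix t :: real assume t: "t \<notin> S"
    let ?v = "vector_derivative (imm M \<circ> \<gamma>) (at t)"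
    show "ennreal (sqrt (mink ?v ?v)) * indicator {0..1} t \<le> ennreal (sqrt \<kappa> * norm (z1 - z0)) * indicator {0..1} t"
    proof (cases "t \<in> {0..1}")
      case True
      then have t01: "t \<in> {0..1} - S" "t \<in> {0<..<1}" using t S(2) by (auto simp: less_le)
      have "(imm M \<circ> \<gamma> has_vector_derivative ?v) (at t)"
        using S(3) t01(1) by (simp add: C1_differentiable_on_eq vector_derivative_works)
      from bounded_linear.has_vector_derivative[OF B_bounded_linear this]
      have "B ?v = z1 - z0" using vector_derivative_unique_at[OF _ dB[OF t01(2)]] by (simp add: o_def)
      then have "mink ?v ?v \<le> \<kappa> * (norm (z1 - z0))\<^sup>2" using S(4)[OF t01(1) refl] by simp
      then have "sqrt (mink ?v ?v) \<le> sqrt (\<kappa> * (norm (z1 - z0))\<^sup>2)" by (rule real_sqrt_le_mono)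
      also have "\<dots> = sqrt \<kappa> * norm (z1 - z0)" by (simp add: real_sqrt_mult)
      finally show ?thesis using True by (simp add: ennreal_leI)
    qed simp
  qed
  from nn_integral_mono_AE[OF this]
  have "curve_length M \<gamma> \<le> (\<integral>\<^sup>+t. ennreal (sqrt \<kappa> * norm (z1 - z0)) * indicator {0..1} (t::real) \<partial>lborel)"
    by (simp add: curve_length_def)
  also have "\<dots> = ennreal (sqrt \<kappa> * norm (z1 - z0))" by (subst nn_integral_cmult_indicator) auto
  finally show "curve_length M \<gamma> \<le> ennreal (sqrt \<kappa> * norm (z1 - z0))" .
qed

section \<open>The distance as a metric\<close>

text \<open>The infimum before \<open>enn2real\<close>, which would send an infinite value to 0.
  Symmetry and the triangle inequality are proved at this level, and finiteness separately.\<close>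

definition surface_einf :: "'a \<Rightarrow> 'a \<Rightarrow> ennreal" where
  "surface_einf p q = (INF \<gamma>\<in>{\<gamma>. piecewise_C1_curve M \<gamma> \<and> \<gamma> 0 = p \<and> \<gamma> 1 = q}. curve_length M \<gamma>)"

lemma surface_dist_einf: "surface_dist M p q = enn2real (surface_einf p q)"
  by (simp add: surface_dist_def surface_einf_def)

lemma einf_le: "piecewise_C1_curve M \<gamma> \<Longrightarrow> \<gamma> 0 = p \<Longrightarrow> \<gamma> 1 = q \<Longrightarrow> surface_einf p q \<le> curve_length M \<gamma>"
  unfolding surface_einf_def by (rule INF_lower) simp

lemma einf_section:
  assumes "continuous_map (top_of_set D) (points M) \<sigma>" "\<And>z. z \<in> D \<Longrightarrow> B (imm M (\<sigma> z)) = z"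
    "closed_segment z0 z1 \<subseteq> D"
  shows "surface_einf (\<sigma> z0) (\<sigma> z1) \<le> ennreal (sqrt \<kappa> * norm (z1 - z0))"
  using einf_le[OF flat_segment(1)[OF assms]] flat_segment(2)[OF assms] by (force intro: order_trans)

lemma einf_lower:
  "ennreal (norm (B (imm M q) - B (imm M p)) / sqrt \<kappa>) \<le> surface_einf p q"
  unfolding surface_einf_def
proof (rule INF_greatest)
  fix \<gamma> assume "\<gamma> \<in> {\<gamma>. piecewise_C1_curve M \<gamma> \<and> \<gamma> 0 = p \<and> \<gamma> 1 = q}"
  then show "ennreal (norm (B (imm M q) - B (imm M p)) / sqrt \<kappa>) \<le> curve_length M \<gamma>"
    using flat_length[of \<gamma> 0 1] by auto
qed

lemma curve_reverse:
  assumes "piecewise_C1_curve M \<gamma>"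
  shows "piecewise_C1_curve M (\<lambda>t. \<gamma> (1 - t))" "curve_length M (\<lambda>t. \<gamma> (1 - t)) = curve_length M \<gamma>"
proof -
  have "continuous_map (top_of_set {0..1}) (top_of_set {0..1}) (\<lambda>t. 1 - t :: real)"
    by (auto simp: continuous_map_in_subtopology intro!: continuous_intros)
  then have path: "pathin (points M) (\<lambda>t. \<gamma> (1 - t))"
    using assms continuous_map_compose[of "top_of_set {0..1}" "top_of_set {0..1}" "\<lambda>t. 1 - t" "points M" \<gamma>]
    by (simp add: piecewise_C1_curve_def pathin_def o_def)
  have "valid_path (reversepath (\<lambda>t. B (imm M (\<gamma> t))))"
    using valid_path_imp_reverse[OF valid_path_bounded_linear[OF B_bounded_linear curve_valid_path[OF assms]]] by (simp add: o_def)
  then show "piecewise_C1_curve M (\<lambda>t. \<gamma> (1 - t))" by (intro curveI[OF path]) (simp add: reversepath_def)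
  show "curve_length M (\<lambda>t. \<gamma> (1 - t)) = curve_length M \<gamma>"
    using mink_length_reversepath[OF curve_valid_path[OF assms]] by (simp add: curve_length_eq reversepath_def o_def)
qed

lemma curve_join:
  assumes "piecewise_C1_curve M \<gamma>1" "piecewise_C1_curve M \<gamma>2" "\<gamma>1 1 = \<gamma>2 0"
  defines "\<gamma> \<equiv> \<lambda>t. if t \<le> 1/2 then \<gamma>1 (2 * t) else \<gamma>2 (2 * t - 1)"
  shows "piecewise_C1_curve M \<gamma>" "curve_length M \<gamma> = curve_length M \<gamma>1 + curve_length M \<gamma>2"
proof -
  have p12: "continuous_map (top_of_set {0..1}) (points M) \<gamma>1" "continuous_map (top_of_set {0..1}) (points M) \<gamma>2"
    using assms(1,2) by (simp_all add: piecewise_C1_curve_def pathin_def)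
  have "continuous_map (top_of_set {0..1}) (points M) (\<lambda>t. if t \<le> 1/2 then \<gamma>1 (2 * t) else \<gamma>2 (2 * t - 1))"
  proof (rule continuous_map_cases_le)
    show "continuous_map (subtopology (top_of_set {0..1}) {x \<in> topspace (top_of_set {0..1}). x \<le> 1/2}) (points M) (\<lambda>t. \<gamma>1 (2 * t))"
    proof -
      have "continuous_map (subtopology (top_of_set {0..1}) {x \<in> topspace (top_of_set {0..1}). x \<le> 1/2}) (top_of_set {0..1}) (\<lambda>t. 2 * t :: real)"
        by (auto simp: continuous_map_in_subtopology subtopology_subtopology intro!: continuous_intros)
      from continuous_map_compose[OF this p12(1)] show ?thesis by (simp add: o_def)
    qed
    show "continuous_map (subtopology (top_of_set {0..1}) {x \<in> topspace (top_of_set {0..1}). 1/2 \<le> x}) (points M) (\<lambda>t. \<gamma>2 (2 * t - 1))"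
    proof -
      have "continuous_map (subtopology (top_of_set {0..1}) {x \<in> topspace (top_of_set {0..1}). 1/2 \<le> x}) (top_of_set {0..1}) (\<lambda>t. 2 * t - 1 :: real)"
        by (auto simp: continuous_map_in_subtopology subtopology_subtopology intro!: continuous_intros)
      from continuous_map_compose[OF this p12(2)] show ?thesis by (simp add: o_def)
    qed
    show "\<gamma>1 (2 * x) = \<gamma>2 (2 * x - 1)" if "x = 1/2" for x unfolding that using assms(3) by simp
  qed (auto intro!: continuous_intros)
  then have path: "pathin (points M) \<gamma>" by (simp add: pathin_def \<gamma>_def)
  have vp: "valid_path (\<lambda>t. B (imm M (\<gamma>1 t)))" "valid_path (\<lambda>t. B (imm M (\<gamma>2 t)))"
    using valid_path_bounded_linear[OF B_bounded_linear curve_valid_path[OF assms(1)]]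
      valid_path_bounded_linear[OF B_bounded_linear curve_valid_path[OF assms(2)]] by (simp_all add: o_def)
  have "valid_path ((\<lambda>t. B (imm M (\<gamma>1 t))) +++ (\<lambda>t. B (imm M (\<gamma>2 t))))"
    by (rule valid_path_join[OF vp]) (simp add: pathfinish_def pathstart_def assms(3))
  moreover have "(\<lambda>t. B (imm M (\<gamma>1 t))) +++ (\<lambda>t. B (imm M (\<gamma>2 t))) = (\<lambda>t. B (imm M (\<gamma> t)))"
    by (auto simp: joinpaths_def \<gamma>_def)
  ultimately show "piecewise_C1_curve M \<gamma>" using curveI[OF path] by simp
  have "(imm M \<circ> \<gamma>1) +++ (imm M \<circ> \<gamma>2) = imm M \<circ> \<gamma>" by (auto simp: joinpaths_def \<gamma>_def)
  then show "curve_length M \<gamma> = curve_length M \<gamma>1 + curve_length M \<gamma>2"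
    using mink_length_join[OF curve_valid_path[OF assms(1)] curve_valid_path[OF assms(2)]] by (simp add: curve_length_eq)
qed

lemma einf_commute: "surface_einf p q = surface_einf q p"
proof -
  have "surface_einf p q \<le> surface_einf q p" for p q
    unfolding surface_einf_def[of q p]
  proof (rule INF_greatest)
    fix \<gamma> assume "\<gamma> \<in> {\<gamma>. piecewise_C1_curve M \<gamma> \<and> \<gamma> 0 = q \<and> \<gamma> 1 = p}"
    then show "surface_einf p q \<le> curve_length M \<gamma>"
      using curve_reverse[of \<gamma>] einf_le[of "\<lambda>t. \<gamma> (1 - t)" p q] by auto
  qed
  then show ?thesis by (intro antisym)
qed

lemma einf_triangle: "surface_einf p r \<le> surface_einf p q + surface_einf q r"
proof (rule ccontr)
  assume "\<not> ?thesis"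
  then have lt: "surface_einf p q + surface_einf q r < surface_einf p r" by simp
  then have fin: "surface_einf p q < top" "surface_einf q r < top"
    using order_less_le_trans[OF lt top_greatest] by (auto simp: less_top)
  obtain x y where xy: "surface_einf p q = ennreal x" "surface_einf q r = ennreal y" "x \<ge> 0" "y \<ge> 0"
    using fin by (metis ennreal_cases less_top)
  have "\<exists>e>0. ennreal (x + y + e) < surface_einf p r"
  proof (cases "surface_einf p r")
    case (real z)
    then have "x + y < z" using lt xy by (simp add: ennreal_plus[symmetric] ennreal_less_iff del: ennreal_plus)
    then show ?thesis using real xy by (intro exI[of _ "(z - x - y) / 2"]) (auto simp: ennreal_less_iff field_simps)
  next
    case top
    then show ?thesis by (intro exI[of _ 1]) simp
  qed
  then obtain e where e: "e > 0" "ennreal (x + y + e) < surface_einf p r" by blast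
  have "surface_einf p q < ennreal (x + e/2)" "surface_einf q r < ennreal (y + e/2)"
    unfolding xy using e xy by (auto simp: ennreal_less_iff)
  then obtain \<gamma>1 \<gamma>2 where \<gamma>: "piecewise_C1_curve M \<gamma>1" "\<gamma>1 0 = p" "\<gamma>1 1 = q" "curve_length M \<gamma>1 < ennreal (x + e/2)"
    "piecewise_C1_curve M \<gamma>2" "\<gamma>2 0 = q" "\<gamma>2 1 = r" "curve_length M \<gamma>2 < ennreal (y + e/2)"
    unfolding surface_einf_def INF_less_iff by blast
  have "surface_einf p r \<le> curve_length M \<gamma>1 + curve_length M \<gamma>2"
    using einf_le[OF curve_join(1)[OF \<gamma>(1,5)], of p r] curve_join(2)[OF \<gamma>(1,5)] \<gamma> by simp
  also have "\<dots> \<le> ennreal (x + e/2) + ennreal (y + e/2)" by (intro add_mono less_imp_le \<gamma>)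
  also have "\<dots> = ennreal (x + y + e)" using xy e by (simp add: ennreal_plus[symmetric] del: ennreal_plus)
  finally show False using e(2) by simp
qed

text \<open>A curve from \<open>p\<close> shorter than \<open>\<epsilon> / sqrt \<kappa>\<close>
  projects into the disk, so by uniqueness of lifts it is the image of its projection under
  \<open>\<sigma>\<close> and ends in \<open>U\<close>. In particular, different points with the
  same projection have positive distance.\<close>

lemma einf_local:
  assumes "p \<in> pts M"
  obtains U \<epsilon> \<sigma> where "openin (points M) U" "p \<in> U" "\<epsilon> > 0" "inj_on (\<lambda>p. B (imm M p)) U"
    "continuous_map (top_of_set (ball (B (imm M p)) \<epsilon>)) (points M) \<sigma>"
    "\<And>z. z \<in> ball (B (imm M p)) \<epsilon> \<Longrightarrow> \<sigma> z \<in> U \<and> B (imm M (\<sigma> z)) = z"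
    "\<sigma> (B (imm M p)) = p"
    "\<And>q. surface_einf p q < ennreal (\<epsilon> / sqrt \<kappa>) \<Longrightarrow> q \<in> U"
    "\<And>q. q \<in> U \<Longrightarrow> B (imm M q) \<in> ball (B (imm M p)) \<epsilon> \<Longrightarrow> surface_einf p q \<le> ennreal (sqrt \<kappa> * norm (B (imm M q) - B (imm M p)))"
proof -
  obtain U \<epsilon> \<sigma> where U: "openin (points M) U" "p \<in> U" "\<epsilon> > 0" "inj_on (\<lambda>p. B (imm M p)) U"
    and \<sigma>: "continuous_map (top_of_set (ball (B (imm M p)) \<epsilon>)) (points M) \<sigma>"
    "\<And>z. z \<in> ball (B (imm M p)) \<epsilon> \<Longrightarrow> \<sigma> z \<in> U \<and> B (imm M (\<sigma> z)) = z"
    using flat_nbhd[OF assms] by metis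
  have \<sigma>q: "\<sigma> (B (imm M q)) = q" if "q \<in> U" "B (imm M q) \<in> ball (B (imm M p)) \<epsilon>" for q
    using \<sigma>(2)[OF that(2)] that(1) U(4) by (auto simp: inj_on_def)
  have \<sigma>p: "\<sigma> (B (imm M p)) = p" by (rule \<sigma>q[OF U(2)]) (use U in simp)
  have stay: "q \<in> U" if q: "surface_einf p q < ennreal (\<epsilon> / sqrt \<kappa>)" for q
  proof -
    obtain \<gamma> where \<gamma>: "piecewise_C1_curve M \<gamma>" "\<gamma> 0 = p" "\<gamma> 1 = q" "curve_length M \<gamma> < ennreal (\<epsilon> / sqrt \<kappa>)"
      using q unfolding surface_einf_def INF_less_iff by blast
    have c\<gamma>: "continuous_map (top_of_set {0..1}) (points M) \<gamma>" using \<gamma>(1) by (simp add: piecewise_C1_curve_def pathin_def)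
    have inb: "B (imm M (\<gamma> t)) \<in> ball (B (imm M p)) \<epsilon>" if "t \<in> {0..1}" for t
    proof -
      have "ennreal (norm (B (imm M (\<gamma> t)) - B (imm M (\<gamma> 0))) / sqrt \<kappa>) < ennreal (\<epsilon> / sqrt \<kappa>)"
        using flat_length[OF \<gamma>(1), of 0 t] that \<gamma>(4) by (auto intro: order_le_less_trans)
      then have "norm (B (imm M (\<gamma> t)) - B (imm M p)) < \<epsilon>"
        using \<kappa>_pos \<gamma>(2) by (simp add: ennreal_less_iff divide_less_cancel)
      then show ?thesis by (simp add: dist_norm norm_minus_commute)
    qed
    have "continuous_map (top_of_set {0..1}) (top_of_set (ball (B (imm M p)) \<epsilon>)) (\<lambda>t. B (imm M (\<gamma> t)))"
      using continuous_map_compose[OF c\<gamma> flat_map_continuous] inb by (auto simp: continuous_map_in_subtopology o_def)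
    from continuous_map_compose[OF this \<sigma>(1)]
    have "continuous_map (top_of_set {0..1}) (points M) (\<lambda>t. \<sigma> (B (imm M (\<gamma> t))))" by (simp add: o_def)
    then have "\<gamma> 1 = \<sigma> (B (imm M (\<gamma> 1)))"
      by (intro flat_lift_unique[OF _ c\<gamma>, where u = 0 and t = 1]) (use \<sigma>(2)[OF inb] \<gamma>(2) \<sigma>p in auto)
    then show "q \<in> U" using \<sigma>(2)[OF inb[of 1]] \<gamma>(3) by simp
  qed
  have near: "surface_einf p q \<le> ennreal (sqrt \<kappa> * norm (B (imm M q) - B (imm M p)))"
    if "q \<in> U" "B (imm M q) \<in> ball (B (imm M p)) \<epsilon>" for q
  proof -
    have "closed_segment (B (imm M p)) (B (imm M q)) \<subseteq> ball (B (imm M p)) \<epsilon>"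
      by (rule closed_segment_subset) (use that U(3) in auto)
    from einf_section[OF \<sigma>(1) _ this] \<sigma>(2) show ?thesis by (simp add: \<sigma>p \<sigma>q[OF that])
  qed
  show ?thesis by (rule that[OF U \<sigma> \<sigma>p stay near])
qed

lemma einf_refl: "p \<in> pts M \<Longrightarrow> surface_einf p p = 0"
proof -
  assume "p \<in> pts M"
  then obtain U \<epsilon> where "p \<in> U" "\<epsilon> > 0"
    "\<And>q. q \<in> U \<Longrightarrow> B (imm M q) \<in> ball (B (imm M p)) \<epsilon> \<Longrightarrow> surface_einf p q \<le> ennreal (sqrt \<kappa> * norm (B (imm M q) - B (imm M p)))"
    using einf_local by metis
  from this(3)[OF this(1)] this(2) show ?thesis by simp
qed

text \<open>By \<open>einf_local\<close> every point has a neighbourhood at finite distance, so the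
  points at finite distance from \<open>p\<close> form an open set with open complement, and the
  surface is connected.\<close>

lemma einf_finite:
  assumes "p \<in> pts M" "q \<in> pts M"
  shows "surface_einf p q < top"
proof -
  have nb: "\<exists>W. openin (points M) W \<and> x \<in> W \<and> (\<forall>y\<in>W. surface_einf x y < top)" if x: "x \<in> pts M" for x
  proof -
    obtain U \<epsilon> where U: "openin (points M) U" "x \<in> U" "\<epsilon> > 0"
      "\<And>q. q \<in> U \<Longrightarrow> B (imm M q) \<in> ball (B (imm M x)) \<epsilon> \<Longrightarrow> surface_einf x q \<le> ennreal (sqrt \<kappa> * norm (B (imm M q) - B (imm M x)))"
      using einf_local[OF x] by metis
    have "openin (points M) {y \<in> topspace (points M). B (imm M y) \<in> ball (B (imm M x)) \<epsilon>}"
      by (rule openin_continuous_map_preimage[OF flat_map_continuous]) simp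
    then have "openin (points M) (U \<inter> {y \<in> topspace (points M). B (imm M y) \<in> ball (B (imm M x)) \<epsilon>})" using U(1) by blast
    moreover have "surface_einf x y < top" if "y \<in> U \<inter> {y \<in> topspace (points M). B (imm M y) \<in> ball (B (imm M x)) \<epsilon>}" for y
      using U(4)[of y] that by (auto intro: order_le_less_trans)
    ultimately show ?thesis using U(2,3) x by (intro exI[of _ "U \<inter> {y \<in> topspace (points M). B (imm M y) \<in> ball (B (imm M x)) \<epsilon>}"]) auto
  qed
  have fin_iff: "surface_einf p x < top \<longleftrightarrow> surface_einf p y < top" if "surface_einf x y < top" for x y
    using that einf_triangle[of p y x] einf_triangle[of p x y] einf_commute[of x y]
    by (metis ennreal_add_eq_top less_top neq_top_trans)
  let ?E = "{x \<in> pts M. surface_einf p x < top}"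
  have "openin (points M) ?E"
  proof (subst openin_subopen, intro ballI)
    fix x assume x: "x \<in> ?E"
    then obtain W where W: "openin (points M) W" "x \<in> W" "\<forall>y\<in>W. surface_einf x y < top" using nb by blast
    then have "W \<subseteq> ?E" using x fin_iff openin_subset[OF W(1)] by blast
    then show "\<exists>T. openin (points M) T \<and> x \<in> T \<and> T \<subseteq> ?E" using W by blast
  qed
  moreover have "openin (points M) (pts M - ?E)"
  proof (subst openin_subopen, intro ballI)
    fix x assume x: "x \<in> pts M - ?E"
    then obtain W where W: "openin (points M) W" "x \<in> W" "\<forall>y\<in>W. surface_einf x y < top" using nb by blast
    then have "W \<subseteq> pts M - ?E" using x fin_iff openin_subset[OF W(1)] by blast
    then show "\<exists>T. openin (points M) T \<and> x \<in> T \<and> T \<subseteq> pts M - ?E" using W by blast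
  qed
  moreover have "p \<in> ?E" using assms(1) einf_refl by simp
  ultimately have "pts M - ?E = {}"
    using surface_connected[OF M] unfolding connected_space_def by blast
  then show ?thesis using assms(2) by blast
qed

lemma ennreal_surface_dist: "p \<in> pts M \<Longrightarrow> q \<in> pts M \<Longrightarrow> ennreal (surface_dist M p q) = surface_einf p q"
  using einf_finite by (simp add: surface_dist_einf)

lemma surface_metric: "Metric_space (pts M) (surface_dist M)"
proof
  show "0 \<le> surface_dist M x y" for x y by (simp add: surface_dist_def)
  show "surface_dist M x y = surface_dist M y x" for x y by (simp add: surface_dist_einf einf_commute)
  show "surface_dist M x y = 0 \<longleftrightarrow> x = y" if xy: "x \<in> pts M" "y \<in> pts M" for x y
  proof
    assume 0: "surface_dist M x y = 0"
    obtain U \<epsilon> where U: "\<epsilon> > 0" "inj_on (\<lambda>p. B (imm M p)) U" "x \<in> U"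
      "\<And>q. surface_einf x q < ennreal (\<epsilon> / sqrt \<kappa>) \<Longrightarrow> q \<in> U"
      using einf_local[OF xy(1)] by metis
    have e0: "surface_einf x y = 0" using 0 ennreal_surface_dist[OF xy] by simp
    then have "y \<in> U" using U(1,4) \<kappa>_pos by (simp add: ennreal_less_iff)
    moreover have "B (imm M x) = B (imm M y)"
      using einf_lower[where p = x and q = y] e0 \<kappa>_pos by (simp add: ennreal_eq_0_iff divide_le_0_iff)
    ultimately show "x = y" using U(2,3) by (auto simp: inj_on_def)
  qed (use xy einf_refl in \<open>simp add: surface_dist_einf\<close>)
  show "surface_dist M x z \<le> surface_dist M x y + surface_dist M y z" if "x \<in> pts M" "y \<in> pts M" "z \<in> pts M" for x y z
  proof -
    have d0: "0 \<le> surface_dist M x y" for x y by (simp add: surface_dist_def)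
    have "ennreal (surface_dist M x z) \<le> ennreal (surface_dist M x y + surface_dist M y z)"
      unfolding ennreal_plus[OF d0 d0] using einf_triangle[of x z y] that by (simp add: ennreal_surface_dist)
    then show ?thesis by (rule ennreal_le_iff[THEN iffD1, rotated]) (intro add_nonneg_nonneg d0)
  qed
qed

lemma surface_dist_lower:
  "p \<in> pts M \<Longrightarrow> q \<in> pts M \<Longrightarrow> norm (B (imm M q) - B (imm M p)) \<le> sqrt \<kappa> * surface_dist M p q"
  using einf_lower[where p = p and q = q] \<kappa>_pos
  by (simp add: ennreal_surface_dist[symmetric] surface_dist_def ennreal_le_iff divide_le_eq mult.commute)

lemma surface_dist_section:
  assumes "continuous_map (top_of_set D) (points M) \<sigma>" "\<And>z. z \<in> D \<Longrightarrow> B (imm M (\<sigma> z)) = z"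
    "closed_segment z0 z1 \<subseteq> D"
  shows "surface_dist M (\<sigma> z0) (\<sigma> z1) \<le> sqrt \<kappa> * norm (z1 - z0)"
proof -
  have "z0 \<in> D" "z1 \<in> D" using assms(3) by auto
  then have "\<sigma> z0 \<in> pts M" "\<sigma> z1 \<in> pts M" using assms(1) by (auto simp: continuous_map_def Pi_iff)
  then show ?thesis
    using einf_section[OF assms] \<kappa>_pos by (simp add: ennreal_surface_dist[symmetric] ennreal_le_iff)
qed

end

section \<open>Completeness and the flat developing map\<close>

context
  fixes M :: "'a surface" and B :: "real^4 \<Rightarrow> real^2" and \<kappa> :: real
  assumes M: "spacelike_surface M" and fc: "flat_comparable M B \<kappa>"
begin

definition flat_section :: "(real^2) set \<Rightarrow> (real^2 \<Rightarrow> 'a) \<Rightarrow> bool" where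
  "flat_section D \<sigma> \<longleftrightarrow> continuous_map (top_of_set D) (points M) \<sigma> \<and> (\<forall>z\<in>D. B (imm M (\<sigma> z)) = z)"

lemma flat_section_unique:
  assumes "flat_section D \<sigma>1" "flat_section D' \<sigma>2" "connected T" "T \<subseteq> D" "T \<subseteq> D'" "a \<in> T" "\<sigma>1 a = \<sigma>2 a" "z \<in> T"
  shows "\<sigma>1 z = \<sigma>2 z"
proof (rule flat_lift_unique[where ?g1.0 = \<sigma>1 and ?g2.0 = \<sigma>2, OF M fc assms(3) _ _ _ assms(6,7,8)])
  show "continuous_map (top_of_set T) (points M) \<sigma>1" "continuous_map (top_of_set T) (points M) \<sigma>2"
    using assms by (auto simp: flat_section_def intro: continuous_map_from_subtopology_mono)
qed (use assms in \<open>auto simp: flat_section_def subset_iff\<close>)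

lemma flat_section_subset: "flat_section D \<sigma> \<Longrightarrow> D' \<subseteq> D \<Longrightarrow> flat_section D' \<sigma>"
  by (auto simp: flat_section_def intro: continuous_map_from_subtopology_mono)

lemma flat_section_glue:
  assumes op: "\<And>i. i \<in> I \<Longrightarrow> open (D i)" and sec: "\<And>i. i \<in> I \<Longrightarrow> flat_section (D i) (s i)"
    and eq: "\<And>i z. i \<in> I \<Longrightarrow> z \<in> D i \<Longrightarrow> \<sigma> z = s i z"
  shows "flat_section (\<Union>i\<in>I. D i) \<sigma>"
  unfolding flat_section_def continuous_map_def
proof (intro conjI allI impI ballI)
  show "\<sigma> \<in> topspace (top_of_set (\<Union>i\<in>I. D i)) \<rightarrow> pts M"
    using sec eq by (fastforce simp: flat_section_def continuous_map_def)
  show "B (imm M (\<sigma> z)) = z" if "z \<in> (\<Union>i\<in>I. D i)" for z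
    using that sec eq by (auto simp: flat_section_def)
  fix W assume W: "openin (points M) W"
  have "open {z \<in> D i. s i z \<in> W}" if i: "i \<in> I" for i
  proof -
    have "openin (top_of_set (D i)) {z \<in> topspace (top_of_set (D i)). s i z \<in> W}"
      by (rule openin_continuous_map_preimage[OF _ W]) (use sec[OF i] in \<open>simp add: flat_section_def\<close>)
    then show ?thesis using openin_open_trans[OF _ op[OF i]] by simp
  qed
  moreover have "{z \<in> topspace (top_of_set (\<Union>i\<in>I. D i)). \<sigma> z \<in> W} = (\<Union>i\<in>I. {z \<in> D i. s i z \<in> W})"
    using eq by auto
  ultimately have "open {z \<in> topspace (top_of_set (\<Union>i\<in>I. D i)). \<sigma> z \<in> W}" by auto
  then show "openin (top_of_set (\<Union>i\<in>I. D i)) {z \<in> topspace (top_of_set (\<Union>i\<in>I. D i)). \<sigma> z \<in> W}"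
    by (rule open_subset[rotated]) auto
qed

text \<open>A section over a disk has, by completeness, a limit along each radius; near the limit the local
  inverse of the developing map continues the section, and by convexity these continuations agree.\<close>

lemma flat_section_extend:
  assumes comp: "complete_surface M" and r: "r > 0" and sec: "flat_section (ball z0 r) \<sigma>"
  obtains r' \<sigma>' where "r' > r" "flat_section (ball z0 r') \<sigma>'" "\<sigma>' z0 = \<sigma> z0"
proof -
  interpret Metric_space "pts M" "surface_dist M" by (rule surface_metric[OF M fc])
  have \<kappa>: "\<kappa> > 0" by (rule \<kappa>_pos[OF M fc])
  have inM: "\<sigma> z \<in> pts M" "B (imm M (\<sigma> z)) = z" if "z \<in> ball z0 r" for z
    using sec that by (auto simp: flat_section_def continuous_map_def Pi_iff)
  have bd: "\<exists>\<epsilon> \<tau> a. \<epsilon> > 0 \<and> flat_section (ball b \<epsilon>) \<tau> \<and> a \<in> ball b \<epsilon> \<inter> ball z0 r \<and> \<tau> a = \<sigma> a" if b: "b \<in> sphere z0 r" for b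
  proof -
    \<comment> \<open>Points on the radius towards \<open>b\<close>; the summand 2 keeps the factor
      between 1/2 and 1, so that all of them lie in the open disk.\<close>
    define a where "a = (\<lambda>n::nat. z0 + (1 - 1 / (real n + 2)) *\<^sub>R (b - z0))"
    have nb: "norm (b - z0) = r" using b by (simp add: dist_norm norm_minus_commute)
    have a: "a n \<in> ball z0 r" for n
    proof -
      have "\<bar>1 - 1 / (real n + 2)\<bar> < 1" by (simp add: abs_less_iff divide_simps)
      then have "norm ((1 - 1 / (real n + 2)) *\<^sub>R (b - z0)) < 1 * r" using nb r by (simp only: norm_scaleR) (simp add: mult_strict_right_mono)
      then show ?thesis by (simp add: a_def dist_norm)
    qed
    have lim: "a \<longlonglongrightarrow> b"
    proof -
      have "(\<lambda>n. 1 - 1 / (real n + 2)) \<longlonglongrightarrow> 1" by real_asymp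
      then have "a \<longlonglongrightarrow> z0 + 1 *\<^sub>R (b - z0)" unfolding a_def by (intro tendsto_intros)
      then show ?thesis by simp
    qed
    have dle: "surface_dist M (\<sigma> (a m)) (\<sigma> (a n)) \<le> sqrt \<kappa> * norm (a n - a m)" for m n
    proof (rule surface_dist_section[OF M fc, of "ball z0 r"])
      show "closed_segment (a m) (a n) \<subseteq> ball z0 r" by (rule closed_segment_subset[OF a a convex_ball])
    qed (use sec in \<open>simp_all add: flat_section_def\<close>)
    have "MCauchy (\<lambda>n. \<sigma> (a n))"
      unfolding MCauchy_def
    proof (intro conjI allI impI)
      show "range (\<lambda>n. \<sigma> (a n)) \<subseteq> pts M" using inM a by blast
      fix \<epsilon> :: real assume "\<epsilon> > 0"
      then have "\<epsilon> / sqrt \<kappa> > 0" using \<kappa> by simp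
      then obtain N where N: "\<And>m n. m \<ge> N \<Longrightarrow> n \<ge> N \<Longrightarrow> dist (a m) (a n) < \<epsilon> / sqrt \<kappa>"
        using convergent_Cauchy[OF convergentI[OF lim]] unfolding Cauchy_def by meson
      have "surface_dist M (\<sigma> (a m)) (\<sigma> (a n)) < \<epsilon>" if "m \<ge> N" "n \<ge> N" for m n
      proof -
        have "sqrt \<kappa> * norm (a n - a m) < sqrt \<kappa> * (\<epsilon> / sqrt \<kappa>)"
          using N[OF that(2,1)] \<kappa> by (intro mult_strict_left_mono) (simp_all add: dist_norm)
        then show ?thesis using dle[of m n] \<kappa> by simp
      qed
      then show "\<exists>N. \<forall>n n'. N \<le> n \<longrightarrow> N \<le> n' \<longrightarrow> surface_dist M (\<sigma> (a n)) (\<sigma> (a n')) < \<epsilon>" by blast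
    qed
    then obtain p where "limitin mtopology (\<lambda>n. \<sigma> (a n)) p sequentially"
      using comp unfolding complete_surface_def mcomplete_def by blast
    then have p: "p \<in> pts M" and plim: "\<And>\<epsilon>. \<epsilon> > 0 \<Longrightarrow> \<exists>N. \<forall>n\<ge>N. surface_dist M (\<sigma> (a n)) p < \<epsilon>"
      unfolding limit_metric_sequentially by blast+
    \<comment> \<open>The projection is Lipschitz, so the limit point \<open>p\<close> supplied by
      completeness lies over \<open>b\<close>.\<close>
    have "a \<longlonglongrightarrow> B (imm M p)"
    proof (rule metric_LIMSEQ_I)
      fix e :: real assume "e > 0"
      then obtain N where N: "\<forall>n\<ge>N. surface_dist M (\<sigma> (a n)) p < e / sqrt \<kappa>" using plim[of "e / sqrt \<kappa>"] \<kappa> by auto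
      have "dist (a n) (B (imm M p)) < e" if "n \<ge> N" for n
      proof -
        have "norm (B (imm M p) - B (imm M (\<sigma> (a n)))) \<le> sqrt \<kappa> * surface_dist M (\<sigma> (a n)) p"
          by (rule surface_dist_lower[OF M fc inM(1)[OF a] p])
        also have "\<dots> < sqrt \<kappa> * (e / sqrt \<kappa>)" using N that \<kappa> by (intro mult_strict_left_mono) auto
        finally show ?thesis using \<kappa> inM(2)[OF a] by (simp add: dist_norm norm_minus_commute)
      qed
      then show "\<exists>N. \<forall>n\<ge>N. dist (a n) (B (imm M p)) < e" by blast
    qed
    with lim have Bp: "B (imm M p) = b" using LIMSEQ_unique by blast
    obtain U \<epsilon> \<tau> where U: "\<epsilon> > 0" "inj_on (\<lambda>p. B (imm M p)) U"
      and \<tau>: "continuous_map (top_of_set (ball (B (imm M p)) \<epsilon>)) (points M) \<tau>"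
      "\<And>z. z \<in> ball (B (imm M p)) \<epsilon> \<Longrightarrow> \<tau> z \<in> U \<and> B (imm M (\<tau> z)) = z"
      and stay: "\<And>q. surface_einf M p q < ennreal (\<epsilon> / sqrt \<kappa>) \<Longrightarrow> q \<in> U"
      using einf_local[OF M fc p] by metis
    obtain N1 where N1: "\<forall>n\<ge>N1. surface_dist M (\<sigma> (a n)) p < \<epsilon> / sqrt \<kappa>" using plim[of "\<epsilon> / sqrt \<kappa>"] U(1) \<kappa> by auto
    obtain N2 where N2: "\<forall>n\<ge>N2. dist (a n) b < \<epsilon>" using lim U(1) unfolding lim_sequentially by blast
    let ?n = "max N1 N2"
    \<comment> \<open>A late point of the lifted radius is close enough to \<open>p\<close> to lie
      in the injective neighbourhood \<open>U\<close>; hence \<open>\<sigma>\<close> and the local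
      section \<open>\<tau>\<close> agree there.\<close>
    have "surface_einf M p (\<sigma> (a ?n)) < ennreal (\<epsilon> / sqrt \<kappa>)"
      using N1 ennreal_surface_dist[OF M fc p inM(1)[OF a]] commute[of p] U(1) \<kappa>
      by (metis ennreal_lessI divide_pos_pos max.cobounded1 real_sqrt_gt_0_iff)
    then have "\<sigma> (a ?n) \<in> U" by (rule stay)
    moreover have ab: "a ?n \<in> ball b \<epsilon>" using N2 by (simp add: dist_commute)
    ultimately have "\<tau> (a ?n) = \<sigma> (a ?n)"
      using \<tau>(2)[of "a ?n"] inM(2)[OF a] U(2) unfolding Bp by (metis inj_onD)
    moreover have "flat_section (ball b \<epsilon>) \<tau>" using \<tau> unfolding flat_section_def Bp by blast
    ultimately show ?thesis using U(1) ab a by blast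
  qed
  then obtain E T A where bd: "\<And>b. b \<in> sphere z0 r \<Longrightarrow> E b > 0 \<and> flat_section (ball b (E b)) (T b)
      \<and> A b \<in> ball b (E b) \<inter> ball z0 r \<and> T b (A b) = \<sigma> (A b)" by metis
  have agree: "T b z = \<sigma> z" if "b \<in> sphere z0 r" "z \<in> ball b (E b) \<inter> ball z0 r" for b z
    by (rule flat_section_unique[where T = "ball b (E b) \<inter> ball z0 r" and a = "A b"])
       (use bd[OF that(1)] sec that(2) in \<open>auto intro!: convex_connected convex_Int\<close>)
  \<comment> \<open>Two disks around boundary points that meet also meet inside the given disk: the
    nearest-point projection onto the closed disk is 1-Lipschitz and fixes the centres, so it moves
    \<open>z\<close> within both disks to a point of the closure of the open one.\<close>
  have agree2: "T b z = T b' z" if b: "b \<in> sphere z0 r" "b' \<in> sphere z0 r" and z: "z \<in> ball b (E b) \<inter> ball b' (E b')" for b b' z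
  proof -
    let ?w = "closest_point (cball z0 r) z"
    have w: "?w \<in> cball z0 r" by (rule closest_point_in_set) (use r in auto)
    have "dist ?w c \<le> dist z c" if "c \<in> sphere z0 r" for c
    proof -
      have "dist (closest_point (cball z0 r) z) (closest_point (cball z0 r) c) \<le> dist z c"
        by (rule closest_point_lipschitz) (use r in auto)
      then show ?thesis using closest_point_self[of c "cball z0 r"] that by simp
    qed
    then have "?w \<in> ball b (E b) \<inter> ball b' (E b')" using b z by (force simp: dist_commute)
    moreover have "?w \<in> closure (ball z0 r)" using w r by simp
    moreover have "open (ball b (E b) \<inter> ball b' (E b'))" by auto
    ultimately have "ball b (E b) \<inter> ball b' (E b') \<inter> ball z0 r \<noteq> {}"
      using open_Int_closure_eq_empty[of "ball b (E b) \<inter> ball b' (E b')" "ball z0 r"] by blast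
    then obtain w' where w': "w' \<in> ball b (E b)" "w' \<in> ball b' (E b')" "w' \<in> ball z0 r" by blast
    show ?thesis
      by (rule flat_section_unique[where T = "ball b (E b) \<inter> ball b' (E b')" and a = w'])
         (use bd[OF b(1)] bd[OF b(2)] z w' agree[OF b(1)] agree[OF b(2)] in \<open>auto intro!: convex_connected convex_Int\<close>)
  qed
  \<comment> \<open>Any choice of the boundary disk gives the same value, by \<open>agree\<close>
    and \<open>agree2\<close>.\<close>
  define \<sigma>' where "\<sigma>' = (\<lambda>z. if z \<in> ball z0 r then \<sigma> z else T (SOME b. b \<in> sphere z0 r \<and> z \<in> ball b (E b)) z)"
  have \<sigma>'T: "\<sigma>' z = T b z" if b: "b \<in> sphere z0 r" and z: "z \<in> ball b (E b)" for b z
  proof (cases "z \<in> ball z0 r")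
    case True
    then show ?thesis using agree[OF b] z by (simp add: \<sigma>'_def)
  next
    case False
    have "(SOME b. b \<in> sphere z0 r \<and> z \<in> ball b (E b)) \<in> sphere z0 r \<and> z \<in> ball (SOME b. b \<in> sphere z0 r \<and> z \<in> ball b (E b)) (E (SOME b. b \<in> sphere z0 r \<and> z \<in> ball b (E b)))"
      by (rule someI[of "\<lambda>b. b \<in> sphere z0 r \<and> z \<in> ball b (E b)" b]) (use b z in blast)
    then show ?thesis using agree2[OF _ b] z False by (simp add: \<sigma>'_def)
  qed
  let ?D = "\<lambda>b. case b of None \<Rightarrow> ball z0 r | Some b \<Rightarrow> ball b (E b)"
  let ?I = "insert None (Some ` sphere z0 r)"
  have sec': "flat_section (\<Union>i\<in>?I. ?D i) \<sigma>'"
  proof (rule flat_section_glue[where s = "\<lambda>b. case b of None \<Rightarrow> \<sigma> | Some b \<Rightarrow> T b"])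
    show "open (?D i)" for i by (cases i) auto
    show "flat_section (?D i) (case i of None \<Rightarrow> \<sigma> | Some b \<Rightarrow> T b)" if "i \<in> ?I" for i
      using that sec bd by auto
    show "\<sigma>' z = (case i of None \<Rightarrow> \<sigma> | Some b \<Rightarrow> T b) z" if "i \<in> ?I" "z \<in> ?D i" for i z
    proof (cases i)
      case None
      then show ?thesis using that by (simp add: \<sigma>'_def)
    next
      case (Some b)
      then have "b \<in> sphere z0 r" "z \<in> ball b (E b)" using that by auto
      then show ?thesis using \<sigma>'T Some by simp
    qed
  qed
  have "cball z0 r \<subseteq> (\<Union>i\<in>?I. ?D i)"
  proof
    fix z assume z: "z \<in> cball z0 r"
    show "z \<in> (\<Union>i\<in>?I. ?D i)"
    proof (cases "z \<in> ball z0 r")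
      case False
      then have "z \<in> sphere z0 r" using z by auto
      then have "Some z \<in> ?I" "z \<in> ?D (Some z)" using bd[of z] by auto
      then show ?thesis by blast
    qed auto
  qed
  have "open (\<Union>i\<in>?I. ?D i)" by (rule open_UN) (auto split: option.split)
  \<comment> \<open>Compactness of the closed disk turns the continuations at single boundary points
    into a uniform gain \<open>\<delta>\<close> of the radius.\<close>
  from compact_subset_open_imp_cball_epsilon_subset[OF compact_cball this \<open>cball z0 r \<subseteq> _\<close>]
  obtain \<delta> where \<delta>: "\<delta> > 0" "(\<Union>x\<in>cball z0 r. cball x \<delta>) \<subseteq> (\<Union>i\<in>?I. ?D i)"
    by blast
  have "ball z0 (r + \<delta>) \<subseteq> (\<Union>x\<in>cball z0 r. cball x \<delta>)"
  proof
    fix z assume z: "z \<in> ball z0 (r + \<delta>)"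
    let ?w = "closest_point (cball z0 r) z"
    show "z \<in> (\<Union>x\<in>cball z0 r. cball x \<delta>)"
    proof (cases "z \<in> cball z0 r")
      case True
      then show ?thesis using \<delta>(1) by (intro UN_I[of z]) auto
    next
      case False
      define w where "w = z0 + (r / dist z0 z) *\<^sub>R (z - z0)"
      have d: "dist z0 z > r" using False by simp
      then have n: "norm (z - z0) = dist z0 z" "dist z0 z > 0" using r by (auto simp: dist_norm norm_minus_commute)
      have "w \<in> cball z0 r" using n r by (simp add: w_def dist_norm)
      moreover have "z - w = (1 - r / dist z0 z) *\<^sub>R (z - z0)" by (simp add: w_def algebra_simps)
      then have "norm (z - w) = (1 - r / dist z0 z) * dist z0 z" using d n by (simp add: abs_of_pos divide_less_eq)
      then have "dist w z = dist z0 z - r" using n by (simp add: dist_norm norm_minus_commute left_diff_distrib)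
      then have "z \<in> cball w \<delta>" using z by simp
      ultimately show ?thesis by blast
    qed
  qed
  then have "flat_section (ball z0 (r + \<delta>)) \<sigma>'" by (rule flat_section_subset[OF sec' order_trans[OF _ \<delta>(2)]])
  moreover have "\<sigma>' z0 = \<sigma> z0" using r by (simp add: \<sigma>'_def)
  ultimately show ?thesis using that[of "r + \<delta>" \<sigma>'] \<delta>(1) by simp
qed

section \<open>Global sections and bijectivity\<close>

text \<open>Sections over concentric disks with the same value at the centre agree, so they glue
  over the union of all admissible disks. If the radii were bounded, the glued section would extend
  beyond their supremum.\<close>

lemma flat_section_global:
  assumes comp: "complete_surface M" and p0: "p0 \<in> pts M"
  obtains \<sigma> where "flat_section UNIV \<sigma>" "\<sigma> (B (imm M p0)) = p0"
proof -
  let ?z0 = "B (imm M p0)"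
  define R where "R = {r. r > 0 \<and> (\<exists>\<sigma>. flat_section (ball ?z0 r) \<sigma> \<and> \<sigma> ?z0 = p0)}"
  obtain s where s: "\<And>r. r \<in> R \<Longrightarrow> flat_section (ball ?z0 r) (s r) \<and> s r ?z0 = p0"
  proof -
    have "\<forall>r\<in>R. \<exists>\<sigma>. flat_section (ball ?z0 r) \<sigma> \<and> \<sigma> ?z0 = p0" by (simp add: R_def)
    from bchoice[OF this] show ?thesis using that by blast
  qed
  have glue: "\<exists>\<sigma>. flat_section (\<Union>r\<in>Q. ball ?z0 r) \<sigma> \<and> \<sigma> ?z0 = p0" if Q: "Q \<subseteq> R" "Q \<noteq> {}" for Q
  proof -
    define \<sigma> where "\<sigma> = (\<lambda>z. s (SOME r. r \<in> Q \<and> z \<in> ball ?z0 r) z)"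
    have eq: "\<sigma> z = s r z" if "r \<in> Q" "z \<in> ball ?z0 r" for r z
    proof -
      let ?r' = "SOME r. r \<in> Q \<and> z \<in> ball ?z0 r"
      have r': "?r' \<in> Q \<and> z \<in> ball ?z0 ?r'" by (rule someI[of _ r]) (use that in blast)
      show ?thesis unfolding \<sigma>_def
      proof (rule flat_section_unique[where T = "ball ?z0 ?r' \<inter> ball ?z0 r" and a = ?z0 and z = z
            and ?\<sigma>1.0 = "s ?r'" and ?\<sigma>2.0 = "s r" and D = "ball ?z0 ?r'" and D' = "ball ?z0 r"])
        show "flat_section (ball ?z0 ?r') (s ?r')" "flat_section (ball ?z0 r) (s r)" "s ?r' ?z0 = s r ?z0"
          using s Q(1) r' that(1) by (auto simp: subset_iff)
        show "?z0 \<in> ball ?z0 ?r' \<inter> ball ?z0 r" using r' that Q(1) by (auto simp: R_def)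
      qed (use that r' in \<open>auto intro!: convex_connected convex_Int\<close>)
    qed
    have "flat_section (\<Union>r\<in>Q. ball ?z0 r) \<sigma>"
      by (rule flat_section_glue[where s = s]) (use s Q(1) eq in auto)
    moreover obtain r where "r \<in> Q" using Q(2) by blast
    then have rR: "r \<in> R" using Q(1) by blast
    then have "r > 0" by (simp add: R_def)
    then have "\<sigma> ?z0 = p0" using eq[OF \<open>r \<in> Q\<close>, of ?z0] s[OF rR] by simp
    ultimately show ?thesis by blast
  qed
  have ne: "R \<noteq> {}"
  proof -
    obtain U \<epsilon> \<sigma> where "\<epsilon> > 0" "continuous_map (top_of_set (ball ?z0 \<epsilon>)) (points M) \<sigma>"
      "\<And>z. z \<in> ball ?z0 \<epsilon> \<Longrightarrow> \<sigma> z \<in> U \<and> B (imm M (\<sigma> z)) = z" "\<sigma> ?z0 = p0"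
      using einf_local[OF M fc p0] by metis
    then have "\<epsilon> \<in> R" unfolding R_def flat_section_def by blast
    then show ?thesis by blast
  qed
  have nbdd: "\<not> bdd_above R"
  proof
    assume bdd: "bdd_above R"
    have "(\<Union>r\<in>R. ball ?z0 r) = ball ?z0 (Sup R)"
    proof
      show "(\<Union>r\<in>R. ball ?z0 r) \<subseteq> ball ?z0 (Sup R)" using cSup_upper[OF _ bdd] by fastforce
      show "ball ?z0 (Sup R) \<subseteq> (\<Union>r\<in>R. ball ?z0 r)"
      proof
        fix z assume "z \<in> ball ?z0 (Sup R)"
        then obtain r where "r \<in> R" "dist ?z0 z < r" using less_cSup_iff[OF ne bdd] by auto
        then show "z \<in> (\<Union>r\<in>R. ball ?z0 r)" by auto
      qed
    qed
    then obtain \<sigma> where \<sigma>: "flat_section (ball ?z0 (Sup R)) \<sigma>" "\<sigma> ?z0 = p0" using glue[OF subset_refl ne] by metis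
    obtain r where "r \<in> R" using ne by blast
    then have "Sup R > 0" using cSup_upper[OF _ bdd, of r] by (auto simp: R_def)
    then obtain r' \<sigma>' where "r' > Sup R" "flat_section (ball ?z0 r') \<sigma>'" "\<sigma>' ?z0 = p0"
      using flat_section_extend[OF comp _ \<sigma>(1)] \<sigma>(2) by metis
    then have "r' \<in> R" using \<open>Sup R > 0\<close> by (auto simp: R_def)
    then show False using cSup_upper[OF _ bdd] \<open>r' > Sup R\<close> by fastforce
  qed
  have "(\<Union>r\<in>R. ball ?z0 r) = UNIV"
  proof -
    have "z \<in> (\<Union>r\<in>R. ball ?z0 r)" for z
    proof -
      obtain r where "r \<in> R" "r > dist ?z0 z" using nbdd unfolding bdd_above_def by (meson not_le)
      then show ?thesis by auto
    qed
    then show ?thesis by blast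
  qed
  then show ?thesis using glue[OF subset_refl ne] that by metis
qed

text \<open>The points fixed by projecting and lifting back with the global section form an open and
  closed set, so the section is inverse to the projection.\<close>

lemma complete_imp_bij:
  assumes comp: "complete_surface M"
  shows "bij_betw (\<lambda>p. B (imm M p)) (pts M) UNIV"
proof -
  obtain p0 where p0: "p0 \<in> pts M" using surface_nonempty[OF M] by blast
  obtain \<sigma> where sec: "flat_section UNIV \<sigma>" and \<sigma>0: "\<sigma> (B (imm M p0)) = p0" by (rule flat_section_global[OF comp p0])
  have \<sigma>: "continuous_map euclidean (points M) \<sigma>" "B (imm M (\<sigma> z)) = z" for z
    using sec by (auto simp: flat_section_def)
  have \<sigma>M: "\<sigma> z \<in> pts M" for z using \<sigma>(1) by (auto simp: continuous_map_def)
  have c: "continuous_map (points M) (points M) (\<lambda>p. \<sigma> (B (imm M p)))"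
    using continuous_map_compose[OF flat_map_continuous[OF M fc] \<sigma>(1)] by (simp add: o_def)
  define E where "E = {p \<in> pts M. \<sigma> (B (imm M p)) = p}"
  have "closedin (points M) E"
    using closedin_continuous_maps_eq[OF surface_hausdorff[OF M] c continuous_map_id] by (simp add: E_def)
  moreover have "openin (points M) E"
  proof (subst openin_subopen, intro ballI)
    fix p assume p: "p \<in> E"
    then have "p \<in> pts M" by (simp add: E_def)
    then obtain U where U: "openin (points M) U" "p \<in> U" "inj_on (\<lambda>p. B (imm M p)) U" using einf_local[OF M fc] by metis
    let ?W = "U \<inter> {q \<in> topspace (points M). \<sigma> (B (imm M q)) \<in> U}"
    have "openin (points M) ?W" using openin_continuous_map_preimage[OF c U(1)] U(1) by blast
    moreover have "p \<in> ?W" using p U(2) by (auto simp: E_def)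
    moreover have "?W \<subseteq> E" using U(3) \<sigma>(2) by (auto simp: E_def inj_on_def)
    ultimately show "\<exists>T. openin (points M) T \<and> p \<in> T \<and> T \<subseteq> E" by blast
  qed
  moreover have "p0 \<in> E" using p0 \<sigma>0 by (simp add: E_def)
  ultimately have "E = pts M" using surface_connected[OF M] by (auto simp: connected_space_clopen_in)
  then show ?thesis
    by (intro bij_betw_byWitness[where f' = \<sigma>]) (use \<sigma>(2) \<sigma>M in \<open>auto simp: E_def\<close>)
qed

text \<open>Only the continuity of the inverse is at stake; near each point it coincides with a
  continuous local section, since the projection is injective.\<close>

lemma bij_section:
  assumes bij: "bij_betw (\<lambda>p. B (imm M p)) (pts M) UNIV"
  shows "flat_section UNIV (inv_into (pts M) (\<lambda>p. B (imm M p)))"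
proof -
  let ?\<sigma> = "inv_into (pts M) (\<lambda>p. B (imm M p))"
  have \<sigma>: "?\<sigma> z \<in> pts M" "B (imm M (?\<sigma> z)) = z" for z
    using bij inv_into_into[of z "\<lambda>p. B (imm M p)" "pts M"] f_inv_into_f[of z "\<lambda>p. B (imm M p)" "pts M"]
    by (auto simp: bij_betw_def)
  have \<sigma>i: "?\<sigma> (B (imm M p)) = p" if "p \<in> pts M" for p
    by (rule inv_into_f_f[OF bij_betw_imp_inj_on[OF bij] that])
  have loc: "\<exists>\<epsilon>>0. flat_section (ball z \<epsilon>) ?\<sigma>" for z
  proof -
    obtain U \<epsilon> \<tau> where U: "openin (points M) U" "\<epsilon> > 0" and \<tau>: "continuous_map (top_of_set (ball (B (imm M (?\<sigma> z))) \<epsilon>)) (points M) \<tau>"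
      "\<And>y. y \<in> ball (B (imm M (?\<sigma> z))) \<epsilon> \<Longrightarrow> \<tau> y \<in> U \<and> B (imm M (\<tau> y)) = y"
      using einf_local[OF M fc \<sigma>(1)[of z]] by metis
    have "\<tau> y = ?\<sigma> y" if "y \<in> ball z \<epsilon>" for y
      using \<tau>(2)[of y] that openin_subset[OF U(1)] \<sigma>i[of "\<tau> y"] unfolding \<sigma> by auto
    then have "continuous_map (top_of_set (ball z \<epsilon>)) (points M) ?\<sigma>"
      using \<tau>(1) unfolding \<sigma> by (auto intro: continuous_map_eq)
    then show ?thesis using U(2) \<sigma> by (auto simp: flat_section_def)
  qed
  then obtain e where e: "\<And>z. e z > 0 \<and> flat_section (ball z (e z)) ?\<sigma>" by metis
  have "flat_section (\<Union>z\<in>UNIV. ball z (e z)) ?\<sigma>"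
    by (rule flat_section_glue[where s = "\<lambda>_. ?\<sigma>"]) (use e in auto)
  moreover have "(\<Union>z\<in>UNIV. ball z (e z)) = UNIV" using e by force
  ultimately show ?thesis by simp
qed

text \<open>With a global section the projection is bi-Lipschitz, because any two points of the
  plane are joined by a segment. Completeness is then inherited from the plane.\<close>

lemma bij_imp_complete:
  assumes bij: "bij_betw (\<lambda>p. B (imm M p)) (pts M) UNIV"
  shows "complete_surface M"
proof -
  interpret Metric_space "pts M" "surface_dist M" by (rule surface_metric[OF M fc])
  let ?\<sigma> = "inv_into (pts M) (\<lambda>p. B (imm M p))"
  have \<kappa>: "\<kappa> > 0" by (rule \<kappa>_pos[OF M fc])
  have sec: "continuous_map (top_of_set UNIV) (points M) ?\<sigma>" "\<And>z. z \<in> UNIV \<Longrightarrow> B (imm M (?\<sigma> z)) = z"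
    using bij_section[OF bij] unfolding flat_section_def by auto
  have \<sigma>M: "?\<sigma> z \<in> pts M" for z using sec(1) by (auto simp: continuous_map_def)
  have \<sigma>i: "?\<sigma> (B (imm M p)) = p" if "p \<in> pts M" for p
    by (rule inv_into_f_f[OF bij_betw_imp_inj_on[OF bij] that])
  show ?thesis unfolding complete_surface_def mcomplete_def
  proof (intro allI impI)
    fix p :: "nat \<Rightarrow> 'a" assume "MCauchy p"
    then have pM: "p n \<in> pts M" and ca: "\<And>\<epsilon>. \<epsilon> > 0 \<Longrightarrow> \<exists>N. \<forall>n n'. N \<le> n \<longrightarrow> N \<le> n' \<longrightarrow> surface_dist M (p n) (p n') < \<epsilon>" for n
      by (auto simp: MCauchy_def)
    have "Cauchy (\<lambda>n. B (imm M (p n)))"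
    proof (rule metric_CauchyI)
      fix e :: real assume "e > 0"
      then obtain N where N: "\<forall>n n'. N \<le> n \<longrightarrow> N \<le> n' \<longrightarrow> surface_dist M (p n) (p n') < e / sqrt \<kappa>" using ca[of "e / sqrt \<kappa>"] \<kappa> by auto
      have "dist (B (imm M (p m))) (B (imm M (p n))) < e" if "m \<ge> N" "n \<ge> N" for m n
      proof -
        have "norm (B (imm M (p n)) - B (imm M (p m))) \<le> sqrt \<kappa> * surface_dist M (p m) (p n)"
          by (rule surface_dist_lower[OF M fc pM pM])
        also have "\<dots> < sqrt \<kappa> * (e / sqrt \<kappa>)" using N that \<kappa> by (intro mult_strict_left_mono) auto
        finally show ?thesis using \<kappa> by (simp add: dist_norm norm_minus_commute)
      qed
      then show "\<exists>N. \<forall>m\<ge>N. \<forall>n\<ge>N. dist (B (imm M (p m))) (B (imm M (p n))) < e" by blast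
    qed
    then obtain z where z: "(\<lambda>n. B (imm M (p n))) \<longlonglongrightarrow> z" using Cauchy_convergent convergent_def by blast
    have "limitin mtopology p (?\<sigma> z) sequentially"
      unfolding limit_metric_sequentially
    proof (intro conjI allI impI \<sigma>M)
      fix e :: real assume "e > 0"
      then obtain N where N: "\<forall>n\<ge>N. dist (B (imm M (p n))) z < e / sqrt \<kappa>"
        using z \<kappa> unfolding lim_sequentially by (metis divide_pos_pos real_sqrt_gt_0_iff)
      have "surface_dist M (p n) (?\<sigma> z) < e" if "n \<ge> N" for n
      proof -
        have "surface_dist M (?\<sigma> (B (imm M (p n)))) (?\<sigma> z) \<le> sqrt \<kappa> * norm (z - B (imm M (p n)))"
          by (rule surface_dist_section[OF M fc sec]) auto
        also have "\<dots> < sqrt \<kappa> * (e / sqrt \<kappa>)"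
          using N that \<kappa> by (intro mult_strict_left_mono) (auto simp: dist_norm norm_minus_commute)
        finally show ?thesis using \<kappa> \<sigma>i[OF pM] by simp
      qed
      then show "\<exists>N. \<forall>n\<ge>N. p n \<in> pts M \<and> surface_dist M (p n) (?\<sigma> z) < e" using pM by blast
    qed
    then show "\<exists>x. limitin mtopology p x sequentially" by blast
  qed
qed

end

section \<open>Graphs\<close>

lemma surface_graph_simps [simp]:
  "points (graph_surface F) = euclidean" "atlas (graph_surface F) = {(UNIV, \<lambda>p. p)}" "imm (graph_surface F) = graph_map F"
  by (simp_all add: graph_surface_def)

lemma param_graph [simp]: "param (graph_surface F) (UNIV, \<lambda>p. p) = graph_map F"
  by (auto simp: param_def fun_eq_iff inv_into_def)

lemma graph_spacelikeI:
  assumes reg: "regular_on (graph_map F) UNIV"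
  shows "spacelike_surface (graph_surface F)"
proof -
  have ch: "is_chart euclidean (UNIV :: (real^2) set, \<lambda>p. p)"
    by (simp add: is_chart_def homeomorphic_map_def) (simp add: quotient_map_def)
  have tr: "transition (UNIV, \<lambda>p. p) (UNIV, \<lambda>p. p) = (\<lambda>p. p :: real^2)"
    by (auto simp: transition_def)
  have "det (matrix (frechet_derivative (\<lambda>p::real^2. p) (at q))) > 0" for q
    by (simp only: det_frechet_derivative[OF differentiable_ident] jac_id zero_less_one)
  then have "compatible (UNIV, \<lambda>p. p) (UNIV, \<lambda>p. p :: real^2)"
    unfolding compatible_def tr by (simp add: smooth_on_ident del: frechet_derivative_ident)
  with ch have at: "oriented_atlas euclidean {(UNIV :: (real^2) set, \<lambda>p. p)}"
    by (simp add: oriented_atlas_def)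
  have fd: "frechet_derivative (graph_map F) (at q) v = v$1 *\<^sub>R pd 1 (graph_map F) q + v$2 *\<^sub>R pd 2 (graph_map F) q" for q v
    using frechet_derivative_pd[OF reg_diff(1)[OF reg, of q]] by simp
  have pos: "mink (frechet_derivative (graph_map F) (at q) v) (frechet_derivative (graph_map F) (at q) v) > 0" if "v \<noteq> 0" for q v
    unfolding fd by (rule spacelike_frame_pos[OF reg_frame[OF reg]]) (use that in \<open>auto simp: vec_eq_iff forall_2\<close>)
  have "inj (frechet_derivative (graph_map F) (at q))" for q
  proof -
    have "linear (frechet_derivative (graph_map F) (at q))"
      by (rule linear_frechet_derivative[OF reg_diff(1)[OF reg]]) simp
    moreover have "v = 0" if "frechet_derivative (graph_map F) (at q) v = 0" for v
      using pos[of v q] that by (auto simp: mink_zero_left)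
    ultimately show ?thesis by (simp add: linear_injective_0)
  qed
  moreover have "connected_space (euclidean :: (real^2) topology)"
    using connected_UNIV[where 'a = "real^2"] connectedin_topspace[of "euclidean :: (real^2) topology"] by (simp add: connectedin_iff_connected)
  moreover have "second_countable (euclidean :: (real^2) topology)"
  proof -
    obtain \<B> :: "(real^2) set set" where \<B>: "countable \<B>" "topological_basis \<B>" using ex_countable_basis by blast
    have "\<exists>V\<in>\<B>. x \<in> V \<and> V \<subseteq> U" if "open U" "x \<in> U" for U x
      using topological_basisE[OF \<B>(2) that] by metis
    then show ?thesis unfolding second_countable_def
      using \<B> topological_basis_open[OF \<B>(2)] by (intro exI[of _ \<B>]) auto
  qed
  ultimately show ?thesis
    using at pos reg_smooth[OF reg] by (simp add: spacelike_surface_def)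
qed

lemma graph_regular:
  assumes "spacelike_surface (graph_surface F)"
  shows "regular_on (graph_map F) UNIV"
  using atlas_regular[OF assms, of "(UNIV, \<lambda>p. p)"] by simp

lemma pr12_graph: "pr12 (graph_map F p) = p"
  by (simp add: pr12_def graph_map_def vector_def vec_eq_iff forall_2)

context
  fixes M :: "'a surface" and L :: "real^4 \<Rightarrow> real^4" and \<kappa> :: real
  assumes M: "spacelike_surface M" and st: "stationary M" and L: "lorentz L"
    and fc: "flat_comparable M (\<lambda>v. pr12 (L v)) \<kappa>"
    and bij: "bij_betw (\<lambda>p. pr12 (L (imm M p))) (pts M) UNIV"
begin

abbreviation (input) sec where "sec \<equiv> inv_into (pts M) (\<lambda>p. pr12 (L (imm M p)))"

lemma sec_in: "sec z \<in> pts M" and flat_sec: "pr12 (L (imm M (sec z))) = z"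
  using bij inv_into_into[of z "\<lambda>p. pr12 (L (imm M p))" "pts M"] f_inv_into_f[of z "\<lambda>p. pr12 (L (imm M p))" "pts M"]
  by (auto simp: bij_betw_def)

lemma sec_flat: "p \<in> pts M \<Longrightarrow> sec (pr12 (L (imm M p))) = p"
  by (rule inv_into_f_f[OF bij_betw_imp_inj_on[OF bij]])

text \<open>In a chart the section is the inverse of a smooth map with nonvanishing Jacobian, so
  \<open>smooth_on_inverse_map\<close> applies to the whole chart at once.\<close>

lemma sec_chart:
  assumes d: "d \<in> atlas M"
  shows "open {z. sec z \<in> fst d}" "smooth_on (\<lambda>z. snd d (sec z)) {z. sec z \<in> fst d}"
    "sec z \<in> fst d \<Longrightarrow> jac (\<lambda>z. snd d (sec z)) z \<noteq> 0"
proof -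
  let ?f = "\<lambda>q. pr12 (L (param M d q))"
  have inv: "snd d (sec (?f q)) = q" if "q \<in> chart_image d" for q
    using sec_flat[of "chart_inv d q"] chart_inv_in[OF that] atlas_subset[OF M d] by (auto simp: param_def)
  have set: "{z. sec z \<in> fst d} = ?f ` chart_image d"
  proof
    show "{z. sec z \<in> fst d} \<subseteq> ?f ` chart_image d"
    proof
      fix z assume "z \<in> {z. sec z \<in> fst d}"
      then have "?f (snd d (sec z)) = z" "snd d (sec z) \<in> chart_image d"
        using atlas_inv_left[OF M d, of "sec z"] flat_sec[of z] by (auto simp: param_def)
      then show "z \<in> ?f ` chart_image d" by (metis imageI)
    qed
    show "?f ` chart_image d \<subseteq> {z. sec z \<in> fst d}"
    proof (rule image_subsetI)
      fix q assume q: "q \<in> chart_image d"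
      then have "chart_inv d q \<in> pts M" by (intro subsetD[OF atlas_subset[OF M d]] chart_inv_in(1))
      then have "sec (?f q) = chart_inv d q" using sec_flat by (simp add: param_def)
      then show "?f q \<in> {z. sec z \<in> fst d}" using chart_inv_in(1)[OF q] by simp
    qed
  qed
  note im = smooth_on_inverse_map[where \<tau> = ?f and \<sigma> = "\<lambda>z. snd d (sec z)",
      OF atlas_open[OF M d] flat_chart(1)[OF M fc d] inv flat_chart(3)[OF M fc d]]
  show o: "open {z. sec z \<in> fst d}" and s: "smooth_on (\<lambda>z. snd d (sec z)) {z. sec z \<in> fst d}"
    unfolding set by (rule im; assumption)+
  assume z: "sec z \<in> fst d"
  then have q: "snd d (sec z) \<in> chart_image d" and fz: "?f (snd d (sec z)) = z"
    using atlas_inv_left[OF M d, of "sec z"] flat_sec[of z] by (auto simp: param_def)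
  have "jac (\<lambda>z. snd d (sec z)) (?f (snd d (sec z))) * jac ?f (snd d (sec z)) = 1"
    by (rule jac_inverse[where \<tau> = ?f and \<sigma> = "\<lambda>z. snd d (sec z)", OF atlas_open[OF M d] q inv
          smooth_on_differentiable[OF atlas_open[OF M d] flat_chart(1)[OF M fc d] q]])
       (use smooth_on_differentiable[OF o s] z fz in auto)
  then show "jac (\<lambda>z. snd d (sec z)) z \<noteq> 0" unfolding fz by auto
qed

text \<open>\<open>F\<close> consists of the last two coordinates of \<open>L\<close> applied to the
  section, so the graph map is the surface moved by \<open>L\<close> and reparametrised by its
  projection. Regularity and vanishing mean curvature pass through both operations.\<close>

lemma bij_imp_congruent_graph:
  "\<exists>F. spacelike_surface (graph_surface F) \<and> stationary (graph_surface F) \<and> congruent_surfaces M (graph_surface F)"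
proof -
  define F where "F = (\<lambda>z. vector [L (imm M (sec z)) $ 3, L (imm M (sec z)) $ 4] :: real^2)"
  have G: "graph_map F z = L (imm M (sec z))" for z
    using flat_sec[of z] by (simp add: graph_map_def F_def pr12_def vec_eq_iff forall_4 forall_2 vector_def)
  have loc: "\<exists>S. z \<in> S \<and> regular_on (graph_map F) S \<and> mean_curvature (graph_map F) z = 0" for z
  proof -
    obtain d where d: "d \<in> atlas M" "sec z \<in> fst d" using atlas_cover[OF M sec_in] by blast
    let ?S = "{z. sec z \<in> fst d}" and ?\<tau> = "\<lambda>z. snd d (sec z)"
    note reg = atlas_regular[OF M d(1)]
    have lin: "linear L" and m: "\<And>u v. mink (L u) (L v) = mink u v" using L by (auto simp: lorentz_def)
    \<comment> \<open>The summand 0 is the translation part expected by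
      \<open>isometry_regular\<close>.\<close>
    define Y where "Y = (\<lambda>q. L (param M d q) + 0)"
    note iso = isometry_regular[OF reg lin m Y_def]
    have img: "?\<tau> ` ?S \<subseteq> chart_image d" by auto
    have XY: "graph_map F w = Y (?\<tau> w)" if "w \<in> ?S" for w
      using atlas_inv_left[OF M d(1), of "sec w"] that by (simp add: G Y_def param_def)
    have J: "jac ?\<tau> w \<noteq> 0" if "w \<in> ?S" for w using sec_chart(3)[OF d(1)] that by simp
    have "regular_on (graph_map F) ?S"
      by (rule reparam_regular[OF iso(1) sec_chart(1,2)[OF d(1)] img XY J])
    moreover have "mean_curvature (graph_map F) z = 0"
    proof (rule reparam_mean_curvature[OF iso(1) sec_chart(1,2)[OF d(1)] img XY J])
      have "?\<tau> z \<in> chart_image d" using d(2) by blast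
      then show "mean_curvature Y (?\<tau> z) = 0"
        using iso(3) st d(1) unfolding stationary_def by blast
    qed (use d(2) in auto)
    ultimately show ?thesis using d(2) by (intro exI[of _ ?S]) simp
  qed
  have "smooth_on (graph_map F) UNIV"
    by (rule smooth_on_local) (use loc in \<open>auto simp: regular_on_def\<close>)
  moreover have "spacelike_frame (pd 1 (graph_map F) z) (pd 2 (graph_map F) z)" for z
    using loc[of z] by (auto simp: regular_on_def)
  ultimately have regG: "regular_on (graph_map F) UNIV" by (simp add: regular_on_def)
  have sp: "spacelike_surface (graph_surface F)" by (rule graph_spacelikeI[OF regG])
  have stG: "stationary (graph_surface F)" using loc by (auto simp: stationary_def)
  define f where "f = (\<lambda>p. pr12 (L (imm M p)))"
  have "diffeomorphism M (graph_surface F) f"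
    unfolding diffeomorphism_def
  proof (intro conjI)
    show "bij_betw f (pts M) (pts (graph_surface F))" using bij by (simp add: f_def)
    show "smooth_map M (graph_surface F) f" unfolding smooth_map_def
    proof (intro conjI ballI)
      show "continuous_map (points M) (points (graph_surface F)) f"
        using flat_map_continuous[OF M fc] by (simp add: f_def)
      fix c d assume c: "c \<in> atlas M" and "d \<in> atlas (graph_surface F)"
      then have d: "d = (UNIV, \<lambda>p. p)" by simp
      show "smooth_on (snd d \<circ> f \<circ> chart_inv c) (snd c ` {p \<in> fst c. f p \<in> fst d})"
        using flat_chart(1)[OF M fc c] by (simp add: d f_def o_def param_def)
    qed
    show "smooth_map (graph_surface F) M (inv_into (pts M) f)" unfolding smooth_map_def
    proof (intro conjI ballI)
      show "continuous_map (points (graph_surface F)) (points M) (inv_into (pts M) f)"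
        using bij_section[OF M fc bij] by (simp add: flat_section_def[OF M fc] f_def)
      fix c d assume d: "d \<in> atlas M" and "c \<in> atlas (graph_surface F)"
      then have c: "c = (UNIV, \<lambda>p. p)" by simp
      show "smooth_on (snd d \<circ> inv_into (pts M) f \<circ> chart_inv c) (snd c ` {p \<in> fst c. inv_into (pts M) f p \<in> fst d})"
        using sec_chart(2)[OF d] by (simp add: c f_def o_def)
    qed
  qed
  moreover have "\<forall>p\<in>pts M. imm (graph_surface F) (f p) = L (imm M p)"
    by (simp add: G f_def sec_flat)
  ultimately have "congruent_surfaces M (graph_surface F)"
    unfolding congruent_surfaces_def using lorentz_mink_isometry[OF L] by blast
  then show ?thesis using sp stG by blast
qed

end

section \<open>A theorem of Joergens\<close>

definition cplx2 :: "complex \<Rightarrow> real^2" where "cplx2 z = vector [Re z, Im z]"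

lemma bounded_linear_cplx2: "bounded_linear cplx2"
proof -
  have "linear cplx2" by (simp add: linear_iff cplx2_def vec_eq_iff forall_2)
  then show ?thesis by (simp add: linear_conv_bounded_linear)
qed

text \<open>Read \<open>(r, s, t)\<close> as the Hessian of a solution of the Monge-Ampere equation with right-hand side 1.
  The Lewy map \<open>H = id + gradient\<close> is expanding, hence a diffeomorphism of the plane, and in the
  coordinates given by \<open>H\<close> the conjugate of \<open>id - gradient\<close> is entire with derivative of modulus less than 1.\<close>

lemma joergens:
  fixes r s t :: "real^2 \<Rightarrow> real"
  assumes sm: "smooth_on r UNIV" "smooth_on s UNIV" "smooth_on t UNIV"
    and cl: "\<And>q. pd 2 r q = pd 1 s q" "\<And>q. pd 2 s q = pd 1 t q"
    and pos: "\<And>q. r q > 0" and det: "\<And>q. r q * t q - s q * s q = 1"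
  shows "r p = r q" "s p = s q"
proof -
  \<comment> \<open>The pair \<open>(a, b)\<close> plays the role of the gradient; \<open>cl\<close>
    says that \<open>(r, s)\<close> and \<open>(s, t)\<close> are closed.\<close>
  obtain a where a: "\<And>q. (a has_derivative (\<lambda>v. r q * v$1 + s q * v$2)) (at q)" and sa: "smooth_on a UNIV"
    using poincare_lemma[of UNIV 0 r s] sm cl by auto
  obtain b where b: "\<And>q. (b has_derivative (\<lambda>v. s q * v$1 + t q * v$2)) (at q)" and sb: "smooth_on b UNIV"
    using poincare_lemma[of UNIV 0 s t] sm cl by auto
  have tpos: "t q > 0" for q
  proof -
    have "r q * t q = 1 + s q * s q" using det[of q] by simp
    then have "r q * t q > 0" by (simp add: add_pos_nonneg)
    then show ?thesis using pos[of q] by (simp add: zero_less_mult_iff)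
  qed
  have quad: "r q * x * x + 2 * (s q * x * y) + t q * y * y \<ge> 0" for q x y
  proof -
    have "r q * (r q * x * x + 2 * (s q * x * y) + t q * y * y) = (r q * x + s q * y)\<^sup>2 + (r q * t q - s q * s q) * y\<^sup>2"
      by algebra
    also have "\<dots> \<ge> 0" unfolding det by simp
    finally show ?thesis using pos[of q] by (simp add: zero_le_mult_iff)
  qed
  define H where "H = (\<lambda>q. vector [q$1 + a q, q$2 + b q] :: real^2)"
  have sH: "smooth_on H UNIV"
  proof (rule smooth_on_vec[OF open_UNIV])
    fix i :: 2
    have "smooth_on (\<lambda>q. q$1 + a q) UNIV" "smooth_on (\<lambda>q. q$2 + b q) UNIV"
      by (intro smooth_on_add smooth_on_nth smooth_on_ident sa sb open_UNIV)+
    then show "smooth_on (\<lambda>x. H x $ i) UNIV" using exhaust_2[of i] by (auto simp: H_def)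
  qed
  have pda: "pd 1 a q = r q" "pd 2 a q = s q" "pd 1 b q = s q" "pd 2 b q = t q" for q
    using pd_eqI[OF a] pd_eqI[OF b] by (simp_all add: axis_def)
  have dab: "a differentiable at q" "b differentiable at q" for q using a b by (auto simp: differentiable_def)
  have pdH: "pd 1 H q = vector [1 + r q, s q]" "pd 2 H q = vector [s q, 1 + t q]" for q
  proof -
    have d: "H differentiable at q" by (rule smooth_on_differentiable[OF open_UNIV sH UNIV_I])
    have n: "(\<lambda>x::real^2. x $ k) differentiable at q" "pd i (\<lambda>x::real^2. x $ k) q = axis i 1 $ k" for i k
      using bounded_linear_imp_differentiable[OF bounded_linear_vec_nth] pd_linear[OF bounded_linear_vec_nth] by auto
    have "pd i H q $ 1 = pd i (\<lambda>x. x$1 + a x) q" "pd i H q $ 2 = pd i (\<lambda>x. x$2 + b x) q" for i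
      using pd_nth[OF d, of i 1] pd_nth[OF d, of i 2] by (simp_all add: H_def)
    then show "pd 1 H q = vector [1 + r q, s q]" "pd 2 H q = vector [s q, 1 + t q]"
      by (simp_all add: vec_eq_iff forall_2 pd_add n dab pda axis_def)
  qed
  have jacH: "jac H q = 2 + r q + t q" for q
    using det[of q] by (simp add: jac_def pdH algebra_simps)
  have S: "2 + r q + t q > 0" for q using pos[of q] tpos[of q] by simp
  \<comment> \<open>By \<open>quad\<close> the field \<open>(a, b)\<close> is monotone, so adding it
    to the identity cannot shorten distances.\<close>
  have expand: "norm (x - y) \<le> norm (H x - H y)" for x y
  proof -
    define v where "v = x - y"
    define \<phi> where "\<phi> = (\<lambda>\<tau>. a (y + \<tau> *\<^sub>R v) * v$1 + b (y + \<tau> *\<^sub>R v) * v$2)"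
    have d\<phi>: "(\<phi> has_real_derivative (r (y + \<tau> *\<^sub>R v) * v$1 * v$1 + 2 * (s (y + \<tau> *\<^sub>R v) * v$1 * v$2) + t (y + \<tau> *\<^sub>R v) * v$2 * v$2)) (at \<tau>)" for \<tau>
    proof -
      have l: "((\<lambda>\<tau>. y + \<tau> *\<^sub>R v) has_derivative (\<lambda>\<tau>. \<tau> *\<^sub>R v)) (at \<tau>)" by (auto intro!: derivative_eq_intros)
      have "((\<lambda>\<tau>. a (y + \<tau> *\<^sub>R v)) has_real_derivative (r (y + \<tau> *\<^sub>R v) * v$1 + s (y + \<tau> *\<^sub>R v) * v$2)) (at \<tau>)"
        "((\<lambda>\<tau>. b (y + \<tau> *\<^sub>R v)) has_real_derivative (s (y + \<tau> *\<^sub>R v) * v$1 + t (y + \<tau> *\<^sub>R v) * v$2)) (at \<tau>)"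
        unfolding has_field_derivative_def
        by (rule has_derivative_eq_rhs[OF has_derivative_compose[OF l a]] has_derivative_eq_rhs[OF has_derivative_compose[OF l b]];
            simp add: fun_eq_iff algebra_simps)+
      then show ?thesis unfolding \<phi>_def
        by (auto intro!: derivative_eq_intros simp: algebra_simps)
    qed
    have "\<phi> 0 \<le> \<phi> 1"
    proof (rule DERIV_nonneg_imp_nondecreasing[of 0 1 \<phi>])
      show "\<exists>y. (\<phi> has_real_derivative y) (at \<tau>) \<and> 0 \<le> y" for \<tau>
        by (intro exI conjI, rule d\<phi>, rule quad)
    qed simp
    then have "(a x - a y) * v$1 + (b x - b y) * v$2 \<ge> 0" by (simp add: \<phi>_def v_def algebra_simps)
    then have "v \<bullet> v \<le> (H x - H y) \<bullet> v"
      by (simp add: H_def inner_vec_def sum_2 v_def algebra_simps)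
    also have "\<dots> \<le> norm (H x - H y) * norm v" by (rule norm_cauchy_schwarz)
    finally have "norm v * norm v \<le> norm (H x - H y) * norm v" by (simp add: dot_square_norm power2_eq_square)
    then show ?thesis unfolding v_def[symmetric] by (cases "v = 0") (auto simp: mult_le_cancel_right)
  qed
  define G where "G = inv H"
  have inj: "inj H" using expand by (metis injI eq_iff_diff_eq_0 norm_eq_zero norm_le_zero_iff)
  have GH: "G (H q) = q" for q using inj by (simp add: G_def)
  have Jn: "jac H q \<noteq> 0" for q unfolding jacH using S[of q] by simp
  have op: "open (range H)" and sG: "smooth_on G (range H)"
    using smooth_on_inverse_map[OF open_UNIV sH, of G] GH Jn by auto
  \<comment> \<open>Expansion pulls Cauchy sequences back along \<open>H\<close>, so the range is
    closed; being open as well, it is the whole plane.\<close>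
  have "closed (range H)"
    unfolding closed_sequential_limits
  proof (intro allI impI)
    fix f l assume "(\<forall>n. f n \<in> range H) \<and> f \<longlonglongrightarrow> l"
    then have fl: "f \<longlonglongrightarrow> l" and "\<forall>n. \<exists>x. f n = H x" by auto
    from choice[OF this(2)] obtain g where g: "\<And>n. f n = H (g n)" by blast
    have "Cauchy g"
    proof (rule metric_CauchyI)
      fix e :: real assume "e > 0"
      then obtain N where N: "\<forall>m\<ge>N. \<forall>n\<ge>N. dist (f m) (f n) < e"
        using LIMSEQ_imp_Cauchy[OF fl] unfolding Cauchy_def by meson
      have "dist (g m) (g n) < e" if "m \<ge> N" "n \<ge> N" for m n
        using N that expand[of "g m" "g n"] by (fastforce simp: g dist_norm)
      then show "\<exists>N. \<forall>m\<ge>N. \<forall>n\<ge>N. dist (g m) (g n) < e" by blast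
    qed
    then obtain x where "g \<longlonglongrightarrow> x" using Cauchy_convergent convergent_def by blast
    moreover have "isCont H x" using smooth_on_continuous[OF sH] by (simp add: continuous_on_eq_continuous_at)
    ultimately have "(\<lambda>n. H (g n)) \<longlonglongrightarrow> H x" using isCont_tendsto_compose by blast
    then have "f \<longlonglongrightarrow> H x" by (simp add: g[symmetric])
    then show "l \<in> range H" using fl LIMSEQ_unique by blast
  qed
  with op have surj: "range H = UNIV"
    using connected_UNIV[where 'a = "real^2"] unfolding connected_clopen by auto
  have HG: "H (G y) = y" for y using surj by (metis GH rangeE UNIV_I)
  have sG: "smooth_on G UNIV" using sG surj by simp
  \<comment> \<open>\<open>w\<close> is the conjugate of the identity minus the gradient, in the
    coordinates given by \<open>H\<close>, and \<open>m\<close> is its candidate derivative.\<close>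
  define m where "m = (\<lambda>q. Complex ((t q - r q) / (2 + r q + t q)) (2 * s q / (2 + r q + t q)))"
  define w where "w = (\<lambda>z. let q = G (cplx2 z) in Complex (q$1 - a q) (b q - q$2))"
  have dw: "(w has_field_derivative m (G (cplx2 z))) (at z)" for z
  proof -
    define q where "q = G (cplx2 z)"
    have dG: "(G has_derivative (\<lambda>v. v$1 *\<^sub>R pd 1 G (cplx2 z) + v$2 *\<^sub>R pd 2 G (cplx2 z))) (at (cplx2 z))" (is "(_ has_derivative ?D) _")
      by (rule smooth_on_has_derivative[OF open_UNIV sG UNIV_I])
    \<comment> \<open>Cramer's rule for the derivative of \<open>H\<close>. As the Hessian has
      determinant 1, the determinant of the identity plus the Hessian is
      \<open>2 + r q + t q\<close>.\<close>
    have solve: "?D u $ 1 = ((1 + t q) * u$1 - s q * u$2) / (2 + r q + t q)" "?D u $ 2 = ((1 + r q) * u$2 - s q * u$1) / (2 + r q + t q)" for u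
    proof -
      let ?v = "?D u"
      have e: "(1 + t q) * (x * (1 + r q) + y * s q) - s q * (x * s q + y * (1 + t q)) = x * (2 + r q + t q)"
        "(1 + r q) * (x * s q + y * (1 + t q)) - s q * (x * (1 + r q) + y * s q) = y * (2 + r q + t q)" for x y
      proof -
        have "(1 + t q) * (x * (1 + r q) + y * s q) - s q * (x * s q + y * (1 + t q)) = x * (1 + r q + t q + (r q * t q - s q * s q))"
          "(1 + r q) * (x * s q + y * (1 + t q)) - s q * (x * (1 + r q) + y * s q) = y * (1 + r q + t q + (r q * t q - s q * s q))"
          by (simp_all add: algebra_simps)
        then show "(1 + t q) * (x * (1 + r q) + y * s q) - s q * (x * s q + y * (1 + t q)) = x * (2 + r q + t q)"
          "(1 + r q) * (x * s q + y * (1 + t q)) - s q * (x * (1 + r q) + y * s q) = y * (2 + r q + t q)"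
          by (simp_all add: det algebra_simps)
      qed
      have "((\<lambda>y. H (G y)) has_derivative (\<lambda>u. (?D u)$1 *\<^sub>R pd 1 H q + (?D u)$2 *\<^sub>R pd 2 H q)) (at (cplx2 z))"
        using has_derivative_compose[OF dG smooth_on_has_derivative[OF open_UNIV sH UNIV_I]] by (simp add: q_def)
      then have "((\<lambda>y. y) has_derivative (\<lambda>u. (?D u)$1 *\<^sub>R pd 1 H q + (?D u)$2 *\<^sub>R pd 2 H q)) (at (cplx2 z))"
        by (simp add: HG)
      from has_derivative_unique[OF this has_derivative_ident]
      have "?v$1 *\<^sub>R pd 1 H q + ?v$2 *\<^sub>R pd 2 H q = u" by meson
      moreover define v where "v = ?D u"
      ultimately have "v$1 *\<^sub>R pd 1 H q + v$2 *\<^sub>R pd 2 H q = u" by simp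
      then have "v$1 * (1 + r q) + v$2 * s q = u$1" "v$1 * s q + v$2 * (1 + t q) = u$2"
        by (auto simp: pdH vec_eq_iff forall_2)
      then have u: "u$1 = v$1 * (1 + r q) + v$2 * s q" "u$2 = v$1 * s q + v$2 * (1 + t q)" by simp_all
      have "(1 + t q) * u$1 - s q * u$2 = v$1 * (2 + r q + t q)" "(1 + r q) * u$2 - s q * u$1 = v$2 * (2 + r q + t q)"
        unfolding u by (rule e)+
      then have "v$1 = ((1 + t q) * u$1 - s q * u$2) / (2 + r q + t q)" "v$2 = ((1 + r q) * u$2 - s q * u$1) / (2 + r q + t q)"
        using S[of q] by simp_all
      then show "?v$1 = ((1 + t q) * u$1 - s q * u$2) / (2 + r q + t q)" "?v$2 = ((1 + r q) * u$2 - s q * u$1) / (2 + r q + t q)"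
        unfolding v_def .
    qed
    have dc: "((\<lambda>z. G (cplx2 z)) has_derivative (\<lambda>h. ?D (cplx2 h))) (at z)"
      by (rule has_derivative_compose[OF bounded_linear_imp_has_derivative[OF bounded_linear_cplx2] dG])
    have d1: "((\<lambda>z. G (cplx2 z) $ k) has_derivative (\<lambda>h. ?D (cplx2 h) $ k)) (at z)" for k
      by (rule bounded_linear.has_derivative[OF bounded_linear_vec_nth dc])
    have da: "((\<lambda>z. a (G (cplx2 z))) has_derivative (\<lambda>h. r q * ?D (cplx2 h) $ 1 + s q * ?D (cplx2 h) $ 2)) (at z)"
      using has_derivative_compose[OF dc a] by (simp add: q_def)
    have db: "((\<lambda>z. b (G (cplx2 z))) has_derivative (\<lambda>h. s q * ?D (cplx2 h) $ 1 + t q * ?D (cplx2 h) $ 2)) (at z)"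
      using has_derivative_compose[OF dc b] by (simp add: q_def)
    have 1: "((\<lambda>z. of_real (G (cplx2 z) $ 1 - a (G (cplx2 z))) + \<i> * of_real (b (G (cplx2 z)) - G (cplx2 z) $ 2)) has_derivative
        (\<lambda>h. of_real (?D (cplx2 h) $ 1 - (r q * ?D (cplx2 h) $ 1 + s q * ?D (cplx2 h) $ 2))
            + \<i> * of_real ((s q * ?D (cplx2 h) $ 1 + t q * ?D (cplx2 h) $ 2) - ?D (cplx2 h) $ 2))) (at z)"
      by (intro has_derivative_add has_derivative_mult_right has_derivative_of_real has_derivative_diff d1 da db)
    have 2: "of_real (?D (cplx2 h) $ 1 - (r q * ?D (cplx2 h) $ 1 + s q * ?D (cplx2 h) $ 2))
            + \<i> * of_real ((s q * ?D (cplx2 h) $ 1 + t q * ?D (cplx2 h) $ 2) - ?D (cplx2 h) $ 2) = m q * h" for h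
    proof -
      have e: "2 + r q + t q \<noteq> 0" using S[of q] by simp
      have c: "cplx2 h $ 1 = Re h" "cplx2 h $ 2 = Im h" by (simp_all add: cplx2_def)
      define x y where "x = Re h" and "y = Im h"
      define P Q where "P = ?D (cplx2 h) $ 1" and "Q = ?D (cplx2 h) $ 2"
      have dt: "r q * t q - s q * s q = 1" by (rule det)
      have P: "P * (2 + r q + t q) = (1 + t q) * x - s q * y" and Q: "Q * (2 + r q + t q) = (1 + r q) * y - s q * x"
        using solve[of "cplx2 h"] e by (simp_all add: P_def Q_def x_def y_def c)
      have "(P - (r q * P + s q * Q)) * (2 + r q + t q) = P * (2 + r q + t q) - (r q * (P * (2 + r q + t q)) + s q * (Q * (2 + r q + t q)))"
        "((s q * P + t q * Q) - Q) * (2 + r q + t q) = (s q * (P * (2 + r q + t q)) + t q * (Q * (2 + r q + t q))) - Q * (2 + r q + t q)"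
        by (simp_all add: algebra_simps)
      then have n1: "(P - (r q * P + s q * Q)) * (2 + r q + t q) = (t q - r q) * x - 2 * s q * y"
        "((s q * P + t q * Q) - Q) * (2 + r q + t q) = (t q - r q) * y + 2 * s q * x"
        unfolding P Q using dt by algebra+
      have "Re (m q) * (2 + r q + t q) = t q - r q" "Im (m q) * (2 + r q + t q) = 2 * s q" using e by (simp_all add: m_def)
      moreover have "Re (m q * h) * K = (Re (m q) * K) * x - (Im (m q) * K) * y" "Im (m q * h) * K = (Re (m q) * K) * y + (Im (m q) * K) * x" for K
        by (simp_all add: x_def y_def algebra_simps)
      ultimately have "Re (m q * h) * (2 + r q + t q) = (t q - r q) * x - 2 * s q * y" "Im (m q * h) * (2 + r q + t q) = (t q - r q) * y + 2 * s q * x"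
        by simp_all
      with n1 have "(P - (r q * P + s q * Q)) * (2 + r q + t q) = Re (m q * h) * (2 + r q + t q)"
        "((s q * P + t q * Q) - Q) * (2 + r q + t q) = Im (m q * h) * (2 + r q + t q)" by simp_all
      then have "P - (r q * P + s q * Q) = Re (m q * h)" "(s q * P + t q * Q) - Q = Im (m q * h)"
        using e by simp_all
      then show ?thesis by (simp add: complex_eq_iff P_def Q_def)
    qed
    have "w = (\<lambda>z. of_real (G (cplx2 z) $ 1 - a (G (cplx2 z))) + \<i> * of_real (b (G (cplx2 z)) - G (cplx2 z) $ 2))"
      by (auto simp: w_def Let_def complex_eq_iff)
    with 1 show ?thesis unfolding has_field_derivative_def 2 by (simp add: q_def)
  qed
  \<comment> \<open>This identity is used twice: it bounds the derivative of \<open>w\<close> by 1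
    for Liouville's theorem, and it recovers the trace \<open>r + t\<close> once \<open>m\<close> is
    known to be constant.\<close>
  have key: "1 - (cmod (m q))\<^sup>2 = 4 / (2 + r q + t q)" for q
  proof -
    have e: "2 + r q + t q \<noteq> 0" using S[of q] by simp
    have "(2 + r q + t q)\<^sup>2 - (t q - r q)\<^sup>2 - (2 * s q)\<^sup>2 = 4 * (2 + r q + t q)" using det[of q] by algebra
    then show ?thesis using e by (simp add: m_def cmod_power2 power_divide divide_simps) (simp add: power2_eq_square algebra_simps)
  qed
  have hol: "w holomorphic_on UNIV" using dw by (auto simp: holomorphic_on_open)
  have dwm: "deriv w z = m (G (cplx2 z))" for z using dw by (rule DERIV_imp_deriv)
  have "deriv w holomorphic_on UNIV" by (rule holomorphic_deriv[OF hol open_UNIV])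
  moreover have "bounded (range (deriv w))"
  proof (rule boundedI)
    fix x assume "x \<in> range (deriv w)"
    then obtain q where x: "x = m q" by (auto simp: dwm)
    have "4 / (2 + r q + t q) > 0" using S[of q] by simp
    then have "(cmod (m q))\<^sup>2 \<le> 1\<^sup>2" using key[of q] unfolding one_power2 by linarith
    then show "norm x \<le> 1" unfolding x by (rule power2_le_imp_le) simp
  qed
  ultimately have "deriv w constant_on UNIV" by (rule Liouville_theorem)
  then obtain c where c: "\<And>z. m (G (cplx2 z)) = c" by (auto simp: constant_on_def dwm)
  have mc: "m q = c" for q
  proof -
    have "cplx2 (Complex (H q $ 1) (H q $ 2)) = H q" by (simp add: cplx2_def vec_eq_iff forall_2)
    then show ?thesis using c[of "Complex (H q $ 1) (H q $ 2)"] by (simp add: GH)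
  qed
  have Sc: "2 + r p + t p = 2 + r q + t q"
  proof -
    have "4 / (2 + r p + t p) = 4 / (2 + r q + t q)" using key[of p] key[of q] by (simp add: mc)
    then show ?thesis using S[of p] S[of q] by (simp add: frac_eq_eq)
  qed
  have "(t p - r p) / (2 + r q + t q) = (t q - r q) / (2 + r q + t q)" "2 * s p / (2 + r q + t q) = 2 * s q / (2 + r q + t q)"
    using mc[of p] mc[of q] unfolding m_def Sc by (simp_all add: complex_eq_iff)
  then have "t p - r p = t q - r q" "s p = s q" using S[of q] by simp_all
  with Sc show "r p = r q" "s p = s q" by simp_all
qed

section \<open>Entire stationary graphs are degenerate of hyperbolic type\<close>

lemma pd_graph_map:
  assumes "regular_on (graph_map F) UNIV"
  shows "pd 1 (graph_map F) q $ 1 = 1" "pd 1 (graph_map F) q $ 2 = 0" "pd 2 (graph_map F) q $ 1 = 0" "pd 2 (graph_map F) q $ 2 = 1"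
proof -
  have d: "graph_map F differentiable at q" by (rule reg_diff(1)[OF assms UNIV_I])
  have n: "pd i (\<lambda>x::real^2. x $ k) q = axis i 1 $ k" for i k
    by (rule pd_linear[OF bounded_linear_vec_nth])
  have "(\<lambda>x. graph_map F x $ 1) = (\<lambda>x. x $ 1)" "(\<lambda>x. graph_map F x $ 2) = (\<lambda>x. x $ 2)"
    by (simp_all add: graph_map_def vector_def)
  then have "pd i (graph_map F) q $ 1 = axis i 1 $ (1::2)" "pd i (graph_map F) q $ 2 = axis i 1 $ (2::2)" for i
    using pd_nth[OF d, of i 1] pd_nth[OF d, of i 2] n[of i] by simp_all
  then show "pd 1 (graph_map F) q $ 1 = 1" "pd 1 (graph_map F) q $ 2 = 0" "pd 2 (graph_map F) q $ 1 = 0" "pd 2 (graph_map F) q $ 2 = 1"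
    by (simp_all add: axis_def)
qed

lemma stationary_graph_hyperplane:
  assumes reg: "regular_on (graph_map F) UNIV" and H: "\<And>q. mean_curvature (graph_map F) q = 0"
  obtains \<alpha> \<beta> where "Im (\<alpha> * cnj \<beta>) \<noteq> 0"
    "\<And>q. \<alpha> * null_vec (pd 1 (graph_map F) q) (pd 2 (graph_map F) q) $ 1
      + \<beta> * null_vec (pd 1 (graph_map F) q) (pd 2 (graph_map F) q) $ 2 = 0"
proof -
  let ?G = "graph_map F"
  define W where "W = (\<lambda>q. sqrt (gramX ?G q))"
  define g where "g = (\<lambda>i j q. mink (pd i ?G q) (pd j ?G q))"
  have W0: "W q > 0" for q using reg_gram[OF reg, of q] by (simp add: W_def)
  have WW: "W q * W q = g 1 1 q * g 2 2 q - g 1 2 q * g 1 2 q" for q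
    unfolding W_def g_def by (rule sqrt_gram_square[OF reg_frame[OF reg UNIV_I]])
  have sm: "smooth_on (\<lambda>q. g i j q / W q) UNIV" for i j
    unfolding g_def W_def by (rule smooth_metric_quotient[OF reg])
  have cl: "pd 2 (\<lambda>q. g 1 1 q / W q) q = pd 1 (\<lambda>q. g 1 2 q / W q) q \<and> pd 2 (\<lambda>q. g 1 2 q / W q) q = pd 1 (\<lambda>q. g 2 2 q / W q) q" for q
  proof -
    let ?P = "\<lambda>q. (g 2 2 q / W q) *\<^sub>R pd 1 ?G q - (g 1 2 q / W q) *\<^sub>R pd 2 ?G q"
    let ?Q = "\<lambda>q. (g 1 1 q / W q) *\<^sub>R pd 2 ?G q - (g 1 2 q / W q) *\<^sub>R pd 1 ?G q"
    have div: "pd 1 ?P q + pd 2 ?Q q = 0"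
      unfolding g_def W_def by (rule stationary_divergence[OF reg UNIV_I H])
    have sX: "smooth_on (\<lambda>q. (g i j q / W q) *\<^sub>R pd m ?G q) UNIV" for i j m
      by (rule smooth_on_bilinear[OF bounded_bilinear_scaleR open_UNIV sm reg_pd[OF reg]])
    have dP: "?P differentiable at q" and dQ: "?Q differentiable at q"
      using smooth_on_differentiable[OF open_UNIV smooth_on_diff[OF open_UNIV sX sX]] by auto
    have Pk: "(\<lambda>x. ?P x $ 1) = (\<lambda>x. g 2 2 x / W x)" "(\<lambda>x. ?P x $ 2) = (\<lambda>x. - (g 1 2 x / W x))"
      "(\<lambda>x. ?Q x $ 1) = (\<lambda>x. - (g 1 2 x / W x))" "(\<lambda>x. ?Q x $ 2) = (\<lambda>x. g 1 1 x / W x)"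
      by (simp_all add: pd_graph_map[OF reg])
    have m: "pd i (\<lambda>x. - (g 1 2 x / W x)) q = - pd i (\<lambda>x. g 1 2 x / W x) q" for i
      by (rule pd_bounded_linear[OF bounded_linear_minus[OF bounded_linear_ident] smooth_on_differentiable[OF open_UNIV sm UNIV_I]])
    have "(pd 1 ?P q + pd 2 ?Q q) $ 1 = 0" "(pd 1 ?P q + pd 2 ?Q q) $ 2 = 0" unfolding div by simp_all
    then have "pd 1 (\<lambda>x. ?P x $ 1) q + pd 2 (\<lambda>x. ?Q x $ 1) q = 0" "pd 1 (\<lambda>x. ?P x $ 2) q + pd 2 (\<lambda>x. ?Q x $ 2) q = 0"
      unfolding pd_nth[OF dP] pd_nth[OF dQ] by (simp_all only: vector_add_component)
    then show ?thesis unfolding Pk m by simp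
  qed
  have pos: "g 1 1 q / W q > 0" for q
    using reg_frame[OF reg, of q] W0[of q] by (simp add: g_def spacelike_frame_def)
  have det: "g 1 1 q / W q * (g 2 2 q / W q) - g 1 2 q / W q * (g 1 2 q / W q) = 1" for q
  proof -
    have "W q * W q \<noteq> 0" using W0[of q] by simp
    then have "(g 1 1 q * g 2 2 q - g 1 2 q * g 1 2 q) / (W q * W q) = 1" unfolding WW[of q] by (rule divide_self)
    then show ?thesis by (simp add: diff_divide_distrib)
  qed
  define r s where "r = g 1 1 0 / W 0" and "s = g 1 2 0 / W 0"
  have rs: "g 1 1 q / W q = r" "g 1 2 q / W q = s" for q
    unfolding r_def s_def
    using joergens[OF sm sm sm, of 1 1 1 2 2 2 q 0] cl pos det by auto
  have "null_vec (pd 1 ?G q) (pd 2 ?G q) $ 1 = of_real (W q) * Complex 1 s"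
    "null_vec (pd 1 ?G q) (pd 2 ?G q) $ 2 = - (of_real (W q) * (\<i> * of_real r))" for q
    using rs[of q] W0[of q] by (simp_all add: null_vec_def cvec_def pd_graph_map[OF reg] complex_eq_iff g_def W_def field_simps)
  \<comment> \<open>The null vector has first entries \<open>W * (1 + i s)\<close> and
    \<open>- i W r\<close> with constant \<open>r\<close> and \<open>s\<close>; the chosen
    coefficients \<open>i r\<close> and \<open>1 + i s\<close> cancel them, and the required
    imaginary part is \<open>r > 0\<close>.\<close>
  then show ?thesis
    using pos[of 0] by (intro that[of "\<i> * of_real r" "Complex 1 s"]) (simp_all add: rs(1))
qed

section \<open>Surfaces congruent to a graph\<close>

context
  fixes M :: "'a surface" and F :: "real^2 \<Rightarrow> real^2" and L :: "real^4 \<Rightarrow> real^4" and b :: "real^4" and f :: "'a \<Rightarrow> real^2"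
  assumes M: "spacelike_surface M" and N: "spacelike_surface (graph_surface F)" and stN: "stationary (graph_surface F)"
    and L: "lorentz L" and f: "diffeomorphism M (graph_surface F) f"
    and imm: "\<And>p. p \<in> pts M \<Longrightarrow> graph_map F (f p) = L (imm M p) + b"
begin

lemma congruent_chart:
  assumes d: "d \<in> atlas M"
  defines "\<tau> \<equiv> \<lambda>q. f (chart_inv d q)" and "Y \<equiv> \<lambda>q. L (param M d q) + b"
  shows "smooth_on \<tau> (chart_image d)" "regular_on Y (chart_image d)"
    "q \<in> chart_image d \<Longrightarrow> pd i Y q = L (pd i (param M d) q)"
    "q \<in> chart_image d \<Longrightarrow> pd i Y q = (pd i \<tau> q $ 1) *\<^sub>R pd 1 (graph_map F) (\<tau> q) + (pd i \<tau> q $ 2) *\<^sub>R pd 2 (graph_map F) (\<tau> q)"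
    "q \<in> chart_image d \<Longrightarrow> jac \<tau> q \<noteq> 0" "q \<in> chart_image d \<Longrightarrow> mean_curvature (param M d) q = 0"
proof -
  have "smooth_map M (graph_surface F) f" using f by (simp add: diffeomorphism_def)
  then have "\<forall>c\<in>atlas M. \<forall>e\<in>{(UNIV, \<lambda>p. p)}. smooth_on (snd e \<circ> f \<circ> chart_inv c) (snd c ` {p \<in> fst c. f p \<in> fst e})"
    unfolding smooth_map_def surface_graph_simps by (rule conjunct2)
  from bspec[OF this d]
  show sm: "smooth_on \<tau> (chart_image d)" by (simp add: \<tau>_def o_def)
  note reg = atlas_regular[OF M d]
  have lin: "linear L" and m: "\<And>u v. mink (L u) (L v) = mink u v" using L by (auto simp: lorentz_def)
  note iso = isometry_regular[OF reg lin m, of Y b]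
  show regY: "regular_on Y (chart_image d)" by (rule iso(1)) (simp add: Y_def)
  show pdY: "pd i Y q = L (pd i (param M d) q)" if "q \<in> chart_image d" for q i
    by (rule iso(2)[OF _ that]) (simp add: Y_def)
  have regG: "regular_on (graph_map F) UNIV" by (rule graph_regular[OF N])
  have YG: "Y q = graph_map F (\<tau> q)" if "q \<in> chart_image d" for q
    using imm[of "chart_inv d q"] chart_inv_in(1)[OF that] atlas_subset[OF M d] by (auto simp: Y_def \<tau>_def param_def)
  show pdG: "pd i Y q = (pd i \<tau> q $ 1) *\<^sub>R pd 1 (graph_map F) (\<tau> q) + (pd i \<tau> q $ 2) *\<^sub>R pd 2 (graph_map F) (\<tau> q)"
    if "q \<in> chart_image d" for q i
    by (rule reparam_pd[where X = Y and Y = "graph_map F" and \<tau> = \<tau>, OF regG reg_open[OF reg] sm subset_UNIV YG that])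
  \<comment> \<open>A singular Jacobian would make the Gram determinant of the regular
    parametrisation \<open>Y\<close> vanish.\<close>
  show J: "jac \<tau> q \<noteq> 0" if "q \<in> chart_image d" for q
  proof
    assume 0: "jac \<tau> q = 0"
    have "gramX Y q = (jac \<tau> q)\<^sup>2 * gramX (graph_map F) (\<tau> q)"
      unfolding pdG[OF that] gram_change_frame jac_def by simp
    with 0 reg_gram[OF regY that] show False by simp
  qed
  assume q: "q \<in> chart_image d"
  have "mean_curvature Y q = 0"
    by (rule reparam_mean_curvature[where Y = "graph_map F" and \<tau> = \<tau>, OF regG reg_open[OF reg] sm subset_UNIV YG J q])
       (use stN in \<open>simp_all add: stationary_def\<close>)
  obtain L' where L': "lorentz L'" "\<And>u. L' (L u) = u" using lorentz_inverse[OF L] by metis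
  then have lin': "linear L'" and m': "\<And>u v. mink (L' u) (L' v) = mink u v" by (auto simp: lorentz_def)
  have "param M d = (\<lambda>q. L' (Y q) + (- L' b))" by (simp add: Y_def linear_add[OF lin'] L'(2))
  from isometry_regular(3)[OF regY lin' m' this q \<open>mean_curvature Y q = 0\<close>] show "mean_curvature (param M d) q = 0" .
qed

lemma congruent_stationary: "stationary M"
  using congruent_chart(6) by (auto simp: stationary_def)

text \<open>The congruence may reverse the orientation; since the surface is connected, it does so everywhere or nowhere.\<close>

lemma congruent_orientation:
  "(\<forall>d\<in>atlas M. \<forall>q\<in>chart_image d. jac (\<lambda>q. f (chart_inv d q)) q > 0) \<or>
   (\<forall>d\<in>atlas M. \<forall>q\<in>chart_image d. jac (\<lambda>q. f (chart_inv d q)) q < 0)"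
proof -
  define j where "j = (\<lambda>d p. jac (\<lambda>q. f (chart_inv d q)) (snd d p))"
  define P where "P = {p. \<exists>d\<in>atlas M. p \<in> fst d \<and> j d p > 0}"
  define Q where "Q = {p. \<exists>d\<in>atlas M. p \<in> fst d \<and> j d p < 0}"
  have cont: "continuous_on (chart_image d) (jac (\<lambda>q. f (chart_inv d q)))" if "d \<in> atlas M" for d
  proof -
    have "smooth_on (jac (\<lambda>q. f (chart_inv d q))) (chart_image d)" unfolding jac_def
      by (intro smooth_on_diff smooth_on_mult smooth_on_nth smooth_on_pd congruent_chart(1)[OF that] atlas_open[OF M that])
    then show ?thesis by (rule smooth_on_continuous)
  qed
  have open_j: "openin (points M) {p \<in> fst d. snd d p \<in> chart_image d \<inter> jac (\<lambda>q. f (chart_inv d q)) -` V}"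
    if "d \<in> atlas M" "open V" for d V
    by (rule chart_open_preimage[OF atlas_chart[OF M that(1)] continuous_open_preimage[OF cont[OF that(1)] atlas_open[OF M that(1)] that(2)]])
  have "P = (\<Union>d\<in>atlas M. {p \<in> fst d. snd d p \<in> chart_image d \<inter> jac (\<lambda>q. f (chart_inv d q)) -` {0<..}})"
    by (auto simp: P_def j_def)
  then have oP: "openin (points M) P" using open_j[OF _ open_greaterThan] by (simp only:) (rule openin_Union, blast)
  have "Q = (\<Union>d\<in>atlas M. {p \<in> fst d. snd d p \<in> chart_image d \<inter> jac (\<lambda>q. f (chart_inv d q)) -` {..<0}})"
    by (auto simp: Q_def j_def)
  then have oQ: "openin (points M) Q" using open_j[OF _ open_lessThan] by (simp only:) (rule openin_Union, blast)
  have cov: "pts M \<subseteq> P \<union> Q"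
  proof
    fix p assume "p \<in> pts M"
    then obtain d where d: "d \<in> atlas M" "p \<in> fst d" using atlas_cover[OF M] by blast
    then have "j d p \<noteq> 0" using congruent_chart(5)[OF d(1)] by (simp add: j_def)
    then show "p \<in> P \<union> Q" using d by (auto simp: P_def Q_def neq_iff)
  qed
  \<comment> \<open>Transitions of the atlas have positive Jacobian, so the sign at a point does not
    depend on the chart.\<close>
  have same: "\<exists>k>0. j d p = j e p * k" if de: "d \<in> atlas M" "e \<in> atlas M" and p: "p \<in> fst d" "p \<in> fst e" for d e p
  proof -
    let ?U = "snd d ` (fst d \<inter> fst e)"
    have U: "open ?U" "snd d p \<in> ?U" using atlas_open_image[OF M de(1) atlas_openin[OF M de(2)]] p by auto
    have tr: "transition d e (snd d p) = snd e p" using atlas_inv_left[OF M de(1) p(1)] by (simp add: transition_def)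
    have "jac (\<lambda>q. f (chart_inv d q)) (snd d p) = jac (\<lambda>q. f (chart_inv e (transition d e q))) (snd d p)"
      by (rule jac_cong[OF U]) (use atlas_inv_left[OF M de(1)] atlas_inv_left[OF M de(2)] in \<open>auto simp: transition_def\<close>)
    also have "\<dots> = jac (\<lambda>q. f (chart_inv e q)) (transition d e (snd d p)) * jac (transition d e) (snd d p)"
      by (rule jac_compose[OF smooth_on_differentiable[OF U(1) atlas_transition(1)[OF M de] U(2)]])
         (use smooth_on_differentiable[OF atlas_open[OF M de(2)] congruent_chart(1)[OF de(2)]] tr p(2) in auto)
    finally show ?thesis using atlas_transition(2)[OF M de U(2)] by (auto simp: j_def tr)
  qed
  have disj: "P \<inter> Q = {}"
  proof -
    have False if "d \<in> atlas M" "p \<in> fst d" "j d p > 0" "e \<in> atlas M" "p \<in> fst e" "j e p < 0" for p d e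
      using same[OF that(1,4,2,5)] that(3,6) by (auto simp: zero_less_mult_iff)
    then show ?thesis unfolding P_def Q_def by blast
  qed
  have "P = {} \<or> Q = {}"
  proof (rule ccontr)
    assume "\<not> (P = {} \<or> Q = {})"
    then show False using surface_connected[OF M] oP oQ cov disj unfolding connected_space_def by blast
  qed
  moreover have in_PQ: "chart_inv d q \<in> pts M \<and> j d (chart_inv d q) = jac (\<lambda>q. f (chart_inv d q)) q \<and> chart_inv d q \<in> fst d"
    if "d \<in> atlas M" "q \<in> chart_image d" for d q
    using chart_inv_in[OF that(2)] subsetD[OF atlas_subset[OF M that(1)]] by (simp add: j_def)
  ultimately show ?thesis
  proof (elim disjE)
    assume "P = {}"
    then have "jac (\<lambda>q. f (chart_inv d q)) q < 0" if "d \<in> atlas M" "q \<in> chart_image d" for d q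
      using in_PQ[OF that] congruent_chart(5)[OF that] that(1) unfolding P_def by (fastforce simp: neq_iff)
    then show ?thesis by blast
  next
    assume "Q = {}"
    then have "jac (\<lambda>q. f (chart_inv d q)) q > 0" if "d \<in> atlas M" "q \<in> chart_image d" for d q
      using in_PQ[OF that] congruent_chart(5)[OF that] that(1) unfolding Q_def by (fastforce simp: neq_iff)
    then show ?thesis by blast
  qed
qed

text \<open>If the congruence reverses the orientation, the null vectors of the surface are
  conjugate to those of the graph, and conjugating the coefficients repairs the equation.\<close>

lemma congruent_normal_form: "\<exists>\<alpha> \<beta>. normal_form M L \<alpha> \<beta>"
proof -
  have H: "mean_curvature (graph_map F) q = 0" for q using stN by (simp add: stationary_def)
  note regG = graph_regular[OF N]
  let ?n = "\<lambda>q. null_vec (pd 1 (graph_map F) q) (pd 2 (graph_map F) q)"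
  obtain \<alpha> \<beta> where im: "Im (\<alpha> * cnj \<beta>) \<noteq> 0" and eq: "\<And>q. \<alpha> * ?n q $ 1 + \<beta> * ?n q $ 2 = 0"
    using stationary_graph_hyperplane[OF regG H] by metis
  have eqc: "cnj \<alpha> * cnj_vec (?n q) $ 1 + cnj \<beta> * cnj_vec (?n q) $ 2 = 0" for q
    using arg_cong[OF eq[of q], of cnj] by (simp add: cnj_vec_def)
  have nv: "\<exists>\<mu>. clin L (nvec M d q) = \<mu> *s (if jac (\<lambda>q. f (chart_inv d q)) q > 0 then ?n (f (chart_inv d q)) else cnj_vec (?n (f (chart_inv d q))))"
    if d: "d \<in> atlas M" "q \<in> chart_image d" for d q
  proof -
    let ?t = "\<lambda>q. f (chart_inv d q)"
    have J: "pd 1 ?t q $ 1 * pd 2 ?t q $ 2 - pd 2 ?t q $ 1 * pd 1 ?t q $ 2 \<noteq> 0" using congruent_chart(5)[OF d] by (simp add: jac_def)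
    have "clin L (nvec M d q) = null_vec (L (pd 1 (param M d) q)) (L (pd 2 (param M d) q))"
      unfolding nvec_def by (rule clin_null_vec[OF L])
    also have "\<dots> = null_vec ((pd 1 ?t q $ 1) *\<^sub>R pd 1 (graph_map F) (?t q) + (pd 1 ?t q $ 2) *\<^sub>R pd 2 (graph_map F) (?t q))
        ((pd 2 ?t q $ 1) *\<^sub>R pd 1 (graph_map F) (?t q) + (pd 2 ?t q $ 2) *\<^sub>R pd 2 (graph_map F) (?t q))"
      unfolding congruent_chart(3)[OF d, symmetric] congruent_chart(4)[OF d] ..
    finally show ?thesis
      using null_vec_change_frame[OF reg_frame[OF regG UNIV_I, of "?t q"] J] unfolding jac_def by metis
  qed
  from congruent_orientation show ?thesis
  proof
    assume or: "\<forall>d\<in>atlas M. \<forall>q\<in>chart_image d. jac (\<lambda>q. f (chart_inv d q)) q > 0"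
    have "\<alpha> * clin L (nvec M d q) $ 1 + \<beta> * clin L (nvec M d q) $ 2 = 0" if d: "d \<in> atlas M" "q \<in> chart_image d" for d q
    proof -
      obtain \<mu> where "clin L (nvec M d q) = \<mu> *s ?n (f (chart_inv d q))" using nv[OF d] or d by auto
      then have "\<alpha> * clin L (nvec M d q) $ 1 + \<beta> * clin L (nvec M d q) $ 2 = \<mu> * (\<alpha> * ?n (f (chart_inv d q)) $ 1 + \<beta> * ?n (f (chart_inv d q)) $ 2)"
        by (simp add: algebra_simps)
      then show ?thesis by (simp only: eq mult_zero_right)
    qed
    then show ?thesis using im L unfolding normal_form_def by blast
  next
    assume or: "\<forall>d\<in>atlas M. \<forall>q\<in>chart_image d. jac (\<lambda>q. f (chart_inv d q)) q < 0"
    have "cnj \<alpha> * clin L (nvec M d q) $ 1 + cnj \<beta> * clin L (nvec M d q) $ 2 = 0" if d: "d \<in> atlas M" "q \<in> chart_image d" for d q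
    proof -
      have "\<not> jac (\<lambda>q. f (chart_inv d q)) q > 0" using bspec[OF bspec[OF or d(1)] d(2)] by linarith
      then obtain \<mu> where "clin L (nvec M d q) = \<mu> *s cnj_vec (?n (f (chart_inv d q)))" using nv[OF d] by auto
      then have "cnj \<alpha> * clin L (nvec M d q) $ 1 + cnj \<beta> * clin L (nvec M d q) $ 2
          = \<mu> * (cnj \<alpha> * cnj_vec (?n (f (chart_inv d q))) $ 1 + cnj \<beta> * cnj_vec (?n (f (chart_inv d q))) $ 2)"
        by (simp add: algebra_simps)
      then show ?thesis by (simp only: eqc mult_zero_right)
    qed
    moreover have "Im (cnj \<alpha> * cnj (cnj \<beta>)) \<noteq> 0" using im by simp
    ultimately show ?thesis using L unfolding normal_form_def by blast
  qed
qed

text \<open>The projection of the surface moved by \<open>L\<close> is \<open>f\<close> followed by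
  the translation by \<open>- pr12 b\<close>.\<close>

lemma congruent_graph_bij: "bij_betw (\<lambda>p. pr12 (L (imm M p))) (pts M) UNIV"
proof -
  have "bij_betw f (pts M) UNIV" using f by (simp add: diffeomorphism_def)
  moreover have "bij_betw (\<lambda>z. z - pr12 b) UNIV UNIV"
    by (rule bij_betw_byWitness[where f' = "\<lambda>z. z + pr12 b"]) auto
  ultimately have "bij_betw ((\<lambda>z. z - pr12 b) \<circ> f) (pts M) UNIV" by (rule bij_betw_trans)
  moreover have "((\<lambda>z. z - pr12 b) \<circ> f) p = pr12 (L (imm M p))" if "p \<in> pts M" for p
  proof -
    have "f p = pr12 (L (imm M p)) + pr12 b"
      using pr12_graph[of F "f p"] imm[OF that] linear_add[OF linear_pr12, of "L (imm M p)" b] by simp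
    then show ?thesis by simp
  qed
  ultimately show ?thesis by (simp cong: bij_betw_cong)
qed

lemma congruent_graph_complete_degenerate: "complete_surface M" "degenerate_hyperbolic M"
proof -
  obtain \<alpha> \<beta> where nf: "normal_form M L \<alpha> \<beta>" using congruent_normal_form by blast
  then show "degenerate_hyperbolic M" by (rule normal_form_degenerate[OF M congruent_stationary])
  obtain \<kappa> where "flat_comparable M (\<lambda>v. pr12 (L v)) \<kappa>" by (rule normal_form_flat_comparable[OF M nf])
  then show "complete_surface M" by (rule bij_imp_complete[OF M _ congruent_graph_bij])
qed

end

lemma complete_degenerate_iff_graph:
  assumes M: "spacelike_surface M"
  shows "stationary M \<and> complete_surface M \<and> degenerate_hyperbolic M \<longleftrightarrow>
          (\<exists>F. spacelike_surface (graph_surface F) \<and> stationary (graph_surface F) \<and> congruent_surfaces M (graph_surface F))" (is "_ \<longleftrightarrow> ?R")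
proof
  assume a: "stationary M \<and> complete_surface M \<and> degenerate_hyperbolic M"
  then obtain L \<alpha> \<beta> where nf: "normal_form M L \<alpha> \<beta>" using degenerate_normal_form[OF M] by metis
  obtain \<kappa> where fc: "flat_comparable M (\<lambda>v. pr12 (L v)) \<kappa>" by (rule normal_form_flat_comparable[OF M nf])
  have "lorentz L" using nf by (simp add: normal_form_def)
  from bij_imp_congruent_graph[OF M _ this fc complete_imp_bij[OF M fc]] a
  show ?R by blast
next
  assume ?R
  then obtain F T f where N: "spacelike_surface (graph_surface F)" "stationary (graph_surface F)"
    and T: "mink_isometry T" and f: "diffeomorphism M (graph_surface F) f" "\<forall>p\<in>pts M. imm (graph_surface F) (f p) = T (imm M p)"
    unfolding congruent_surfaces_def by blast
  obtain L b where L: "lorentz L" "T = (\<lambda>p. L p + b)" using T by (auto simp: mink_isometry_def lorentz_def)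
  have im: "graph_map F (f p) = L (imm M p) + b" if "p \<in> pts M" for p using f(2) that L(2) by simp
  show "stationary M \<and> complete_surface M \<and> degenerate_hyperbolic M"
    using congruent_stationary[OF M N L(1) f(1) im] congruent_graph_complete_degenerate[OF M N L(1) f(1) im] by blast
qed

section \<open>The two rulings of the quadric\<close>

text \<open>The first coordinate of \<^const>\<open>Psi\<close> on the punctured line through \<open>z\<close>; the two quotients agree
  on null vectors by \<open>(z\<^sub>1 + iz\<^sub>2) (z\<^sub>1 - iz\<^sub>2) = (z\<^sub>4 - z\<^sub>3) (z\<^sub>4 + z\<^sub>3)\<close>.\<close>

definition ruling :: "complex^4 \<Rightarrow> ext_complex" where
  "ruling z = (if z$3 + z$4 \<noteq> 0 then Some ((z$1 + \<i> * z$2) / (z$3 + z$4))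
    else if z$1 - \<i> * z$2 \<noteq> 0 then Some ((z$4 - z$3) / (z$1 - \<i> * z$2)) else None)"

text \<open>This Lorentz reflection exchanges the two rulings of the quadric, so the second
  coordinate of \<open>Psi\<close> is the first one after reflection and results on
  \<open>psi1\<close> carry over to \<open>psi2\<close>.\<close>

definition reflect2 :: "'a::comm_ring_1^4 \<Rightarrow> 'a^4" where
  "reflect2 z = vector [z$1, - z$2, z$3, z$4]"

lemma vec4_eq_iff: "(x::'a^4) = y \<longleftrightarrow> x$1 = y$1 \<and> x$2 = y$2 \<and> x$3 = y$3 \<and> x$4 = y$4"
  by (simp add: vec_eq_iff forall_4)

lemma vector_4_nth [simp]:
  "(vector [a, b, c, d] :: 'a::zero^4) $ 1 = a" "(vector [a, b, c, d] :: 'a^4) $ 2 = b"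
  "(vector [a, b, c, d] :: 'a^4) $ 3 = c" "(vector [a, b, c, d] :: 'a^4) $ 4 = d"
  by (simp_all add: vector_def)

lemma reflect2_simps [simp]: "reflect2 z $ 1 = z$1" "reflect2 z $ 2 = - z$2" "reflect2 z $ 3 = z$3" "reflect2 z $ 4 = z$4"
  by (simp_all add: reflect2_def)

lemma mink_reflect2 [simp]: "mink (reflect2 z) (reflect2 w) = mink z w"
  by (simp add: mink_def)

lemma lorentz_reflect2: "lorentz (reflect2 :: real^4 \<Rightarrow> real^4)"
  by (auto simp: lorentz_def linear_iff vec4_eq_iff)

lemma clin_reflect2: "clin (\<lambda>v. reflect2 (L v)) z = reflect2 (clin L z)"
  by (simp add: clin_def vec4_eq_iff complex_eq_iff)

lemma null_product: "mink z z = 0 \<Longrightarrow> (z$1 + \<i> * z$2) * (z$1 - \<i> * z$2) = (z$4 - z$3) * (z$3 + z$4)" for z :: "complex^4"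
  by (simp add: mink_def algebra_simps power2_eq_square)

lemma ruling_smult: "c \<noteq> 0 \<Longrightarrow> ruling (c *s z) = ruling z"
proof -
  assume c: "c \<noteq> 0"
  have "c * z$3 + c * z$4 = c * (z$3 + z$4)" "c * z$1 - \<i> * (c * z$2) = c * (z$1 - \<i> * z$2)"
    "c * z$1 + \<i> * (c * z$2) = c * (z$1 + \<i> * z$2)" "c * z$4 - c * z$3 = c * (z$4 - z$3)"
    by (simp_all add: algebra_simps)
  then show ?thesis using c by (simp add: ruling_def)
qed

lemma null_coordinates_zero:
  assumes "z$1 + \<i> * z$2 = 0" "z$1 - \<i> * z$2 = 0" "z$4 - z$3 = 0" "z$3 + z$4 = 0"
  shows "z = (0::complex^4)"
proof -
  have "2 * z$1 = 0" "2 * \<i> * z$2 = 0" "2 * z$3 = 0" "2 * z$4 = 0"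
    using assms by (simp_all only: algebra_simps) algebra+
  then show ?thesis by (simp add: vec4_eq_iff)
qed

text \<open>In the null coordinates \<open>A\<close>, \<open>B\<close>, \<open>C\<close>,
  \<open>D\<close> the quadric is \<open>A * B = C * D\<close>. Each value of the ruling then
  amounts to two linear equations, which exhibit its fibre as a projective line and remove the case
  distinction between the quotients.\<close>

lemma ruling_eq_iff:
  assumes z: "z \<noteq> 0" "mink z z = 0"
  shows "ruling z = Some w \<longleftrightarrow> z$1 + \<i> * z$2 = w * (z$3 + z$4) \<and> z$4 - z$3 = w * (z$1 - \<i> * z$2)"
    "ruling z = None \<longleftrightarrow> z$3 + z$4 = 0 \<and> z$1 - \<i> * z$2 = 0"
proof -
  define A B C D where "A = z$1 + \<i> * z$2" and "B = z$1 - \<i> * z$2" and "C = z$4 - z$3" and "D = z$3 + z$4"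
  have eq: "A * B = C * D" using null_product[OF z(2)] by (simp add: A_def B_def C_def D_def)
  have nz: "A \<noteq> 0 \<or> B \<noteq> 0 \<or> C \<noteq> 0 \<or> D \<noteq> 0"
    using null_coordinates_zero[of z] z(1) unfolding A_def B_def C_def D_def by blast
  have r: "ruling z = (if D \<noteq> 0 then Some (A / D) else if B \<noteq> 0 then Some (C / B) else None)"
    by (simp add: ruling_def A_def B_def C_def D_def)
  have "ruling z = Some w \<longleftrightarrow> A = w * D \<and> C = w * B"
  proof (cases "D = 0")
    case D: False
    have "C = w * B" if "A = w * D" using eq D that by auto
    with D show ?thesis by (auto simp: r field_simps)
  next
    case D: True
    show ?thesis
    proof (cases "B = 0")
      case True
      with D eq nz show ?thesis by (auto simp: r)
    next
      case False
      with D eq have "A = 0" by simp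
      with D False show ?thesis by (auto simp: r field_simps)
    qed
  qed
  then show "ruling z = Some w \<longleftrightarrow> z$1 + \<i> * z$2 = w * (z$3 + z$4) \<and> z$4 - z$3 = w * (z$1 - \<i> * z$2)"
    unfolding A_def B_def C_def D_def .
  show "ruling z = None \<longleftrightarrow> z$3 + z$4 = 0 \<and> z$1 - \<i> * z$2 = 0"
    unfolding r by (auto simp: B_def D_def)
qed

lemma Psi_inv_rep:
  obtains z where "Psi_inv (w1, w2) = proj z" "z \<noteq> 0" "mink z z = 0" "ruling z = w1" "ruling (reflect2 z) = w2"
proof (cases w1; cases w2)
  assume "w1 = None" "w2 = None"
  then show thesis by (intro that[of "vector [0, 0, - 1, 1]"]) (auto simp: vec4_eq_iff mink_def ruling_def)
next
  fix a assume "w1 = None" "w2 = Some a"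
  then show thesis by (intro that[of "vector [1, - \<i>, - a, a]"]) (auto simp: vec4_eq_iff mink_def ruling_def)
next
  fix a assume "w1 = Some a" "w2 = None"
  then show thesis by (intro that[of "vector [1, \<i>, - a, a]"]) (auto simp: vec4_eq_iff mink_def ruling_def)
next
  fix a b assume w: "w1 = Some a" "w2 = Some b"
  show thesis
  proof (rule that[of "vector [a + b, - \<i> * (a - b), 1 - a * b, 1 + a * b]"])
    show "(vector [a + b, - \<i> * (a - b), 1 - a * b, 1 + a * b] :: complex^4) \<noteq> 0"
    proof -
      have "(x::complex^4) \<noteq> 0" if "x$3 + x$4 = 2" for x using that by auto
      then show ?thesis by simp
    qed
    show "mink (vector [a + b, - \<i> * (a - b), 1 - a * b, 1 + a * b]) (vector [a + b, - \<i> * (a - b), 1 - a * b, 1 + a * b]) = (0::complex)"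
      by (simp add: mink_def algebra_simps)
    show "ruling (vector [a + b, - \<i> * (a - b), 1 - a * b, 1 + a * b]) = w1"
      "ruling (reflect2 (vector [a + b, - \<i> * (a - b), 1 - a * b, 1 + a * b])) = w2"
      by (simp_all add: ruling_def w algebra_simps)
  qed (simp add: w)
qed

text \<open>A line of one family meets a line of the other in a single point: the equations of both
  fibres express all four null coordinates by one of them, which cannot vanish and whose quotient is
  the factor \<open>c\<close>.\<close>

lemma ruling_pair_inj:
  assumes z: "z \<noteq> 0" "mink z z = 0" and w: "w \<noteq> 0" "mink w w = 0"
    and eq: "ruling z = ruling w" "ruling (reflect2 z) = ruling (reflect2 w)"
  shows "proj z = proj w"
proof -
  have rz: "reflect2 z \<noteq> 0" "reflect2 w \<noteq> 0" using z(1) w(1) by (auto simp: vec4_eq_iff)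
  have mz: "mink (reflect2 z) (reflect2 z) = 0" "mink (reflect2 w) (reflect2 w) = 0" using z(2) w(2) by simp_all
  have key: "\<exists>c. c \<noteq> 0 \<and> y = c *s x"
    if xy: "x \<noteq> 0" "mink x x = 0" "y \<noteq> 0" "mink y y = 0" "ruling x = ruling y" "ruling (reflect2 x) = ruling (reflect2 y)" for x y
  proof -
    have r: "reflect2 x \<noteq> 0" "mink (reflect2 x) (reflect2 x) = 0" "reflect2 y \<noteq> 0" "mink (reflect2 y) (reflect2 y) = 0"
      using xy by (auto simp: vec4_eq_iff)
    note e = ruling_eq_iff[OF xy(1,2)] ruling_eq_iff[OF xy(3,4)] ruling_eq_iff[OF r(1,2)] ruling_eq_iff[OF r(3,4)]
    have lin: "y = c *s x" if "y$1 + \<i> * y$2 = c * (x$1 + \<i> * x$2)" "y$1 - \<i> * y$2 = c * (x$1 - \<i> * x$2)"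
      "y$4 - y$3 = c * (x$4 - x$3)" "y$3 + y$4 = c * (x$3 + x$4)" for c
    proof -
      have "y - c *s x = 0" by (rule null_coordinates_zero) (use that in \<open>simp_all add: algebra_simps\<close>)
      then show ?thesis by simp
    qed
    have "\<exists>c. y = c *s x"
    proof (cases "ruling x"; cases "ruling (reflect2 x)")
      fix a b assume a: "ruling x = Some a" "ruling (reflect2 x) = Some b"
      then have a': "ruling y = Some a" "ruling (reflect2 y) = Some b" using xy(5,6) by simp_all
      have x: "x$1 + \<i> * x$2 = a * (x$3 + x$4)" "x$4 - x$3 = a * (x$1 - \<i> * x$2)" "x$1 - \<i> * x$2 = b * (x$3 + x$4)"
        and y: "y$1 + \<i> * y$2 = a * (y$3 + y$4)" "y$4 - y$3 = a * (y$1 - \<i> * y$2)" "y$1 - \<i> * y$2 = b * (y$3 + y$4)"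
        using a a' unfolding e by auto
      have "x$3 + x$4 \<noteq> 0" using null_coordinates_zero[of x] x xy(1) by auto
      then show ?thesis
        by (intro exI[of _ "(y$3 + y$4) / (x$3 + x$4)"] lin) (simp_all only: x y, simp_all)
    next
      fix a assume a: "ruling x = Some a" "ruling (reflect2 x) = None"
      then have a': "ruling y = Some a" "ruling (reflect2 y) = None" using xy(5,6) by simp_all
      have x: "x$3 + x$4 = 0" "x$1 + \<i> * x$2 = 0" "x$4 - x$3 = a * (x$1 - \<i> * x$2)"
        and y: "y$3 + y$4 = 0" "y$1 + \<i> * y$2 = 0" "y$4 - y$3 = a * (y$1 - \<i> * y$2)"
        using a a' unfolding e by auto
      have "x$1 - \<i> * x$2 \<noteq> 0" using null_coordinates_zero[of x] x xy(1) by auto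
      then show ?thesis
        by (intro exI[of _ "(y$1 - \<i> * y$2) / (x$1 - \<i> * x$2)"] lin) (simp_all only: x y, simp_all)
    next
      fix b assume a: "ruling x = None" "ruling (reflect2 x) = Some b"
      then have a': "ruling y = None" "ruling (reflect2 y) = Some b" using xy(5,6) by simp_all
      have x: "x$3 + x$4 = 0" "x$1 - \<i> * x$2 = 0" "x$4 - x$3 = b * (x$1 + \<i> * x$2)"
        and y: "y$3 + y$4 = 0" "y$1 - \<i> * y$2 = 0" "y$4 - y$3 = b * (y$1 + \<i> * y$2)"
        using a a' unfolding e by auto
      have "x$1 + \<i> * x$2 \<noteq> 0" using null_coordinates_zero[of x] x xy(1) by auto
      then show ?thesis
        by (intro exI[of _ "(y$1 + \<i> * y$2) / (x$1 + \<i> * x$2)"] lin) (simp_all only: x y, simp_all)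
    next
      assume a: "ruling x = None" "ruling (reflect2 x) = None"
      then have a': "ruling y = None" "ruling (reflect2 y) = None" using xy(5,6) by simp_all
      have x: "x$3 + x$4 = 0" "x$1 - \<i> * x$2 = 0" "x$1 + \<i> * x$2 = 0"
        and y: "y$3 + y$4 = 0" "y$1 - \<i> * y$2 = 0" "y$1 + \<i> * y$2 = 0"
        using a a' unfolding e by auto
      have "x$4 - x$3 \<noteq> 0" using null_coordinates_zero[of x] x xy(1) by auto
      then show ?thesis
        by (intro exI[of _ "(y$4 - y$3) / (x$4 - x$3)"] lin) (simp_all only: x y, simp_all)
    qed
    then show ?thesis using xy(3) by auto
  qed
  obtain c where "c \<noteq> 0" "w = c *s z" using key[OF z w eq] by blast
  then show ?thesis using proj_smult by metis
qed

lemma proj_ruling: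
  assumes "proj z = proj w" "z \<noteq> 0"
  shows "ruling z = ruling w" "ruling (reflect2 z) = ruling (reflect2 w)"
proof -
  obtain c where c: "c \<noteq> 0" "z = c *s w" using assms proj_eq_iff by metis
  then show "ruling z = ruling w" by (simp add: ruling_smult)
  have "reflect2 z = c *s reflect2 w" by (simp add: c(2) vec4_eq_iff)
  then show "ruling (reflect2 z) = ruling (reflect2 w)" using ruling_smult[OF c(1)] by simp
qed

text \<open>\<open>Psi\<close> is defined as an inverse. Injectivity of \<open>Psi_inv\<close> can
  be read off the rulings of a representative, because they do not depend on its scaling.\<close>

lemma Psi_proj:
  assumes z: "z \<noteq> 0" "mink z z = 0"
  shows "Psi (proj z) = (ruling z, ruling (reflect2 z))"
proof -
  have "inj Psi_inv"
  proof (rule injI)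
    fix a b assume eq: "Psi_inv a = Psi_inv b"
    obtain x where x: "Psi_inv (fst a, snd a) = proj x" "x \<noteq> 0" "ruling x = fst a" "ruling (reflect2 x) = snd a"
      by (rule Psi_inv_rep)
    obtain y where y: "Psi_inv (fst b, snd b) = proj y" "ruling y = fst b" "ruling (reflect2 y) = snd b"
      by (rule Psi_inv_rep)
    have "proj x = proj y" using x(1) y(1) eq by simp
    from proj_ruling[OF this x(2)] show "a = b" using x(3,4) y(2,3) by (simp add: prod_eq_iff)
  qed
  moreover obtain x where x: "Psi_inv (ruling z, ruling (reflect2 z)) = proj x" "x \<noteq> 0" "mink x x = 0"
    "ruling x = ruling z" "ruling (reflect2 x) = ruling (reflect2 z)"
    by (rule Psi_inv_rep)
  moreover have "proj x = proj z" by (rule ruling_pair_inj[OF x(2,3) z x(4,5)])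
  ultimately show ?thesis unfolding Psi_def by (intro the_inv_into_f_eq) auto
qed

text \<open>The lines of a ruling are totally isotropic. Used in the contrapositive: null vectors
  that are not orthogonal have different values.\<close>

lemma ruling_eq_imp_orthogonal:
  assumes z: "z \<noteq> 0" "mink z z = 0" and w: "w \<noteq> 0" "mink w w = 0" and eq: "ruling z = ruling w"
  shows "mink z w = 0"
proof -
  have m: "2 * mink z w = (z$1 + \<i> * z$2) * (w$1 - \<i> * w$2) + (z$1 - \<i> * z$2) * (w$1 + \<i> * w$2)
      - (z$4 - z$3) * (w$3 + w$4) - (z$3 + z$4) * (w$4 - w$3)"
    by (simp add: mink_def algebra_simps)
  show ?thesis
  proof (cases "ruling z")
    case None
    with eq have "z$3 + z$4 = 0" "z$1 - \<i> * z$2 = 0" "w$3 + w$4 = 0" "w$1 - \<i> * w$2 = 0"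
      using ruling_eq_iff(2)[OF z] ruling_eq_iff(2)[OF w] by auto
    then show ?thesis using m by simp
  next
    case (Some a)
    have "z$1 + \<i> * z$2 = a * (z$3 + z$4) \<and> z$4 - z$3 = a * (z$1 - \<i> * z$2)"
      using Some unfolding ruling_eq_iff(1)[OF z] .
    moreover have "w$1 + \<i> * w$2 = a * (w$3 + w$4) \<and> w$4 - w$3 = a * (w$1 - \<i> * w$2)"
      using Some unfolding eq ruling_eq_iff(1)[OF w] .
    ultimately have "2 * mink z w = (a * (z$3 + z$4)) * (w$1 - \<i> * w$2) + (z$1 - \<i> * z$2) * (a * (w$3 + w$4))
      - (a * (z$1 - \<i> * z$2)) * (w$3 + w$4) - (z$3 + z$4) * (a * (w$1 - \<i> * w$2))" unfolding m by simp
    then have "2 * mink z w = 0" by (simp add: algebra_simps)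
    then show ?thesis by simp
  qed
qed

text \<open>A ruling is a projective line, so it meets every hyperplane.\<close>

lemma ruling_meets_hyperplane:
  obtains z where "z \<noteq> 0" "mink z z = 0" "ruling z = w" "mink A z = 0"
proof -
  note th = that
  \<comment> \<open>On the line spanned by \<open>u\<close> and \<open>v\<close>, the point with
    coefficients \<open>mink A v\<close> and \<open>- mink A u\<close> lies on the hyperplane,
    unless \<open>u\<close> itself already does.\<close>
  have comb: thesis
    if uv: "\<And>s t. s \<noteq> 0 \<or> t \<noteq> 0 \<Longrightarrow> s *s u + t *s v \<noteq> 0 \<and> mink (s *s u + t *s v) (s *s u + t *s v) = 0 \<and> ruling (s *s u + t *s v) = w" for u v
  proof (cases "mink A u = 0")
    case True
    then show thesis using uv[of 1 0] th[of "1 *s u + 0 *s v"] by simp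
  next
    case False
    have "mink A (mink A v *s u + (- mink A u) *s v) = 0"
      by (simp only: mink_add_right mink_smult_right) simp
    then show thesis using uv[of "mink A v" "- mink A u"] False th[of "mink A v *s u + (- mink A u) *s v"] by simp
  qed
  show thesis
  proof (cases w)
    case None
    show ?thesis
    proof (rule comb[of "vector [0, 0, - 1, 1]" "vector [1, - \<i>, 0, 0]"])
      fix s t :: complex assume "s \<noteq> 0 \<or> t \<noteq> 0"
      then show "s *s vector [0, 0, - 1, 1] + t *s vector [1, - \<i>, 0, 0] \<noteq> (0::complex^4) \<and>
        mink (s *s vector [0, 0, - 1, 1] + t *s vector [1, - \<i>, 0, 0]) (s *s vector [0, 0, - 1, 1] + t *s vector [1, - \<i>, 0, 0]) = (0::complex) \<and>
        ruling (s *s vector [0, 0, - 1, 1] + t *s vector [1, - \<i>, 0, 0]) = w"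
        by (auto simp: vec4_eq_iff mink_def ruling_def None algebra_simps)
    qed
  next
    case (Some a)
    show ?thesis
    proof (rule comb[of "vector [1, \<i>, - a, a]" "vector [a, - \<i> * a, 1, 1]"])
      fix s t :: complex assume st: "s \<noteq> 0 \<or> t \<noteq> 0"
      let ?z = "s *s vector [1, \<i>, - a, a] + t *s vector [a, - \<i> * a, 1, 1] :: complex^4"
      have z: "?z $ 1 = s + t * a" "?z $ 2 = \<i> * (s - t * a)" "?z $ 3 = t - s * a" "?z $ 4 = t + s * a"
        by (simp_all add: algebra_simps)
      have nz: "?z \<noteq> 0"
      proof
        assume 0: "?z = 0"
        have "?z $ 3 + ?z $ 4 = 2 * t" "?z $ 1 - \<i> * ?z $ 2 = 2 * s" unfolding z by (simp_all add: algebra_simps)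
        then show False using st unfolding 0 by simp
      qed
      have m: "mink ?z ?z = 0" unfolding mink_def z by (simp add: algebra_simps)
      have "?z $ 1 + \<i> * ?z $ 2 = a * (?z $ 3 + ?z $ 4)" "?z $ 4 - ?z $ 3 = a * (?z $ 1 - \<i> * ?z $ 2)"
        unfolding z by (simp_all add: algebra_simps)
      then have "ruling ?z = w" unfolding Some using ruling_eq_iff(1)[OF nz m] by blast
      with nz m show "?z \<noteq> 0 \<and> mink ?z ?z = 0 \<and> ruling ?z = w" by blast
    qed
  qed
qed

text \<open>The hyperplane \<open>\<alpha> z\<^sub>1 + \<beta> z\<^sub>2 = 0\<close> meets the quadric in the conic formed by the points
  \<open>(a, b, z\<^sub>3, z\<^sub>4)\<close> with \<open>z\<^sub>3 + z\<^sub>4 = \<kappa>\<close> and the two points at \<open>\<kappa> = 0, \<infinity>\<close>; the latter give the exceptional values.\<close>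

definition conic_point :: "complex \<Rightarrow> complex \<Rightarrow> complex \<Rightarrow> complex \<Rightarrow> complex^4" where
  "conic_point a b k h = vector [a, b, (k + h) / 2, (k - h) / 2]"

text \<open>The two exceptional points \<open>e1\<close>, \<open>e2\<close> are orthogonal neither
  to each other nor to any finite point of the conic, so their values are distinct and are not
  attained elsewhere. For any other value, its line in the ruling meets the hyperplane in a point of
  the conic different from both, hence in a multiple of a finite point.\<close>

lemma conic_ruling_values:
  assumes L: "lorentz L" and ab: "\<alpha> * a + \<beta> * b = 0" and D: "a\<^sup>2 + b\<^sup>2 \<noteq> 0" and \<alpha>\<beta>: "\<alpha> \<noteq> 0 \<or> \<beta> \<noteq> 0"
  obtains E where "card E = 2" "\<And>k h. h * k = - (a\<^sup>2 + b\<^sup>2) \<Longrightarrow> ruling (clin L (conic_point a b k h)) \<notin> E"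
    "\<And>w. w \<notin> E \<Longrightarrow> \<exists>k. k \<noteq> 0 \<and> (\<forall>h. h * k = - (a\<^sup>2 + b\<^sup>2) \<longrightarrow> ruling (clin L (conic_point a b k h)) = w)"
proof -
  have lin: "linear L" using L by (simp add: lorentz_def)
  obtain L' where L': "lorentz L'" "\<And>u. L' (L u) = u" "\<And>u. L (L' u) = u" using lorentz_inverse[OF L] by metis
  have inv: "clin L (clin L' z) = z" "clin L' (clin L z) = z" for z
    by (rule Re_Im_eqI; simp add: Re_Im_clin L')+
  have z0: "clin L z = 0 \<longleftrightarrow> z = 0" for z
  proof -
    have "clin L 0 = 0" using clin_smult[OF lin, of 0 0] by simp
    moreover have "clin L' 0 = 0" using clin_smult[of L' 0 0] L'(1) by (simp add: lorentz_def)
    ultimately show ?thesis using inv(2)[of z] by auto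
  qed
  \<comment> \<open>The points of the conic at infinite \<open>k\<close> and at
    \<open>k = 0\<close>, in this order.\<close>
  define e1 e2 where "e1 = conic_point 0 0 1 0" and "e2 = conic_point 0 0 0 1"
  have e: "e1 \<noteq> 0" "e2 \<noteq> 0" "mink e1 e1 = 0" "mink e2 e2 = 0" "mink e1 e2 \<noteq> 0"
    by (auto simp: e1_def e2_def conic_point_def vec4_eq_iff mink_def)
  let ?p = "conic_point a b"
  have ab0: "a \<noteq> 0 \<or> b \<noteq> 0" using D by auto
  have p: "?p k h \<noteq> 0" "mink (?p k h) (?p k h) = 0" "mink (?p k h) e1 \<noteq> 0" "mink (?p k h) e2 \<noteq> 0" if "h * k = - (a\<^sup>2 + b\<^sup>2)" for k h
  proof -
    show "?p k h \<noteq> 0" using ab0 by (auto simp: conic_point_def vec4_eq_iff)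
    have "mink (?p k h) (?p k h) = a\<^sup>2 + b\<^sup>2 + h * k"
      by (simp add: mink_def conic_point_def field_simps power2_eq_square)
    then show "mink (?p k h) (?p k h) = 0" using that by simp
    have "h \<noteq> 0" "k \<noteq> 0" using that D by (metis mult_zero_left mult_zero_right neg_equal_0_iff_equal)+
    then show "mink (?p k h) e1 \<noteq> 0" "mink (?p k h) e2 \<noteq> 0"
      by (auto simp: mink_def conic_point_def e1_def e2_def field_simps)
  qed
  have ne: "ruling (clin L x) \<noteq> ruling (clin L y)" if "x \<noteq> 0" "mink x x = 0" "y \<noteq> 0" "mink y y = 0" "mink x y \<noteq> 0" for x y
    using ruling_eq_imp_orthogonal[of "clin L x" "clin L y"] that by (auto simp: z0 mink_clin[OF L])
  let ?E = "{ruling (clin L e1), ruling (clin L e2)}"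
  show thesis
  proof (rule that[of ?E])
    show "card ?E = 2" using ne[OF e(1,3,2,4,5)] by simp
    show "ruling (clin L (?p k h)) \<notin> ?E" if "h * k = - (a\<^sup>2 + b\<^sup>2)" for k h
      using ne[OF p(1,2)[OF that] e(1,3) p(3)[OF that]] ne[OF p(1,2)[OF that] e(2,4) p(4)[OF that]] by simp
    fix w assume w: "w \<notin> ?E"
    define A where "A = clin L (vector [\<alpha>, \<beta>, 0, 0])"
    obtain z where z: "z \<noteq> 0" "mink z z = 0" "ruling z = w" "mink A z = 0" by (rule ruling_meets_hyperplane)
    define y where "y = clin L' z"
    have Ly: "clin L y = z" by (simp add: y_def inv)
    have y: "y \<noteq> 0" "mink y y = 0" using z(1,2) z0[of y] mink_clin[OF L, of y y] by (auto simp: Ly)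
    have hy: "\<alpha> * y$1 + \<beta> * y$2 = 0"
      using z(4) mink_clin[OF L, of "vector [\<alpha>, \<beta>, 0, 0]" y] unfolding A_def Ly by (simp add: mink_def)
    obtain t where t: "y$1 = t * a" "y$2 = t * b"
    proof -
      have "a * y$2 = b * y$1" using hy ab \<alpha>\<beta> by algebra
      then show thesis using that[of "y$1 / a"] that[of "y$2 / b"] ab0 by (cases "a = 0") (auto simp: field_simps)
    qed
    have yy: "(y$1)\<^sup>2 + (y$2)\<^sup>2 + (y$3 - y$4) * (y$3 + y$4) = 0"
      using y(2) by (simp add: mink_def algebra_simps power2_eq_square)
    \<comment> \<open>With \<open>t = 0\<close> the null vector \<open>y\<close> would be a multiple
      of \<open>e1\<close> or \<open>e2\<close>, whose values are excluded.\<close>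
    have "t \<noteq> 0"
    proof
      assume "t = 0"
      then have "y$1 = 0" "y$2 = 0" using t by simp_all
      with yy have "y$3 = y$4 \<or> y$3 = - y$4" by (auto simp: eq_neg_iff_add_eq_0)
      then obtain c e where ce: "e = e1 \<or> e = e2" "y = c *s e"
        using \<open>y$1 = 0\<close> \<open>y$2 = 0\<close> that[of e1 "2 * y$4"] that[of e2 "- 2 * y$4"]
        by (auto simp: e1_def e2_def conic_point_def vec4_eq_iff)
      with y(1) have "c \<noteq> 0" by auto
      then have "ruling z = ruling (clin L e)" unfolding Ly[symmetric] ce(2) clin_smult[OF lin] by (rule ruling_smult)
      then have "ruling z = ruling (clin L e1) \<or> ruling z = ruling (clin L e2)" using ce(1) by auto
      with w z(3) show False by auto
    qed
    define k where "k = (y$3 + y$4) / t"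
    have kk: "(y$3 - y$4) / t * k = - (a\<^sup>2 + b\<^sup>2)"
    proof -
      have "(y$3 - y$4) * (y$3 + y$4) = - (a\<^sup>2 + b\<^sup>2) * t\<^sup>2" using yy unfolding t by algebra
      then show ?thesis using \<open>t \<noteq> 0\<close> by (simp add: k_def power2_eq_square)
    qed
    then have "k \<noteq> 0" using D by (metis mult_zero_right neg_equal_0_iff_equal)
    moreover have "ruling (clin L (?p k h)) = w" if h: "h * k = - (a\<^sup>2 + b\<^sup>2)" for h
    proof -
      have "h = (y$3 - y$4) / t" using h kk \<open>k \<noteq> 0\<close> by (metis mult_right_cancel)
      then have "y = t *s ?p k h" using t \<open>t \<noteq> 0\<close> by (auto simp: k_def conic_point_def vec4_eq_iff add_divide_distrib[symmetric] diff_divide_distrib[symmetric])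
      then have "clin L y = t *s clin L (?p k h)" by (simp add: clin_smult[OF lin])
      then show ?thesis using z(3) ruling_smult[OF \<open>t \<noteq> 0\<close>] Ly by metis
    qed
    ultimately show "\<exists>k. k \<noteq> 0 \<and> (\<forall>h. h * k = - (a\<^sup>2 + b\<^sup>2) \<longrightarrow> ruling (clin L (?p k h)) = w)" by blast
  qed
qed

section \<open>The global isothermal parameter\<close>

text \<open>The function \<open>cnj \<alpha> x\<^sub>1 + cnj \<beta> x\<^sub>2\<close> is an isothermal parameter on a surface in normal form.\<close>

definition iso_of :: "complex \<Rightarrow> complex \<Rightarrow> real^2 \<Rightarrow> real^2" where
  "iso_of \<alpha> \<beta> x = cplx2 (cnj \<alpha> * of_real (x$1) + cnj \<beta> * of_real (x$2))"

text \<open>The inverse of \<open>iso_of\<close>, by Cramer's rule for a real system with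
  determinant \<open>Im (\<alpha> * cnj \<beta>)\<close>.\<close>

definition flat_of :: "complex \<Rightarrow> complex \<Rightarrow> real^2 \<Rightarrow> real^2" where
  "flat_of \<alpha> \<beta> y = vector [- Im (\<beta> * Complex (y$1) (y$2)) / Im (\<alpha> * cnj \<beta>), Im (\<alpha> * Complex (y$1) (y$2)) / Im (\<alpha> * cnj \<beta>)]"

lemma cplx2_nth [simp]: "cplx2 z $ 1 = Re z" "cplx2 z $ 2 = Im z"
  by (simp_all add: cplx2_def)

lemma cplx2_Complex: "cplx2 (Complex (y$1) (y$2)) = y"
  by (simp add: vec_eq_iff forall_2)

lemma cplx2_inject: "cplx2 z = cplx2 w \<longleftrightarrow> z = w"
  by (simp add: vec_eq_iff forall_2 complex_eq_iff)

lemma bounded_linear_flat_of: "bounded_linear (flat_of \<alpha> \<beta>)"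
proof -
  have "linear (flat_of \<alpha> \<beta>)"
    by (simp add: linear_iff flat_of_def vec_eq_iff forall_2 add_divide_distrib[symmetric] algebra_simps)
  then show ?thesis by (simp add: linear_conv_bounded_linear)
qed

lemma bounded_linear_iso_of: "bounded_linear (iso_of \<alpha> \<beta>)"
proof -
  have "linear (iso_of \<alpha> \<beta>)"
    by (simp add: linear_iff iso_of_def vec_eq_iff forall_2 algebra_simps)
  then show ?thesis by (simp add: linear_conv_bounded_linear)
qed

lemma iso_flat:
  assumes "Im (\<alpha> * cnj \<beta>) \<noteq> 0"
  shows "iso_of \<alpha> \<beta> (flat_of \<alpha> \<beta> y) = y" "flat_of \<alpha> \<beta> (iso_of \<alpha> \<beta> x) = x"
proof -
  define \<delta> where "\<delta> = Im (\<alpha> * cnj \<beta>)"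
  have \<delta>: "\<delta> \<noteq> 0" using assms by (simp add: \<delta>_def)
  define w where "w = Complex (y$1) (y$2)"
  have "cnj \<alpha> * of_real (- Im (\<beta> * w)) + cnj \<beta> * of_real (Im (\<alpha> * w)) = of_real \<delta> * w"
    by (simp add: \<delta>_def complex_eq_iff algebra_simps)
  then have "(cnj \<alpha> * of_real (- Im (\<beta> * w)) + cnj \<beta> * of_real (Im (\<alpha> * w))) / of_real \<delta> = w" using \<delta> by simp
  then have "cnj \<alpha> * of_real (flat_of \<alpha> \<beta> y $ 1) + cnj \<beta> * of_real (flat_of \<alpha> \<beta> y $ 2) = w"
    unfolding flat_of_def w_def[symmetric] \<delta>_def[symmetric] using \<delta> by (simp add: field_simps)
  then show "iso_of \<alpha> \<beta> (flat_of \<alpha> \<beta> y) = y" by (simp add: iso_of_def w_def cplx2_Complex)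
  define v where "v = cnj \<alpha> * of_real (x$1) + cnj \<beta> * of_real (x$2)"
  have c: "Complex (iso_of \<alpha> \<beta> x $ 1) (iso_of \<alpha> \<beta> x $ 2) = v" by (simp add: iso_of_def v_def complex_eq_iff)
  have "- Im (\<beta> * v) = x$1 * \<delta>" "Im (\<alpha> * v) = x$2 * \<delta>"
    by (simp_all add: v_def \<delta>_def algebra_simps)
  then show "flat_of \<alpha> \<beta> (iso_of \<alpha> \<beta> x) = x"
    unfolding flat_of_def c \<delta>_def[symmetric] using \<delta> by (simp add: vec_eq_iff forall_2)
qed

lemma flat_of_axis:
  assumes "Im (\<alpha> * cnj \<beta>) \<noteq> 0"
  defines "a \<equiv> flat_of \<alpha> \<beta> (axis 1 1)" and "b \<equiv> flat_of \<alpha> \<beta> (axis 2 1)"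
  shows "cnj \<alpha> * of_real (a$1) + cnj \<beta> * of_real (a$2) = 1" "cnj \<alpha> * of_real (b$1) + cnj \<beta> * of_real (b$2) = \<i>"
    "\<alpha> * of_real (a$1) + \<beta> * of_real (a$2) = 1" "\<alpha> * of_real (b$1) + \<beta> * of_real (b$2) = - \<i>"
    "jac (flat_of \<alpha> \<beta>) q \<noteq> 0"
proof -
  have "iso_of \<alpha> \<beta> a = cplx2 1" "iso_of \<alpha> \<beta> b = cplx2 \<i>"
    unfolding a_def b_def iso_flat[OF assms(1)] by (simp_all add: vec_eq_iff forall_2 axis_def)
  then show e: "cnj \<alpha> * of_real (a$1) + cnj \<beta> * of_real (a$2) = 1" "cnj \<alpha> * of_real (b$1) + cnj \<beta> * of_real (b$2) = \<i>"
    by (simp_all only: iso_of_def cplx2_inject)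
  from arg_cong[OF e(1), of cnj] arg_cong[OF e(2), of cnj]
  show "\<alpha> * of_real (a$1) + \<beta> * of_real (a$2) = 1" "\<alpha> * of_real (b$1) + \<beta> * of_real (b$2) = - \<i>" by simp_all
  have "jac (flat_of \<alpha> \<beta>) q = a$1 * b$2 - b$1 * a$2"
    unfolding jac_def pd_linear[OF bounded_linear_flat_of] a_def b_def ..
  also have "\<dots> = 1 / Im (\<alpha> * cnj \<beta>)"
  proof -
    have "Re \<alpha> * a$1 + Re \<beta> * a$2 = 1" "Im \<alpha> * a$1 + Im \<beta> * a$2 = 0" "Re \<alpha> * b$1 + Re \<beta> * b$2 = 0" "Im \<alpha> * b$1 + Im \<beta> * b$2 = - 1"
      using \<open>\<alpha> * of_real (a$1) + \<beta> * of_real (a$2) = 1\<close> \<open>\<alpha> * of_real (b$1) + \<beta> * of_real (b$2) = - \<i>\<close>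
      by (simp_all add: complex_eq_iff)
    then have "(a$1 * b$2 - b$1 * a$2) * (Im \<alpha> * Re \<beta> - Re \<alpha> * Im \<beta>) = 1" by algebra
    moreover have "Im (\<alpha> * cnj \<beta>) = Im \<alpha> * Re \<beta> - Re \<alpha> * Im \<beta>" by simp
    ultimately show ?thesis using assms(1) by (simp add: eq_divide_eq)
  qed
  finally show "jac (flat_of \<alpha> \<beta>) q \<noteq> 0" using assms(1) by simp
qed

definition iso_par :: "'a surface \<Rightarrow> (real^4 \<Rightarrow> real^4) \<Rightarrow> complex \<Rightarrow> complex \<Rightarrow> real^2 \<Rightarrow> 'a" where
  "iso_par M L \<alpha> \<beta> y = inv_into (pts M) (\<lambda>p. pr12 (L (imm M p))) (flat_of \<alpha> \<beta> y)"

definition iso_imm :: "'a surface \<Rightarrow> (real^4 \<Rightarrow> real^4) \<Rightarrow> complex \<Rightarrow> complex \<Rightarrow> real^2 \<Rightarrow> real^4" where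
  "iso_imm M L \<alpha> \<beta> y = imm M (iso_par M L \<alpha> \<beta> y)"

section \<open>Holomorphic derivatives and the curvature in an isothermal parameter\<close>

definition dz :: "(real^2 \<Rightarrow> real^4) \<Rightarrow> 4 \<Rightarrow> complex \<Rightarrow> complex" where
  "dz X k z = complex_deriv_z X (cplx2 z) $ k"

text \<open>For a harmonic map \<open>X_zz = (X_uu - X_vv - 2 i X_uv) / 4\<close> becomes
  \<open>(X_uu - i X_uv) / 2\<close>.\<close>

definition dz2 :: "(real^2 \<Rightarrow> real^4) \<Rightarrow> 4 \<Rightarrow> complex \<Rightarrow> complex" where
  "dz2 X k z = Complex (pd 1 (pd 1 X) (cplx2 z) $ k / 2) (- pd 1 (pd 2 X) (cplx2 z) $ k / 2)"

text \<open>The Cauchy-Riemann equations for \<open>X_z\<close> are harmonicity together with the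
  symmetry of second derivatives.\<close>

lemma harmonic_dz_has_derivative:
  assumes sm: "smooth_on X UNIV" and harm: "\<And>q. pd 1 (pd 1 X) q + pd 2 (pd 2 X) q = 0"
  shows "(dz X k has_field_derivative dz2 X k z) (at z)"
proof -
  let ?A = "pd 1 (pd 1 X) (cplx2 z) $ k" and ?B = "pd 1 (pd 2 X) (cplx2 z) $ k"
  have c: "pd 2 (pd 1 X) (cplx2 z) $ k = ?B" using pd_commute[OF open_UNIV sm UNIV_I] by simp
  have "pd 2 (pd 2 X) (cplx2 z) = - pd 1 (pd 1 X) (cplx2 z)" using harm[of "cplx2 z"] by (simp add: eq_neg_iff_add_eq_0 add.commute)
  then have h: "pd 2 (pd 2 X) (cplx2 z) $ k = - ?A" by simp
  have d: "((\<lambda>z. pd i X (cplx2 z) $ k) has_derivative (\<lambda>h. Re h * pd 1 (pd i X) (cplx2 z) $ k + Im h * pd 2 (pd i X) (cplx2 z) $ k)) (at z)" for i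
  proof -
    have "((\<lambda>z. pd i X (cplx2 z)) has_derivative (\<lambda>h. cplx2 h $ 1 *\<^sub>R pd 1 (pd i X) (cplx2 z) + cplx2 h $ 2 *\<^sub>R pd 2 (pd i X) (cplx2 z))) (at z)"
      by (rule has_derivative_compose[OF bounded_linear_imp_has_derivative[OF bounded_linear_cplx2]
          smooth_on_has_derivative[OF open_UNIV smooth_on_pd[OF sm] UNIV_I]])
    from bounded_linear.has_derivative[OF bounded_linear_vec_nth this, of k] show ?thesis by simp
  qed
  have "((\<lambda>z. (of_real (pd 1 X (cplx2 z) $ k) - \<i> * of_real (pd 2 X (cplx2 z) $ k)) * (1/2) :: complex) has_derivative
     (\<lambda>h. (of_real (Re h * ?A + Im h * pd 2 (pd 1 X) (cplx2 z) $ k) - \<i> * of_real (Re h * ?B + Im h * pd 2 (pd 2 X) (cplx2 z) $ k)) * (1/2))) (at z)"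
    by (intro has_derivative_mult_left has_derivative_diff has_derivative_mult_right has_derivative_of_real d)
  moreover have "(of_real (Re h * ?A + Im h * ?B) - \<i> * of_real (Re h * ?B + Im h * (- ?A))) * (1/2) = dz2 X k z * h" for h
    by (simp add: dz2_def complex_eq_iff field_simps)
  moreover have "dz X k = (\<lambda>z. (of_real (pd 1 X (cplx2 z) $ k) - \<i> * of_real (pd 2 X (cplx2 z) $ k)) * (1/2))"
    by (simp add: dz_def complex_deriv_z_def fun_eq_iff)
  ultimately show ?thesis unfolding has_field_derivative_def c h by simp
qed

lemma mink_nrm_conformal:
  assumes E: "mink a a = E" "mink b b = E" "mink a b = 0" "E > 0"
  shows "mink (nrm a b v) (nrm a b w) = mink v w - (mink v a * mink w a + mink v b * mink w b) / E"
proof -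
  have ba: "mink b a = 0" using E(3) mink_commute by metis
  have g: "gram a b = E * E" using E by (simp add: gram_def)
  have n: "nrm a b x = x - (mink x a / E) *\<^sub>R a - (mink x b / E) *\<^sub>R b" for x
    using E(4) by (simp add: nrm_def g E)
  show ?thesis unfolding n using E
    by (simp add: mink_simps ba mink_commute[of a w] mink_commute[of b w] field_simps)
qed

text \<open>Meant for \<open>a = X_u\<close>, \<open>b = X_v\<close>,
  \<open>v = X_uu = - X_vv\<close> and \<open>u = X_uv\<close>, with first two coordinates linear in
  the parameter. The assumption \<open>kh\<close>, the derivative of the constant product of
  \<open>k\<close> and \<open>h\<close>, identifies \<open>mink u b\<close> with
  \<open>mink v a\<close> and \<open>mink u a\<close> with \<open>- mink v b\<close>, so that in the
  Gauss equation only the products of \<open>v\<close> with the frame remain.\<close>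

lemma conic_curvature:
  fixes a b v u :: "real^4"
  assumes E: "mink a a = E" "mink b b = E" "mink a b = 0" "E > 0"
    and v: "v$1 = 0" "v$2 = 0" and u: "u$1 = 0" "u$2 = 0"
  defines "k \<equiv> Complex ((a$3 + a$4) / 2) (- (b$3 + b$4) / 2)" and "h \<equiv> Complex ((a$3 - a$4) / 2) (- (b$3 - b$4) / 2)"
    and "k' \<equiv> Complex ((v$3 + v$4) / 2) (- (u$3 + u$4) / 2)" and "h' \<equiv> Complex ((v$3 - v$4) / 2) (- (u$3 - u$4) / 2)"
  assumes kh: "k' * h + k * h' = 0"
  shows "(mink (nrm a b v) (nrm a b (- v)) - mink (nrm a b u) (nrm a b u)) / gram a b
    = - 4 * (Re (k' * cnj h') - (cmod ((k' * cnj h + h' * cnj k) / 2))\<^sup>2 / (E / 2)) / E\<^sup>2"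
proof -
  have g: "gram a b = E\<^sup>2" using E by (simp add: gram_def power2_eq_square)
  define p q where "p = mink v a" and "q = mink v b"
  have vv: "mink v v + mink u u = 4 * Re (k' * cnj h')"
    by (simp add: mink_def v u k'_def h'_def field_simps)
  have re: "mink v a - mink u b = 2 * Re (k' * h + k * h')" and im: "mink v b + mink u a = - 2 * Im (k' * h + k * h')"
    by (simp_all add: mink_def v u k'_def h'_def k_def h_def field_simps)
  have pq: "mink u b = p" "mink u a = - q" using re im unfolding kh by (simp_all add: p_def q_def)
  have "mink v a + mink u b = 2 * Re (k' * cnj h + h' * cnj k)" "mink v b - mink u a = 2 * Im (k' * cnj h + h' * cnj k)"
    by (simp_all add: mink_def v u k'_def h'_def k_def h_def field_simps)
  then have "Re (k' * cnj h + h' * cnj k) = p" "Im (k' * cnj h + h' * cnj k) = q" using pq by (simp_all add: p_def q_def)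
  then have c: "(cmod ((k' * cnj h + h' * cnj k) / 2))\<^sup>2 = (p\<^sup>2 + q\<^sup>2) / 4"
    unfolding norm_divide power_divide cmod_power2 by simp
  have "mink (nrm a b v) (nrm a b (- v)) - mink (nrm a b u) (nrm a b u) = - (mink v v + mink u u) + 2 * (p\<^sup>2 + q\<^sup>2) / E"
    unfolding mink_nrm_conformal[OF E] using E(4)
    by (simp add: mink_simps pq p_def[symmetric] q_def[symmetric] field_simps power2_eq_square)
  moreover have "- (4 * S) + 2 * P / E = - 4 * (S - P / 4 / (E / 2))" for S P
    using E(4) by (simp add: field_simps)
  ultimately show ?thesis unfolding vv c g by (simp only:)
qed

section \<open>Values of the Gauss map\<close>

text \<open>If \<open>D = 0\<close>, the identity theorem makes \<open>k\<close> or \<open>h\<close>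
  vanish identically, and the curvature expression \<open>ne\<close> would be 0. Otherwise
  \<open>k\<close> has no zeros and so has a logarithm on the plane; a constant logarithm would
  again make the expression 0.\<close>

lemma nonflat_exponential_data:
  fixes k h k' h' :: "complex \<Rightarrow> complex" and D :: complex and \<epsilon> :: "complex \<Rightarrow> real"
  assumes dk: "\<And>z. (k has_field_derivative k' z) (at z)" and dh: "\<And>z. (h has_field_derivative h' z) (at z)"
    and hk: "\<And>z. h z * k z = - D"
    and ne: "Re (k' z0 * cnj (h' z0)) - (cmod ((k' z0 * cnj (h z0) + h' z0 * cnj (k z0)) / 2))\<^sup>2 / e \<noteq> 0"
  obtains g g' where "D \<noteq> 0" "\<And>z. k z = exp (g z)" "\<And>z. (g has_field_derivative g' z) (at z)" "\<nexists>c. g = (\<lambda>z. c)"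
    "\<And>z. k' z = g' z * k z" "\<And>z. h' z = - (g' z * h z)"
proof -
  have hol: "k holomorphic_on UNIV" "h holomorphic_on UNIV" using dk dh by (auto simp: holomorphic_on_open)
  have zero: "f' z = 0" if "\<And>z. (f has_field_derivative f' z) (at z)" "\<And>z. f z = c" for f f' :: "complex \<Rightarrow> complex" and c z
  proof -
    have "f = (\<lambda>z. c)" using that(2) by blast
    then show ?thesis using that(1)[of z] DERIV_unique DERIV_const by metis
  qed
  have D: "D \<noteq> 0"
  proof
    assume "D = 0"
    then have hk0: "h z * k z = 0" for z using hk by simp
    have "(\<forall>z. k z = 0) \<or> (\<forall>z. h z = 0)"
    proof (rule disjCI)
      assume "\<not> (\<forall>z. h z = 0)"
      then obtain z1 where z1: "h z1 \<noteq> 0" by blast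
      have o: "open {z. h z \<noteq> 0}"
        using open_Collect_neq[OF holomorphic_on_imp_continuous_on[OF hol(2)] continuous_on_const] by simp
      have "k z = (\<lambda>z. 0) z" for z
        by (rule analytic_continuation_open[OF o open_UNIV _ connected_UNIV subset_UNIV hol(1)]) (use z1 hk0 in auto)
      then show "\<forall>z. k z = 0" by simp
    qed
    then show False
    proof
      assume k: "\<forall>z. k z = 0"
      then have "k' z0 = 0" using zero[OF dk] by blast
      with k ne show False by simp
    next
      assume h: "\<forall>z. h z = 0"
      then have "h' z0 = 0" using zero[OF dh] by blast
      with h ne show False by simp
    qed
  qed
  then have nz: "k z \<noteq> 0" "h z \<noteq> 0" for z using hk[of z] by auto
  obtain g where g: "g holomorphic_on UNIV" "\<And>z. z \<in> UNIV \<Longrightarrow> k z = exp (g z)"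
    by (rule contractible_imp_holomorphic_log[OF hol(1)]) (use nz in auto)
  define g' where "g' = deriv g"
  have dg: "(g has_field_derivative g' z) (at z)" for z
    unfolding g'_def by (rule holomorphic_derivI[OF g(1)]) auto
  have k': "k' z = g' z * k z" for z
  proof -
    have "((\<lambda>z. exp (g z)) has_field_derivative exp (g z) * g' z) (at z)" by (rule DERIV_chain2[OF DERIV_exp dg])
    moreover have "(\<lambda>z. exp (g z)) = k" using g(2) by auto
    ultimately have "k' z = exp (g z) * g' z" using dk DERIV_unique by metis
    then show ?thesis using g(2) by simp
  qed
  have h': "h' z = - (g' z * h z)" for z
  proof -
    have "h' z * k z + k' z * h z = 0" using zero[OF DERIV_mult[OF dh dk], of "- D" z] hk by simp
    then have "(h' z + g' z * h z) * k z = 0" unfolding k' by (simp add: algebra_simps)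
    then have "h' z + g' z * h z = 0" using nz(1)[of z] by simp
    then show ?thesis by (simp add: eq_neg_iff_add_eq_0)
  qed
  have "\<nexists>c. g = (\<lambda>z. c)"
  proof
    assume "\<exists>c. g = (\<lambda>z. c)"
    then have "g' z0 = 0" using zero[OF dg] by metis
    then have "k' z0 = 0" "h' z0 = 0" by (simp_all add: k' h')
    with ne show False by simp
  qed
  then show thesis using that D g(2) dg k' h' by blast
qed

text \<open>The little theorem of Picard is applied to \<open>g\<close>: it misses at most one of
  the infinitely many logarithms of \<open>w\<close>, and different logarithms have different
  preimages.\<close>

lemma exp_entire_values_infinite:
  assumes g: "g holomorphic_on UNIV" and nc: "\<nexists>c. g = (\<lambda>z. c)" and w: "w \<noteq> 0"
  shows "infinite {z. exp (g z) = w}"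
proof
  assume fin: "finite {z. exp (g z) = w}"
  define v where "v = (\<lambda>n::nat. Ln w + of_real (2 * pi * real n) * \<i>)"
  have ev: "exp (v n) = w" for n
  proof -
    have "exp (of_real (2 * pi * real n) * \<i>) = (1::complex)"
      using exp_integer_2pi[of "of_nat n"] by (simp add: mult_ac)
    then show ?thesis using w by (simp add: v_def exp_add)
  qed
  have inj: "inj v" by (auto simp: inj_def v_def)
  have "v -` (g ` {z. exp (g z) = w}) = {n. v n \<in> range g}"
    using ev by (auto simp: image_iff) (metis ev)
  moreover have "finite (v -` (g ` {z. exp (g z) = w}))" by (rule finite_vimageI[OF finite_imageI[OF fin] inj])
  ultimately have "finite {n. v n \<in> range g}" by simp
  then have inf: "infinite (- {n. v n \<in> range g})" by (simp add: finite_compl)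
  then obtain m where m: "m \<in> - {n. v n \<in> range g}" using infinite_imp_nonempty by blast
  have "infinite (- {n. v n \<in> range g} - {m})" using inf by (simp add: infinite_remove)
  then obtain n where "n \<in> - {n. v n \<in> range g} - {m}" using infinite_imp_nonempty by blast
  with m have "m \<noteq> n" "v m \<notin> range g" "v n \<notin> range g" by auto
  then have "v m \<noteq> v n" "range g \<inter> {v m, v n} = {}" using inj by (auto simp: inj_def)
  then obtain c where "g = (\<lambda>x. c)" using little_Picard[OF g] by blast
  with nc show False by blast
qed

text \<open>\<open>L\<close> and \<open>\<psi>\<close> are kept general so that the lemma covers
  \<open>psi1\<close> and, with the reflected Lorentz map, \<open>psi2\<close>. Bijectivity of
  \<open>P\<close> transports infinite sets of parameters to infinite sets of points.\<close>

lemma conic_values: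
  assumes L: "lorentz L" and ab: "\<alpha> * a + \<beta> * b = 0" "\<alpha> \<noteq> 0 \<or> \<beta> \<noteq> 0" and D: "a\<^sup>2 + b\<^sup>2 \<noteq> 0"
    and hk: "\<And>z. h z * k z = - (a\<^sup>2 + b\<^sup>2)" and inf: "\<And>w. w \<noteq> 0 \<Longrightarrow> infinite {z::complex. k z = w}"
    and P: "bij_betw P UNIV S" and \<psi>: "\<And>z. \<psi> (P z) = ruling (clin L (conic_point a b (k z) (h z)))"
  shows "inf_often_except_two S \<psi>"
proof -
  obtain E where E: "card E = 2" "\<And>k h. h * k = - (a\<^sup>2 + b\<^sup>2) \<Longrightarrow> ruling (clin L (conic_point a b k h)) \<notin> E"
    "\<And>w. w \<notin> E \<Longrightarrow> \<exists>k. k \<noteq> 0 \<and> (\<forall>h. h * k = - (a\<^sup>2 + b\<^sup>2) \<longrightarrow> ruling (clin L (conic_point a b k h)) = w)"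
    by (rule conic_ruling_values[OF L ab(1) D ab(2)]) blast
  have "w \<notin> E \<longleftrightarrow> infinite {p \<in> S. \<psi> p = w}" for w
  proof
    assume "w \<notin> E"
    then obtain \<kappa> where \<kappa>: "\<kappa> \<noteq> 0" "\<And>h. h * \<kappa> = - (a\<^sup>2 + b\<^sup>2) \<Longrightarrow> ruling (clin L (conic_point a b \<kappa> h)) = w" using E(3) by blast
    have "P ` {z. k z = \<kappa>} \<subseteq> {p \<in> S. \<psi> p = w}"
    proof (rule image_subsetI)
      fix z assume "z \<in> {z. k z = \<kappa>}"
      then show "P z \<in> {p \<in> S. \<psi> p = w}" using \<kappa>(2)[of "h z"] hk[of z] bij_betwE[OF P] by (simp add: \<psi>)
    qed
    moreover have "infinite (P ` {z. k z = \<kappa>})"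
      using inf[OF \<kappa>(1)] inj_on_subset[OF bij_betw_imp_inj_on[OF P] subset_UNIV] by (simp add: finite_image_iff)
    ultimately show "infinite {p \<in> S. \<psi> p = w}" using finite_subset by blast
  next
    assume "infinite {p \<in> S. \<psi> p = w}"
    then obtain p where "p \<in> S" "\<psi> p = w" using not_finite_existsD by auto
    moreover obtain z where "p = P z" using \<open>p \<in> S\<close> bij_betw_imp_surj_on[OF P] by blast
    ultimately show "w \<notin> E" using E(2)[OF hk[of z]] \<psi> by auto
  qed
  with E(1) show ?thesis unfolding inf_often_except_two_def by blast
qed

section \<open>The area measure\<close>

text \<open>A bridge between the gauge integral, for which the change of variables is stated, and
  nonnegative integrals that may be infinite.\<close>

lemma nn_integral_set_integral:
  fixes F :: "'a::euclidean_space \<Rightarrow> real"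
  assumes meas: "(\<lambda>x. indicator S x * F x) \<in> borel_measurable borel" and nn: "\<And>x. x \<in> S \<Longrightarrow> F x \<ge> 0"
  shows "(\<integral>\<^sup>+x\<in>S. ennreal (F x) \<partial>lborel) = (if F absolutely_integrable_on S then ennreal (integral S F) else \<infinity>)"
proof -
  have eq: "(\<integral>\<^sup>+x\<in>S. ennreal (F x) \<partial>lborel) = (\<integral>\<^sup>+x. ennreal (indicator S x * F x) \<partial>lborel)"
    by (intro nn_integral_cong) (auto split: split_indicator)
  have ai: "F absolutely_integrable_on S \<longleftrightarrow> F integrable_on S" by (rule absolutely_integrable_on_iff_nonneg[OF nn])
  show ?thesis
  proof (cases "F integrable_on S")
    case True
    then have "(F has_integral integral S F) S" by (rule integrable_integral)
    from nn_integral_has_integral_lebesgue[OF nn this] show ?thesis using True ai eq by simp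
  next
    case False
    have "(\<integral>\<^sup>+x. ennreal (indicator S x * F x) \<partial>lborel) = \<infinity>"
    proof (rule ccontr)
      assume "\<not> ?thesis"
      then have "(\<integral>\<^sup>+x. ennreal (indicator S x * F x) \<partial>lborel) < \<infinity>" by (simp add: less_top)
      from nn_integral_integrable_on[OF meas _ this] nn have "(\<lambda>x. indicator S x * F x) integrable_on UNIV"
        by (auto split: split_indicator)
      moreover have "(\<lambda>x. indicator S x * F x) = (\<lambda>x. if x \<in> S then F x else 0)" by (auto split: split_indicator)
      ultimately show False using False by (simp add: integrable_restrict_UNIV)
    qed
    then show ?thesis using False ai eq by simp
  qed
qed

lemma nn_integral_change_of_variables:
  fixes \<tau> :: "real^2 \<Rightarrow> real^2" and f :: "real^2 \<Rightarrow> real"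
  assumes S: "S \<in> sets borel" and der: "\<And>x. x \<in> S \<Longrightarrow> (\<tau> has_derivative D x) (at x)" and inj: "inj_on \<tau> S"
    and nn: "\<And>y. y \<in> \<tau> ` S \<Longrightarrow> f y \<ge> 0" and m1: "(\<lambda>y. indicator (\<tau> ` S) y * f y) \<in> borel_measurable borel"
    and m2: "(\<lambda>x. indicator S x * (\<bar>det (matrix (D x))\<bar> * f (\<tau> x))) \<in> borel_measurable borel"
  shows "(\<integral>\<^sup>+x\<in>S. ennreal (\<bar>det (matrix (D x))\<bar> * f (\<tau> x)) \<partial>lborel) = (\<integral>\<^sup>+y\<in>\<tau> ` S. ennreal (f y) \<partial>lborel)"
proof -
  let ?F = "\<lambda>x. \<bar>det (matrix (D x))\<bar> * f (\<tau> x)"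
  have key: "?F absolutely_integrable_on S \<and> integral S ?F = b \<longleftrightarrow> f absolutely_integrable_on (\<tau> ` S) \<and> integral (\<tau> ` S) f = b" for b
  proof -
    \<comment> \<open>The change of variables theorem concerns vector-valued integrands, so the real
      function is encoded in dimension 1.\<close>
    have "(\<lambda>x. \<bar>det (matrix (D x))\<bar> *\<^sub>R (vec (f (\<tau> x)) :: real^1)) absolutely_integrable_on S \<and>
        integral S (\<lambda>x. \<bar>det (matrix (D x))\<bar> *\<^sub>R (vec (f (\<tau> x)) :: real^1)) = vec b \<longleftrightarrow>
        (\<lambda>y. vec (f y) :: real^1) absolutely_integrable_on (\<tau> ` S) \<and> integral (\<tau> ` S) (\<lambda>y. vec (f y) :: real^1) = vec b"
      by (rule has_absolute_integral_change_of_variables[OF _ has_derivative_at_withinI[OF der] inj]) (use S in auto)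
    then show ?thesis by (simp add: absolutely_integrable_on_1_iff integral_on_1_eq vec_eq_iff)
  qed
  show ?thesis
    using nn_integral_set_integral[OF m1 nn] nn_integral_set_integral[OF m2] nn key[of "integral (\<tau> ` S) f"] key[of "integral S ?F"]
    by (cases "?F absolutely_integrable_on S") auto
qed

section \<open>The total curvature\<close>

text \<open>By Picard's theorem \<open>g\<close> covers all of a horizontal strip up to one point, so the area formula makes
  the integral of \<open>|g'|\<^sup>2\<close> over the preimage of the strip at least the area of the strip.\<close>

lemma strip_preimage_area_infinite:
  fixes g g' :: "complex \<Rightarrow> complex"
  assumes dg: "\<And>z. (g has_field_derivative g' z) (at z)" and nc: "\<nexists>c. g = (\<lambda>z. c)" and \<omega>: "\<omega> \<noteq> 0"
  defines "S \<equiv> {y::real^2. Re (\<omega> * exp (g (Complex (y$1) (y$2)) - cnj (g (Complex (y$1) (y$2))))) > 0}"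
  shows "S \<in> sets borel" "(\<lambda>y::real^2. (cmod (g' (Complex (y$1) (y$2))))\<^sup>2) \<in> borel_measurable borel"
    "(\<integral>\<^sup>+y\<in>S. ennreal ((cmod (g' (Complex (y$1) (y$2))))\<^sup>2) \<partial>lborel) = \<infinity>"
proof -
  define Z where "Z = (\<lambda>y::real^2. Complex (y$1) (y$2))"
  have cZ: "cplx2 (Z y) = y" and Zc: "Z (cplx2 w) = w" for y w by (simp_all add: Z_def cplx2_Complex)
  have "linear Z" by (simp add: Z_def linear_iff complex_eq_iff)
  then have blZ: "bounded_linear Z" by (simp add: linear_conv_bounded_linear)
  have hol: "g holomorphic_on UNIV" using dg by (auto simp: holomorphic_on_open)
  have "g' = deriv g" using DERIV_imp_deriv[OF dg] by auto
  then have "g' holomorphic_on UNIV" using holomorphic_deriv[OF hol open_UNIV] by simp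
  then have contg: "continuous_on UNIV (\<lambda>y. g' (Z y))" "continuous_on UNIV (\<lambda>y. g (Z y))"
    using hol by (auto intro!: continuous_on_compose2[OF holomorphic_on_imp_continuous_on linear_continuous_on[OF blZ]])
  have S: "S = {y. 0 < Re (\<omega> * exp (g (Z y) - cnj (g (Z y))))}" by (simp add: S_def Z_def)
  have "open S" unfolding S by (intro open_Collect_less continuous_intros contg)
  then show Sb: "S \<in> sets borel" by simp
  define F where "F = (\<lambda>y. (cmod (g' (Z y)))\<^sup>2)"
  have contF: "continuous_on UNIV F" unfolding F_def by (intro continuous_intros contg)
  then show "(\<lambda>y::real^2. (cmod (g' (Complex (y$1) (y$2))))\<^sup>2) \<in> borel_measurable borel"
    unfolding F_def Z_def by (rule borel_measurable_continuous_onI)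
  define G where "G = (\<lambda>y. cplx2 (g (Z y)))"
  define G' where "G' = (\<lambda>y v. cplx2 (g' (Z y) * Z v))"
  have dG: "(G has_derivative G' y) (at y)" for y
  proof -
    have "((\<lambda>y. g (Z y)) has_derivative (\<lambda>v. g' (Z y) * Z v)) (at y)"
      by (rule has_derivative_compose[OF bounded_linear_imp_has_derivative[OF blZ] dg[unfolded has_field_derivative_def]])
    from bounded_linear.has_derivative[OF bounded_linear_cplx2 this] show ?thesis by (simp add: G_def G'_def)
  qed
  have det: "\<bar>det (matrix (G' y))\<bar> = F y" for y
  proof -
    have "det (matrix (G' y)) = F y"
      unfolding F_def cmod_power2 by (simp add: det_2 matrix_def G'_def Z_def axis_def power2_eq_square)
    moreover have "F y \<ge> 0" by (simp add: F_def)
    ultimately show ?thesis by simp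
  qed
  have "(\<integral>\<^sup>+y\<in>S. ennreal (F y) \<partial>lborel) = \<infinity>"
  proof (rule ccontr)
    assume fin: "\<not> ?thesis"
    have meas: "(\<lambda>y. indicator S y * F y) \<in> borel_measurable borel"
      using borel_measurable_continuous_on_indicator[OF Sb continuous_on_subset[OF contF subset_UNIV]] by simp
    have "(\<integral>\<^sup>+y\<in>S. ennreal (F y) \<partial>lborel) = (if F absolutely_integrable_on S then ennreal (integral S F) else \<infinity>)"
      by (rule nn_integral_set_integral[OF meas]) (simp add: F_def)
    with fin have "F absolutely_integrable_on S" by (auto split: if_splits)
    then have "(\<lambda>y. \<bar>det (matrix (G' y))\<bar>) integrable_on S" unfolding det by (simp add: absolutely_integrable_on_def)
    \<comment> \<open>The integrand is the Jacobian determinant of \<open>G\<close>, so a finite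
      integral would give the image of \<open>S\<close> finite measure.\<close>
    then have GS: "G ` S \<in> lmeasurable"
      by (intro measurable_differentiable_image[of S G G'] has_derivative_at_withinI[OF dG]) (use Sb in auto)
    \<comment> \<open>At \<open>t0\<close> the rotated number \<open>\<omega> * exp (2 i t0)\<close>
      is the positive real \<open>cmod \<omega>\<close>; by continuity the inequality defining
      \<open>S\<close> holds when the imaginary part of \<open>g\<close> is close to
      \<open>t0\<close>.\<close>
    define t0 where "t0 = - Arg \<omega> / 2"
    define f where "f = (\<lambda>t::real. Re (\<omega> * exp (2 * \<i> * of_real t)))"
    have "\<omega> * exp (2 * \<i> * of_real t0) = of_real (cmod \<omega>) * (exp (\<i> * of_real (Arg \<omega>)) * exp (2 * \<i> * of_real t0))"
      using Arg_eq[OF \<omega>] by (metis mult.assoc)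
    also have "exp (\<i> * of_real (Arg \<omega>)) * exp (2 * \<i> * of_real t0) = 1" by (simp add: exp_add[symmetric] t0_def)
    finally have e: "\<omega> * exp (2 * \<i> * of_real t0) = of_real (cmod \<omega>) * 1" .
    have "f t0 > 0" unfolding f_def e using \<omega> by simp
    moreover have "open {t. 0 < f t}" unfolding f_def by (intro open_Collect_less continuous_intros)
    ultimately obtain \<delta> where \<delta>: "\<delta> > 0" "cball t0 \<delta> \<subseteq> {t. 0 < f t}" by (metis mem_Collect_eq open_contains_cball)
    obtain w1 where w1: "\<And>w. w \<noteq> w1 \<Longrightarrow> w \<in> range g"
    proof -
      have "\<exists>c. g = (\<lambda>x. c)" if "a \<noteq> b" "a \<notin> range g" "b \<notin> range g" for a b
        by (rule little_Picard[OF hol that(1)]) (use that in auto)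
      then show thesis using that nc by metis
    qed
    define m where "m = measure lebesgue (G ` S \<union> {cplx2 w1})"
    \<comment> \<open>The condition in \<open>S\<close> restricts only the imaginary part of
      \<open>g\<close>. Up to the possibly omitted value \<open>w1\<close>, the image therefore
      contains boxes of height \<open>2 * \<delta>\<close> and arbitrary length
      \<open>n\<close>.\<close>
    have "real n * (2 * \<delta>) \<le> m" for n :: nat
    proof -
      define B where "B = cbox (vector [0, t0 - \<delta>]) (vector [real n, t0 + \<delta>] :: real^2)"
      have ne: "B \<noteq> {}" using \<delta>(1) by (simp add: B_def interval_ne_empty_cart forall_2)
      have "measure lebesgue B = real n * (2 * \<delta>)"
        using content_cbox_cart[OF ne[unfolded B_def]] by (simp add: B_def UNIV_2)
      moreover have "B \<subseteq> G ` S \<union> {cplx2 w1}"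
      proof
        fix v assume v: "v \<in> B"
        show "v \<in> G ` S \<union> {cplx2 w1}"
        proof (cases "Z v = w1")
          case True
          then show ?thesis using cZ[of v] by auto
        next
          case False
          then obtain z where z: "Z v = g z" using w1 by blast
          have "v$2 \<in> cball t0 \<delta>" using v by (simp add: B_def mem_box_cart forall_2 dist_real_def abs_le_iff)
          then have "f (Im (g z)) > 0" using \<delta>(2) z[symmetric] by (auto simp: Z_def)
          moreover have "g z - cnj (g z) = 2 * \<i> * of_real (Im (g z))" by (simp add: complex_eq_iff)
          ultimately have "cplx2 z \<in> S" by (simp add: S Zc f_def)
          moreover have "G (cplx2 z) = v" using z cZ[of v] by (simp add: G_def Zc)
          ultimately show ?thesis by blast
        qed
      qed
      moreover have "G ` S \<union> {cplx2 w1} \<in> lmeasurable" using lmeasurable_cbox[of "cplx2 w1" "cplx2 w1"] by (intro fmeasurable.Un GS) simp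
      ultimately show ?thesis
        unfolding m_def using measure_mono_fmeasurable[of B "G ` S \<union> {cplx2 w1}" lebesgue] by (simp add: B_def)
    qed
    moreover obtain n :: nat where "m / (2 * \<delta>) < real n" using reals_Archimedean2 by blast
    ultimately show False using \<delta>(1) by (metis divide_less_eq linorder_not_less mult_pos_pos zero_less_numeral)
  qed
  then show "(\<integral>\<^sup>+y\<in>S. ennreal ((cmod (g' (Complex (y$1) (y$2))))\<^sup>2) \<partial>lborel) = \<infinity>" by (simp add: F_def Z_def)
qed

text \<open>Here \<open>\<gamma>\<close> is the derivative of the logarithm of \<open>k\<close>.
  With \<open>s = k * cnj h\<close> the curvature is
  \<open>\<bar>\<gamma>\<bar>^2 * (Re s + (Im s)^2 / e) / e^2\<close>, and
  \<open>e \<ge> Re s\<close> gives \<open>e * Re s + (Im s)^2 \<ge> d^2\<close>. Only the factor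
  \<open>e^2\<close> is replaced by its bound \<open>(p + d)^2\<close>; the remaining
  \<open>e\<close> is left to cancel against the area density.\<close>

lemma conic_curvature_lower_bound:
  fixes k h \<gamma> :: complex
  assumes p: "p \<ge> 0" and s: "Re (k * cnj h) > 0"
  defines "e \<equiv> p + Re (k * cnj h)" and "d \<equiv> cmod (h * k)"
  shows "d\<^sup>2 * (cmod \<gamma>)\<^sup>2 / ((p + d)\<^sup>2 * e)
    \<le> - (Re (\<gamma> * k * cnj (- (\<gamma> * h))) - (cmod ((\<gamma> * k * cnj h + - (\<gamma> * h) * cnj k) / 2))\<^sup>2 / e) / e\<^sup>2"
proof -
  define s where "s = k * cnj h"
  have d: "d = cmod s" by (simp add: d_def s_def norm_mult)
  have s0: "Re s > 0" and e: "e = p + Re s" using s by (simp_all add: s_def e_def)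
  then have e0: "e > 0" using p by simp
  have "Re s \<le> d" unfolding d by (rule complex_Re_le_cmod)
  then have "e \<le> p + d" by (simp add: e)
  then have pd: "e\<^sup>2 \<le> (p + d)\<^sup>2" using e0 by (intro power_mono) auto
  have "\<gamma> * k * cnj (- (\<gamma> * h)) = - (of_real ((cmod \<gamma>)\<^sup>2) * s)"
    by (simp add: s_def complex_norm_square mult_ac del: of_real_power)
  then have 1: "Re (\<gamma> * k * cnj (- (\<gamma> * h))) = - ((cmod \<gamma>)\<^sup>2 * Re s)" by (simp del: of_real_power)
  have "s - cnj s = 2 * \<i> * of_real (Im s)" by (simp add: complex_eq_iff)
  moreover have "(\<gamma> * k * cnj h + - (\<gamma> * h) * cnj k) / 2 = \<gamma> * ((s - cnj s) / 2)" by (simp add: s_def algebra_simps)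
  ultimately have 2: "(cmod ((\<gamma> * k * cnj h + - (\<gamma> * h) * cnj k) / 2))\<^sup>2 = (cmod \<gamma>)\<^sup>2 * (Im s)\<^sup>2"
    by (simp add: norm_mult power_mult_distrib)
  have "d\<^sup>2 \<le> e * Re s + (Im s)\<^sup>2"
    unfolding d cmod_power2 using p s0 by (simp add: e power2_eq_square algebra_simps)
  then have "d\<^sup>2 / e \<le> Re s + (Im s)\<^sup>2 / e" using e0 by (simp add: field_simps)
  then have "(cmod \<gamma>)\<^sup>2 * (d\<^sup>2 / e) \<le> (cmod \<gamma>)\<^sup>2 * (Re s + (Im s)\<^sup>2 / e)" by (rule mult_left_mono) simp
  then have "(cmod \<gamma>)\<^sup>2 * (d\<^sup>2 / e) / e\<^sup>2 \<le> (cmod \<gamma>)\<^sup>2 * (Re s + (Im s)\<^sup>2 / e) / e\<^sup>2" by (rule divide_right_mono) simp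
  moreover have "d\<^sup>2 * (cmod \<gamma>)\<^sup>2 / ((p + d)\<^sup>2 * e) \<le> d\<^sup>2 * (cmod \<gamma>)\<^sup>2 / (e\<^sup>2 * e)"
    using e0 pd by (intro divide_left_mono mult_right_mono) (auto intro!: mult_pos_pos intro: less_le_trans)
  moreover have "d\<^sup>2 * (cmod \<gamma>)\<^sup>2 / (e\<^sup>2 * e) = (cmod \<gamma>)\<^sup>2 * (d\<^sup>2 / e) / e\<^sup>2" by (simp add: mult_ac)
  moreover have "- (- ((cmod \<gamma>)\<^sup>2 * Re s) - (cmod \<gamma>)\<^sup>2 * (Im s)\<^sup>2 / e) = (cmod \<gamma>)\<^sup>2 * (Re s + (Im s)\<^sup>2 / e)"
    by (simp add: algebra_simps)
  ultimately show ?thesis unfolding 1 2 by simp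
qed

section \<open>The Weierstrass data of a surface in normal form\<close>

context
  fixes M :: "'a surface" and L :: "real^4 \<Rightarrow> real^4" and \<alpha> \<beta> :: complex and \<kappa> :: real
  assumes M: "spacelike_surface M" and st: "stationary M" and nf: "normal_form M L \<alpha> \<beta>"
    and fc: "flat_comparable M (\<lambda>v. pr12 (L v)) \<kappa>"
    and bij: "bij_betw (\<lambda>p. pr12 (L (imm M p))) (pts M) UNIV"
begin

abbreviation (input) isoP where "isoP \<equiv> iso_par M L \<alpha> \<beta>"
abbreviation (input) isoX where "isoX \<equiv> iso_imm M L \<alpha> \<beta>"
abbreviation (input) isoY where "isoY \<equiv> \<lambda>y. L (iso_imm M L \<alpha> \<beta> y)"

lemma nf_L: "lorentz L" and nf_Im: "Im (\<alpha> * cnj \<beta>) \<noteq> 0"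
  using nf by (auto simp: normal_form_def)

lemmas sec_facts = sec_in[OF M st nf_L fc bij] flat_sec[OF M st nf_L fc bij] sec_flat[OF M st nf_L fc bij]
lemmas sec_chart' = sec_chart[OF M st nf_L fc bij]

lemma iso_par_in: "isoP y \<in> pts M" and flat_iso_par: "pr12 (L (imm M (isoP y))) = flat_of \<alpha> \<beta> y"
  unfolding iso_par_def by (rule sec_facts)+

lemma iso_par_left: "p \<in> pts M \<Longrightarrow> isoP (iso_of \<alpha> \<beta> (pr12 (L (imm M p)))) = p"
  unfolding iso_par_def iso_flat[OF nf_Im] by (rule sec_facts)

lemma iso_par_right: "iso_of \<alpha> \<beta> (pr12 (L (imm M (isoP y)))) = y"
  by (simp add: flat_iso_par iso_flat[OF nf_Im])

lemma iso_par_chart: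
  assumes d: "d \<in> atlas M"
  shows "open {y. isoP y \<in> fst d}" "smooth_on (\<lambda>y. snd d (isoP y)) {y. isoP y \<in> fst d}"
    "isoP y \<in> fst d \<Longrightarrow> jac (\<lambda>y. snd d (isoP y)) y \<noteq> 0"
proof -
  let ?s = "inv_into (pts M) (\<lambda>p. pr12 (L (imm M p)))" and ?f = "flat_of \<alpha> \<beta>"
  note c = sec_chart'[OF d]
  have eq: "{y. isoP y \<in> fst d} = ?f -` {z. ?s z \<in> fst d}" by (auto simp: iso_par_def)
  have cont: "isCont ?f x" for x by (rule linear_continuous_at[OF bounded_linear_flat_of])
  show o: "open {y. isoP y \<in> fst d}" unfolding eq by (rule open_vimage[OF c(1)]) (use cont in \<open>simp add: continuous_at_imp_continuous_on\<close>)
  have smf: "smooth_on ?f {y. isoP y \<in> fst d}" by (rule smooth_on_linear[OF bounded_linear_flat_of o])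
  have "smooth_on (\<lambda>y. snd d (?s (?f y))) {y. isoP y \<in> fst d}"
    by (rule smooth_on_compose[OF c(2) smf _ o c(1)]) (auto simp: iso_par_def)
  then show "smooth_on (\<lambda>y. snd d (isoP y)) {y. isoP y \<in> fst d}" by (simp add: iso_par_def)
  assume y: "isoP y \<in> fst d"
  then have fy: "?s (?f y) \<in> fst d" by (simp add: iso_par_def)
  have "jac (\<lambda>y. snd d (?s (?f y))) y = jac (\<lambda>z. snd d (?s z)) (?f y) * jac ?f y"
    by (rule jac_compose[OF smooth_on_differentiable[OF o smf] smooth_on_differentiable[OF c(1,2)]])
       (use y fy in auto)
  then show "jac (\<lambda>y. snd d (isoP y)) y \<noteq> 0"
    using c(3)[OF fy] flat_of_axis(5)[OF nf_Im] by (simp add: iso_par_def)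
qed

lemma iso_imm_chart:
  assumes d: "d \<in> atlas M" and y: "isoP y \<in> fst d"
  shows "isoX y = param M d (snd d (isoP y))" "snd d (isoP y) \<in> chart_image d"
  using atlas_inv_left[OF M d y] y by (simp_all add: iso_imm_def param_def)

lemma iso_imm_local:
  assumes d: "d \<in> atlas M" and y: "isoP y \<in> fst d"
  shows "regular_on isoX {y. isoP y \<in> fst d}" "mean_curvature isoX y = 0"
    "local_gauss_curvature isoX y = local_gauss_curvature (param M d) (snd d (isoP y))"
    "gramX isoX y = (jac (\<lambda>y. snd d (isoP y)) y)\<^sup>2 * gramX (param M d) (snd d (isoP y))"
    "pd i isoX y = (pd i (\<lambda>y. snd d (isoP y)) y $ 1) *\<^sub>R pd 1 (param M d) (snd d (isoP y)) + (pd i (\<lambda>y. snd d (isoP y)) y $ 2) *\<^sub>R pd 2 (param M d) (snd d (isoP y))"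
proof -
  note c = iso_par_chart[OF d]
  have img: "(\<lambda>y. snd d (isoP y)) ` {y. isoP y \<in> fst d} \<subseteq> chart_image d" by auto
  have XY: "\<And>y. y \<in> {y. isoP y \<in> fst d} \<Longrightarrow> isoX y = param M d (snd d (isoP y))" using iso_imm_chart(1)[OF d] by simp
  have J: "\<And>y. y \<in> {y. isoP y \<in> fst d} \<Longrightarrow> jac (\<lambda>y. snd d (isoP y)) y \<noteq> 0" using c(3) by simp
  have yin: "y \<in> {y. isoP y \<in> fst d}" using y by simp
  note reg = atlas_regular[OF M d]
  show "regular_on isoX {y. isoP y \<in> fst d}" by (rule reparam_regular[OF reg c(1,2) img XY J])
  show "local_gauss_curvature isoX y = local_gauss_curvature (param M d) (snd d (isoP y))"
    by (rule reparam_gauss_curvature[OF reg c(1,2) img XY J yin])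
  show "gramX isoX y = (jac (\<lambda>y. snd d (isoP y)) y)\<^sup>2 * gramX (param M d) (snd d (isoP y))"
    by (rule reparam_gram[OF reg c(1,2) img XY J yin])
  show "pd i isoX y = (pd i (\<lambda>y. snd d (isoP y)) y $ 1) *\<^sub>R pd 1 (param M d) (snd d (isoP y)) + (pd i (\<lambda>y. snd d (isoP y)) y $ 2) *\<^sub>R pd 2 (param M d) (snd d (isoP y))"
    by (rule reparam_pd[OF reg c(1,2) img XY yin])
  have "mean_curvature (param M d) (snd d (isoP y)) = 0"
    using st d iso_imm_chart(2)[OF d y] unfolding stationary_def by blast
  then show "mean_curvature isoX y = 0" by (intro reparam_mean_curvature[OF reg c(1,2) img XY J yin])
qed

lemma iso_par_cover: obtains d where "d \<in> atlas M" "isoP y \<in> fst d"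
  using atlas_cover[OF M iso_par_in] by blast

lemma iso_imm_regular: "regular_on isoX UNIV" and iso_imm_mean_curvature: "mean_curvature isoX y = 0"
proof -
  have "smooth_on isoX UNIV"
  proof (rule smooth_on_local)
    fix y obtain d where d: "d \<in> atlas M" "isoP y \<in> fst d" by (rule iso_par_cover)
    show "\<exists>U. open U \<and> y \<in> U \<and> smooth_on isoX U"
      using iso_imm_local(1)[OF d] d(2) by (intro exI[of _ "{y. isoP y \<in> fst d}"]) (auto simp: regular_on_def)
  qed simp
  moreover have "spacelike_frame (pd 1 isoX y) (pd 2 isoX y)" for y
  proof -
    obtain d where d: "d \<in> atlas M" "isoP y \<in> fst d" by (rule iso_par_cover)
    show ?thesis using iso_imm_local(1)[OF d] d(2) by (simp add: regular_on_def)
  qed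
  ultimately show "regular_on isoX UNIV" by (simp add: regular_on_def)
  obtain d where d: "d \<in> atlas M" "isoP y \<in> fst d" by (rule iso_par_cover)
  show "mean_curvature isoX y = 0" by (rule iso_imm_local(2)[OF d])
qed

lemma L_imm_regular: "regular_on isoY UNIV" and pd_L_imm: "pd i isoY y = L (pd i isoX y)"
  and L_imm_mean_curvature: "mean_curvature isoY y = 0"
proof -
  have l: "linear L" "\<And>u v. mink (L u) (L v) = mink u v" using nf_L by (auto simp: lorentz_def)
  note iso = isometry_regular[OF iso_imm_regular l, of "isoY" 0]
  show "regular_on isoY UNIV" by (rule iso(1)) simp
  show "pd i isoY y = L (pd i isoX y)" by (rule iso(2)) simp_all
  show "mean_curvature isoY y = 0" by (rule iso(3)) (simp_all add: iso_imm_mean_curvature)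
qed

lemma pr12_pd: "pr12 (pd i isoY y) = flat_of \<alpha> \<beta> (axis i 1)"
proof -
  have "pr12 (pd i isoY y) = pd i (\<lambda>y. pr12 (isoY y)) y"
    by (rule pd_bounded_linear[symmetric]) (use linear_pr12 reg_diff(1)[OF L_imm_regular] in \<open>auto simp: linear_conv_bounded_linear\<close>)
  also have "(\<lambda>y. pr12 (isoY y)) = flat_of \<alpha> \<beta>" using flat_iso_par by (simp add: iso_imm_def fun_eq_iff)
  finally show ?thesis by (simp add: pd_linear[OF bounded_linear_flat_of])
qed

text \<open>Contracting the null vector \<open>n\<close> of the global parametrisation with
  \<open>(\<alpha>, \<beta>)\<close> and with the conjugate pair gives \<open>W + i F - E\<close>
  and \<open>W + i F + E\<close>. By the normal form one of these vanishes, depending on the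
  orientation of the parameter. The second cannot, as \<open>W\<close> and \<open>E\<close> are
  positive; so the parameter is positively oriented, \<open>W = E\<close> and
  \<open>F = 0\<close>.\<close>

lemma iso_conformal:
  "mink (pd 1 isoX y) (pd 1 isoX y) = mink (pd 2 isoX y) (pd 2 isoX y)" "mink (pd 1 isoX y) (pd 2 isoX y) = 0"
  "gauss_map M (isoP y) = proj (complex_deriv_z isoX y)"
proof -
  obtain d where d: "d \<in> atlas M" "isoP y \<in> fst d" by (rule iso_par_cover)
  define q where "q = snd d (isoP y)"
  have q: "q \<in> chart_image d" using d(2) by (simp add: q_def)
  let ?t = "\<lambda>y. snd d (isoP y)"
  define n where "n = clin L (null_vec (pd 1 isoX y) (pd 2 isoX y))"
  define E F W where "E = mink (pd 1 isoX y) (pd 1 isoX y)" and "F = mink (pd 1 isoX y) (pd 2 isoX y)" and "W = sqrt (gramX isoX y)"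
  note fr = reg_frame[OF iso_imm_regular UNIV_I, of y]
  have pos: "E > 0" "W > 0" using fr spacelike_frame_gram[OF fr] by (simp_all add: E_def W_def spacelike_frame_def)
  define a b where "a = flat_of \<alpha> \<beta> (axis 1 1)" and "b = flat_of \<alpha> \<beta> (axis 2 1)"
  note ax = flat_of_axis[OF nf_Im, folded a_def b_def]
  have mL: "\<And>u v. mink (L u) (L v) = mink u v" using nf_L by (simp add: lorentz_def)
  have ab: "L (pd 1 isoX y) $ 1 = a $ 1" "L (pd 1 isoX y) $ 2 = a $ 2" "L (pd 2 isoX y) $ 1 = b $ 1" "L (pd 2 isoX y) $ 2 = b $ 2"
    using pr12_pd[of 1 y] pr12_pd[of 2 y] by (simp_all add: pd_L_imm a_def b_def pr12_def vec_eq_iff forall_2)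
  have n: "n $ 1 = Complex W F * of_real (a$1) - \<i> * of_real E * of_real (b$1)" "n $ 2 = Complex W F * of_real (a$2) - \<i> * of_real E * of_real (b$2)"
    unfolding n_def clin_null_vec[OF nf_L] by (simp_all add: null_vec_def gram_def mL ab cvec_def E_def F_def W_def)
  have n1: "\<alpha> * n$1 + \<beta> * n$2 = Complex W F - of_real E"
  proof -
    have "\<alpha> * n$1 + \<beta> * n$2 = Complex W F * (\<alpha> * of_real (a$1) + \<beta> * of_real (a$2)) - \<i> * of_real E * (\<alpha> * of_real (b$1) + \<beta> * of_real (b$2))"
      unfolding n by (simp add: algebra_simps)
    then show ?thesis unfolding ax by (simp add: algebra_simps)
  qed
  have n2: "cnj \<alpha> * n$1 + cnj \<beta> * n$2 = Complex W F + of_real E"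
  proof -
    have "cnj \<alpha> * n$1 + cnj \<beta> * n$2 = Complex W F * (cnj \<alpha> * of_real (a$1) + cnj \<beta> * of_real (a$2)) - \<i> * of_real E * (cnj \<alpha> * of_real (b$1) + cnj \<beta> * of_real (b$2))"
      unfolding n by (simp add: algebra_simps)
    then show ?thesis unfolding ax by (simp add: algebra_simps)
  qed
  define v where "v = clin L (nvec M d q)"
  have v: "\<alpha> * v$1 + \<beta> * v$2 = 0" using nf d(1) q unfolding normal_form_def v_def by blast
  have J: "pd 1 ?t y $ 1 * pd 2 ?t y $ 2 - pd 2 ?t y $ 1 * pd 1 ?t y $ 2 \<noteq> 0" using iso_par_chart(3)[OF d] by (simp add: jac_def)
  obtain \<mu> where \<mu>: "\<mu> \<noteq> 0" "null_vec (pd 1 isoX y) (pd 2 isoX y)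
      = \<mu> *s (if pd 1 ?t y $ 1 * pd 2 ?t y $ 2 - pd 2 ?t y $ 1 * pd 1 ?t y $ 2 > 0 then nvec M d q else cnj_vec (nvec M d q))"
    using null_vec_change_frame[OF reg_frame[OF atlas_regular[OF M d(1)] q] J]
    unfolding iso_imm_local(5)[OF d] nvec_def q_def by blast
  have linL: "linear L" using nf_L by (simp add: lorentz_def)
  have n\<mu>: "n = \<mu> *s (if pd 1 ?t y $ 1 * pd 2 ?t y $ 2 - pd 2 ?t y $ 1 * pd 1 ?t y $ 2 > 0 then v else cnj_vec v)"
    unfolding n_def \<mu>(2) v_def by (simp add: clin_smult[OF linL] clin_cnj_vec[OF linL])
  have J': "pd 1 ?t y $ 1 * pd 2 ?t y $ 2 - pd 2 ?t y $ 1 * pd 1 ?t y $ 2 > 0"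
  proof (rule ccontr)
    assume "\<not> ?thesis"
    with n\<mu> have "n = \<mu> *s cnj_vec v" by (simp only: if_False)
    then have "cnj \<alpha> * n$1 + cnj \<beta> * n$2 = \<mu> * cnj (\<alpha> * v$1 + \<beta> * v$2)" by (simp add: cnj_vec_def algebra_simps)
    then have "W + E = 0" unfolding n2 v by (simp add: complex_eq_iff)
    with pos show False by simp
  qed
  with n\<mu> have "n = \<mu> *s v" by (simp only: if_True)
  then have "\<alpha> * n$1 + \<beta> * n$2 = \<mu> * (\<alpha> * v$1 + \<beta> * v$2)" by (simp add: algebra_simps)
  then have WE: "W = E" "F = 0" unfolding n1 v by (simp_all add: complex_eq_iff)
  then have F: "mink (pd 1 isoX y) (pd 2 isoX y) = 0" by (simp add: F_def)
  have "E * E = E * mink (pd 2 isoX y) (pd 2 isoX y)"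
    using sqrt_gram_square[OF fr] WE unfolding W_def E_def F by simp
  with pos have E: "mink (pd 1 isoX y) (pd 1 isoX y) = mink (pd 2 isoX y) (pd 2 isoX y)" by (simp add: E_def)
  show "mink (pd 1 isoX y) (pd 1 isoX y) = mink (pd 2 isoX y) (pd 2 isoX y)" "mink (pd 1 isoX y) (pd 2 isoX y) = 0" using E F .
  have "gauss_map M (isoP y) = proj (nvec M d q)" unfolding q_def by (rule gauss_map_eq[OF M st d])
  also have "\<dots> = proj (null_vec (pd 1 isoX y) (pd 2 isoX y))" using \<mu> J' by (simp add: proj_smult)
  also have "null_vec (pd 1 isoX y) (pd 2 isoX y) = complex_of_real (2 * mink (pd 1 isoX y) (pd 1 isoX y)) *s complex_deriv_z isoX y"
    by (rule null_vec_isothermal[OF fr]) (simp_all add: metric_coeff_def E F)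
  also have "proj \<dots> = proj (complex_deriv_z isoX y)"
    by (rule proj_smult) (use pos in \<open>simp add: E_def\<close>)
  finally show "gauss_map M (isoP y) = proj (complex_deriv_z isoX y)" .
qed

lemma L_imm_conformal: "mink (pd 1 isoY y) (pd 1 isoY y) = mink (pd 2 isoY y) (pd 2 isoY y)" "mink (pd 1 isoY y) (pd 2 isoY y) = 0"
  using iso_conformal nf_L unfolding pd_L_imm by (simp_all add: lorentz_def)

text \<open>In a conformal parameter the metric quotients in \<open>stationary_divergence\<close>
  are 0 and 1, which leaves the flat Laplacian.\<close>

lemma L_imm_harmonic: "pd 1 (pd 1 isoY) y + pd 2 (pd 2 isoY) y = 0"
proof -
  have W: "sqrt (gramX isoY q) = mink (pd 1 isoY q) (pd 1 isoY q)" and pos: "mink (pd 1 isoY q) (pd 1 isoY q) > 0" for q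
    using reg_frame[OF L_imm_regular UNIV_I, of q] L_imm_conformal[of q] by (auto simp: gram_def spacelike_frame_def)
  have "(\<lambda>q. (mink (pd 2 isoY q) (pd 2 isoY q) / sqrt (gramX isoY q)) *\<^sub>R pd 1 isoY q - (mink (pd 1 isoY q) (pd 2 isoY q) / sqrt (gramX isoY q)) *\<^sub>R pd 2 isoY q) = pd 1 isoY"
    "(\<lambda>q. (mink (pd 1 isoY q) (pd 1 isoY q) / sqrt (gramX isoY q)) *\<^sub>R pd 2 isoY q - (mink (pd 1 isoY q) (pd 2 isoY q) / sqrt (gramX isoY q)) *\<^sub>R pd 1 isoY q) = pd 2 isoY"
    unfolding W L_imm_conformal(2) L_imm_conformal(1)[symmetric] using pos by (auto simp: less_imp_neq[symmetric])
  then show ?thesis using stationary_divergence[OF L_imm_regular UNIV_I L_imm_mean_curvature, of y] by simp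
qed

text \<open>\<open>L\<close> preserves the metric coefficients, from which the whole definition of
  the curvature is built; invariance under reparametrisation makes the description unique.\<close>

lemma iso_gauss_curvature: "gauss_curvature M (isoP y) = local_gauss_curvature isoY y"
proof -
  have 1: "metric_coeff isoX = metric_coeff isoY"
    using nf_L by (auto simp: fun_eq_iff metric_coeff_def pd_L_imm lorentz_def)
  then have 2: "metric_matrix isoX = metric_matrix isoY" by (intro ext) (simp only: metric_matrix_def)
  then have "inv_metric isoX = inv_metric isoY" by (intro ext) (simp only: inv_metric_def)
  with 1 have "christoffel isoX = christoffel isoY" by (intro ext) (simp only: christoffel_def)
  then have "riemann_122 isoX = riemann_122 isoY" by (intro ext) (simp only: riemann_122_def)
  with 1 2 have "local_gauss_curvature isoX = local_gauss_curvature isoY" by (intro ext) (simp only: local_gauss_curvature_def)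
  then have key: "local_gauss_curvature isoY y = local_gauss_curvature (param M d) (snd d (isoP y))" if "d \<in> atlas M" "isoP y \<in> fst d" for d
    using iso_imm_local(3)[OF that] by simp
  obtain d where d: "d \<in> atlas M" "isoP y \<in> fst d" by (rule iso_par_cover)
  show ?thesis unfolding gauss_curvature_def
  proof (rule the_equality)
    show "\<exists>c\<in>atlas M. isoP y \<in> fst c \<and> local_gauss_curvature isoY y = local_gauss_curvature (param M c) (snd c (isoP y))"
      using d key[OF d] by blast
    show "k = local_gauss_curvature isoY y"
      if "\<exists>c\<in>atlas M. isoP y \<in> fst c \<and> k = local_gauss_curvature (param M c) (snd c (isoP y))" for k
      using that by (elim bexE conjE) (simp only: key)
  qed
qed

text \<open>\<open>a\<close> and \<open>b\<close> are constant because the first two coordinates of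
  the surface moved by \<open>L\<close> are linear in the isothermal parameter, and the product of
  \<open>h\<close> and \<open>k\<close> is fixed by nullity. The Gauss map is that of the surface
  itself, so \<open>L\<close> is undone by its inverse \<open>L'\<close>.\<close>

lemma weierstrass_data:
  obtains a b k h k' h' L' where "\<alpha> * a + \<beta> * b = 0" "lorentz L'"
    "\<And>z. (k has_field_derivative k' z) (at z)" "\<And>z. (h has_field_derivative h' z) (at z)"
    "\<And>z. h z * k z = - (a\<^sup>2 + b\<^sup>2)"
    "\<And>z. gauss_map M (isoP (cplx2 z)) = proj (clin L' (conic_point a b (k z) (h z)))"
    "\<And>z. (cmod a)\<^sup>2 + (cmod b)\<^sup>2 + Re (k z * cnj (h z)) > 0"
    "\<And>z. sqrt (gramX isoX (cplx2 z)) = 2 * ((cmod a)\<^sup>2 + (cmod b)\<^sup>2 + Re (k z * cnj (h z)))"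
    "\<And>z. gauss_curvature M (isoP (cplx2 z)) =
       - (Re (k' z * cnj (h' z)) - (cmod ((k' z * cnj (h z) + h' z * cnj (k z)) / 2))\<^sup>2 / ((cmod a)\<^sup>2 + (cmod b)\<^sup>2 + Re (k z * cnj (h z))))
         / ((cmod a)\<^sup>2 + (cmod b)\<^sup>2 + Re (k z * cnj (h z)))\<^sup>2"
proof -
  note reg = L_imm_regular
  have L: "lorentz L" and im: "Im (\<alpha> * cnj \<beta>) \<noteq> 0" using nf by (auto simp: normal_form_def)
  obtain L' where L': "lorentz L'" "\<And>u. L' (L u) = u" using lorentz_inverse[OF L] by metis
  define e1 e2 where "e1 = flat_of \<alpha> \<beta> (axis 1 1)" and "e2 = flat_of \<alpha> \<beta> (axis 2 1)"
  note ax = flat_of_axis[OF im, folded e1_def e2_def]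
  have f: "pd 1 isoY y $ 1 = e1 $ 1" "pd 1 isoY y $ 2 = e1 $ 2" "pd 2 isoY y $ 1 = e2 $ 1" "pd 2 isoY y $ 2 = e2 $ 2" for y
    using pr12_pd[of 1 y] pr12_pd[of 2 y] by (simp_all add: e1_def e2_def pr12_def vec_eq_iff forall_2)
  define a b where "a = Complex (e1$1 / 2) (- e2$1 / 2)" and "b = Complex (e1$2 / 2) (- e2$2 / 2)"
  define k where "k = (\<lambda>z. dz isoY 3 z + dz isoY 4 z)"
  define h where "h = (\<lambda>z. dz isoY 3 z - dz isoY 4 z)"
  define k' where "k' = (\<lambda>z. dz2 isoY 3 z + dz2 isoY 4 z)"
  define h' where "h' = (\<lambda>z. dz2 isoY 3 z - dz2 isoY 4 z)"
  note der = harmonic_dz_has_derivative[OF reg_smooth[OF reg] L_imm_harmonic]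
  have dk: "(k has_field_derivative k' z) (at z)" and dh: "(h has_field_derivative h' z) (at z)" for z
    unfolding k_def h_def k'_def h'_def by (intro DERIV_add DERIV_diff der)+
  have dzc: "dz isoY j z = Complex (pd 1 isoY (cplx2 z) $ j / 2) (- pd 2 isoY (cplx2 z) $ j / 2)" for j z
    by (simp add: dz_def complex_deriv_z_def complex_eq_iff)
  have k: "k z = Complex ((pd 1 isoY (cplx2 z) $ 3 + pd 1 isoY (cplx2 z) $ 4) / 2) (- (pd 2 isoY (cplx2 z) $ 3 + pd 2 isoY (cplx2 z) $ 4) / 2)"
    and h: "h z = Complex ((pd 1 isoY (cplx2 z) $ 3 - pd 1 isoY (cplx2 z) $ 4) / 2) (- (pd 2 isoY (cplx2 z) $ 3 - pd 2 isoY (cplx2 z) $ 4) / 2)"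
    and k': "k' z = Complex ((pd 1 (pd 1 isoY) (cplx2 z) $ 3 + pd 1 (pd 1 isoY) (cplx2 z) $ 4) / 2) (- (pd 1 (pd 2 isoY) (cplx2 z) $ 3 + pd 1 (pd 2 isoY) (cplx2 z) $ 4) / 2)"
    and h': "h' z = Complex ((pd 1 (pd 1 isoY) (cplx2 z) $ 3 - pd 1 (pd 1 isoY) (cplx2 z) $ 4) / 2) (- (pd 1 (pd 2 isoY) (cplx2 z) $ 3 - pd 1 (pd 2 isoY) (cplx2 z) $ 4) / 2)" for z
    by (simp_all add: k_def h_def k'_def h'_def dzc dz2_def complex_eq_iff field_simps)
  have hk: "h z * k z = - (a\<^sup>2 + b\<^sup>2)" for z
    using L_imm_conformal[of "cplx2 z"] unfolding mink_def f
    by (simp add: h k a_def b_def complex_eq_iff power2_eq_square field_simps)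
  have hk': "k' z * h z + k z * h' z = 0" for z
  proof -
    have "((\<lambda>z. k z * h z) has_field_derivative k' z * h z + h' z * k z) (at z)" by (rule DERIV_mult[OF dk dh])
    moreover have "(\<lambda>z. k z * h z) = (\<lambda>z. - (a\<^sup>2 + b\<^sup>2))" using hk by (simp add: mult.commute)
    ultimately have "k' z * h z + h' z * k z = 0" by (metis DERIV_unique DERIV_const)
    then show ?thesis by (simp add: mult.commute)
  qed
  define \<epsilon> where "\<epsilon> = (\<lambda>z. (cmod a)\<^sup>2 + (cmod b)\<^sup>2 + Re (k z * cnj (h z)))"
  define E where "E = (\<lambda>z. mink (pd 1 isoY (cplx2 z)) (pd 1 isoY (cplx2 z)))"
  have E\<epsilon>: "E z = 2 * \<epsilon> z" for z
  proof -
    have "E z = (mink (pd 1 isoY (cplx2 z)) (pd 1 isoY (cplx2 z)) + mink (pd 2 isoY (cplx2 z)) (pd 2 isoY (cplx2 z))) / 2"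
      using L_imm_conformal(1) by (simp add: E_def)
    then show ?thesis unfolding mink_def f \<epsilon>_def h k a_def b_def cmod_power2
      by (simp add: power2_eq_square field_simps)
  qed
  have Epos: "E z > 0" for z using reg_frame[OF reg UNIV_I, of "cplx2 z"] by (simp add: E_def spacelike_frame_def)
  have dd: "pd i (pd j isoY) q $ 1 = 0" "pd i (pd j isoY) q $ 2 = 0" for i j q
  proof -
    have "pr12 (pd i (pd j isoY) q) = pd i (\<lambda>y. pr12 (pd j isoY y)) q"
      by (rule pd_bounded_linear[symmetric]) (use linear_pr12 reg_diff(2)[OF reg] in \<open>auto simp: linear_conv_bounded_linear\<close>)
    also have "\<dots> = 0" unfolding pr12_pd by simp
    finally show "pd i (pd j isoY) q $ 1 = 0" "pd i (pd j isoY) q $ 2 = 0" by (simp_all add: pr12_def vec_eq_iff forall_2)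
  qed
  have curv: "gauss_curvature M (isoP (cplx2 z)) =
       - (Re (k' z * cnj (h' z)) - (cmod ((k' z * cnj (h z) + h' z * cnj (k z)) / 2))\<^sup>2 / \<epsilon> z) / (\<epsilon> z)\<^sup>2" for z
  proof -
    let ?q = "cplx2 z"
    have w: "pd 2 (pd 2 isoY) ?q = - pd 1 (pd 1 isoY) ?q"
      using L_imm_harmonic[of ?q] by (simp add: eq_neg_iff_add_eq_0 add.commute)
    have "gauss_curvature M (isoP ?q) = - 4 * (Re (k' z * cnj (h' z)) - (cmod ((k' z * cnj (h z) + h' z * cnj (k z)) / 2))\<^sup>2 / (E z / 2)) / (E z)\<^sup>2"
      unfolding iso_gauss_curvature local_gauss_curvature_eq[OF reg UNIV_I] w k h k' h'
      by (rule conic_curvature[OF _ _ _ Epos])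
         (use L_imm_conformal[of ?q] hk'[of z] in \<open>simp_all only: E_def dd k h k' h' refl\<close>)
    moreover have "- 4 * A / (2 * e)\<^sup>2 = - A / e\<^sup>2" "2 * e / 2 = e" for A e :: real
      by (simp_all add: power2_eq_square)
    ultimately show ?thesis unfolding E\<epsilon> by (simp only:)
  qed
  have gm: "gauss_map M (isoP (cplx2 z)) = proj (clin L' (conic_point a b (k z) (h z)))" for z
  proof -
    have c: "complex_deriv_z X q = (\<chi> k. Complex (pd 1 X q $ k / 2) (- pd 2 X q $ k / 2))" for X q
      by (simp add: complex_deriv_z_def vec_eq_iff complex_eq_iff)
    have RI: "Re_vec (complex_deriv_z X q) = (1/2) *\<^sub>R pd 1 X q" "Im_vec (complex_deriv_z X q) = (- 1/2) *\<^sub>R pd 2 X q" for X q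
      by (simp_all add: c Re_vec_def Im_vec_def vec_eq_iff)
    have lin: "linear L'" using L'(1) by (simp add: lorentz_def)
    have "complex_deriv_z isoX (cplx2 z) = clin L' (complex_deriv_z isoY (cplx2 z))"
      by (rule Re_Im_eqI) (simp_all only: Re_Im_clin RI linear_scale[OF lin] pd_L_imm L'(2))
    also have "complex_deriv_z isoY (cplx2 z) = conic_point a b (k z) (h z)"
      by (simp add: c conic_point_def vec4_eq_iff f a_def b_def k h complex_eq_iff field_simps)
    finally show ?thesis using iso_conformal(3) by simp
  qed
  have "\<alpha> * a + \<beta> * b = ((\<alpha> * of_real (e1$1) + \<beta> * of_real (e1$2)) - \<i> * (\<alpha> * of_real (e2$1) + \<beta> * of_real (e2$2))) / 2"
    by (simp add: a_def b_def complex_eq_iff field_simps)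
  then have ab: "\<alpha> * a + \<beta> * b = 0" unfolding ax by simp
  have area: "sqrt (gramX isoX (cplx2 z)) = 2 * \<epsilon> z" for z
  proof -
    have "gramX isoX (cplx2 z) = (E z)\<^sup>2"
      using iso_conformal(1,2)[of "cplx2 z"] L by (simp add: gram_def E_def pd_L_imm lorentz_def power2_eq_square)
    then have "sqrt (gramX isoX (cplx2 z)) = E z" using Epos[of z] by simp
    then show ?thesis by (simp only: E\<epsilon>)
  qed
  have "\<epsilon> z > 0" for z using Epos[of z] by (simp add: E\<epsilon>)
  then show thesis
    by (intro that[OF ab L'(1) dk dh hk gm] area[unfolded \<epsilon>_def] curv[unfolded \<epsilon>_def]) (simp only: \<epsilon>_def)
qed

section \<open>The area measure as a push-forward\<close>

abbreviation (input) paW where "paW \<equiv> \<lambda>y. sqrt (gramX isoX y)"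
abbreviation (input) paS where "paS \<equiv> sigma (pts M) {U. openin (points M) U}"

lemma iso_par_bij: "bij_betw isoP UNIV (pts M)"
  by (rule bij_betw_byWitness[where f' = "\<lambda>p. iso_of \<alpha> \<beta> (pr12 (L (imm M p)))"])
     (auto simp: iso_par_left iso_par_right iso_par_in)

lemma sets_paS: "sets paS = sigma_sets (pts M) {U. openin (points M) U}" "space paS = pts M"
  using openin_subset by (auto simp: sets_measure_of_conv space_measure_of_conv)

lemma iso_par_measurable: "isoP \<in> borel \<rightarrow>\<^sub>M paS"
proof (rule measurable_measure_of)
  show "{U. openin (points M) U} \<subseteq> Pow (pts M)" using openin_subset by auto
  show "isoP \<in> space borel \<rightarrow> pts M" using iso_par_in by auto
  fix U assume "U \<in> {U. openin (points M) U}"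
  then have U: "openin (points M) U" by simp
  let ?s = "inv_into (pts M) (\<lambda>p. pr12 (L (imm M p)))"
  have "continuous_map (top_of_set UNIV) (points M) ?s"
    using bij_section[OF M fc bij] by (simp add: flat_section_def[OF M fc])
  then have "open {z. ?s z \<in> U}" using openin_continuous_map_preimage[OF _ U, of euclidean ?s] by simp
  then have "open (flat_of \<alpha> \<beta> -` {z. ?s z \<in> U})"
    by (rule open_vimage) (simp add: linear_continuous_on[OF bounded_linear_flat_of])
  moreover have "flat_of \<alpha> \<beta> -` {z. ?s z \<in> U} = isoP -` U" by (auto simp: iso_par_def)
  ultimately show "isoP -` U \<inter> space borel \<in> sets borel" by simp
qed

lemma area_density_measurable: "(\<lambda>y. ennreal (paW y)) \<in> borel_measurable lborel"
proof -
  have "continuous_on UNIV paW"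
    by (rule smooth_on_continuous[OF smooth_sqrt_gram[OF iso_imm_regular]])
  then have "paW \<in> borel_measurable borel" by (rule borel_measurable_continuous_onI)
  from measurable_compose[OF this measurable_ennreal] show ?thesis by simp
qed

text \<open>The candidate for \<open>area_measure\<close>: Lebesgue measure of the parameter plane,
  weighted by the area density and pushed to the surface.\<close>

definition paM :: "'a measure" where
  "paM = distr (density lborel (\<lambda>y. ennreal (paW y))) paS isoP"

lemma emeasure_paM: "B \<in> sets paS \<Longrightarrow> emeasure paM B = (\<integral>\<^sup>+y\<in>isoP -` B. ennreal (paW y) \<partial>lborel)"
proof -
  assume B: "B \<in> sets paS"
  have m: "isoP \<in> density lborel (\<lambda>y. ennreal (paW y)) \<rightarrow>\<^sub>M paS" using iso_par_measurable by simp
  have "isoP -` B \<in> sets lborel" using measurable_sets[OF iso_par_measurable B] by simp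
  then show ?thesis
    unfolding paM_def by (simp add: emeasure_distr[OF m B] emeasure_density[OF area_density_measurable])
qed

text \<open>A change of variables from the global parameter to the chart; by
  \<open>reparam_gram\<close> the area densities differ exactly by the modulus of the
  Jacobian.\<close>

lemma paM_chart:
  assumes c: "c \<in> atlas M" and B: "B \<in> sets paS" "B \<subseteq> fst c"
  shows "emeasure paM B = (\<integral>\<^sup>+q\<in>snd c ` B. ennreal (sqrt (det (metric_matrix (param M c) q))) \<partial>lborel)"
proof -
  define A where "A = isoP -` B"
  let ?t = "\<lambda>y. snd c (isoP y)" and ?f = "\<lambda>q. sqrt (gramX (param M c) q)"
  have A: "A \<in> sets borel" using measurable_sets[OF iso_par_measurable B(1)] by (simp add: A_def)
  have Ac: "isoP y \<in> fst c" if "y \<in> A" for y using that B(2) by (auto simp: A_def)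
  have BA: "B = isoP ` A"
    using bij_betw_imp_surj_on[OF iso_par_bij] atlas_subset[OF M c] B(2) by (auto simp: A_def)
  then have tA: "?t ` A = snd c ` B" by auto
  note ch = iso_par_chart[OF c] and loc = iso_imm_local[OF c]
  have der: "(?t has_derivative frechet_derivative ?t (at y)) (at y)" and dt: "det (matrix (frechet_derivative ?t (at y))) = jac ?t y" if "y \<in> A" for y
    using smooth_on_differentiable[OF ch(1,2)] Ac[OF that] by (auto simp: frechet_derivative_works[symmetric] det_frechet_derivative)
  have inj: "inj_on ?t A"
  proof (rule inj_onI)
    fix x y assume xy: "x \<in> A" "y \<in> A" "?t x = ?t y"
    then have "isoP x = isoP y" using chart_inj[OF atlas_chart[OF M c]] Ac by (meson inj_onD)
    then show "x = y" using iso_par_right by metis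
  qed
  have W: "\<bar>det (matrix (frechet_derivative ?t (at y)))\<bar> * ?f (?t y) = paW y" if "y \<in> A" for y
    unfolding dt[OF that] loc(4)[OF Ac[OF that]] by (simp add: real_sqrt_mult)
  have sub: "?t ` A \<subseteq> chart_image c" using Ac by auto
  have reg: "regular_on (param M c) (chart_image c)" by (rule atlas_regular[OF M c])
  \<comment> \<open>Rewritten as a preimage under the continuous inverse parameter, the image of
    \<open>A\<close> is seen to be a Borel set.\<close>
  have "?t ` A = {q \<in> chart_image c. iso_of \<alpha> \<beta> (pr12 (L (param M c q))) \<in> A}"
  proof (intro equalityI subsetI)
    fix q assume "q \<in> ?t ` A"
    then obtain y where "y \<in> A" "q = ?t y" by blast
    then show "q \<in> {q \<in> chart_image c. iso_of \<alpha> \<beta> (pr12 (L (param M c q))) \<in> A}"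
      using atlas_inv_left[OF M c Ac] iso_par_right Ac by (auto simp: param_def)
  next
    fix q assume q: "q \<in> {q \<in> chart_image c. iso_of \<alpha> \<beta> (pr12 (L (param M c q))) \<in> A}"
    then have "chart_inv c q \<in> pts M" by (intro subsetD[OF atlas_subset[OF M c]] chart_inv_in(1)) simp
    from iso_par_left[OF this] have "q = ?t (iso_of \<alpha> \<beta> (pr12 (L (param M c q))))"
      using q chart_inv_in(2)[of q c] by (simp add: param_def)
    with q show "q \<in> ?t ` A" by blast
  qed
  moreover have "{q \<in> chart_image c. iso_of \<alpha> \<beta> (pr12 (L (param M c q))) \<in> A} \<in> sets borel"
  proof -
    have "continuous_on (chart_image c) (\<lambda>q. pr12 (L (param M c q)))"
      by (rule smooth_on_continuous[OF flat_chart(1)[OF M fc c]])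
    then have "continuous_on (chart_image c) (\<lambda>q. iso_of \<alpha> \<beta> (pr12 (L (param M c q))))"
      by (rule bounded_linear.continuous_on[OF bounded_linear_iso_of])
    then have "(\<lambda>q. iso_of \<alpha> \<beta> (pr12 (L (param M c q)))) \<in> restrict_space borel (chart_image c) \<rightarrow>\<^sub>M borel"
      by (rule borel_measurable_continuous_on_restrict)
    from measurable_sets[OF this A] show ?thesis
      using atlas_open[OF M c] by (simp add: space_restrict_space sets_restrict_space_iff vimage_def Int_def conj_commute)
  qed
  ultimately have tAb: "?t ` A \<in> sets borel" by simp
  have m1: "(\<lambda>q. indicator (?t ` A) q * ?f q) \<in> borel_measurable borel"
    using borel_measurable_continuous_on_indicator[OF tAb continuous_on_subset[OF smooth_on_continuous[OF smooth_sqrt_gram[OF reg]] sub]] by simp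
  have m2: "(\<lambda>y. indicator A y * (\<bar>det (matrix (frechet_derivative ?t (at y)))\<bar> * ?f (?t y))) \<in> borel_measurable borel"
  proof -
    have "(\<lambda>y. indicator A y * paW y) \<in> borel_measurable borel"
      using borel_measurable_continuous_on_indicator[OF A continuous_on_subset[OF smooth_on_continuous[OF smooth_sqrt_gram[OF iso_imm_regular]] subset_UNIV]] by simp
    also have "(\<lambda>y. indicator A y * paW y) = (\<lambda>y. indicator A y * (\<bar>det (matrix (frechet_derivative ?t (at y)))\<bar> * ?f (?t y)))"
      using W by (auto split: split_indicator)
    finally show ?thesis .
  qed
  have "emeasure paM B = (\<integral>\<^sup>+y\<in>A. ennreal (paW y) \<partial>lborel)" unfolding A_def by (rule emeasure_paM[OF B(1)])
  also have "\<dots> = (\<integral>\<^sup>+y\<in>A. ennreal (\<bar>det (matrix (frechet_derivative ?t (at y)))\<bar> * ?f (?t y)) \<partial>lborel)"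
    using W by (intro nn_integral_cong) (auto split: split_indicator)
  also have "\<dots> = (\<integral>\<^sup>+q\<in>?t ` A. ennreal (?f q) \<partial>lborel)"
    by (rule nn_integral_change_of_variables[OF A der inj _ m1 m2])
       (use reg_gram[OF reg] sub in \<open>auto intro!: real_sqrt_ge_zero less_imp_le\<close>)
  finally show ?thesis unfolding tA det_metric_matrix[OF reg] .
qed

text \<open>Lindelof's theorem in the plane, transported by the global parameter.\<close>

lemma countable_chart_cover:
  obtains D :: "nat \<Rightarrow> 'a chart" where "\<And>n. D n \<in> atlas M" "(\<Union>n. fst (D n)) = pts M"
proof -
  let ?U = "\<lambda>c. {y. isoP y \<in> fst c}"
  obtain F where F: "F \<subseteq> ?U ` atlas M" "countable F" "\<Union> F = \<Union> (?U ` atlas M)"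
    by (rule Lindelof[of "?U ` atlas M"]) (use iso_par_chart(1) in auto)
  have all: "y \<in> \<Union> (?U ` atlas M)" for y
  proof -
    obtain c where "c \<in> atlas M" "isoP y \<in> fst c" by (rule iso_par_cover)
    then show ?thesis by (intro UN_I[of c]) simp_all
  qed
  with F(3) have cov: "\<Union> F = UNIV" using all by (intro set_eqI) (simp only: UNIV_I)
  obtain C where C: "countable C" "C \<subseteq> atlas M" "F = ?U ` C" using countable_subset_image[of F ?U "atlas M"] F(1,2) by blast
  have ne: "C \<noteq> {}" using cov C(3) by auto
  show thesis
  proof (rule that[of "from_nat_into C"])
    show in_atlas: "from_nat_into C n \<in> atlas M" for n using from_nat_into[OF ne, of n] C(2) by blast
    show "(\<Union>n. fst (from_nat_into C n)) = pts M"
    proof (intro equalityI subsetI)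
      fix p assume "p \<in> (\<Union>n. fst (from_nat_into C n))"
      then show "p \<in> pts M" using atlas_subset[OF M in_atlas] by blast
    next
      fix p assume "p \<in> pts M"
      then obtain y where p: "p = isoP y" using bij_betw_imp_surj_on[OF iso_par_bij] by blast
      obtain c where "c \<in> C" "isoP y \<in> fst c" using cov C(3) by blast
      then show "p \<in> (\<Union>n. fst (from_nat_into C n))" using from_nat_into_surj[OF C(1)] p by blast
    qed
  qed
qed

text \<open>The description prescribes values only on sets inside a single chart. Cutting along the
  disjoint pieces of a countable chart cover shows that they determine the measure.\<close>

lemma area_measure_eq: "area_measure M = paM"
  unfolding area_measure_def
proof (rule the_equality)
  let ?I = "\<lambda>c B. \<integral>\<^sup>+q\<in>snd c ` B. ennreal (sqrt (det (metric_matrix (param M c) q))) \<partial>lborel"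
  let ?Q = "\<lambda>\<mu>. space \<mu> = pts M \<and> sets \<mu> = sigma_sets (pts M) {U. openin (points M) U} \<and>
     (\<forall>c\<in>atlas M. \<forall>B\<in>sets \<mu>. B \<subseteq> fst c \<longrightarrow> emeasure \<mu> B = ?I c B)"
  have sp: "space paM = pts M" and se: "sets paM = sets paS" by (simp_all add: paM_def sets_paS)
  show Q: "?Q paM" using paM_chart sp se sets_paS(1) by simp
  fix \<nu> assume \<nu>: "?Q \<nu>"
  obtain D :: "nat \<Rightarrow> 'a chart" where D: "\<And>n. D n \<in> atlas M" "(\<Union>n. fst (D n)) = pts M" using countable_chart_cover by blast
  let ?D = "disjointed (\<lambda>n. fst (D n))"
  have decomp: "emeasure \<mu> A = (\<Sum>n. ?I (D n) (A \<inter> ?D n))" if \<mu>: "?Q \<mu>" and A: "A \<in> sets \<mu>" for \<mu> A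
  proof -
    have Ds: "fst (D n) \<in> sets \<mu>" for n
      using \<mu> atlas_openin[OF M D(1)] by (auto intro: sigma_sets.Basic)
    then have Dd: "?D n \<in> sets \<mu>" for n using sets.range_disjointed_sets[of "\<lambda>n. fst (D n)" \<mu>] by auto
    have "A \<subseteq> pts M" using sets.sets_into_space[OF A] \<mu> by simp
    moreover have "(\<Union>n. A \<inter> ?D n) = A \<inter> pts M" using UN_disjointed_eq[of "\<lambda>n. fst (D n)"] unfolding D(2) by (simp only: Int_UN_distrib[symmetric])
    ultimately have "A = (\<Union>n. A \<inter> ?D n)" by blast
    moreover have "disjoint_family (\<lambda>n. A \<inter> ?D n)"
      using disjoint_family_disjointed[of "\<lambda>n. fst (D n)"] unfolding disjoint_family_on_def by blast
    moreover have "range (\<lambda>n. A \<inter> ?D n) \<subseteq> sets \<mu>" using A Dd by auto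
    ultimately have "emeasure \<mu> A = (\<Sum>n. emeasure \<mu> (A \<inter> ?D n))" using suminf_emeasure[of "\<lambda>n. A \<inter> ?D n" \<mu>] by simp
    also have "\<dots> = (\<Sum>n. ?I (D n) (A \<inter> ?D n))"
    proof (rule suminf_cong)
      fix n
      have "A \<inter> ?D n \<in> sets \<mu>" "A \<inter> ?D n \<subseteq> fst (D n)" using A Dd disjointed_subset[of "\<lambda>n. fst (D n)" n] by auto
      then show "emeasure \<mu> (A \<inter> ?D n) = ?I (D n) (A \<inter> ?D n)" using \<mu> D(1) by blast
    qed
    finally show ?thesis .
  qed
  show "\<nu> = paM"
  proof (rule measure_eqI)
    show s: "sets \<nu> = sets paM" using \<nu> Q by simp
    fix A assume "A \<in> sets \<nu>"
    then show "emeasure \<nu> A = emeasure paM A" using decomp[OF \<nu>] decomp[OF Q] s by simp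
  qed
qed

text \<open>Stated for a measurable minorant \<open>r\<close> on the parameter plane:
  \<open>r\<close> is moved through the push-forward, and its comparison with the curvature is
  pointwise.\<close>

lemma total_abs_curvature_lower:
  assumes r: "r \<in> borel_measurable borel" and le: "\<And>y. r y \<le> ennreal \<bar>gauss_curvature M (isoP y)\<bar>"
  shows "(\<integral>\<^sup>+y. ennreal (paW y) * r y \<partial>lborel) \<le> total_abs_curvature M"
proof -
  let ?x = "\<lambda>p. iso_of \<alpha> \<beta> (pr12 (L (imm M p)))"
  have m: "isoP \<in> density lborel (\<lambda>y. ennreal (paW y)) \<rightarrow>\<^sub>M paS" using iso_par_measurable by simp
  have x: "?x \<in> paS \<rightarrow>\<^sub>M borel"
  proof (rule borel_measurableI)
    fix V :: "(real^2) set" assume V: "open V"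
    have "continuous_map (points M) euclidean (\<lambda>p. pr12 (L (imm M p)))" by (rule flat_map_continuous[OF M fc])
    then have "continuous_map (points M) euclidean (iso_of \<alpha> \<beta> \<circ> (\<lambda>p. pr12 (L (imm M p))))"
      by (rule continuous_map_compose) (simp add: linear_continuous_on[OF bounded_linear_iso_of])
    then have "openin (points M) {p \<in> pts M. ?x p \<in> V}" using openin_continuous_map_preimage[of "points M" euclidean _ V] V by (simp add: o_def)
    moreover have "?x -` V \<inter> space paS = {p \<in> pts M. ?x p \<in> V}" using sets_paS(2) by auto
    ultimately show "?x -` V \<inter> space paS \<in> sets paS" unfolding sets_paS(1) by (auto intro: sigma_sets.Basic)
  qed
  have rx: "(\<lambda>p. r (?x p)) \<in> borel_measurable paS" by (rule measurable_compose[OF x r])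
  have "(\<integral>\<^sup>+y. ennreal (paW y) * r y \<partial>lborel) = (\<integral>\<^sup>+y. r y \<partial>density lborel (\<lambda>y. ennreal (paW y)))"
    by (rule nn_integral_density[symmetric]) (use area_density_measurable r in auto)
  also have "\<dots> = (\<integral>\<^sup>+y. r (?x (isoP y)) \<partial>density lborel (\<lambda>y. ennreal (paW y)))" by (simp add: iso_par_right)
  also have "\<dots> = (\<integral>\<^sup>+p. r (?x p) \<partial>paM)"
    unfolding paM_def by (rule nn_integral_distr[symmetric, OF m]) (use rx in simp)
  also have "\<dots> \<le> total_abs_curvature M" unfolding total_abs_curvature_def area_measure_eq
  proof (rule nn_integral_mono)
    fix p assume "p \<in> space paM"
    then have "p \<in> pts M" by (simp add: paM_def sets_paS)
    then show "r (?x p) \<le> ennreal \<bar>gauss_curvature M p\<bar>" using le[of "?x p"] by (simp add: iso_par_left)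
  qed
  finally show ?thesis .
qed

section \<open>Values and total curvature of a nonflat surface\<close>

lemma nonflat_values_and_curvature:
  assumes "nonflat M"
  shows "inf_often_except_two (pts M) (psi1 M)" "inf_often_except_two (pts M) (psi2 M)" "total_abs_curvature M = \<infinity>"
proof -
  obtain a b k h k' h' L' where ab: "\<alpha> * a + \<beta> * b = 0" and L': "lorentz L'"
    and dk: "\<And>z. (k has_field_derivative k' z) (at z)" and dh: "\<And>z. (h has_field_derivative h' z) (at z)"
    and hk: "\<And>z. h z * k z = - (a\<^sup>2 + b\<^sup>2)"
    and gm: "\<And>z. gauss_map M (isoP (cplx2 z)) = proj (clin L' (conic_point a b (k z) (h z)))"
    and area: "\<And>z. sqrt (gramX isoX (cplx2 z)) = 2 * ((cmod a)\<^sup>2 + (cmod b)\<^sup>2 + Re (k z * cnj (h z)))"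
    and K: "\<And>z. gauss_curvature M (isoP (cplx2 z)) =
       - (Re (k' z * cnj (h' z)) - (cmod ((k' z * cnj (h z) + h' z * cnj (k z)) / 2))\<^sup>2 / ((cmod a)\<^sup>2 + (cmod b)\<^sup>2 + Re (k z * cnj (h z))))
         / ((cmod a)\<^sup>2 + (cmod b)\<^sup>2 + Re (k z * cnj (h z)))\<^sup>2"
    by (rule weierstrass_data) blast
  have P: "bij_betw (\<lambda>z. isoP (cplx2 z)) UNIV (pts M)"
  proof -
    have "bij_betw cplx2 UNIV UNIV"
      by (rule bij_betw_byWitness[where f' = "\<lambda>y. Complex (y$1) (y$2)"]) (auto simp: cplx2_Complex)
    from bij_betw_trans[OF this iso_par_bij] show ?thesis by (simp add: o_def)
  qed
  obtain p where p: "p \<in> pts M" "gauss_curvature M p \<noteq> 0" using assms by (auto simp: nonflat_def)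
  then have "p \<in> range (\<lambda>z. isoP (cplx2 z))" using bij_betw_imp_surj_on[OF P] by simp
  then obtain z0 where "p = isoP (cplx2 z0)" by (rule rangeE)
  with p(2) have z0: "gauss_curvature M (isoP (cplx2 z0)) \<noteq> 0" by simp
  have ne: "Re (k' z0 * cnj (h' z0)) - (cmod ((k' z0 * cnj (h z0) + h' z0 * cnj (k z0)) / 2))\<^sup>2 / ((cmod a)\<^sup>2 + (cmod b)\<^sup>2 + Re (k z0 * cnj (h z0))) \<noteq> 0"
    using z0 unfolding K by auto
  obtain g g' where D: "a\<^sup>2 + b\<^sup>2 \<noteq> 0" and kg: "\<And>z. k z = exp (g z)" and dg: "\<And>z. (g has_field_derivative g' z) (at z)"
    and nc: "\<nexists>c. g = (\<lambda>z. c)" and k': "\<And>z. k' z = g' z * k z" and h': "\<And>z. h' z = - (g' z * h z)"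
    by (rule nonflat_exponential_data[OF dk dh hk ne]) blast
  have \<alpha>\<beta>: "\<alpha> \<noteq> 0 \<or> \<beta> \<noteq> 0" using nf by (auto simp: normal_form_def)
  have hol: "g holomorphic_on UNIV" using dg by (auto simp: holomorphic_on_open)
  have inf: "infinite {z. k z = w}" if "w \<noteq> 0" for w unfolding kg by (rule exp_entire_values_infinite[OF hol nc that])
  have Psi: "Psi (gauss_map M (isoP (cplx2 z))) = (ruling (clin L' (conic_point a b (k z) (h z))), ruling (reflect2 (clin L' (conic_point a b (k z) (h z)))))" for z
  proof -
    let ?c = "conic_point a b (k z) (h z)"
    have "mink ?c ?c = a\<^sup>2 + b\<^sup>2 + h z * k z" by (simp add: mink_def conic_point_def field_simps power2_eq_square)
    then have m: "mink (clin L' ?c) (clin L' ?c) = 0" unfolding mink_clin[OF L'] hk by simp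
    have "clin L' ?c \<noteq> 0"
    proof
      assume 0: "clin L' ?c = 0"
      have "mink ?c (conic_point 0 0 1 0) = mink (clin L' ?c) (clin L' (conic_point 0 0 1 0))" by (rule mink_clin[OF L', symmetric])
      then have "h z = 0" unfolding 0 by (simp add: mink_zero_left) (simp add: mink_def conic_point_def field_simps)
      then have "- (a\<^sup>2 + b\<^sup>2) = 0" using hk[of z] by (simp only: mult_zero_left)
      then show False using D by (simp only: neg_equal_0_iff_equal)
    qed
    then show ?thesis unfolding gm by (rule Psi_proj[OF _ m])
  qed
  show "inf_often_except_two (pts M) (psi1 M)"
    by (rule conic_values[OF L' ab \<alpha>\<beta> D hk inf P]) (simp_all add: psi1_def Psi)
  have "lorentz (\<lambda>v. reflect2 (L' v))"
    using lorentz_reflect2 L' linear_compose[of L' reflect2] unfolding lorentz_def by (auto simp: o_def)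
  then show "inf_often_except_two (pts M) (psi2 M)"
    by (rule conic_values[OF _ ab \<alpha>\<beta> D hk inf P]) (simp_all add: psi2_def Psi clin_reflect2)
  define \<omega> where "\<omega> = - cnj (a\<^sup>2 + b\<^sup>2)"
  have \<omega>: "\<omega> \<noteq> 0" using D by (metis \<omega>_def complex_cnj_zero_iff neg_equal_0_iff_equal)
  define S where "S = {y::real^2. Re (\<omega> * exp (g (Complex (y$1) (y$2)) - cnj (g (Complex (y$1) (y$2))))) > 0}"
  note strip = strip_preimage_area_infinite[OF dg nc \<omega>, folded S_def]
  \<comment> \<open>Since \<open>cnj (h z) * cnj (k z) = \<omega>\<close> and
    \<open>k = exp g\<close>, the argument of \<open>k z * cnj (h z)\<close> depends only on the
    imaginary part of \<open>g z\<close>. So \<open>S\<close> is the preimage of horizontal strips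
    on which this product has positive real part.\<close>
  have sk: "k z * cnj (h z) = \<omega> * exp (g z - cnj (g z))" for z
  proof -
    have "cnj (h z) * cnj (k z) = \<omega>" using arg_cong[OF hk[of z], of cnj] by (simp add: \<omega>_def)
    moreover have "k z = exp (g z - cnj (g z)) * cnj (k z)" unfolding kg by (simp add: exp_diff exp_cnj)
    ultimately show ?thesis by (metis mult.assoc mult.commute)
  qed
  define p d where "p = (cmod a)\<^sup>2 + (cmod b)\<^sup>2" and "d = cmod (a\<^sup>2 + b\<^sup>2)"
  have p0: "p \<ge> 0" and d0: "d > 0" using D by (simp_all add: p_def d_def)
  \<comment> \<open>The factor 2 compensates that of the area density
    \<open>2 * (p + Re (k z * cnj (h z)))\<close>, by which \<open>r\<close> divides; what remains
    is the bound of \<open>conic_curvature_lower_bound\<close>.\<close>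
  define C where "C = 2 * d\<^sup>2 / (p + d)\<^sup>2"
  have C0: "C > 0" using p0 d0 by (simp add: C_def zero_less_divide_iff)
  define F where "F = (\<lambda>y::real^2. (cmod (g' (Complex (y$1) (y$2))))\<^sup>2)"
  define r where "r = (\<lambda>y. indicator S y * ennreal (C * F y / paW y))"
  have W0: "paW y > 0" for y using reg_gram[OF iso_imm_regular UNIV_I] by simp
  have rm: "r \<in> borel_measurable borel"
  proof -
    have "paW \<in> borel_measurable borel"
      by (rule borel_measurable_continuous_onI[OF smooth_on_continuous[OF smooth_sqrt_gram[OF iso_imm_regular]]])
    then have "(\<lambda>y. C * F y / paW y) \<in> borel_measurable borel"
      using strip(2) unfolding F_def by (intro borel_measurable_divide borel_measurable_times borel_measurable_const)
    from measurable_compose[OF this measurable_ennreal] show ?thesis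
      unfolding r_def by (intro borel_measurable_times_ennreal borel_measurable_indicator strip(1))
  qed
  have rle: "r y \<le> ennreal \<bar>gauss_curvature M (isoP y)\<bar>" for y
  proof (cases "y \<in> S")
    case True
    define z where "z = Complex (y$1) (y$2)"
    have y: "y = cplx2 z" by (simp add: z_def cplx2_Complex)
    have s: "Re (k z * cnj (h z)) > 0" using True unfolding sk S_def z_def by simp
    have "C * F y / paW y = d\<^sup>2 * (cmod (g' z))\<^sup>2 / ((p + d)\<^sup>2 * (p + Re (k z * cnj (h z))))"
    proof -
      have "F y = (cmod (g' z))\<^sup>2" by (simp add: F_def z_def)
      moreover have "paW y = 2 * (p + Re (k z * cnj (h z)))" unfolding y area p_def ..
      moreover have "2 * x / A * f / (2 * e) = x * f / (A * e)" for x A f e :: real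
        by (cases "A = 0 \<or> e = 0") (auto simp: field_simps)
      ultimately show ?thesis unfolding C_def by (simp only:)
    qed
    also have "\<dots> \<le> gauss_curvature M (isoP y)"
      using conic_curvature_lower_bound[OF p0 s, of "g' z"] unfolding y K k' h' p_def hk d_def norm_minus_cancel .
    finally show ?thesis using True by (simp add: r_def)
  qed (simp add: r_def)
  have "(\<integral>\<^sup>+y. ennreal (paW y) * r y \<partial>lborel) = (\<integral>\<^sup>+y. ennreal C * (ennreal (F y) * indicator S y) \<partial>lborel)"
  proof (rule nn_integral_cong)
    fix y
    have "ennreal (paW y) * ennreal (C * F y / paW y) = ennreal (C * F y)"
      using W0[of y] C0 by (subst ennreal_mult'[symmetric]) (auto simp: F_def less_imp_neq[symmetric])
    moreover have "ennreal (C * F y) = ennreal C * ennreal (F y)" by (rule ennreal_mult') (use C0 in simp)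
    ultimately show "ennreal (paW y) * r y = ennreal C * (ennreal (F y) * indicator S y)"
      by (auto simp: r_def split: split_indicator)
  qed
  also have "\<dots> = ennreal C * (\<integral>\<^sup>+y\<in>S. ennreal (F y) \<partial>lborel)"
  proof (rule nn_integral_cmult)
    have "(\<lambda>y. ennreal (F y)) \<in> borel_measurable lborel" using measurable_compose[OF strip(2) measurable_ennreal] by (simp add: F_def)
    then show "(\<lambda>y. ennreal (F y) * indicator S y) \<in> borel_measurable lborel"
      using strip(1) by (intro borel_measurable_times_ennreal borel_measurable_indicator) auto
  qed
  also have "\<dots> = \<infinity>" using strip(3) C0 by (simp add: F_def ennreal_mult_eq_top_iff)
  finally show "total_abs_curvature M = \<infinity>"
    using total_abs_curvature_lower[OF rm rle] by (simp add: top_unique)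
qed

end

theorem theorem4p5:
  fixes M :: "'a surface"
  assumes "spacelike_surface M"
  shows "(stationary M \<and> complete_surface M \<and> degenerate_hyperbolic M \<longleftrightarrow>
          (\<exists>F. spacelike_surface (graph_surface F) \<and> stationary (graph_surface F) \<and>
               congruent_surfaces M (graph_surface F))) \<and>
         (stationary M \<and> complete_surface M \<and> degenerate_hyperbolic M \<and> nonflat M \<longrightarrow>
          inf_often_except_two (pts M) (psi1 M) \<and>
          inf_often_except_two (pts M) (psi2 M) \<and>
          total_abs_curvature M = \<infinity>)"
proof (intro conjI[OF complete_degenerate_iff_graph[OF assms]] impI)
  assume a: "stationary M \<and> complete_surface M \<and> degenerate_hyperbolic M \<and> nonflat M"
  then obtain L \<alpha> \<beta> where nf: "normal_form M L \<alpha> \<beta>" using degenerate_normal_form[OF assms] by metis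
  obtain \<kappa> where fc: "flat_comparable M (\<lambda>v. pr12 (L v)) \<kappa>" by (rule normal_form_flat_comparable[OF assms nf])
  from a have st: "stationary M" and comp: "complete_surface M" and nonflat: "nonflat M" by blast+
  from nonflat_values_and_curvature[OF assms st nf fc complete_imp_bij[OF assms fc comp] nonflat]
  show "inf_often_except_two (pts M) (psi1 M) \<and> inf_often_except_two (pts M) (psi2 M) \<and> total_abs_curvature M = \<infinity>"
    by blast
qed

end
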